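(* Let $\mathbb D\subset\mathbb R^2$ denote the disk of unit area. For every $n\in\mathbb N=\{1,2,\dots\}$ there exist constants $c_n,B_n>0$ (depending only on $n$) such that the following holds: if $\Omega\subset\mathbb R^2$ is a bounded simply-connected planar domain with area $|\Omega|=1$, then for all $B\ge B_n$, \[ \frac{\lambda_n(\Omega,B)}{\lambda_n(\mathbb D,B)} \ \ge\ 1 + c_n B\,\alpha(\Omega)^3 - \frac{\ln B}{c_n}. \]
   Context: For a bounded simply-connected domain $\Omega\subset\mathbb R^2$ (no regularity of the boundary is assumed) and $B\ge 0$, let $\mathscr L_{\Omega,B}$ be the shifted magnetic Dirichlet Laplacian in $L^2(\Omega)$, \[ \mathscr L_{\Omega,B}u = -(\nabla-i\mathbf A)^2u - Bu,\qquad \mathrm{dom}\,\mathscr L_{\Omega,B}=\{u\in H^1_0(\Omega)\colon \Delta u\in L^2(\Omega)\}, \] where $\mathbf A=(A_1,A_2)^\top$ is a vector potential with $\partial_1A_2-\partial_2A_1=B$; for definiteness take $\mathbf A=(-Bx_2,0)^\top$. This operator is self-adjoint with compact resolvent, and $\lambda_1(\Omega,B)\le\lambda_2(\Omega,B)\le\cdots$ denote its eigenvalues in non-decreasing order, repeated with multiplicity (they are positive). The Fraenkel asymmetry of $\Omega$ is \[ \alpha(\Omega)=\inf_{x\in\mathbb R^2}\frac{|\Omega\,\Delta\,(\mathcal D+x)|}{|\Omega|}, \] where $\mathcal D$ is a disk of the same area as $\Omega$, $|\cdot|$ is Lebesgue measure, and $A\,\Delta\, B=(A\setminus B)\cup(B\setminus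 A)$ is the symmetric difference of sets. *)

theory Defs
  imports "HOL-Analysis.Analysis"
begin

definition partial_deriv :: "2 \<Rightarrow> (real^2 \<Rightarrow> complex) \<Rightarrow> real^2 \<Rightarrow> complex" where
  "partial_deriv j f = (\<lambda>x. frechet_derivative f (at x) (axis j 1))"

primrec C_k :: "nat \<Rightarrow> (real^2 \<Rightarrow> complex) \<Rightarrow> bool" where
  "C_k 0 f \<longleftrightarrow> continuous_on UNIV f"
| "C_k (Suc k) f \<longleftrightarrow> (\<forall>x. f differentiable (at x)) \<and> (\<forall>j. C_k k (partial_deriv j f))"

definition test_functions :: "(real^2) set \<Rightarrow> (real^2 \<Rightarrow> complex) set" where
  "test_functions \<Omega> = {\<phi>. (\<forall>k. C_k k \<phi>) \<and>
     compact (closure {x. \<phi> x \<noteq> 0}) \<and> closure {x. \<phi> x \<noteq> 0} \<subseteq> \<Omega>}"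

text \<open>
  Distributions on \<open>\<Omega>\<close> are represented by functionals of which only the values on
  \<open>test_functions \<Omega>\<close> matter. The pairing is bilinear, without complex conjugation.
\<close>

type_synonym distribution = "(real^2 \<Rightarrow> complex) \<Rightarrow> complex"

definition distr_eq :: "(real^2) set \<Rightarrow> distribution \<Rightarrow> distribution \<Rightarrow> bool" where
  "distr_eq \<Omega> S T \<longleftrightarrow> (\<forall>\<phi>\<in>test_functions \<Omega>. S \<phi> = T \<phi>)"

definition distr_of :: "(real^2) set \<Rightarrow> (real^2 \<Rightarrow> complex) \<Rightarrow> distribution" where
  "distr_of \<Omega> u = (\<lambda>\<phi>. integral\<^sup>L (lebesgue_on \<Omega>) (\<lambda>x. u x * \<phi> x))"

definition distr_deriv :: "2 \<Rightarrow> distribution \<Rightarrow> distribution" where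
  "distr_deriv j T = (\<lambda>\<phi>. - T (partial_deriv j \<phi>))"

definition distr_mult :: "(real^2 \<Rightarrow> complex) \<Rightarrow> distribution \<Rightarrow> distribution" where
  "distr_mult a T = (\<lambda>\<phi>. T (\<lambda>x. a x * \<phi> x))"

definition distr_laplacian :: "distribution \<Rightarrow> distribution" where
  "distr_laplacian T = (\<lambda>\<phi>. \<Sum>j\<in>UNIV. distr_deriv j (distr_deriv j T) \<phi>)"

text \<open>Elements are functions, not classes of functions equal almost everywhere.\<close>

definition L2 :: "(real^2) set \<Rightarrow> (real^2 \<Rightarrow> complex) set" where
  "L2 \<Omega> = {u \<in> borel_measurable (lebesgue_on \<Omega>).
     integrable (lebesgue_on \<Omega>) (\<lambda>x. (cmod (u x))\<^sup>2)}"

definition L2_norm :: "(real^2) set \<Rightarrow> (real^2 \<Rightarrow> complex) \<Rightarrow> real" where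
  "L2_norm \<Omega> u = sqrt (integral\<^sup>L (lebesgue_on \<Omega>) (\<lambda>x. (cmod (u x))\<^sup>2))"

definition weak_gradient ::
    "(real^2) set \<Rightarrow> (real^2 \<Rightarrow> complex) \<Rightarrow> (2 \<Rightarrow> real^2 \<Rightarrow> complex) \<Rightarrow> bool" where
  "weak_gradient \<Omega> u g \<longleftrightarrow>
     (\<forall>j. distr_eq \<Omega> (distr_deriv j (distr_of \<Omega> u)) (distr_of \<Omega> (g j)))"

text \<open>\<open>H\<^sup>1\<^sub>0(\<Omega>)\<close>: the closure of the test functions in the norm of \<open>H\<^sup>1(\<Omega>)\<close>.\<close>

definition H1_0 :: "(real^2) set \<Rightarrow> (real^2 \<Rightarrow> complex) set" where
  "H1_0 \<Omega> = {u \<in> L2 \<Omega>. \<exists>g. (\<forall>j. g j \<in> L2 \<Omega>) \<and> weak_gradient \<Omega> u g \<and>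
     (\<exists>\<phi>. (\<forall>k. \<phi> k \<in> test_functions \<Omega>) \<and>
        (\<lambda>k::nat. L2_norm \<Omega> (\<lambda>x. \<phi> k x - u x)) \<longlonglongrightarrow> 0 \<and>
        (\<forall>j. (\<lambda>k. L2_norm \<Omega> (\<lambda>x. partial_deriv j (\<phi> k) x - g j x)) \<longlonglongrightarrow> 0))}"

definition vector_potential :: "real \<Rightarrow> real^2 \<Rightarrow> real^2" where
  "vector_potential B x = vector [- B * x$2, 0]"

definition covariant_deriv :: "real \<Rightarrow> 2 \<Rightarrow> distribution \<Rightarrow> distribution" where
  "covariant_deriv B j T = (\<lambda>\<phi>. distr_deriv j T \<phi> -
     \<i> * distr_mult (\<lambda>x. complex_of_real (vector_potential B x $ j)) T \<phi>)"

definition magnetic_operator :: "real \<Rightarrow> distribution \<Rightarrow> distribution" where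
  "magnetic_operator B T =
     (\<lambda>\<phi>. - (\<Sum>j\<in>UNIV. covariant_deriv B j (covariant_deriv B j T) \<phi>) - of_real B * T \<phi>)"

text \<open>
  The domain does not depend on the field strength: \<open>\<Omega>\<close> is meant to be bounded, so the vector
  potential and its derivatives are bounded on it.
\<close>

definition magnetic_domain :: "(real^2) set \<Rightarrow> (real^2 \<Rightarrow> complex) set" where
  "magnetic_domain \<Omega> = {u \<in> H1_0 \<Omega>.
     \<exists>w\<in>L2 \<Omega>. distr_eq \<Omega> (distr_laplacian (distr_of \<Omega> u)) (distr_of \<Omega> w)}"

definition magnetic_eigenspace :: "(real^2) set \<Rightarrow> real \<Rightarrow> real \<Rightarrow> (real^2 \<Rightarrow> complex) set" where
  "magnetic_eigenspace \<Omega> B \<mu> = {u \<in> magnetic_domain \<Omega>.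
     distr_eq \<Omega> (magnetic_operator B (distr_of \<Omega> u)) (distr_of \<Omega> (\<lambda>x. of_real \<mu> * u x))}"

text \<open>Linear independence over the complex numbers, modulo equality almost everywhere in \<open>\<Omega>\<close>.\<close>

definition AE_independent :: "(real^2) set \<Rightarrow> nat \<Rightarrow> (nat \<Rightarrow> real^2 \<Rightarrow> complex) \<Rightarrow> bool" where
  "AE_independent \<Omega> m u \<longleftrightarrow>
     (\<forall>c. (AE x in lebesgue_on \<Omega>. (\<Sum>i<m. c i * u i x) = 0) \<longrightarrow> (\<forall>i<m. c i = 0))"

definition multiplicity_at_least :: "(real^2) set \<Rightarrow> real \<Rightarrow> real \<Rightarrow> nat \<Rightarrow> bool" where
  "multiplicity_at_least \<Omega> B \<mu> m \<longleftrightarrow>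
     (\<exists>u. (\<forall>i<m. u i \<in> magnetic_eigenspace \<Omega> B \<mu>) \<and> AE_independent \<Omega> m u)"

text \<open>
  A non-decreasing sequence in which every real \<open>\<mu>\<close> occurs exactly as often as its multiplicity
  (so not at all if it is not an eigenvalue). These conditions determine the sequence.
\<close>

definition eigenvalue_enumeration :: "(real^2) set \<Rightarrow> real \<Rightarrow> (nat \<Rightarrow> real) \<Rightarrow> bool" where
  "eigenvalue_enumeration \<Omega> B l \<longleftrightarrow> mono l \<and>
     (\<forall>\<mu> m. multiplicity_at_least \<Omega> B \<mu> m \<longleftrightarrow>
        (\<exists>K. finite K \<and> card K = m \<and> (\<forall>k\<in>K. l k = \<mu>)))"

text \<open>The eigenvalues are numbered from 1, the enumerating sequence from 0.\<close>

definition magnetic_eigenvalue :: "nat \<Rightarrow> (real^2) set \<Rightarrow> real \<Rightarrow> real" where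
  "magnetic_eigenvalue n \<Omega> B = (THE l. eigenvalue_enumeration \<Omega> B l) (n - 1)"

definition disk_of_area :: "real \<Rightarrow> (real^2) set" where
  "disk_of_area a = ball 0 (sqrt (a / pi))"

definition fraenkel_asymmetry :: "(real^2) set \<Rightarrow> real" where
  "fraenkel_asymmetry \<Omega> = (INF x. measure lebesgue
      (sym_diff \<Omega> ((\<lambda>y. y + x) ` disk_of_area (measure lebesgue \<Omega>))) / measure lebesgue \<Omega>)"

end

theory Submission
  imports Defs "HOL-Complex_Analysis.Complex_Analysis" "HOL-Library.Function_Algebras"
begin

text \<open>
  The form of the operator on test functions is \<open>\<integral>|D\<^sub>B u|\<^sup>2\<close> with
  \<open>D\<^sub>B = \<partial>\<^sub>1 + \<i>\<partial>\<^sub>2 + \<i>Bx\<^sub>2\<close>. For \<open>F\<close> holomorphic on \<open>\<Omega>\<close> the gauge factor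
  \<open>e\<^bsup>B(x\<^sub>2\<^sup>2/2 + F)\<^esup>\<close> turns \<open>D\<^sub>B\<close> into the Cauchy-Riemann operator. Choosing \<open>F\<close> so that the
  real part \<open>\<psi>\<close> of the exponent (which satisfies \<open>\<Delta>\<psi> = 1\<close>) vanishes on the boundary bounds every
  eigenvalue below by \<open>e\<^bsup>-2B max(-\<psi>)\<^esup>\<close>. The Riemann map \<open>h\<close> of the domain that sends 0 to a given
  point writes the value of \<open>-4\<psi>\<close> there as \<open>\<Sum>\<^bsub>n\<ge>1\<^esub>|a\<^sub>n|\<^sup>2\<close>, \<open>a\<^sub>n\<close> its Taylor coefficients, while
  the area is \<open>\<pi>\<Sum>n|a\<^sub>n|\<^sup>2\<close>. So \<open>-\<psi>\<close> is at most \<open>1/(4\<pi>)\<close>, its maximum for the disk, and a small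
  deficit makes \<open>h\<close> nearly affine: it is at least a multiple of \<open>\<alpha>\<^sup>3\<close>. For the disk, cut-off lowest
  Landau level functions \<open>z\<^sup>k e\<^bsup>-B|z|\<^sup>2/4\<^esup>\<close> show that the lower bound \<open>e\<^bsup>-B/(2\<pi>)\<^esup>\<close> is sharp up to
  a power of \<open>B\<close>, which accounts for the logarithm.
\<close>

section \<open>Smooth functions and test functions\<close>

text \<open>Without regularity of the boundary neither the Riemann map nor \<open>\<psi>\<close>
  need have boundary values. The lower bound is therefore proved for one test function at a time, on
  the image of a smaller concentric disk that contains its support: there the map is analytic up to
  the circle, a Taylor polynomial replaces it in the boundary data at the cost of an error
  \<open>\<epsilon>\<close>, and \<open>\<epsilon>\<close> tends to 0 at the end. The asymmetry
  stays that of the whole domain, since its estimate asks only that the image lies in the domain.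
  After the gauge there remains a Poincare inequality whose constant is 1 for every domain of area
  at most 1; this keeps all constants independent of the domain. Eigenvalues are defined by counting
  weak eigenfunctions, so a spectral theorem for the closure of \<open>D_B\<close> has to show that
  they form a sequence and that trial functions bound them. The lower bound is the same for all
  \<open>n\<close>; only the power of \<open>B\<close> on the disk depends on \<open>n\<close>. The
  cube is a balance: an affine approximation on the disk of squared radius \<open>1 - d\<close> has
  error \<open>d\<close> when the deficit is at most \<open>d^3\<close>, and the missing ring has
  area of order \<open>d\<close> too.\<close>

definition smooth :: "(real^2 \<Rightarrow> complex) \<Rightarrow> bool" where
  "smooth f \<longleftrightarrow> (\<forall>k. C_k k f)"

lemma smooth_iff:
  "smooth f \<longleftrightarrow> (\<forall>x. f differentiable (at x)) \<and> (\<forall>j. smooth (partial_deriv j f))"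
proof
  assume f: "smooth f"
  then have "C_k (Suc k) f" for k unfolding smooth_def by blast
  then show "(\<forall>x. f differentiable (at x)) \<and> (\<forall>j. smooth (partial_deriv j f))"
    by (auto simp: smooth_def)
next
  assume *: "(\<forall>x. f differentiable (at x)) \<and> (\<forall>j. smooth (partial_deriv j f))"
  show "smooth f" unfolding smooth_def
  proof
    fix k show "C_k k f"
    proof (cases k)
      case 0
      then show ?thesis using *
        by (simp add: continuous_at_imp_continuous_on differentiable_imp_continuous_within)
    qed (use * in \<open>auto simp: smooth_def\<close>)
  qed
qed

text \<open>Induction on the order of differentiability inside the class \<open>P\<close>. It
  replaces formulas for higher derivatives of products and compositions: it is enough to exhibit a
  class that one differentiation does not leave.\<close>

lemma smooth_coinduct [consumes 1, case_names step]:
  assumes "P f" and step: "\<And>f. P f \<Longrightarrow> (\<forall>x. f differentiable (at x)) \<and> (\<forall>j. P (partial_deriv j f))"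
  shows "smooth f"
proof -
  have "P f \<Longrightarrow> C_k k f" for k f
  proof (induction k arbitrary: f)
    case 0
    then show ?case using step[of f]
      by (simp add: continuous_at_imp_continuous_on differentiable_imp_continuous_within)
  qed (use step in auto)
  then show ?thesis using assms(1) by (simp add: smooth_def)
qed

lemma smooth_differentiable: "smooth f \<Longrightarrow> f differentiable (at x)"
  using smooth_iff by blast

lemma smooth_partial: "smooth f \<Longrightarrow> smooth (partial_deriv j f)"
  using smooth_iff by blast

lemma smooth_continuous: "smooth f \<Longrightarrow> continuous_on A f"
  using smooth_differentiable
  by (metis continuous_at_imp_continuous_on differentiable_imp_continuous_within)

lemma partial_deriv_eq:
  "(f has_derivative D) (at x) \<Longrightarrow> partial_deriv j f x = D (axis j 1)"
  unfolding partial_deriv_def by (metis frechet_derivative_at)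

lemma partial_deriv_add:
  "f differentiable (at x) \<Longrightarrow> g differentiable (at x) \<Longrightarrow>
    partial_deriv j (\<lambda>x. f x + g x) x = partial_deriv j f x + partial_deriv j g x"
  unfolding frechet_derivative_works
  by (subst partial_deriv_eq[OF has_derivative_add]) (auto simp: partial_deriv_def)

lemma partial_deriv_mult:
  "f differentiable (at x) \<Longrightarrow> g differentiable (at x) \<Longrightarrow>
    partial_deriv j (\<lambda>x. f x * g x) x = partial_deriv j f x * g x + f x * partial_deriv j g x"
  unfolding frechet_derivative_works
  by (subst partial_deriv_eq[OF has_derivative_mult]) (auto simp: partial_deriv_def)

lemma has_derivative_comp_field:
  fixes f :: "'a::real_normed_vector \<Rightarrow> 'b::real_normed_field"
  assumes "(g has_field_derivative d) (at (f x))" "(f has_derivative D) (at x)"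
  shows "((\<lambda>x. g (f x)) has_derivative (\<lambda>h. d * D h)) (at x)"
  using has_derivative_compose[OF assms(2), of g "(*) d"] assms(1)
  by (simp add: has_field_derivative_def)

text \<open>Smoothness is defined for complex-valued functions only, so a real function of one
  variable enters as a function of \<open>Re (f x)\<close>, embedded back into the complex
  numbers.\<close>

lemma has_derivative_of_real_Re:
  fixes f :: "'a::real_normed_vector \<Rightarrow> complex"
  assumes "(g has_field_derivative d) (at (Re (f x)))" "(f has_derivative D) (at x)"
  shows "((\<lambda>x. of_real (g (Re (f x))) :: complex) has_derivative (\<lambda>h. of_real (d * Re (D h)))) (at x)"
proof -
  have "((\<lambda>x. Re (f x)) has_derivative (\<lambda>h. Re (D h))) (at x)"
    by (rule bounded_linear.has_derivative[OF bounded_linear_Re assms(2)])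
  then have "((\<lambda>x. g (Re (f x))) has_derivative (\<lambda>h. d * Re (D h))) (at x)"
    using has_derivative_comp_field[of g d "\<lambda>x. Re (f x)"] assms(1) by blast
  then show ?thesis by (rule bounded_linear.has_derivative[OF bounded_linear_of_real])
qed

text \<open>The functions \<open>p(1/t) exp(-1/t)\<close>, \<open>p\<close> a polynomial, extended by zero to \<open>t \<le> 0\<close>, form a
  family that is closed under differentiation.\<close>

definition flat :: "real poly \<Rightarrow> real \<Rightarrow> real" where
  "flat p t = (if t > 0 then poly p (1 / t) * exp (- (1 / t)) else 0)"

lemma poly_times_exp_minus_tendsto_0: "((\<lambda>y::real. poly p y * exp (- y)) \<longlongrightarrow> 0) at_top"
proof -
  have "((\<lambda>y::real. \<Sum>i\<le>degree p. coeff p i * (y ^ i / exp y)) \<longlongrightarrow> (\<Sum>i\<le>degree p. coeff p i * 0)) at_top"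
    by (intro tendsto_intros tendsto_power_div_exp_0)
  then show ?thesis by (simp add: poly_altdef sum_distrib_right exp_minus divide_inverse mult.assoc)
qed

text \<open>With \<open>y = 1/t\<close> the derivative of \<open>p(y) exp(-y)\<close> in
  \<open>t\<close> is \<open>y^2 (p(y) - p'(y)) exp(-y)\<close>, again of the same kind; the factor
  \<open>[:0, 0, 1:]\<close> is \<open>y^2\<close>. Only the origin needs a limit.\<close>

lemma flat_has_derivative:
  "(flat p has_field_derivative flat ([:0, 0, 1:] * (p - pderiv p)) t) (at t)"
proof (cases t "0::real" rule: linorder_cases)
  case less
  have "((\<lambda>_. 0) has_field_derivative 0) (at t)" by simp
  then have "(flat p has_field_derivative 0) (at t)"
    by (rule has_field_derivative_transform_within_open[where S = "{..<0}"])
       (use less in \<open>auto simp: flat_def\<close>)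
  then show ?thesis using less by (simp add: flat_def)
next
  case greater
  have "((\<lambda>t. poly p (1 / t) * exp (- (1 / t))) has_field_derivative
      flat ([:0, 0, 1:] * (p - pderiv p)) t) (at t)"
    using greater
    by (auto intro!: derivative_eq_intros DERIV_chain2[OF poly_DERIV] simp: flat_def field_simps power2_eq_square)
  then show ?thesis
    by (rule has_field_derivative_transform_within_open[where S = "{0<..}"])
       (use greater in \<open>auto simp: flat_def\<close>)
next
  case equal
  have "((\<lambda>h. flat p h / h) \<longlongrightarrow> 0) (at 0)"
  proof (rule filterlim_split_at)
    have "\<forall>\<^sub>F h in at_left 0. (0::real) = flat p h / h"
      using eventually_at_left_real[of "-1" "0::real"] by (auto simp: flat_def elim: eventually_mono)
    then show "((\<lambda>h. flat p h / h) \<longlongrightarrow> 0) (at_left 0)"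
      using tendsto_cong by (metis (mono_tags, lifting) tendsto_const tendsto_eventually eventually_mono)
    \<comment> \<open>The difference quotient at 0 divides by \<open>h\<close>, that is, multiplies
      by one more power of \<open>1/h\<close>; hence \<open>pCons 0 p\<close>.\<close>
    have "((\<lambda>h. poly (pCons 0 p) (inverse h) * exp (- inverse h)) \<longlongrightarrow> 0) (at_right (0::real))"
      by (rule filterlim_compose[OF poly_times_exp_minus_tendsto_0 filterlim_inverse_at_top_right])
    moreover have "\<forall>\<^sub>F h in at_right 0. poly (pCons 0 p) (inverse h) * exp (- inverse h) = flat p h / h"
      using eventually_at_right_real[of "0::real" 1]
      by (auto simp: flat_def divide_inverse elim: eventually_mono)
    ultimately show "((\<lambda>h. flat p h / h) \<longlongrightarrow> 0) (at_right 0)"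
      using tendsto_cong by fast
  qed
  then show ?thesis using equal by (simp add: has_field_derivative_iff flat_def[of _ 0])
qed

lemma partial_deriv_unary:
  assumes "f differentiable (at x)"
  shows "partial_deriv j (\<lambda>x. exp (f x)) x = exp (f x) * partial_deriv j f x"
    and "partial_deriv j (\<lambda>x. of_real (Re (f x))) x = of_real (Re (partial_deriv j f x))"
    and "partial_deriv j (\<lambda>x. cnj (f x)) x = cnj (partial_deriv j f x)"
    and "partial_deriv j (\<lambda>x. of_real (flat p (Re (f x)))) x =
      of_real (flat ([:0, 0, 1:] * (p - pderiv p)) (Re (f x))) * of_real (Re (partial_deriv j f x))"
proof -
  have f: "(f has_derivative frechet_derivative f (at x)) (at x)"
    using assms by (simp add: frechet_derivative_works)
  show "partial_deriv j (\<lambda>x. exp (f x)) x = exp (f x) * partial_deriv j f x"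
    using partial_deriv_eq[OF has_derivative_comp_field[OF DERIV_exp f]] by (simp add: partial_deriv_def)
  show "partial_deriv j (\<lambda>x. of_real (Re (f x))) x = of_real (Re (partial_deriv j f x))"
    using partial_deriv_eq[OF has_derivative_of_real_Re[OF DERIV_ident f]] by (simp add: partial_deriv_def)
  show "partial_deriv j (\<lambda>x. cnj (f x)) x = cnj (partial_deriv j f x)"
    using partial_deriv_eq[OF bounded_linear.has_derivative[OF bounded_linear_cnj f]]
    by (simp add: partial_deriv_def)
  show "partial_deriv j (\<lambda>x. of_real (flat p (Re (f x)))) x =
      of_real (flat ([:0, 0, 1:] * (p - pderiv p)) (Re (f x))) * of_real (Re (partial_deriv j f x))"
    using partial_deriv_eq[OF has_derivative_of_real_Re[OF flat_has_derivative f]]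
    by (simp add: partial_deriv_def)
qed

text \<open>A class closed under one differentiation. The chain rule dictates its rules: the
  derivative of \<open>exp f\<close> is a product, and that of a \<open>flat\<close> term contains
  the real part of a derivative, which is why \<open>Re\<close> has a rule of its own.\<close>

inductive smooth_term :: "(real^2 \<Rightarrow> complex) \<Rightarrow> bool" where
  base: "smooth f \<Longrightarrow> smooth_term f"
| add: "smooth_term f \<Longrightarrow> smooth_term g \<Longrightarrow> smooth_term (\<lambda>x. f x + g x)"
| mult: "smooth_term f \<Longrightarrow> smooth_term g \<Longrightarrow> smooth_term (\<lambda>x. f x * g x)"
| exp: "smooth_term f \<Longrightarrow> smooth_term (\<lambda>x. exp (f x))"
| cnj: "smooth_term f \<Longrightarrow> smooth_term (\<lambda>x. cnj (f x))"
| Re: "smooth_term f \<Longrightarrow> smooth_term (\<lambda>x. of_real (Re (f x)))"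
| flat: "smooth_term f \<Longrightarrow> smooth_term (\<lambda>x. of_real (flat p (Re (f x))))"

lemma smooth_term_step:
  "smooth_term f \<Longrightarrow> (\<forall>x. f differentiable (at x)) \<and> (\<forall>j. smooth_term (partial_deriv j f))"
proof (induction rule: smooth_term.induct)
  case (base f)
  then show ?case using smooth_iff smooth_term.base by blast
next
  case (add f g)
  then have "partial_deriv j (\<lambda>x. f x + g x) = (\<lambda>x. partial_deriv j f x + partial_deriv j g x)" for j
    by (simp add: fun_eq_iff partial_deriv_add)
  with add show ?case by (auto intro: smooth_term.intros)
next
  case (mult f g)
  then have "partial_deriv j (\<lambda>x. f x * g x) = (\<lambda>x. partial_deriv j f x * g x + f x * partial_deriv j g x)" for j
    by (simp add: fun_eq_iff partial_deriv_mult)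
  moreover have "(\<lambda>x. f x * g x) differentiable (at x)" for x using mult by auto
  ultimately show ?case using mult by (auto intro!: smooth_term.add smooth_term.mult)
next
  case (exp f)
  then have "partial_deriv j (\<lambda>x. exp (f x)) = (\<lambda>x. exp (f x) * partial_deriv j f x)" for j
    by (simp add: fun_eq_iff partial_deriv_unary)
  moreover have "(\<lambda>x. exp (f x)) differentiable (at x)" for x
    using exp has_derivative_comp_field[OF DERIV_exp] by (metis differentiable_def)
  ultimately show ?case using exp by (auto intro: smooth_term.intros)
next
  case (cnj f)
  then have "partial_deriv j (\<lambda>x. cnj (f x)) = (\<lambda>x. cnj (partial_deriv j f x))" for j
    by (simp add: fun_eq_iff partial_deriv_unary)
  moreover have "(\<lambda>x. cnj (f x)) differentiable (at x)" for x
    using cnj bounded_linear.has_derivative[OF bounded_linear_cnj] by (metis differentiable_def)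
  ultimately show ?case using cnj by (auto intro: smooth_term.intros)
next
  case (Re f)
  then have "partial_deriv j (\<lambda>x. of_real (Re (f x))) = (\<lambda>x. of_real (Re (partial_deriv j f x)))" for j
    by (simp add: fun_eq_iff partial_deriv_unary)
  moreover have "(\<lambda>x. of_real (Re (f x)) :: complex) differentiable (at x)" for x
    using Re has_derivative_of_real_Re[OF DERIV_ident] unfolding differentiable_def by fast
  ultimately show ?case using Re by (auto intro: smooth_term.intros)
next
  case (flat f p)
  then have "partial_deriv j (\<lambda>x. of_real (flat p (Re (f x)))) = (\<lambda>x.
      of_real (flat ([:0, 0, 1:] * (p - pderiv p)) (Re (f x))) * of_real (Re (partial_deriv j f x)))" for j
    by (simp add: fun_eq_iff partial_deriv_unary)
  moreover have "(\<lambda>x. of_real (flat p (Re (f x))) :: complex) differentiable (at x)" for x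
    using flat has_derivative_of_real_Re[OF flat_has_derivative] unfolding differentiable_def by fast
  ultimately show ?case using flat smooth_term.flat smooth_term.Re smooth_term.mult by auto
qed

lemma smooth_term_smooth: "smooth_term f \<Longrightarrow> smooth f"
  by (rule smooth_coinduct[of smooth_term]) (auto dest: smooth_term_step)

lemma smooth_const [simp]: "smooth (\<lambda>x. c)"
proof (rule smooth_coinduct[of "\<lambda>f. \<exists>c. f = (\<lambda>x. c)"])
  fix f :: "real^2 \<Rightarrow> complex" assume "\<exists>c. f = (\<lambda>x. c)"
  then obtain c where f: "f = (\<lambda>x. c)" by blast
  have "partial_deriv j f = (\<lambda>x. 0)" for j
    using partial_deriv_eq[OF has_derivative_const] by (auto simp: f)
  then show "(\<forall>x. f differentiable (at x)) \<and> (\<forall>j. \<exists>c. partial_deriv j f = (\<lambda>x. c))"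
    by (auto simp: f)
qed blast

lemma partial_deriv_coord: "partial_deriv j (\<lambda>x. of_real (x $ i)) x = (if i = j then 1 else 0)"
  and coord_differentiable: "(\<lambda>x::real^2. of_real (x $ i) :: complex) differentiable (at x)"
proof -
  have *: "((\<lambda>x::real^2. of_real (x $ i) :: complex) has_derivative (\<lambda>h. of_real (h $ i))) (at x)"
    by (intro bounded_linear_imp_has_derivative bounded_linear_compose[OF bounded_linear_of_real]
        bounded_linear_vec_nth)
  show "partial_deriv j (\<lambda>x. of_real (x $ i)) x = (if i = j then 1 else 0)"
    using partial_deriv_eq[OF *] by (simp add: axis_def)
  show "(\<lambda>x::real^2. of_real (x $ i) :: complex) differentiable (at x)"
    using * unfolding differentiable_def by blast
qed

lemma smooth_coord [simp]: "smooth (\<lambda>x. of_real (x $ i))"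
proof -
  have "partial_deriv j (\<lambda>x. of_real (x $ i)) = (\<lambda>x. if i = j then 1 else 0)" for j
    by (simp add: fun_eq_iff partial_deriv_coord)
  then show ?thesis by (subst smooth_iff) (simp add: coord_differentiable)
qed

lemma smooth_add: "smooth f \<Longrightarrow> smooth g \<Longrightarrow> smooth (\<lambda>x. f x + g x)"
  and smooth_mult: "smooth f \<Longrightarrow> smooth g \<Longrightarrow> smooth (\<lambda>x. f x * g x)"
  and smooth_exp: "smooth f \<Longrightarrow> smooth (\<lambda>x. exp (f x))"
  and smooth_cnj: "smooth f \<Longrightarrow> smooth (\<lambda>x. cnj (f x))"
  and smooth_flat: "smooth f \<Longrightarrow> smooth (\<lambda>x. of_real (flat p (Re (f x))))"
  by (blast intro: smooth_term_smooth smooth_term.base smooth_term.add smooth_term.mult smooth_term.exp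
      smooth_term.cnj smooth_term.flat)+

lemma smooth_uminus: "smooth f \<Longrightarrow> smooth (\<lambda>x. - f x)"
  using smooth_mult[of "\<lambda>_. -1" f] by simp

lemma smooth_diff: "smooth f \<Longrightarrow> smooth g \<Longrightarrow> smooth (\<lambda>x. f x - g x)"
  using smooth_add[of f "\<lambda>x. - g x"] smooth_uminus[of g] by simp

lemma smooth_power: "smooth f \<Longrightarrow> smooth (\<lambda>x. f x ^ n)"
  by (induction n) (auto intro: smooth_mult)

lemma smooth_sum: "(\<And>i. i \<in> I \<Longrightarrow> smooth (f i)) \<Longrightarrow> smooth (\<lambda>x. \<Sum>i\<in>I. f i x)"
  by (induction I rule: infinite_finite_induct) (auto intro: smooth_add)

lemmas smooth_intros = smooth_add smooth_mult smooth_exp smooth_cnj smooth_flat smooth_uminus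
  smooth_diff smooth_power smooth_sum smooth_const smooth_coord smooth_partial

section \<open>Test functions and their supports\<close>

abbreviation tsupp :: "(real^2 \<Rightarrow> complex) \<Rightarrow> (real^2) set" where
  "tsupp f \<equiv> closure {x. f x \<noteq> 0}"

lemma test_functions_iff: "\<phi> \<in> test_functions \<Omega> \<longleftrightarrow> smooth \<phi> \<and> compact (tsupp \<phi>) \<and> tsupp \<phi> \<subseteq> \<Omega>"
  by (simp add: test_functions_def smooth_def)

lemma test_smooth: "\<phi> \<in> test_functions \<Omega> \<Longrightarrow> smooth \<phi>"
  by (simp add: test_functions_iff)

lemma test_zero_outside: "\<phi> \<in> test_functions \<Omega> \<Longrightarrow> x \<notin> \<Omega> \<Longrightarrow> \<phi> x = 0"
  using closure_subset[of "{x. \<phi> x \<noteq> 0}"] by (auto simp: test_functions_iff)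

lemma zero_outside_tsupp: "x \<notin> tsupp f \<Longrightarrow> f x = 0"
  using closure_subset[of "{x. f x \<noteq> 0}"] by auto

lemma test_subsupport:
  assumes "\<phi> \<in> test_functions \<Omega>" "smooth f" "\<And>x. x \<notin> tsupp \<phi> \<Longrightarrow> f x = 0"
  shows "f \<in> test_functions \<Omega>"
proof -
  have "tsupp f \<subseteq> tsupp \<phi>"
    by (rule closure_minimal) (use assms(3) in auto)
  moreover have "compact (tsupp f)"
    using compact_Int_closed[of "tsupp \<phi>" "tsupp f"] calculation assms(1)
    by (simp add: test_functions_iff Int_absorb1)
  ultimately show ?thesis using assms by (auto simp: test_functions_iff)
qed

lemma test_mult: "\<phi> \<in> test_functions \<Omega> \<Longrightarrow> smooth f \<Longrightarrow> (\<lambda>x. f x * \<phi> x) \<in> test_functions \<Omega>"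
proof (rule test_subsupport[of \<phi>])
  show "f x * \<phi> x = 0" if "x \<notin> tsupp \<phi>" for x
    using zero_outside_tsupp[OF that] by simp
qed (simp_all add: test_smooth smooth_mult)

lemma test_scale: "\<phi> \<in> test_functions \<Omega> \<Longrightarrow> (\<lambda>x. c * \<phi> x) \<in> test_functions \<Omega>"
  by (rule test_mult) simp_all

lemma test_add:
  assumes "\<phi> \<in> test_functions \<Omega>" "\<psi> \<in> test_functions \<Omega>"
  shows "(\<lambda>x. \<phi> x + \<psi> x) \<in> test_functions \<Omega>"
proof -
  have sub: "tsupp (\<lambda>x. \<phi> x + \<psi> x) \<subseteq> tsupp \<phi> \<union> tsupp \<psi>"
    unfolding closure_Un[symmetric] by (intro closure_mono) auto
  moreover have "compact (tsupp \<phi> \<union> tsupp \<psi>)" using assms by (auto simp: test_functions_iff)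
  ultimately have "compact (tsupp (\<lambda>x. \<phi> x + \<psi> x))"
    using compact_Int_closed[of "tsupp \<phi> \<union> tsupp \<psi>" "tsupp (\<lambda>x. \<phi> x + \<psi> x)"] by (simp add: Int_absorb1)
  then show ?thesis using assms sub by (auto simp: test_functions_iff smooth_add)
qed

lemma test_zero: "(\<lambda>x. 0) \<in> test_functions \<Omega>"
  by (simp add: test_functions_iff)

lemma test_diff:
  "\<phi> \<in> test_functions \<Omega> \<Longrightarrow> \<psi> \<in> test_functions \<Omega> \<Longrightarrow> (\<lambda>x. \<phi> x - \<psi> x) \<in> test_functions \<Omega>"
  using test_add[of \<phi> \<Omega> "\<lambda>x. - 1 * \<psi> x"] test_scale[of \<psi> \<Omega> "-1"] by simp

lemma test_sum: "(\<And>i. i \<in> I \<Longrightarrow> f i \<in> test_functions \<Omega>) \<Longrightarrow> (\<lambda>x. \<Sum>i\<in>I. f i x) \<in> test_functions \<Omega>"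
  by (induction I rule: infinite_finite_induct) (auto intro: test_add test_zero)

lemma test_cnj: "\<phi> \<in> test_functions \<Omega> \<Longrightarrow> (\<lambda>x. cnj (\<phi> x)) \<in> test_functions \<Omega>"
  by (simp add: test_functions_iff smooth_cnj)

lemma locally_zero_derivative:
  fixes f :: "real^2 \<Rightarrow> complex"
  assumes "\<And>y. y \<notin> C \<Longrightarrow> f y = 0" "closed C" "x \<notin> C"
  shows "(f has_derivative (\<lambda>h. 0)) (at x)"
  by (rule has_derivative_transform_within_open[of "\<lambda>_. 0" _ _ UNIV "- C"]) (use assms in auto)

lemma partial_deriv_outside: "x \<notin> tsupp f \<Longrightarrow> partial_deriv j f x = 0"
  using partial_deriv_eq[OF locally_zero_derivative[of "tsupp f" f x, OF zero_outside_tsupp[of _ f] closed_closure]] by simp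

lemma test_partial: "\<phi> \<in> test_functions \<Omega> \<Longrightarrow> partial_deriv j \<phi> \<in> test_functions \<Omega>"
  by (rule test_subsupport[of \<phi>]) (auto simp: test_smooth smooth_partial partial_deriv_outside)

lemma test_mono: "\<phi> \<in> test_functions \<Omega> \<Longrightarrow> \<Omega> \<subseteq> \<Omega>' \<Longrightarrow> \<phi> \<in> test_functions \<Omega>'"
  by (auto simp: test_functions_iff)

section \<open>The plane as complex numbers; holomorphic factors\<close>

definition to_complex :: "real^2 \<Rightarrow> complex" where
  "to_complex x = Complex (x $ 1) (x $ 2)"

lemma to_complex_alt: "to_complex x = of_real (x $ 1) + \<i> * of_real (x $ 2)"
  by (simp add: to_complex_def Complex_eq)

lemma linear_to_complex: "linear to_complex"
  by (rule linearI) (simp_all add: to_complex_def complex_eq_iff)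

lemma bounded_linear_to_complex: "bounded_linear to_complex"
  using linear_to_complex by (simp add: linear_conv_bounded_linear)

lemma norm_to_complex: "cmod (to_complex x) = norm x"
  by (simp add: to_complex_def norm_vec_def L2_set_def sum_2 complex_norm)

lemma smooth_to_complex: "smooth to_complex"
  unfolding to_complex_alt[abs_def] by (intro smooth_intros)

lemma to_complex_axis: "to_complex (axis 1 1) = 1" "to_complex (axis 2 1) = \<i>"
  by (simp_all add: to_complex_def axis_def complex_eq_iff)

lemma has_derivative_to_complex_comp:
  assumes "g field_differentiable (at (to_complex x))"
  shows "((\<lambda>x. g (to_complex x)) has_derivative (\<lambda>h. deriv g (to_complex x) * to_complex h)) (at x)"
  using assms
  by (intro has_derivative_comp_field bounded_linear_imp_has_derivative bounded_linear_to_complex)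
     (simp add: DERIV_deriv_iff_field_differentiable)

text \<open>On the support of \<open>\<phi>\<close> both factors are differentiable. Off it the
  product is zero near \<open>x\<close>, whatever value the total function \<open>g\<close> takes
  there; so a function that is holomorphic only on the domain can serve as a global factor.\<close>

lemma test_holomorphic_derivative:
  assumes "\<phi> \<in> test_functions \<Omega>" "g holomorphic_on to_complex ` \<Omega>" "open (to_complex ` \<Omega>)"
  shows "((\<lambda>x. \<phi> x * g (to_complex x)) has_derivative
     (\<lambda>h. \<phi> x * (deriv g (to_complex x) * to_complex h) + frechet_derivative \<phi> (at x) h * g (to_complex x))) (at x)"
proof (cases "x \<in> tsupp \<phi>")
  case True
  then have "x \<in> \<Omega>" using assms(1) by (auto simp: test_functions_iff)
  then have "g field_differentiable (at (to_complex x))"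
    using holomorphic_on_imp_differentiable_at[OF assms(2,3)] by blast
  then show ?thesis
    using assms(1) smooth_differentiable
    by (intro has_derivative_mult has_derivative_to_complex_comp)
       (simp_all add: frechet_derivative_works[symmetric] test_smooth)
next
  case False
  have z: "\<phi> y = 0" if "y \<notin> tsupp \<phi>" for y using that by (rule zero_outside_tsupp)
  have "(\<phi> has_derivative (\<lambda>h. 0)) (at x)"
    by (rule locally_zero_derivative[OF z closed_closure False])
  then have "frechet_derivative \<phi> (at x) = (\<lambda>h. 0)"
    using frechet_derivative_at by metis
  moreover have "\<phi> y * g (to_complex y) = 0" if "y \<notin> tsupp \<phi>" for y
    using z[OF that] by simp
  then have "((\<lambda>x. \<phi> x * g (to_complex x)) has_derivative (\<lambda>h. 0)) (at x)"
    by (rule locally_zero_derivative[OF _ closed_closure False])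
  ultimately show ?thesis using z[OF False] by simp
qed

lemma partial_deriv_test_holomorphic:
  assumes "\<phi> \<in> test_functions \<Omega>" "g holomorphic_on to_complex ` \<Omega>" "open (to_complex ` \<Omega>)"
  shows "partial_deriv j (\<lambda>x. \<phi> x * g (to_complex x)) =
     (\<lambda>x. (to_complex (axis j 1) * \<phi> x) * deriv g (to_complex x) + partial_deriv j \<phi> x * g (to_complex x))"
  by (rule ext) (subst partial_deriv_eq[OF test_holomorphic_derivative[OF assms]],
    simp add: partial_deriv_def algebra_simps)

text \<open>The holomorphic factor need not be smooth on the whole plane, so
  \<open>smooth_term\<close> does not cover these products. One differentiation turns a product into
  two, \<open>\<phi>\<close> times \<open>deriv g\<close> and a derivative of \<open>\<phi>\<close>
  times \<open>g\<close>; hence the closure under sums.\<close>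

inductive holomorphic_multiples :: "(real^2) set \<Rightarrow> (real^2 \<Rightarrow> complex) \<Rightarrow> bool" for \<Omega> where
  base: "\<phi> \<in> test_functions \<Omega> \<Longrightarrow> g holomorphic_on to_complex ` \<Omega> \<Longrightarrow>
    holomorphic_multiples \<Omega> (\<lambda>x. \<phi> x * g (to_complex x))"
| add: "holomorphic_multiples \<Omega> u \<Longrightarrow> holomorphic_multiples \<Omega> v \<Longrightarrow> holomorphic_multiples \<Omega> (\<lambda>x. u x + v x)"

lemma test_mult_holomorphic:
  assumes "\<phi> \<in> test_functions \<Omega>" "g holomorphic_on to_complex ` \<Omega>" "open (to_complex ` \<Omega>)"
  shows "(\<lambda>x. \<phi> x * g (to_complex x)) \<in> test_functions \<Omega>"
proof (rule test_subsupport[OF assms(1)])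
  have "holomorphic_multiples \<Omega> f \<Longrightarrow>
    (\<forall>x. f differentiable (at x)) \<and> (\<forall>j. holomorphic_multiples \<Omega> (partial_deriv j f))" for f
  proof (induction rule: holomorphic_multiples.induct)
    case (base \<phi> g)
    have "(\<lambda>x. \<phi> x * g (to_complex x)) differentiable (at x)" for x
      using test_holomorphic_derivative[OF base assms(3)] unfolding differentiable_def by blast
    moreover have "holomorphic_multiples \<Omega> (partial_deriv j (\<lambda>x. \<phi> x * g (to_complex x)))" for j
      unfolding partial_deriv_test_holomorphic[OF base assms(3)]
      by (intro holomorphic_multiples.intros test_scale test_partial base holomorphic_deriv assms(3))
    ultimately show ?case by blast
  next
    case (add u v)
    then have "partial_deriv j (\<lambda>x. u x + v x) = (\<lambda>x. partial_deriv j u x + partial_deriv j v x)" for j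
      by (simp add: fun_eq_iff partial_deriv_add)
    with add show ?case by (auto intro: holomorphic_multiples.intros)
  qed
  then show "smooth (\<lambda>x. \<phi> x * g (to_complex x))"
    by (intro smooth_coinduct[of "holomorphic_multiples \<Omega>"] holomorphic_multiples.base assms)
  show "\<phi> x * g (to_complex x) = 0" if "x \<notin> tsupp \<phi>" for x
    using zero_outside_tsupp[OF that] by simp
qed

text \<open>The profile is \<open>flat 1\<close> of \<open>r^2 - |x - c|^2\<close>. The exact set of
  nonzeros is recorded, because later the vanishing of a multiple of the bump must force the other
  factor to vanish on a ball.\<close>

lemma bump_exists:
  assumes "open \<Omega>" "c \<in> \<Omega>"
  shows "\<exists>\<phi>\<in>test_functions \<Omega>. \<exists>r>0. \<forall>x. \<phi> x \<noteq> 0 \<longleftrightarrow> x \<in> ball c r"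
proof -
  obtain r where r: "r > 0" "cball c r \<subseteq> \<Omega>" using assms open_contains_cball by blast
  define f where "f = (\<lambda>x::real^2. of_real (r\<^sup>2) - ((of_real (x $ 1) - of_real (c $ 1))\<^sup>2 + (of_real (x $ 2) - of_real (c $ 2))\<^sup>2) :: complex)"
  define \<phi> where "\<phi> = (\<lambda>x. complex_of_real (flat 1 (Re (f x))))"
  have d: "(dist c x)\<^sup>2 = (c $ 1 - x $ 1)\<^sup>2 + (c $ 2 - x $ 2)\<^sup>2" for x
    by (simp add: dist_norm norm_vec_def L2_set_def sum_2)
  have Ref: "Re (f x) = r\<^sup>2 - (dist c x)\<^sup>2" for x
    using d[of x] by (simp add: f_def power2_eq_square algebra_simps)
  have iff: "\<phi> x \<noteq> 0 \<longleftrightarrow> x \<in> ball c r" for x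
    using r(1) by (auto simp: \<phi>_def Ref flat_def abs_less_iff power2_less_imp_less
        intro: power_strict_mono)
  have "{x. \<phi> x \<noteq> 0} = ball c r" using iff by blast
  then have "tsupp \<phi> = cball c r" using r(1) by simp
  moreover have "smooth \<phi>" unfolding \<phi>_def f_def by (intro smooth_intros)
  ultimately show ?thesis using iff r by (intro bexI[of _ \<phi>]) (auto simp: test_functions_iff)
qed

section \<open>Integration by parts and the Poincare inequality\<close>

definition vec2 :: "real \<Rightarrow> real \<Rightarrow> real^2" where
  "vec2 x y = vector [x, y]"

lemma vec2_nth [simp]: "vec2 x y $ 1 = x" "vec2 x y $ 2 = y"
  by (simp_all add: vec2_def)

lemma vec2_eta [simp]: "vec2 (p $ 1) (p $ 2) = p"
  by (simp add: vec_eq_iff forall_2)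

lemma vec2_eq: "vec2 x y = x *\<^sub>R axis 1 1 + y *\<^sub>R axis 2 1"
  by (simp add: vec_eq_iff forall_2 axis_def)

lemma continuous_on_vec2 [continuous_intros]:
  "continuous_on A f \<Longrightarrow> continuous_on A g \<Longrightarrow> continuous_on A (\<lambda>z. vec2 (f z) (g z))"
  unfolding vec2_eq by (intro continuous_intros)

lemma Basis_real2: "(Basis :: (real^2) set) = {axis 1 1, axis 2 1}"
  unfolding Basis_vec_def by (auto simp: UNIV_2)

lemma Basis_real_pair: "(Basis :: (real \<times> real) set) = {(1, 0), (0, 1)}"
  by (auto simp: Basis_prod_def)

text \<open>Lebesgue measure is determined by its values on boxes. This moves integrals over
  \<open>real^2\<close> to the product type \<open>real \<times> real\<close>, where they can be
  iterated.\<close>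

lemma distr_vec2: "distr (lborel :: (real \<times> real) measure) borel (\<lambda>(x, y). vec2 x y) = lborel"
proof (rule lborel_eqI[symmetric])
  have [measurable]: "(\<lambda>(x, y). vec2 x y) \<in> borel_measurable (borel :: (real \<times> real) measure)"
    unfolding split_beta by (intro borel_measurable_continuous_onI continuous_intros)
  fix l u :: "real^2"
  assume le: "\<And>b. b \<in> Basis \<Longrightarrow> l \<bullet> b \<le> u \<bullet> b"
  have vim: "(\<lambda>(x, y). vec2 x y) -` box l u = box (l $ 1, l $ 2) (u $ 1, u $ 2)"
    by (auto simp: mem_box Basis_prod_def Basis_real2 inner_axis)
  have ax: "axis 1 (1::real) \<noteq> (axis 2 1 :: real^2)" by (simp add: axis_eq_axis)
  have l12: "l $ 1 \<le> u $ 1" "l $ 2 \<le> u $ 2"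
    using le[of "axis 1 1"] le[of "axis 2 1"] by (auto simp: Basis_real2 inner_axis)
  show "emeasure (distr lborel borel (\<lambda>(x, y). vec2 x y)) (box l u) = ennreal (\<Prod>b\<in>Basis. (u - l) \<bullet> b)"
    using ax l12
    by (simp add: emeasure_distr vim emeasure_lborel_box_eq Basis_real2 inner_axis Basis_real_pair)
qed simp

text \<open>The values \<open>R\<close> and \<open>-R\<close> themselves count as outside, so that
  boundary terms on the edges of the square are zero.\<close>

definition vanishes_outside :: "real \<Rightarrow> (real^2 \<Rightarrow> 'b::zero) \<Rightarrow> bool" where
  "vanishes_outside R f \<longleftrightarrow> (\<forall>x y. \<bar>x\<bar> \<ge> R \<or> \<bar>y\<bar> \<ge> R \<longrightarrow> f (vec2 x y) = 0)"

definition square :: "real \<Rightarrow> (real^2) set" where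
  "square R = {p. \<bar>p $ 1\<bar> < R \<and> \<bar>p $ 2\<bar> < R}"

lemma test_square_vanishes: "\<phi> \<in> test_functions (square R) \<Longrightarrow> vanishes_outside R \<phi>"
  unfolding vanishes_outside_def by (auto simp: square_def intro!: test_zero_outside)

lemma bounded_subset_square:
  assumes "bounded \<Omega>"
  shows "\<exists>R>0. \<Omega> \<subseteq> square R"
proof -
  obtain R where R: "R > 0" "\<And>x. x \<in> \<Omega> \<Longrightarrow> norm x < R"
    using assms by (meson bounded_pos_less)
  then have "\<Omega> \<subseteq> square R"
    using component_le_norm_cart order_le_less_trans unfolding square_def by blast
  then show ?thesis using R(1) by blast
qed

lemma test_in_square:
  assumes "\<phi> \<in> test_functions \<Omega>"
  shows "\<exists>R>0. \<phi> \<in> test_functions (square R)"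
proof -
  have "bounded (tsupp \<phi>)" using assms compact_imp_bounded by (auto simp: test_functions_iff)
  then show ?thesis using assms bounded_subset_square by (simp add: test_functions_iff)
qed

text \<open>Plane integrals become iterated gauge integrals over one bounded square, in both orders,
  so that the fundamental theorem of calculus can be applied along either axis in the inner
  integral.\<close>

lemma
  fixes f :: "real^2 \<Rightarrow> 'b::euclidean_space"
  assumes cont: "continuous_on UNIV f" and van: "vanishes_outside R f"
  shows integrable_vanishing: "integrable lborel f"
    and iterated_integral: "integral\<^sup>L lborel f = integral {-R..R} (\<lambda>x. integral {-R..R} (\<lambda>y. f (vec2 x y)))"
    and iterated_integral': "integral\<^sup>L lborel f = integral {-R..R} (\<lambda>y. integral {-R..R} (\<lambda>x. f (vec2 x y)))"
proof -
  define g where "g = (\<lambda>(x, y). f (vec2 x y))"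
  have [measurable]: "(\<lambda>(x, y). vec2 x y) \<in> borel_measurable (borel :: (real \<times> real) measure)"
    unfolding split_beta by (intro borel_measurable_continuous_onI continuous_intros)
  have m1 [measurable]: "(\<lambda>p. vec2 (fst p) (snd p)) \<in> borel_measurable (borel :: (real \<times> real) measure)"
    by (intro borel_measurable_continuous_onI continuous_intros)
  have [measurable]: "f \<in> borel_measurable borel"
    using cont by (rule borel_measurable_continuous_onI)
  have gc: "continuous_on UNIV g"
    unfolding g_def split_beta by (intro continuous_on_compose2[OF cont] continuous_intros) auto
  have g0: "g z = 0" if "z \<notin> cbox (-R, -R) (R, R)" for z
    using that van unfolding g_def vanishes_outside_def
    by (cases z) (force simp: cbox_Pair_eq not_le)
  have "integrable lborel (\<lambda>z. indicator (cbox (-R, -R) (R, R)) z *\<^sub>R g z)"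
    by (intro borel_integrable_compact compact_cbox continuous_on_subset[OF gc]) auto
  also have "(\<lambda>z. indicator (cbox (-R, -R) (R, R)) z *\<^sub>R g z) = g"
    using g0 by (auto simp: fun_eq_iff indicator_def)
  finally have gi: "integrable lborel g" .
  then have "integrable (distr lborel borel (\<lambda>(x, y). vec2 x y)) f"
    by (subst integrable_distr_eq) (auto simp: g_def case_prod_unfold)
  then show "integrable lborel f" by (simp add: distr_vec2)
  have "integral\<^sup>L lborel f = integral\<^sup>L (distr lborel borel (\<lambda>(x, y). vec2 x y)) f"
    by (simp add: distr_vec2)
  also have "\<dots> = integral\<^sup>L lborel g"
    by (subst integral_distr) (auto simp: g_def case_prod_unfold)
  also have "\<dots> = integral UNIV g" using integral_lborel[OF gi] by simp
  also have "\<dots> = integral (cbox (-R, -R) (R, R)) g"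
  proof -
    have "g = (\<lambda>z. if z \<in> cbox (-R, -R) (R, R) then g z else 0)" using g0 by auto
    then show ?thesis by (metis Henstock_Kurzweil_Integration.integral_restrict_UNIV)
  qed
  finally have eq: "integral\<^sup>L lborel f = integral (cbox (-R, -R) (R, R)) g" .
  also have "\<dots> = integral (cbox (-R) R) (\<lambda>x. integral (cbox (-R) R) (\<lambda>y. g (x, y)))"
    by (rule integral_prod_continuous) (rule continuous_on_subset[OF gc], simp)
  finally show "integral\<^sup>L lborel f = integral {-R..R} (\<lambda>x. integral {-R..R} (\<lambda>y. f (vec2 x y)))"
    by (simp add: g_def)
  have "integral (cbox (-R, -R) (R, R)) g = integral (cbox (-R) R) (\<lambda>y. integral (cbox (-R) R) (\<lambda>x. g (x, y)))"
  proof -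
    have "integral (cbox (-R, -R) (R, R)) (\<lambda>(x, y). g (x, y)) = integral (cbox (-R, -R) (R, R)) (\<lambda>(x, y). g (y, x))"
      by (rule integral_swap_2dim) (auto intro: continuous_on_subset[OF gc])
    also have "\<dots> = integral (cbox (-R) R) (\<lambda>y. integral (cbox (-R) R) (\<lambda>x. g (x, y)))"
      unfolding split_beta
      by (subst integral_prod_continuous)
         (auto intro!: continuous_on_compose2[OF gc] continuous_intros)
    finally show ?thesis by simp
  qed
  then show "integral\<^sup>L lborel f = integral {-R..R} (\<lambda>y. integral {-R..R} (\<lambda>x. f (vec2 x y)))"
    using eq by (simp add: g_def)
qed

lemma has_vector_derivative_slice:
  assumes "f differentiable (at (vec2 x y))"
  shows "((\<lambda>x. f (vec2 x y)) has_vector_derivative partial_deriv 1 f (vec2 x y)) (at x within A)"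
    and "((\<lambda>y. f (vec2 x y)) has_vector_derivative partial_deriv 2 f (vec2 x y)) (at y within A)"
proof -
  have f: "(f has_derivative frechet_derivative f (at (vec2 x y))) (at (vec2 x y))"
    using assms by (simp add: frechet_derivative_works)
  then have lin: "linear (frechet_derivative f (at (vec2 x y)))"
    using has_derivative_linear by blast
  have "((\<lambda>x. vec2 x y) has_derivative (\<lambda>h. h *\<^sub>R axis 1 1)) (at x within A)"
    unfolding vec2_eq by (auto intro!: derivative_eq_intros)
  from has_derivative_compose[OF this f]
  show "((\<lambda>x. f (vec2 x y)) has_vector_derivative partial_deriv 1 f (vec2 x y)) (at x within A)"
    by (simp add: has_vector_derivative_def partial_deriv_def linear_scale[OF lin])
  have "((\<lambda>y. vec2 x y) has_derivative (\<lambda>h. h *\<^sub>R axis 2 1)) (at y within A)"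
    unfolding vec2_eq by (auto intro!: derivative_eq_intros)
  from has_derivative_compose[OF this f]
  show "((\<lambda>y. f (vec2 x y)) has_vector_derivative partial_deriv 2 f (vec2 x y)) (at y within A)"
    by (simp add: has_vector_derivative_def partial_deriv_def linear_scale[OF lin])
qed

lemma smooth_slice:
  assumes "smooth f"
  shows "((\<lambda>x. f (vec2 x y)) has_vector_derivative partial_deriv 1 f (vec2 x y)) (at x within A)"
    and "((\<lambda>y. f (vec2 x y)) has_vector_derivative partial_deriv 2 f (vec2 x y)) (at y within A)"
  using has_vector_derivative_slice[OF smooth_differentiable[OF assms]] by auto

lemma continuous_on_smooth_vec2 [continuous_intros]:
  assumes "smooth f" "continuous_on A g" "continuous_on A h"
  shows "continuous_on A (\<lambda>z. f (vec2 (g z) (h z)))"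
  by (rule continuous_on_compose2[OF smooth_continuous[OF assms(1), of UNIV]]) (auto intro!: continuous_intros assms)

lemma integral_slice:
  assumes "smooth f" "a \<le> b"
  shows "((\<lambda>t. partial_deriv 1 f (vec2 t y)) has_integral (f (vec2 b y) - f (vec2 a y))) {a..b}"
    and "((\<lambda>t. partial_deriv 2 f (vec2 x t)) has_integral (f (vec2 x b) - f (vec2 x a))) {a..b}"
  using assms by (intro fundamental_theorem_of_calculus smooth_slice; simp)+

text \<open>Integrating first along the axis of the derivative leaves a difference of two boundary
  values, both zero.\<close>

lemma integral_partial_zero:
  assumes "f \<in> test_functions \<Omega>"
  shows "integral\<^sup>L lborel (partial_deriv j f) = 0"
proof -
  obtain R where R: "R > 0" and fR: "f \<in> test_functions (square R)" using test_in_square[OF assms] by blast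
  have f: "smooth f" and van: "vanishes_outside R f" using fR by (simp_all add: test_smooth test_square_vanishes)
  have c: "continuous_on UNIV (partial_deriv j f)" for j by (intro smooth_continuous smooth_partial f)
  have v: "vanishes_outside R (partial_deriv j f)" for j by (intro test_square_vanishes test_partial fR)
  have z: "f (vec2 R y) = 0" "f (vec2 (-R) y) = 0" "f (vec2 y R) = 0" "f (vec2 y (-R)) = 0" for y
    using van R by (auto simp: vanishes_outside_def)
  have "integral\<^sup>L lborel (partial_deriv 1 f) = 0"
    unfolding iterated_integral'[OF c v]
    using integral_unique[OF integral_slice(1)[OF f, of "-R" R]] R by (simp add: z)
  moreover have "integral\<^sup>L lborel (partial_deriv 2 f) = 0"
    unfolding iterated_integral[OF c v]
    using integral_unique[OF integral_slice(2)[OF f, of "-R" R]] R by (simp add: z)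
  ultimately show ?thesis using exhaust_2[of j] by auto
qed

text \<open>The Leibniz rule differentiates the integral of \<open>partial_deriv 1 f\<close> from
  \<open>a\<close> to \<open>t\<close> in the second variable; the result is an increment of
  \<open>partial_deriv 2 f\<close>, and differentiating it in \<open>t\<close> gives the claim. This
  symmetry removes the cross term of the Dirichlet integral below.\<close>

lemma partial_deriv_commute:
  assumes f: "smooth f"
  shows "partial_deriv 1 (partial_deriv 2 f) p = partial_deriv 2 (partial_deriv 1 f) p"
proof -
  define x y where "x = p $ 1" and "y = p $ 2"
  define a where "a = x - 1"
  have s: "smooth (partial_deriv j f)" "smooth (partial_deriv i (partial_deriv j f))" for i j
    by (intro smooth_partial f)+
  have 1: "partial_deriv 2 f (vec2 t y) - partial_deriv 2 f (vec2 a y) =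
      integral {a..t} (\<lambda>u. partial_deriv 2 (partial_deriv 1 f) (vec2 u y))" if "a \<le> t" for t
  proof -
    have "((\<lambda>y. integral (cbox a t) (\<lambda>u. partial_deriv 1 f (vec2 u y))) has_vector_derivative
      integral (cbox a t) (\<lambda>u. partial_deriv 2 (partial_deriv 1 f) (vec2 u y))) (at y within UNIV)"
      by (rule leibniz_rule_vector_derivative)
         (auto intro!: smooth_slice s integrable_continuous_interval continuous_intros simp: split_beta)
    moreover have "integral (cbox a t) (\<lambda>u. partial_deriv 1 f (vec2 u y)) = f (vec2 t y) - f (vec2 a y)" for y
      using integral_unique[OF integral_slice(1)[OF f that]] by simp
    ultimately have "((\<lambda>y. f (vec2 t y) - f (vec2 a y)) has_vector_derivative
      integral {a..t} (\<lambda>u. partial_deriv 2 (partial_deriv 1 f) (vec2 u y))) (at y)" by simp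
    moreover have "((\<lambda>y. f (vec2 t y) - f (vec2 a y)) has_vector_derivative
      partial_deriv 2 f (vec2 t y) - partial_deriv 2 f (vec2 a y)) (at y)"
      by (intro has_vector_derivative_diff smooth_slice f)
    ultimately show ?thesis using vector_derivative_unique_at by metis
  qed
  have "((\<lambda>t. integral {a..t} (\<lambda>u. partial_deriv 2 (partial_deriv 1 f) (vec2 u y))) has_vector_derivative
      partial_deriv 2 (partial_deriv 1 f) (vec2 x y)) (at x within {a..x+1})"
    by (rule integral_has_vector_derivative) (auto intro!: continuous_intros s simp: a_def)
  then have "((\<lambda>t. integral {a..t} (\<lambda>u. partial_deriv 2 (partial_deriv 1 f) (vec2 u y))) has_vector_derivative
      partial_deriv 2 (partial_deriv 1 f) (vec2 x y)) (at x)"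
    using at_within_Icc_at[of a x "x + 1"] by (simp add: a_def)
  then have "((\<lambda>t. partial_deriv 2 f (vec2 t y) - partial_deriv 2 f (vec2 a y)) has_vector_derivative
      partial_deriv 2 (partial_deriv 1 f) (vec2 x y)) (at x)"
  proof (rule has_vector_derivative_transform_within_open[where S = "{a<..}"])
    show "x \<in> {a<..}" by (simp add: a_def)
  qed (simp_all add: 1)
  moreover have "((\<lambda>t. partial_deriv 2 f (vec2 t y) - partial_deriv 2 f (vec2 a y)) has_vector_derivative
      partial_deriv 1 (partial_deriv 2 f) (vec2 x y) - 0) (at x)"
    by (intro has_vector_derivative_diff smooth_slice s) simp
  ultimately have "partial_deriv 2 (partial_deriv 1 f) (vec2 x y) = partial_deriv 1 (partial_deriv 2 f) (vec2 x y) - 0"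
    by (rule vector_derivative_unique_at)
  then show ?thesis by (simp add: x_def y_def)
qed

lemma test_integrable:
  assumes "\<phi> \<in> test_functions \<Omega>"
  shows "integrable lborel \<phi>"
proof -
  obtain R where "\<phi> \<in> test_functions (square R)" using test_in_square[OF assms] by blast
  then show ?thesis
    by (intro integrable_vanishing[of \<phi> R] smooth_continuous test_square_vanishes) (simp add: test_smooth)
qed

lemma test_norm_square_integrable:
  assumes "\<phi> \<in> test_functions \<Omega>"
  shows "integrable lborel (\<lambda>x. (cmod (\<phi> x))\<^sup>2)"
proof -
  have "integrable lborel (\<lambda>x. cnj (\<phi> x) * \<phi> x)"
    by (rule test_integrable[OF test_mult[OF assms smooth_cnj[OF test_smooth[OF assms]]]])
  from integrable_norm[OF this] show ?thesis by (simp add: norm_mult power2_eq_square)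
qed

lemma integration_by_parts:
  assumes f: "f \<in> test_functions \<Omega>" and g: "smooth g"
  shows "(\<integral>x. partial_deriv j f x * g x \<partial>lborel) = - (\<integral>x. f x * partial_deriv j g x \<partial>lborel)"
proof -
  have fg: "(\<lambda>x. f x * g x) \<in> test_functions \<Omega>"
    using test_mult[OF f g] by (simp add: mult.commute)
  have eq: "partial_deriv j (\<lambda>x. f x * g x) = (\<lambda>x. partial_deriv j f x * g x + f x * partial_deriv j g x)"
    using f g by (simp add: fun_eq_iff partial_deriv_mult test_smooth smooth_differentiable)
  have 1: "integrable lborel (\<lambda>x. partial_deriv j f x * g x)"
    using test_integrable[OF test_mult[OF test_partial[OF f] g]] by (simp add: mult.commute)
  have 2: "integrable lborel (\<lambda>x. f x * partial_deriv j g x)"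
    using test_integrable[OF test_mult[OF f smooth_partial[OF g]]] by (simp add: mult.commute)
  show ?thesis
    using integral_partial_zero[OF fg, of j] Bochner_Integration.integral_add[OF 1 2]
    by (simp add: eq add_eq_0_iff)
qed

lemma partial_deriv_cnj: "smooth f \<Longrightarrow> partial_deriv j (\<lambda>x. cnj (f x)) = (\<lambda>x. cnj (partial_deriv j f x))"
  by (simp add: fun_eq_iff partial_deriv_unary smooth_differentiable)

section \<open>The Cauchy-Riemann operator and the Dirichlet integral\<close>

definition dbar :: "(real^2 \<Rightarrow> complex) \<Rightarrow> real^2 \<Rightarrow> complex" where
  "dbar f x = partial_deriv 1 f x + \<i> * partial_deriv 2 f x"

lemma cmod_add_ii: "(cmod (a + \<i> * b))\<^sup>2 = (cmod a)\<^sup>2 + (cmod b)\<^sup>2 + 2 * Im (a * cnj b)"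
  unfolding cmod_power2 by (simp add: power2_eq_square algebra_simps)

text \<open>Expanding the square leaves twice the imaginary part of the integral of
  \<open>partial_deriv 1 \<phi>\<close> against the conjugate of
  \<open>partial_deriv 2 \<phi>\<close>. Integration by parts turns this integral and its conjugate
  into the same expression, because mixed derivatives commute; so it is real. Hence the single
  operator \<open>dbar\<close> controls the whole gradient.\<close>

lemma integral_dbar_square:
  assumes \<phi>: "\<phi> \<in> test_functions \<Omega>"
  shows "(\<integral>x. (cmod (dbar \<phi> x))\<^sup>2 \<partial>lborel) =
    (\<integral>x. (cmod (partial_deriv 1 \<phi> x))\<^sup>2 \<partial>lborel) + (\<integral>x. (cmod (partial_deriv 2 \<phi> x))\<^sup>2 \<partial>lborel)"
proof -
  note s = test_smooth[OF \<phi>]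
  define I where "I = (\<integral>x. partial_deriv 1 \<phi> x * cnj (partial_deriv 2 \<phi> x) \<partial>lborel)"
  have *: "(\<integral>x. partial_deriv i \<phi> x * cnj (partial_deriv j \<phi> x) \<partial>lborel) =
      - (\<integral>x. \<phi> x * cnj (partial_deriv i (partial_deriv j \<phi>) x) \<partial>lborel)" for i j
    using integration_by_parts[OF \<phi> smooth_cnj[OF smooth_partial[OF s]], of i j]
    by (simp add: partial_deriv_cnj smooth_partial s)
  have int: "integrable lborel (\<lambda>x. partial_deriv 1 \<phi> x * cnj (partial_deriv 2 \<phi> x))"
    using test_integrable[OF test_mult[OF test_partial[OF \<phi>] smooth_cnj[OF smooth_partial[OF s]]]]
    by (simp add: mult.commute)
  have "cnj I = (\<integral>x. cnj (partial_deriv 1 \<phi> x * cnj (partial_deriv 2 \<phi> x)) \<partial>lborel)"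
    unfolding I_def by (rule Bochner_Integration.integral_cnj[symmetric])
  also have "\<dots> = (\<integral>x. partial_deriv 2 \<phi> x * cnj (partial_deriv 1 \<phi> x) \<partial>lborel)"
    by (simp only: complex_cnj_mult complex_cnj_cnj mult.commute)
  also have "\<dots> = I" unfolding I_def * by (simp add: partial_deriv_commute[OF s])
  finally have "Im I = 0" by (simp add: complex_eq_iff)
  moreover have "Im I = (\<integral>x. Im (partial_deriv 1 \<phi> x * cnj (partial_deriv 2 \<phi> x)) \<partial>lborel)"
    unfolding I_def by (rule integral_Im[OF int, symmetric])
  moreover define J where "J x = Im (partial_deriv 1 \<phi> x * cnj (partial_deriv 2 \<phi> x))" for x
  ultimately have J: "(\<integral>x. J x \<partial>lborel) = 0" by simp
  have iJ: "integrable lborel J" unfolding J_def by (rule integrable_Im[OF int])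
  have "(cmod (dbar \<phi> x))\<^sup>2 = (cmod (partial_deriv 1 \<phi> x))\<^sup>2 + (cmod (partial_deriv 2 \<phi> x))\<^sup>2 + 2 * J x" for x
    unfolding dbar_def cmod_add_ii J_def ..
  then show ?thesis
    using test_norm_square_integrable[OF test_partial[OF \<phi>, of 1]]
      test_norm_square_integrable[OF test_partial[OF \<phi>, of 2]] iJ J by simp
qed

text \<open>Cauchy-Schwarz against the indicator of a set of measure at most 1: expand the integral
  of the square of \<open>w - m * indicator D\<close>, with \<open>m\<close> the integral of
  \<open>w\<close>.\<close>

lemma integral_square_le:
  fixes w :: "'a \<Rightarrow> real"
  assumes w: "integrable M w" "integrable M (\<lambda>x. (w x)\<^sup>2)" and D: "D \<in> sets M" "emeasure M D \<noteq> \<infinity>" "measure M D \<le> 1"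
    and zero: "\<And>x. x \<notin> D \<Longrightarrow> w x = 0"
  shows "(\<integral>x. w x \<partial>M)\<^sup>2 \<le> (\<integral>x. (w x)\<^sup>2 \<partial>M)"
proof -
  define m where "m = (\<integral>x. w x \<partial>M)"
  have i: "integrable M (indicator D :: 'a \<Rightarrow> real)" using D by (auto simp: top.not_eq_extremum)
  have "0 \<le> (\<integral>x. (w x - m * indicator D x)\<^sup>2 \<partial>M)" by simp
  also have "(\<lambda>x. (w x - m * indicator D x)\<^sup>2) = (\<lambda>x. (w x)\<^sup>2 - 2 * m * w x + m\<^sup>2 * indicator D x)"
  proof
    fix x show "(w x - m * indicator D x)\<^sup>2 = (w x)\<^sup>2 - 2 * m * w x + m\<^sup>2 * indicator D x"
      using zero[of x] by (cases "x \<in> D") (auto simp: power2_eq_square algebra_simps)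
  qed
  also have "(\<integral>x. (w x)\<^sup>2 - 2 * m * w x + m\<^sup>2 * indicator D x \<partial>M) =
      (\<integral>x. (w x)\<^sup>2 \<partial>M) - 2 * m * m + m\<^sup>2 * measure M D"
    using w i D sets.sets_into_space[OF D(1)] by (simp add: m_def[symmetric] Int_absorb2)
  also have "\<dots> \<le> (\<integral>x. (w x)\<^sup>2 \<partial>M) - m\<^sup>2"
    using mult_left_mono[OF D(3), of "m\<^sup>2"] by (simp add: power2_eq_square)
  finally show ?thesis by (simp add: m_def)
qed

lemma integral_norm_slice_bound:
  fixes u u' :: "real \<Rightarrow> complex"
  assumes u: "\<And>t. (u has_vector_derivative u' t) (at t)" and c: "continuous_on UNIV u'"
    and xy: "x \<in> {a..b}" "y \<in> {a..b}"
  shows "cmod (u x - u y) \<le> integral {a..b} (\<lambda>t. cmod (u' t))"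
  using xy
proof (induction x y rule: linorder_wlog)
  case (le x y)
  have ci: "continuous_on A u'" for A using c continuous_on_subset by blast
  have i: "(\<lambda>t. cmod (u' t)) integrable_on {p..q}" for p q
    by (intro integrable_continuous_interval continuous_intros ci)
  have "(u' has_integral (u y - u x)) {x..y}"
    using le by (intro fundamental_theorem_of_calculus) (auto intro: has_vector_derivative_at_within u)
  then have "cmod (u y - u x) \<le> integral {x..y} (\<lambda>t. cmod (u' t))"
    using integral_norm_bound_integral[OF _ i, of u' x y] by (simp add: has_integral_iff)
  also have "\<dots> \<le> integral {a..b} (\<lambda>t. cmod (u' t))"
    using le by (intro integral_subset_le i) auto
  finally show ?case by (simp add: norm_minus_commute)
qed (simp add: norm_minus_commute)

text \<open>A value of \<open>\<phi>\<close> is bounded by the integral of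
  \<open>|partial_deriv 1 \<phi>|\<close> along its horizontal line and by that of
  \<open>|partial_deriv 2 \<phi>|\<close> along its vertical line. So the square is at most
  \<open>Q x * P y\<close>, whose integral factors into two \<open>L1\<close> norms; area at most 1
  bounds these by \<open>L2\<close> norms. The constant is the same for all domains.\<close>

theorem Poincare_inequality:
  assumes \<phi>: "\<phi> \<in> test_functions \<Omega>" and \<Omega>: "open \<Omega>" "bounded \<Omega>" "measure lebesgue \<Omega> \<le> 1"
  shows "(\<integral>x. (cmod (\<phi> x))\<^sup>2 \<partial>lborel) \<le>
    (\<integral>x. (cmod (partial_deriv 1 \<phi> x))\<^sup>2 \<partial>lborel) + (\<integral>x. (cmod (partial_deriv 2 \<phi> x))\<^sup>2 \<partial>lborel)"
proof -
  obtain R where R: "R > 0" "\<phi> \<in> test_functions (square R)" using test_in_square[OF \<phi>] by blast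
  note s = test_smooth[OF \<phi>]
  have sp: "smooth (partial_deriv j \<phi>)" for j by (intro smooth_partial s)
  have vp: "vanishes_outside R (partial_deriv j \<phi>)" for j by (intro test_square_vanishes test_partial R)
  have vn: "vanishes_outside R (\<lambda>x. cmod (f x))" "vanishes_outside R (\<lambda>x. (cmod (f x))\<^sup>2)"
    if "vanishes_outside R f" for f :: "real^2 \<Rightarrow> complex"
    using that by (auto simp: vanishes_outside_def)
  define P where "P y = integral {-R..R} (\<lambda>x. cmod (partial_deriv 1 \<phi> (vec2 x y)))" for y
  define Q where "Q x = integral {-R..R} (\<lambda>y. cmod (partial_deriv 2 \<phi> (vec2 x y)))" for x
  have cP: "continuous_on A P" for A
    unfolding P_def cbox_interval[symmetric]
    by (rule integral_continuous_on_param) (auto simp: split_beta intro!: continuous_intros sp)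
  have cQ: "continuous_on A Q" for A
    unfolding Q_def cbox_interval[symmetric]
    by (rule integral_continuous_on_param) (auto simp: split_beta intro!: continuous_intros sp)
  have z: "\<phi> (vec2 (-R) y) = 0" "\<phi> (vec2 x (-R)) = 0" for x y
    using test_square_vanishes[OF R(2)] by (auto simp: vanishes_outside_def)
  have bP: "cmod (\<phi> (vec2 x y)) \<le> P y" and bQ: "cmod (\<phi> (vec2 x y)) \<le> Q x"
    if "x \<in> {-R..R}" "y \<in> {-R..R}" for x y
  proof -
    have "cmod (\<phi> (vec2 x y) - \<phi> (vec2 (-R) y)) \<le> P y"
      unfolding P_def using that R
      by (intro integral_norm_slice_bound) (auto intro!: smooth_slice s continuous_intros sp)
    then show "cmod (\<phi> (vec2 x y)) \<le> P y" by (simp add: z)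
    have "cmod (\<phi> (vec2 x y) - \<phi> (vec2 x (-R))) \<le> Q x"
      unfolding Q_def using that R
      by (intro integral_norm_slice_bound) (auto intro!: smooth_slice s continuous_intros sp)
    then show "cmod (\<phi> (vec2 x y)) \<le> Q x" by (simp add: z)
  qed
  have ab: "b * a \<le> a\<^sup>2 + b\<^sup>2" if "a \<ge> 0" "b \<ge> 0" for a b :: real
    using sum_squares_bound[of a b] mult_nonneg_nonneg[OF that] mult.commute[of a b] by linarith
  have cn: "continuous_on UNIV (\<lambda>x. cmod (partial_deriv j \<phi> x))" for j
    by (intro continuous_intros smooth_continuous sp)
  have "(\<integral>x. (cmod (\<phi> x))\<^sup>2 \<partial>lborel) =
      integral {-R..R} (\<lambda>x. integral {-R..R} (\<lambda>y. (cmod (\<phi> (vec2 x y)))\<^sup>2))"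
    by (intro iterated_integral continuous_intros smooth_continuous s vn test_square_vanishes R)
  also have "\<dots> \<le> integral {-R..R} (\<lambda>x. integral {-R..R} (\<lambda>y. Q x * P y))"
  proof (intro integral_le integrable_continuous_interval)
    show "continuous_on {-R..R} (\<lambda>x. integral {-R..R} (\<lambda>y. (cmod (\<phi> (vec2 x y)))\<^sup>2))"
      unfolding cbox_interval[symmetric]
      by (rule integral_continuous_on_param) (auto simp: split_beta intro!: continuous_intros s)
    show "continuous_on {-R..R} (\<lambda>x. integral {-R..R} (\<lambda>y. Q x * P y))"
      by (simp, intro continuous_intros cQ)
  qed (use bP bQ in \<open>auto simp: power2_eq_square intro!: mult_mono continuous_intros s cP order_trans[OF norm_ge_zero bQ]\<close>)
  also have "\<dots> = integral {-R..R} Q * integral {-R..R} P" by simp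
  also have "integral {-R..R} P = (\<integral>x. cmod (partial_deriv 1 \<phi> x) \<partial>lborel)"
    unfolding P_def by (intro iterated_integral'[symmetric] cn vn vp)
  also have "integral {-R..R} Q = (\<integral>x. cmod (partial_deriv 2 \<phi> x) \<partial>lborel)"
    unfolding Q_def by (intro iterated_integral[symmetric] cn vn vp)
  also have "(\<integral>x. cmod (partial_deriv 2 \<phi> x) \<partial>lborel) * (\<integral>x. cmod (partial_deriv 1 \<phi> x) \<partial>lborel)
     \<le> (\<integral>x. cmod (partial_deriv 1 \<phi> x) \<partial>lborel)\<^sup>2 + (\<integral>x. cmod (partial_deriv 2 \<phi> x) \<partial>lborel)\<^sup>2"
    by (rule ab) simp_all
  also have "(\<integral>x. cmod (partial_deriv j \<phi> x) \<partial>lborel)\<^sup>2 \<le> (\<integral>x. (cmod (partial_deriv j \<phi> x))\<^sup>2 \<partial>lborel)" for j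
  proof (rule integral_square_le[where D = \<Omega>])
    show "integrable lborel (\<lambda>x. cmod (partial_deriv j \<phi> x))"
      by (intro integrable_norm test_integrable[OF test_partial[OF \<phi>]])
    show "integrable lborel (\<lambda>x. (cmod (partial_deriv j \<phi> x))\<^sup>2)"
      by (rule test_norm_square_integrable[OF test_partial[OF \<phi>]])
    show "\<Omega> \<in> sets lborel" using \<Omega> by simp
    show "emeasure lborel \<Omega> \<noteq> \<infinity>" using emeasure_bounded_finite[OF \<Omega>(2)] by auto
    show "measure lborel \<Omega> \<le> 1" using \<Omega> by (simp add: measure_completion)
  qed (simp add: test_zero_outside[OF test_partial[OF \<phi>]])
  note add_mono[OF this[of 1] this[of 2]]
  finally show ?thesis by simp
qed

section \<open>Spectral sequences of pairs of Hermitian forms\<close>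

text \<open>Induction on the number of equations. Both \<open>c\<close> and \<open>e\<close> solve
  the first \<open>k\<close>; \<open>e\<close> vanishes at \<open>j0\<close> and \<open>c\<close>
  does not. The combination \<open>r * e - s * c\<close> cancels the next equation and is nonzero at
  \<open>j0\<close> unless \<open>s = 0\<close>, in which case \<open>e\<close> itself solves
  it.\<close>

lemma underdetermined_system:
  fixes A :: "nat \<Rightarrow> 'a \<Rightarrow> complex"
  assumes "finite J" "card J > k"
  shows "\<exists>c. (\<exists>j\<in>J. c j \<noteq> 0) \<and> (\<forall>i<k. (\<Sum>j\<in>J. c j * A i j) = 0)"
  using assms
proof (induction k arbitrary: J)
  case 0
  then obtain j where "j \<in> J" by (metis card.empty less_irrefl ex_in_conv)
  then show ?case by (intro exI[of _ "\<lambda>_. 1"]) auto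
next
  case (Suc k)
  obtain c j0 where c: "j0 \<in> J" "c j0 \<noteq> 0" "\<forall>i<k. (\<Sum>j\<in>J. c j * A i j) = 0"
    using Suc.IH[of J] Suc.prems by force
  obtain d j1 where d: "j1 \<in> J - {j0}" "d j1 \<noteq> 0" "\<forall>i<k. (\<Sum>j\<in>J - {j0}. d j * A i j) = 0"
    using Suc.IH[of "J - {j0}"] Suc.prems c(1) by force
  define e where "e = d(j0 := 0)"
  have e: "(\<Sum>j\<in>J. e j * A i j) = (\<Sum>j\<in>J - {j0}. d j * A i j)" for i
    using Suc.prems(1) c(1) by (subst sum.remove[of J j0]) (auto simp: e_def intro!: sum.cong)
  define r where "r = (\<Sum>j\<in>J. c j * A k j)"
  define s where "s = (\<Sum>j\<in>J. e j * A k j)"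
  show ?case
  proof (cases "s = 0")
    case True
    then show ?thesis using d e by (intro exI[of _ e]) (auto simp: s_def less_Suc_eq e_def)
  next
    case False
    have *: "(\<Sum>j\<in>J. (r * e j - s * c j) * A i j) = r * (\<Sum>j\<in>J. e j * A i j) - s * (\<Sum>j\<in>J. c j * A i j)" for i
      by (simp add: sum_subtractf sum_distrib_left algebra_simps)
    have "r * e j0 - s * c j0 \<noteq> 0" using c False by (simp add: e_def)
    moreover have "\<forall>i<Suc k. (\<Sum>j\<in>J. (r * e j - s * c j) * A i j) = 0"
      unfolding * using c(3) d(3) e by (auto simp: less_Suc_eq r_def s_def)
    ultimately show ?thesis using c(1) by (intro exI[of _ "\<lambda>j. r * e j - s * c j"]) auto
  qed
qed

text \<open>The form lives on a subspace of a type of total functions and is only semidefinite: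
  elements of \<open>L2\<close> are functions and not classes, so \<open>q\<close> may vanish at a
  nonzero element.\<close>

locale hermitian_form = vector_space sc
  for sc :: "complex \<Rightarrow> 'v::ab_group_add \<Rightarrow> 'v" +
  fixes S :: "'v set" and b :: "'v \<Rightarrow> 'v \<Rightarrow> complex"
  assumes S: "subspace S"
    and add_left: "\<lbrakk>u \<in> S; v \<in> S; w \<in> S\<rbrakk> \<Longrightarrow> b (u + v) w = b u w + b v w"
    and scale_left: "\<lbrakk>u \<in> S; v \<in> S\<rbrakk> \<Longrightarrow> b (sc c u) v = c * b u v"
    and cnj_swap: "\<lbrakk>u \<in> S; v \<in> S\<rbrakk> \<Longrightarrow> b v u = cnj (b u v)"
    and Re_self_nonneg: "u \<in> S \<Longrightarrow> Re (b u u) \<ge> 0"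
begin

definition q where "q u = Re (b u u)"

lemma add_in [intro]: "u \<in> S \<Longrightarrow> v \<in> S \<Longrightarrow> u + v \<in> S" using S by (rule subspace_add)
lemma scale_in [intro]: "u \<in> S \<Longrightarrow> sc c u \<in> S" using S by (rule subspace_scale)
lemma diff_in [intro]: "u \<in> S \<Longrightarrow> v \<in> S \<Longrightarrow> u - v \<in> S" using S by (rule subspace_diff)
lemma zero_in: "0 \<in> S" using S by (rule subspace_0)
lemma sum_in [intro]: "(\<And>i. i \<in> I \<Longrightarrow> f i \<in> S) \<Longrightarrow> sum f I \<in> S" using S by (rule subspace_sum)

lemma zero_left [simp]: "u \<in> S \<Longrightarrow> b 0 u = 0"
  using scale_left[of u u 0] by simp

lemma diff_left: "\<lbrakk>u \<in> S; v \<in> S; w \<in> S\<rbrakk> \<Longrightarrow> b (u - v) w = b u w - b v w"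
  using add_left[of "u - v" v w] by (simp add: diff_in)

lemma add_right: "\<lbrakk>u \<in> S; v \<in> S; w \<in> S\<rbrakk> \<Longrightarrow> b w (u + v) = b w u + b w v"
  by (metis add_in add_left cnj_swap complex_cnj_add)

lemma diff_right: "\<lbrakk>u \<in> S; v \<in> S; w \<in> S\<rbrakk> \<Longrightarrow> b w (u - v) = b w u - b w v"
  by (metis diff_in diff_left cnj_swap complex_cnj_diff)

lemma scale_right: "\<lbrakk>u \<in> S; v \<in> S\<rbrakk> \<Longrightarrow> b u (sc c v) = cnj c * b u v"
  by (metis scale_in scale_left cnj_swap complex_cnj_mult)

lemma zero_right [simp]: "u \<in> S \<Longrightarrow> b u 0 = 0"
  using cnj_swap[of 0 u] zero_in by simp

lemma sum_left: "(\<And>i. i \<in> I \<Longrightarrow> f i \<in> S) \<Longrightarrow> w \<in> S \<Longrightarrow> b (sum f I) w = (\<Sum>i\<in>I. b (f i) w)"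
  by (induction I rule: infinite_finite_induct) (auto simp: add_left sum_in)

lemma sum_right: "(\<And>i. i \<in> I \<Longrightarrow> f i \<in> S) \<Longrightarrow> w \<in> S \<Longrightarrow> b w (sum f I) = (\<Sum>i\<in>I. b w (f i))"
  by (induction I rule: infinite_finite_induct) (auto simp: add_right sum_in)

lemma self_eq: "u \<in> S \<Longrightarrow> b u u = of_real (q u)"
  using cnj_swap[of u u] by (auto simp: q_def complex_eq_iff)

lemma q_nonneg: "u \<in> S \<Longrightarrow> q u \<ge> 0"
  unfolding q_def by (rule Re_self_nonneg)

lemma q_zero [simp]: "q 0 = 0"
  using zero_in by (simp add: q_def)

lemma q_add: "\<lbrakk>u \<in> S; v \<in> S\<rbrakk> \<Longrightarrow> q (u + v) = q u + q v + 2 * Re (b u v)"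
  using cnj_swap[of u v] by (simp add: q_def add_left add_right add_in)

lemma q_diff: "\<lbrakk>u \<in> S; v \<in> S\<rbrakk> \<Longrightarrow> q (u - v) = q u + q v - 2 * Re (b u v)"
  using cnj_swap[of u v] by (simp add: q_def diff_left diff_right diff_in)

lemma q_scale: "u \<in> S \<Longrightarrow> q (sc c u) = (cmod c)\<^sup>2 * q u"
proof -
  assume "u \<in> S"
  then have "b (sc c u) (sc c u) = of_real ((cmod c)\<^sup>2) * of_real (q u)"
    unfolding complex_norm_square using self_eq[of u] by (simp add: scale_left scale_right scale_in del: self_eq)
  then show ?thesis
    unfolding q_def by (metis Re_complex_of_real of_real_mult)
qed

lemma parallelogram: "\<lbrakk>u \<in> S; v \<in> S\<rbrakk> \<Longrightarrow> q (u - v) = 2 * q u + 2 * q v - q (u + v)"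
  by (simp add: q_add q_diff)

lemma Cauchy_Schwarz:
  assumes u: "u \<in> S" and v: "v \<in> S"
  shows "(cmod (b u v))\<^sup>2 \<le> q u * q v"
proof -
  define z where "z = b u v"
  have *: "0 \<le> q u + (cmod c)\<^sup>2 * q v + 2 * Re (cnj c * z)" for c
    using q_nonneg[of "u + sc c v"] u v
    by (simp add: q_add q_scale scale_in add_in scale_right z_def)
  have zz: "Re (cnj z * z) = (cmod z)\<^sup>2"
    by (metis complex_norm_square mult.commute Re_complex_of_real)
  show ?thesis
  proof (cases "q v = 0")
    case True
    have "0 \<le> q u - 2 * t * (cmod z)\<^sup>2" for t :: real
      using *[of "- of_real t * z"] True zz[symmetric] by (simp add: algebra_simps)
    \<comment> \<open>For \<open>z\<close> nonzero this \<open>t\<close> makes the right-hand side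
      above equal to \<open>-1\<close>.\<close>
    from this[of "(q u + 1) / (2 * (cmod z)\<^sup>2)"] have "z = 0"
      by (cases "z = 0") auto
    then show ?thesis using True by (simp add: z_def)
  next
    case False
    then have pos: "q v > 0" using q_nonneg[OF v] by simp
    have "0 \<le> q u - (cmod z)\<^sup>2 / q v"
    proof -
      have "Re (cnj (- z / of_real (q v)) * z) = - (cmod z)\<^sup>2 / q v"
        using zz by (metis Re_divide_of_real complex_cnj_divide complex_cnj_complex_of_real complex_cnj_minus
            divide_minus_left mult_minus_left times_divide_eq_left uminus_complex.sel(1))
      moreover have "(cmod (- z / of_real (q v)))\<^sup>2 * q v = (cmod z)\<^sup>2 / q v"
        using pos by (simp add: norm_divide power_divide power2_eq_square)
      ultimately show ?thesis using *[of "- z / of_real (q v)"] by linarith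
    qed
    then show ?thesis using pos by (simp add: field_simps z_def)
  qed
qed

lemma Cauchy_Schwarz_sqrt: "\<lbrakk>u \<in> S; v \<in> S\<rbrakk> \<Longrightarrow> cmod (b u v) \<le> sqrt (q u) * sqrt (q v)"
  using Cauchy_Schwarz[of u v] by (metis real_le_rsqrt real_sqrt_mult)

lemma q_minus: "u \<in> S \<Longrightarrow> v \<in> S \<Longrightarrow> q (u - v) = q (v - u)"
  using cnj_swap[of u v] by (simp add: q_diff)

lemma q_add_le: "\<lbrakk>u \<in> S; v \<in> S\<rbrakk> \<Longrightarrow> q (u + v) \<le> 2 * q u + 2 * q v"
  using parallelogram[of u v] q_nonneg[of "u - v"] by (simp add: diff_in)

lemma form_tendsto:
  assumes X: "\<And>n. X n \<in> S" "x \<in> S" "(\<lambda>n. q (X n - x)) \<longlonglongrightarrow> 0" and v: "v \<in> S"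
  shows "(\<lambda>n. b (X n) v) \<longlonglongrightarrow> b x v"
proof -
  have "(\<lambda>n. sqrt (q (X n - x)) * sqrt (q v)) \<longlonglongrightarrow> sqrt 0 * sqrt (q v)"
    by (intro tendsto_intros X)
  then have "(\<lambda>n. sqrt (q (X n - x)) * sqrt (q v)) \<longlonglongrightarrow> 0" by simp
  then have "(\<lambda>n. b (X n) v - b x v) \<longlonglongrightarrow> 0"
    by (rule Lim_null_comparison[rotated])
       (use Cauchy_Schwarz_sqrt X v in \<open>auto simp: diff_left[symmetric] diff_in\<close>)
  then show ?thesis by (rule LIM_zero_cancel)
qed

lemma q_tendsto:
  assumes X: "\<And>n. X n \<in> S" "x \<in> S" "(\<lambda>n. q (X n - x)) \<longlonglongrightarrow> 0"
  shows "(\<lambda>n. q (X n)) \<longlonglongrightarrow> q x"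
proof -
  have "(\<lambda>n. q (X n - x) + 2 * Re (b (X n) x) - q x) \<longlonglongrightarrow> 0 + 2 * Re (b x x) - q x"
    by (intro tendsto_intros X form_tendsto)
  moreover have "q (X n - x) + 2 * Re (b (X n) x) - q x = q (X n)" for n
    using X by (simp add: q_diff)
  ultimately show ?thesis by (simp add: q_def)
qed

lemma q_normalize:
  assumes pos: "u \<in> S" "q u > 0"
  shows "q (sc (of_real (1 / sqrt (q u))) u) = 1"
  using assms by (simp add: q_scale power_divide norm_divide)

end

text \<open>Here \<open>a\<close> is the energy and \<open>b\<close> the \<open>L2\<close> product.
  The assumptions are those of the discrete spectral theorem: the form domain is complete for both
  seminorms together, its embedding is compact, and its dimension modulo null vectors is infinite.
  Compactness is phrased by Cauchy subsequences, so that it names no limit.\<close>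

locale form_pair = A: hermitian_form sc S a + B: hermitian_form sc S b
  for sc :: "complex \<Rightarrow> 'v::ab_group_add \<Rightarrow> 'v" and S a b +
  assumes complete: "\<lbrakk>\<And>n. X n \<in> S; \<And>e. e > 0 \<Longrightarrow> \<exists>N. \<forall>m\<ge>N. \<forall>n\<ge>N. A.q (X m - X n) < e \<and> B.q (X m - X n) < e\<rbrakk>
      \<Longrightarrow> \<exists>x\<in>S. (\<lambda>n. A.q (X n - x)) \<longlonglongrightarrow> 0 \<and> (\<lambda>n. B.q (X n - x)) \<longlonglongrightarrow> 0"
    and compact: "\<lbrakk>\<And>n. X n \<in> S; \<And>n. A.q (X n) + B.q (X n) \<le> C\<rbrakk>
      \<Longrightarrow> \<exists>r::nat\<Rightarrow>nat. strict_mono r \<and> (\<forall>e>0. \<exists>N. \<forall>m\<ge>N. \<forall>n\<ge>N. B.q (X (r m) - X (r n)) < e)"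
    and infinite_dim: "\<exists>u. (\<forall>i<n::nat. u i \<in> S) \<and> (\<forall>c. B.q (\<Sum>i<n. sc (c i) (u i)) = 0 \<longrightarrow> (\<forall>i<n. c i = 0))"
begin

definition perp :: "(nat \<Rightarrow> 'v) \<Rightarrow> nat \<Rightarrow> 'v set" where
  "perp e k = {v \<in> S. \<forall>i<k. b v (e i) = 0}"

lemma perp_meets_span:
  assumes u: "\<And>i. i < m \<Longrightarrow> u i \<in> S" and "k < m" and e: "\<And>i. i < k \<Longrightarrow> e i \<in> S"
  shows "\<exists>c. (\<exists>i<m. c i \<noteq> 0) \<and> (\<Sum>i<m. sc (c i) (u i)) \<in> perp e k"
proof -
  obtain c where c: "\<exists>j\<in>{..<m}. c j \<noteq> 0" "\<forall>i<k. (\<Sum>j<m. c j * b (u j) (e i)) = 0"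
    using underdetermined_system[of "{..<m}" k "\<lambda>i j. b (u j) (e i)"] assms by auto
  have "b (\<Sum>i<m. sc (c i) (u i)) (e i) = 0" if "i < k" for i
    using c(2) that u e by (subst B.sum_left) (auto simp: B.scale_left)
  then show ?thesis using c(1) u by (intro exI[of _ c]) (auto simp: perp_def)
qed

lemma perp_nontrivial:
  assumes e: "\<And>i. i < k \<Longrightarrow> e i \<in> S"
  shows "\<exists>v\<in>perp e k. B.q v > 0"
proof -
  obtain u where u: "\<forall>i<Suc k. u i \<in> S" "\<And>c. B.q (\<Sum>i<Suc k. sc (c i) (u i)) = 0 \<Longrightarrow> (\<forall>i<Suc k. c i = 0)"
    using infinite_dim[of "Suc k"] by blast
  obtain c where c: "\<exists>i<Suc k. c i \<noteq> 0" "(\<Sum>i<Suc k. sc (c i) (u i)) \<in> perp e k"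
    using perp_meets_span[of "Suc k" u k e] u e by auto
  have "B.q (\<Sum>i<Suc k. sc (c i) (u i)) \<noteq> 0" using u(2) c(1) by blast
  moreover have "B.q (\<Sum>i<Suc k. sc (c i) (u i)) \<ge> 0"
    using c(2) by (intro B.q_nonneg) (auto simp: perp_def)
  ultimately show ?thesis using c(2) by force
qed

lemma perp_closed:
  assumes "\<And>i. i < k \<Longrightarrow> e i \<in> S"
  shows "u \<in> perp e k \<Longrightarrow> v \<in> perp e k \<Longrightarrow> u + v \<in> perp e k"
    "u \<in> perp e k \<Longrightarrow> v \<in> perp e k \<Longrightarrow> u - v \<in> perp e k"
    "u \<in> perp e k \<Longrightarrow> sc c u \<in> perp e k" "0 \<in> perp e k"
  using assms B.zero_in by (auto simp: perp_def B.add_left B.diff_left B.scale_left)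

text \<open>The direct method. Compactness makes a minimising sequence Cauchy for \<open>B\<close>
  along a subsequence. Sums of two terms stay in \<open>perp e k\<close>, so their energy is at
  least \<open>\<mu>\<close> times their \<open>B.q\<close>; by the parallelogram identity
  differences then have small energy too. Strong convergence results without any weak limit.\<close>

lemma minimizer_exists:
  assumes e: "\<And>i. i < k \<Longrightarrow> e i \<in> S"
  shows "\<exists>x\<in>perp e k. B.q x = 1 \<and> (\<forall>v\<in>perp e k. A.q x * B.q v \<le> A.q v)"
proof -
  have perpS: "v \<in> S" if "v \<in> perp e k" for v using that by (simp add: perp_def)
  define R where "R = A.q ` {v \<in> perp e k. B.q v = 1}"
  define \<mu> where "\<mu> = Inf R"
  obtain v0 where v0: "v0 \<in> perp e k" "B.q v0 > 0" using perp_nontrivial[of k e] e by blast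
  have Rne: "R \<noteq> {}"
    using B.q_normalize[OF perpS[OF v0(1)] v0(2)] perp_closed(3)[of k e, OF e v0(1)] by (auto simp: R_def)
  have Rbdd: "bdd_below R"
    by (rule bdd_belowI[of _ 0]) (use A.q_nonneg perpS in \<open>auto simp: R_def\<close>)
  have le: "\<mu> * B.q v \<le> A.q v" if v: "v \<in> perp e k" for v
  proof (cases "B.q v = 0")
    case True then show ?thesis using A.q_nonneg[OF perpS[OF v]] by simp
  next
    case False
    then have pos: "B.q v > 0" using B.q_nonneg[OF perpS[OF v]] by simp
    have "A.q (sc (of_real (1 / sqrt (B.q v))) v) \<in> R"
      using B.q_normalize[OF perpS[OF v] pos] perp_closed(3)[of k e, OF e v] by (auto simp: R_def)
    then have "\<mu> \<le> A.q (sc (of_real (1 / sqrt (B.q v))) v)"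
      unfolding \<mu>_def using Rbdd by (rule cInf_lower)
    also have "\<dots> = A.q v / B.q v"
      using perpS[OF v] pos by (simp add: A.q_scale power_divide norm_divide)
    finally show ?thesis using pos by (simp add: field_simps)
  qed
  have "\<exists>v. v \<in> perp e k \<and> B.q v = 1 \<and> A.q v < \<mu> + 1 / Suc n" for n
    using cInf_lessD[OF Rne, of "\<mu> + 1 / Suc n"] by (auto simp: \<mu>_def R_def)
  then obtain X where X: "\<And>n. X n \<in> perp e k" "\<And>n. B.q (X n) = 1" "\<And>n. A.q (X n) < \<mu> + 1 / Suc n"
    by metis
  have one: "1 / real (Suc n) \<le> 1" for n by simp
  have "A.q (X n) + B.q (X n) \<le> \<mu> + 2" for n
    using X(3)[of n] one[of n] X(2)[of n] by linarith
  then obtain r :: "nat \<Rightarrow> nat" where r: "strict_mono r"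
    "\<And>e. e > 0 \<Longrightarrow> \<exists>N. \<forall>m\<ge>N. \<forall>n\<ge>N. B.q (X (r m) - X (r n)) < e"
    using compact[of X "\<mu> + 2"] X perpS by metis
  define Y where "Y = X \<circ> r"
  have Y: "Y n \<in> perp e k" "B.q (Y n) = 1" for n using X by (auto simp: Y_def)
  have YA: "A.q (Y n) < \<mu> + 1 / Suc n" for n
  proof -
    have "n \<le> r n" using r(1) by (rule seq_suble)
    then have "1 / real (Suc (r n)) \<le> 1 / Suc n" by (simp add: frac_le)
    then show ?thesis using X(3)[of "r n"] unfolding Y_def o_def by linarith
  qed
  have Alim: "(\<lambda>n. A.q (Y n)) \<longlonglongrightarrow> \<mu>"
  proof (rule tendsto_sandwich[of "\<lambda>_. \<mu>" _ _ "\<lambda>n. \<mu> + 1 / Suc n"])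
    show "\<forall>\<^sub>F n in sequentially. \<mu> \<le> A.q (Y n)" using le[OF Y(1)] Y(2) by simp
    show "\<forall>\<^sub>F n in sequentially. A.q (Y n) \<le> \<mu> + 1 / real (Suc n)" by (rule always_eventually) (use YA less_imp_le in blast)
    have "(\<lambda>n. \<mu> + 1 / real (Suc n)) \<longlonglongrightarrow> \<mu> + 0"
      by (intro tendsto_intros LIMSEQ_Suc lim_1_over_n)
    then show "(\<lambda>n. \<mu> + 1 / real (Suc n)) \<longlonglongrightarrow> \<mu>" by simp
  qed simp
  have diff: "A.q (Y m - Y n) \<le> 2 * A.q (Y m) + 2 * A.q (Y n) - 4 * \<mu> + \<mu> * B.q (Y m - Y n)" for m n
  proof -
    have "\<mu> * B.q (Y m + Y n) \<le> A.q (Y m + Y n)" by (rule le) (intro perp_closed e Y)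
    moreover have "B.q (Y m + Y n) = 4 - B.q (Y m - Y n)"
      using B.parallelogram[of "Y m" "Y n"] Y perpS by simp
    moreover have "A.q (Y m - Y n) = 2 * A.q (Y m) + 2 * A.q (Y n) - A.q (Y m + Y n)"
      by (rule A.parallelogram[OF perpS[OF Y(1)] perpS[OF Y(1)]])
    ultimately show ?thesis by (simp add: algebra_simps)
  qed
  have l0: "\<mu> \<ge> 0" unfolding \<mu>_def
    by (rule cInf_greatest[OF Rne]) (use A.q_nonneg perpS in \<open>auto simp: R_def\<close>)
  have "\<exists>N. \<forall>m\<ge>N. \<forall>n\<ge>N. A.q (Y m - Y n) < \<epsilon> \<and> B.q (Y m - Y n) < \<epsilon>" if "\<epsilon> > 0" for \<epsilon>
  proof -
    \<comment> \<open>The estimate \<open>diff\<close> will leave less than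
      \<open>4 * \<delta> + \<mu> * \<delta>\<close>; the more generous factor 8 also makes
      \<open>\<delta>\<close> itself smaller than \<open>\<epsilon>\<close>.\<close>
    define \<delta> where "\<delta> = \<epsilon> / (8 * (\<mu> + 1))"
    have nz: "8 * (\<mu> + 1) > 0" using l0 by simp
    then have \<delta>: "\<delta> > 0" "\<delta> * 8 * (\<mu> + 1) = \<epsilon>" using that
      nonzero_eq_divide_eq[of "8 * (\<mu> + 1)" \<delta> \<epsilon>] by (simp_all add: \<delta>_def mult.assoc)
    have d1: "\<delta> * 8 \<le> \<epsilon>" using \<delta>(1) l0 unfolding \<delta>(2)[symmetric] by (simp add: field_simps)
    obtain N1 where N1: "\<forall>m\<ge>N1. \<forall>n\<ge>N1. B.q (Y m - Y n) < \<delta>"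
      using r(2)[OF \<delta>(1)] by (auto simp: Y_def)
    obtain N2 where N2: "\<forall>n\<ge>N2. \<bar>A.q (Y n) - \<mu>\<bar> < \<delta>"
      using LIMSEQ_D[OF Alim \<delta>(1)] by auto
    show ?thesis
    proof (intro exI[of _ "max N1 N2"] allI impI conjI)
      fix m n assume mn: "m \<ge> max N1 N2" "n \<ge> max N1 N2"
      have 1: "B.q (Y m - Y n) < \<delta>" using N1 mn by auto
      have 2: "A.q (Y m) < \<mu> + \<delta>" "A.q (Y n) < \<mu> + \<delta>" using N2 mn by (auto simp: abs_less_iff)
      have 3: "\<mu> * B.q (Y m - Y n) \<le> \<mu> * \<delta>" using 1 l0 by (intro mult_left_mono) auto
      have "A.q (Y m - Y n) < 4 * \<delta> + \<mu> * \<delta>" using diff[of m n] 2 3 by linarith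
      also have "\<dots> \<le> \<delta> * 8 * (\<mu> + 1)" using \<delta>(1) l0 by (simp add: algebra_simps)
      finally show "A.q (Y m - Y n) < \<epsilon>" using \<delta> by simp
      show "B.q (Y m - Y n) < \<epsilon>" using 1 d1 \<delta>(1) by linarith
    qed
  qed
  then obtain x where x: "x \<in> S" "(\<lambda>n. A.q (Y n - x)) \<longlonglongrightarrow> 0" "(\<lambda>n. B.q (Y n - x)) \<longlonglongrightarrow> 0"
    using complete[of Y] Y perpS by blast
  have xA: "A.q x = \<mu>"
    using A.q_tendsto[OF _ x(1,2)] Y perpS Alim LIMSEQ_unique by blast
  have xB: "B.q x = 1"
    using B.q_tendsto[OF _ x(1,3)] Y perpS by (simp add: LIMSEQ_const_iff)
  have "b x (e i) = 0" if "i < k" for i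
  proof -
    have "(\<lambda>n. b (Y n) (e i)) \<longlonglongrightarrow> b x (e i)"
      by (rule B.form_tendsto[OF perpS[OF Y(1)] x(1,3) e[OF that]])
    moreover have "(\<lambda>n. b (Y n) (e i)) = (\<lambda>n. 0)"
      using Y(1) that unfolding perp_def by blast
    ultimately show ?thesis by (simp add: LIMSEQ_const_iff)
  qed
  then have "x \<in> perp e k" using x(1) by (auto simp: perp_def)
  then show ?thesis using xA xB le by blast
qed

text \<open>Each \<open>e k\<close> minimises the energy on the complement of the earlier ones. The
  last conjunct keeps this minimality, from which both the exact multiplicities and the bounds by
  trial functions are read off later.\<close>

theorem spectral_sequence:
  "\<exists>l e. mono l \<and> (\<forall>k. e k \<in> S) \<and> (\<forall>j k. b (e j) (e k) = (if j = k then 1 else 0)) \<and>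
     (\<forall>k. \<forall>v\<in>S. a (e k) v = of_real (l k) * b (e k) v) \<and> (\<forall>M. \<exists>k. l k > M) \<and>
     (\<forall>k. \<forall>v\<in>perp e k. l k * B.q v \<le> A.q v)"
proof -
  define P where "P e k x \<longleftrightarrow> x \<in> perp e k \<and> B.q x = 1 \<and> (\<forall>v\<in>perp e k. A.q x * B.q v \<le> A.q v)" for e k x
  have cong: "perp f x = perp g x" if "\<And>y. y < x \<Longrightarrow> f y = g y" for f g x
    using that by (auto simp: perp_def)
  have "\<exists>e. \<forall>k. P e k (e k)"
  proof (rule dependent_wellorder_choice)
    show "P f x r = P g x r" if "\<And>y. y < x \<Longrightarrow> f y = g y" for r f g x
      using cong[OF that] by (simp add: P_def)
    show "\<exists>r. P f x r" if "\<And>y. y < x \<Longrightarrow> P f y (f y)" for f x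
      using minimizer_exists[of x f] that by (auto simp: P_def perp_def)
  qed
  then obtain e where P: "\<And>k. P e k (e k)" by blast
  have eS: "e k \<in> S" for k using P[of k] by (auto simp: P_def perp_def)
  define l where "l k = A.q (e k)" for k
  have min: "l k * B.q v \<le> A.q v" if "v \<in> perp e k" for k v
    using P[of k] that by (auto simp: P_def l_def)
  have orth0: "b (e k) (e j) = 0" if "j < k" for j k using P[of k] that by (auto simp: P_def perp_def)
  have orth: "b (e j) (e k) = (if j = k then 1 else 0)" for j k
  proof (cases j k rule: linorder_cases)
    case less
    then show ?thesis using orth0[OF less] B.cnj_swap[OF eS eS, of k j] by simp
  next
    case equal
    then show ?thesis using P[of k] B.self_eq[OF eS[of k]] by (simp add: P_def)
  qed (use orth0 in simp)
  have l0: "l k \<ge> 0" for k unfolding l_def by (rule A.q_nonneg[OF eS])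
  have mono: "mono l"
  proof (rule mono_iff_le_Suc[THEN iffD2], intro allI)
    fix k
    have "e (Suc k) \<in> perp e k" using P[of "Suc k"] by (auto simp: P_def perp_def)
    then show "l k \<le> l (Suc k)" using min[of "e (Suc k)" k] P[of "Suc k"] by (simp add: P_def l_def)
  qed
  \<comment> \<open>On \<open>perp e k\<close> the form \<open>a - l k * b\<close> is nonnegative by
    minimality and vanishes at \<open>e k\<close>. Cauchy-Schwarz for this form shows that it pairs
    \<open>e k\<close> with everything to zero.\<close>
  have eigen_perp: "a (e k) v = of_real (l k) * b (e k) v" if v: "v \<in> perp e k" for k v
  proof -
    interpret C: hermitian_form sc "perp e k" "\<lambda>u v. a u v - of_real (l k) * b u v"
    proof
      show "A.subspace (perp e k)" using perp_closed[of k e] eS by (intro A.subspaceI) auto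
      show "Re (a u u - of_real (l k) * b u u) \<ge> 0" if "u \<in> perp e k" for u
        using min[OF that] by (simp add: A.q_def B.q_def)
    qed (auto simp: perp_def A.add_left B.add_left A.scale_left B.scale_left algebra_simps
          A.cnj_swap[symmetric] B.cnj_swap[symmetric])
    have ek: "e k \<in> perp e k" using P[of k] by (simp add: P_def)
    have "C.q (e k) = 0"
      unfolding C.q_def using P[of k] by (simp add: P_def A.q_def B.q_def l_def)
    then show ?thesis using C.Cauchy_Schwarz[OF ek v] by simp
  qed
  \<comment> \<open>From \<open>perp e k\<close> to all of \<open>S\<close>: subtract from
    \<open>v\<close> its projection \<open>s\<close> onto the earlier eigenvectors. Both forms pair
    \<open>e k\<close> with \<open>s\<close> to zero, \<open>b\<close> by orthogonality and
    \<open>a\<close> by the equations of the earlier eigenvectors.\<close>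
  have eigen: "\<forall>v\<in>S. a (e k) v = of_real (l k) * b (e k) v" for k
  proof (induction k rule: less_induct)
    case (less k)
    show ?case
    proof
      fix v assume v: "v \<in> S"
      define s where "s = (\<Sum>i<k. sc (b v (e i)) (e i))"
      have sS: "s \<in> S" unfolding s_def by (intro B.sum_in B.scale_in eS)
      have bs: "b s (e j) = b v (e j)" if "j < k" for j
      proof -
        have "b s (e j) = (\<Sum>i<k. b v (e i) * (if i = j then 1 else 0))"
          unfolding s_def by (subst B.sum_left) (auto simp: B.scale_left eS orth)
        also have "\<dots> = b v (e j)" using that by (simp add: if_distrib cong: if_cong)
        finally show ?thesis .
      qed
      have "v - s \<in> perp e k" using v sS bs eS by (auto simp: perp_def B.diff_left)
      then have 1: "a (e k) (v - s) = of_real (l k) * b (e k) (v - s)" by (rule eigen_perp)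
      have 2: "b (e k) s = 0" unfolding s_def
        by (subst B.sum_right) (auto simp: B.scale_right eS orth)
      have "a (e k) (e i) = 0" if "i < k" for i
        using less[OF that] eS[of k] A.cnj_swap[OF eS eS, of k i] orth[of i k] that by simp
      then have 3: "a (e k) s = 0" unfolding s_def
        by (subst A.sum_right) (auto simp: A.scale_right eS)
      show "a (e k) v = of_real (l k) * b (e k) v"
        using 1 2 3 v sS eS by (simp add: A.diff_right B.diff_right)
    qed
  qed
  \<comment> \<open>Bounded \<open>l\<close> would bound the energies, and some subsequence would be
    Cauchy for \<open>B\<close>; but two orthonormal vectors differ by a vector with
    \<open>B.q\<close> equal to 2.\<close>
  have unbdd: "\<exists>k. l k > M" for M
  proof (rule ccontr)
    assume "\<not> ?thesis"
    then have "A.q (e k) + B.q (e k) \<le> M + 1" for k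
      using P[of k] by (simp add: P_def l_def not_less)
    then obtain r :: "nat \<Rightarrow> nat" where r: "strict_mono r"
      "\<And>\<epsilon>. \<epsilon> > 0 \<Longrightarrow> \<exists>N. \<forall>m\<ge>N. \<forall>n\<ge>N. B.q (e (r m) - e (r n)) < \<epsilon>"
      using compact[of e "M + 1"] eS by metis
    obtain N where "\<forall>m\<ge>N. \<forall>n\<ge>N. B.q (e (r m) - e (r n)) < 1" using r(2)[of 1] by auto
    then have "B.q (e (r N) - e (r (Suc N))) < 1" by simp
    moreover have "r N \<noteq> r (Suc N)" using r(1) by (metis lessI nat_neq_iff strict_mono_less)
    then have "B.q (e (r N) - e (r (Suc N))) = 2"
      using P by (subst B.q_diff) (auto simp: eS orth P_def)
    ultimately show False by simp
  qed
  show ?thesis using mono eS orth eigen unbdd min by blast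
qed

end

section \<open>Compactness\<close>

lemma interval_Cauchy_Schwarz:
  fixes g :: "real \<Rightarrow> real"
  assumes g: "continuous_on {a..b} g" and ab: "a \<le> b"
  shows "(integral {a..b} g)\<^sup>2 \<le> (b - a) * integral {a..b} (\<lambda>t. (g t)\<^sup>2)"
proof (cases "a = b")
  case False
  then have h: "b - a > 0" using ab by simp
  define m where "m = integral {a..b} g / (b - a)"
  have i: "g integrable_on {a..b}" "(\<lambda>t. (g t)\<^sup>2) integrable_on {a..b}"
    by (intro integrable_continuous_interval continuous_intros g)+
  have "0 \<le> integral {a..b} (\<lambda>t. (g t - m)\<^sup>2)"
    by (intro integral_nonneg integrable_continuous_interval continuous_intros g) simp
  also have "(\<lambda>t. (g t - m)\<^sup>2) = (\<lambda>t. (g t)\<^sup>2 - 2 * m * g t + m\<^sup>2)"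
    by (auto simp: fun_eq_iff power2_eq_square algebra_simps)
  also have "((\<lambda>t. (g t)\<^sup>2 - 2 * m * g t + m\<^sup>2) has_integral
      (integral {a..b} (\<lambda>t. (g t)\<^sup>2) - 2 * m * integral {a..b} g + m\<^sup>2 * (b - a))) {a..b}"
    using has_integral_const_real[of "m\<^sup>2" a b] ab
    by (intro has_integral_add has_integral_diff has_integral_mult_right integrable_integral i) (simp add: mult.commute)
  then have "integral {a..b} (\<lambda>t. (g t)\<^sup>2 - 2 * m * g t + m\<^sup>2) =
      integral {a..b} (\<lambda>t. (g t)\<^sup>2) - 2 * m * integral {a..b} g + m\<^sup>2 * (b - a)"
    by (rule integral_unique)
  also have "\<dots> = integral {a..b} (\<lambda>t. (g t)\<^sup>2) - (integral {a..b} g)\<^sup>2 / (b - a)"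
  proof -
    have m: "m * (b - a) = integral {a..b} g" using h by (simp add: m_def)
    have "m\<^sup>2 * (b - a) = m * integral {a..b} g" by (simp add: power2_eq_square m[symmetric])
    moreover have "(integral {a..b} g)\<^sup>2 / (b - a) = m * integral {a..b} g" by (simp add: m_def power2_eq_square)
    ultimately show ?thesis by simp
  qed
  finally show ?thesis using h by (simp add: field_simps)
qed simp

text \<open>On the interval \<open>w\<close> differs from its mean by at most the integral
  \<open>D\<close> of \<open>|w'|\<close>. Squaring, with
  \<open>(a + b)^2 \<le> 2 a^2 + 2 b^2\<close> and Cauchy-Schwarz for \<open>D\<close>, gives two
  terms: one with the factor \<open>h^2\<close>, small on short cells, and one that depends on a
  single number.\<close>

lemma cell_inequality:
  fixes w w' :: "real \<Rightarrow> complex"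
  assumes w: "\<And>t. (w has_vector_derivative w' t) (at t)" and c: "continuous_on UNIV w'" and h: "b - a = h" "h > 0"
  shows "integral {a..b} (\<lambda>t. (cmod (w t))\<^sup>2) \<le>
     2 * h\<^sup>2 * integral {a..b} (\<lambda>t. (cmod (w' t))\<^sup>2) + 2 / h * (cmod (integral {a..b} w))\<^sup>2"
proof -
  have cw: "continuous_on A w" for A
    using w by (meson continuous_at_imp_continuous_on has_vector_derivative_continuous)
  have cw': "continuous_on A w'" for A using c continuous_on_subset by blast
  define D where "D = integral {a..b} (\<lambda>t. cmod (w' t))"
  define M where "M = integral {a..b} w"
  have D: "D\<^sup>2 \<le> h * integral {a..b} (\<lambda>t. (cmod (w' t))\<^sup>2)"
    unfolding D_def h(1)[symmetric] using h
    by (intro interval_Cauchy_Schwarz continuous_intros cw') simp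
  have "cmod (w x) \<le> D + cmod M / h" if x: "x \<in> {a..b}" for x
  proof -
    have "integral {a..b} (\<lambda>t. w x - w t) = h * w x - M"
      using h unfolding M_def
      by (subst integral_diff) (auto intro: integrable_continuous_interval cw simp: scaleR_conv_of_real)
    moreover have "cmod (integral {a..b} (\<lambda>t. w x - w t)) \<le> integral {a..b} (\<lambda>t. D)"
      using integral_norm_slice_bound[OF w c] x unfolding D_def
      by (intro integral_norm_bound_integral) (auto intro!: integrable_continuous_interval continuous_intros cw)
    ultimately have "cmod (h * w x - M) \<le> h * D" using h by simp
    moreover have "h * cmod (w x) = cmod (h * w x)" using h by (simp add: norm_mult)
    ultimately have "h * cmod (w x) \<le> h * D + cmod M"
      using norm_triangle_ineq2[of "h * w x" M] by linarith
    then show ?thesis using h by (simp add: field_simps)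
  qed
  then have pt: "(cmod (w x))\<^sup>2 \<le> 2 * D\<^sup>2 + 2 * (cmod M)\<^sup>2 / h\<^sup>2" if "x \<in> {a..b}" for x
  proof -
    have "(cmod (w x))\<^sup>2 \<le> (D + cmod M / h)\<^sup>2" using \<open>\<And>x. x \<in> {a..b} \<Longrightarrow> _\<close>[OF that] by (intro power_mono) auto
    also have "\<dots> \<le> 2 * D\<^sup>2 + 2 * (cmod M / h)\<^sup>2"
      using sum_squares_bound[of D "cmod M / h"] by (simp add: power2_sum)
    finally show ?thesis by (simp add: power_divide)
  qed
  have "integral {a..b} (\<lambda>t. (cmod (w t))\<^sup>2) \<le> integral {a..b} (\<lambda>t. 2 * D\<^sup>2 + 2 * (cmod M)\<^sup>2 / h\<^sup>2)"
    by (intro integral_le pt) (auto intro!: integrable_continuous_interval continuous_intros cw)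
  also have "\<dots> = h * (2 * D\<^sup>2 + 2 * (cmod M)\<^sup>2 / h\<^sup>2)" using h by simp
  also have "\<dots> = 2 * h * D\<^sup>2 + 2 / h * (cmod M)\<^sup>2" using h by (simp add: field_simps power2_eq_square)
  also have "\<dots> \<le> 2 * h * (h * integral {a..b} (\<lambda>t. (cmod (w' t))\<^sup>2)) + 2 / h * (cmod M)\<^sup>2"
    using D h by (intro add_mono mult_left_mono) auto
  finally show ?thesis by (simp add: M_def power2_eq_square mult.assoc)
qed

context
  fixes R h :: real and N :: nat
  assumes R: "R > 0" and N: "N > 0" and h_def: "h = 2 * R / N"
begin

definition knot :: "nat \<Rightarrow> real" where "knot i = - R + real i * h"

lemma knot_diff: "knot (Suc i) - knot i = h"
  by (simp add: knot_def algebra_simps)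

lemma knot_le: "knot i \<le> knot (Suc i)"
proof -
  have "h > 0" using R N by (simp add: h_def)
  then show ?thesis using knot_diff[of i] by linarith
qed

lemma sum_cells:
  fixes g :: "real \<Rightarrow> 'b::banach"
  assumes "continuous_on UNIV g"
  shows "(\<Sum>i<N. integral {knot i..knot (Suc i)} g) = integral {-R..R} g"
proof -
  have h: "h > 0" using R N by (simp add: h_def)
  have "(\<Sum>i<n. integral {knot i..knot (Suc i)} g) = integral {-R..knot n} g" for n
  proof (induction n)
    case (Suc n)
    then show ?case
      using h knot_le[of n]
      by (simp, intro Henstock_Kurzweil_Integration.integral_combine)
        (auto intro!: integrable_continuous_interval continuous_on_subset[OF assms] simp: knot_def)
  qed (simp add: knot_def)
  moreover have "real N * h = 2 * R" using N by (simp add: h_def)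
  then have "knot N = R" by (simp add: knot_def)
  ultimately show ?thesis by metis
qed

lemma sum_cells_inequality:
  fixes w w' :: "real \<Rightarrow> complex"
  assumes w: "\<And>t. (w has_vector_derivative w' t) (at t)" and c: "continuous_on UNIV w'"
  shows "integral {-R..R} (\<lambda>t. (cmod (w t))\<^sup>2) \<le> 2 * h\<^sup>2 * integral {-R..R} (\<lambda>t. (cmod (w' t))\<^sup>2) +
     2 / h * (\<Sum>i<N. (cmod (integral {knot i..knot (Suc i)} w))\<^sup>2)"
proof -
  have h: "h > 0" using R N by (simp add: h_def)
  have cw: "continuous_on A w" for A
    using w by (meson continuous_at_imp_continuous_on has_vector_derivative_continuous)
  have "(\<Sum>i<N. integral {knot i..knot (Suc i)} (\<lambda>t. (cmod (w t))\<^sup>2)) \<le>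
    (\<Sum>i<N. 2 * h\<^sup>2 * integral {knot i..knot (Suc i)} (\<lambda>t. (cmod (w' t))\<^sup>2) +
      2 / h * (cmod (integral {knot i..knot (Suc i)} w))\<^sup>2)"
    by (intro sum_mono cell_inequality w c h knot_diff)
  also have "\<dots> = 2 * h\<^sup>2 * (\<Sum>i<N. integral {knot i..knot (Suc i)} (\<lambda>t. (cmod (w' t))\<^sup>2)) +
      2 / h * (\<Sum>i<N. (cmod (integral {knot i..knot (Suc i)} w))\<^sup>2)"
    by (simp add: sum.distrib sum_distrib_left)
  finally show ?thesis
    by (subst (asm) (1 2) sum_cells) (auto intro!: continuous_intros cw c)
qed

definition cell_integral :: "nat \<Rightarrow> nat \<Rightarrow> (real^2 \<Rightarrow> complex) \<Rightarrow> complex" where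
  "cell_integral i j f = integral {knot j..knot (Suc j)} (\<lambda>y. integral {knot i..knot (Suc i)} (\<lambda>x. f (vec2 x y)))"

text \<open>The one-dimensional inequality is applied twice: in \<open>x\<close> for fixed
  \<open>y\<close>, then to the strip integrals \<open>U i\<close> as functions of \<open>y\<close>.
  Up to \<open>h^2\<close> times the energy, finitely many numbers thus control the
  \<open>L2\<close> norm. The second bound keeps these numbers bounded along a bounded
  sequence.\<close>

lemma
  assumes \<phi>: "\<phi> \<in> test_functions (square R)"
  shows grid_inequality: "(\<integral>x. (cmod (\<phi> x))\<^sup>2 \<partial>lborel) \<le>
      4 * h\<^sup>2 * ((\<integral>x. (cmod (partial_deriv 1 \<phi> x))\<^sup>2 \<partial>lborel) + (\<integral>x. (cmod (partial_deriv 2 \<phi> x))\<^sup>2 \<partial>lborel)) +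
      4 / h\<^sup>2 * (\<Sum>i<N. \<Sum>j<N. (cmod (cell_integral i j \<phi>))\<^sup>2)"
    and cell_integral_bound: "i < N \<Longrightarrow> j < N \<Longrightarrow>
      (cmod (cell_integral i j \<phi>))\<^sup>2 \<le> h\<^sup>2 * (\<integral>x. (cmod (\<phi> x))\<^sup>2 \<partial>lborel)"
proof -
  have h: "h > 0" using R N by (simp add: h_def)
  note s = test_smooth[OF \<phi>]
  have sp: "smooth (partial_deriv j \<phi>)" for j by (intro smooth_partial s)
  define U where "U i y = integral {knot i..knot (Suc i)} (\<lambda>x. \<phi> (vec2 x y))" for i y
  define U' where "U' i y = integral {knot i..knot (Suc i)} (\<lambda>x. partial_deriv 2 \<phi> (vec2 x y))" for i y
  have U: "(U i has_vector_derivative U' i y) (at y)" for i y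
    unfolding U_def U'_def cbox_interval[symmetric]
    by (rule leibniz_rule_vector_derivative)
       (auto intro!: smooth_slice s sp integrable_continuous_interval continuous_intros simp: split_beta)
  have cU': "continuous_on A (U' i)" for A i
    unfolding U'_def cbox_interval[symmetric]
    by (rule integral_continuous_on_param) (auto simp: split_beta intro!: continuous_intros sp)
  have cU: "continuous_on A (U i)" for A i
    using U by (meson continuous_at_imp_continuous_on has_vector_derivative_continuous)
  have cI: "continuous_on A (\<lambda>y. integral {a..b} (\<lambda>x. (cmod (f (vec2 x y)))\<^sup>2))" if "smooth f" for f a b A
    unfolding cbox_interval[symmetric]
    by (rule integral_continuous_on_param) (auto simp: split_beta intro!: continuous_intros that)
  have CS: "(cmod (integral {a..b} u))\<^sup>2 \<le> (b - a) * integral {a..b} (\<lambda>x. (cmod (u x))\<^sup>2)"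
    if "continuous_on UNIV u" "a \<le> b" for u :: "real \<Rightarrow> complex" and a b
  proof -
    have cu: "continuous_on A u" for A using that(1) continuous_on_subset by blast
    have "cmod (integral {a..b} u) \<le> integral {a..b} (\<lambda>x. cmod (u x))"
      by (intro integral_norm_bound_integral integrable_continuous_interval continuous_intros cu) simp
    then have "(cmod (integral {a..b} u))\<^sup>2 \<le> (integral {a..b} (\<lambda>x. cmod (u x)))\<^sup>2"
      by (intro power_mono) auto
    also have "\<dots> \<le> (b - a) * integral {a..b} (\<lambda>x. (cmod (u x))\<^sup>2)"
      using that(2) by (intro interval_Cauchy_Schwarz continuous_intros cu)
    finally show ?thesis .
  qed
  have kh: "knot (Suc i) - knot i = h" "knot i \<le> knot (Suc i)" for i
    by (simp_all add: knot_diff knot_le)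
  have it: "(\<integral>x. (cmod (f x))\<^sup>2 \<partial>lborel) = integral {-R..R} (\<lambda>y. integral {-R..R} (\<lambda>x. (cmod (f (vec2 x y)))\<^sup>2))"
    if "f \<in> test_functions (square R)" for f
    using test_square_vanishes[OF that]
    by (intro iterated_integral' continuous_intros smooth_continuous test_smooth[OF that])
       (auto simp: vanishes_outside_def)
  have Ub: "(cmod (U i y))\<^sup>2 \<le> h * integral {knot i..knot (Suc i)} (\<lambda>x. (cmod (\<phi> (vec2 x y)))\<^sup>2)" for i y
    unfolding U_def using CS[OF _ kh(2), of "\<lambda>x. \<phi> (vec2 x y)" i]
    unfolding kh by (simp add: continuous_on_smooth_vec2[OF s] continuous_on_id continuous_on_const)
  have U'b: "(cmod (U' i y))\<^sup>2 \<le> h * integral {knot i..knot (Suc i)} (\<lambda>x. (cmod (partial_deriv 2 \<phi> (vec2 x y)))\<^sup>2)" for i y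
    unfolding U'_def using CS[OF _ kh(2), of "\<lambda>x. partial_deriv 2 \<phi> (vec2 x y)" i]
    unfolding kh by (simp add: continuous_on_smooth_vec2[OF sp] continuous_on_id continuous_on_const)
  have A: "cell_integral i j \<phi> = integral {knot j..knot (Suc j)} (U i)" for i j
    unfolding cell_integral_def U_def[abs_def] ..
  show "(cmod (cell_integral i j \<phi>))\<^sup>2 \<le> h\<^sup>2 * (\<integral>x. (cmod (\<phi> x))\<^sup>2 \<partial>lborel)" if ij: "i < N" "j < N"
  proof -
    have sub: "{knot i..knot (Suc i)} \<subseteq> {-R..R}" if "i < N" for i
    proof -
      have "real (Suc i) * h \<le> real N * h" using that h by (intro mult_right_mono) auto
      moreover have "real N * h = 2 * R" using N by (simp add: h_def)
      ultimately show ?thesis using h by (auto simp: knot_def)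
    qed
    have "(cmod (cell_integral i j \<phi>))\<^sup>2 \<le> h * integral {knot j..knot (Suc j)} (\<lambda>y. (cmod (U i y))\<^sup>2)"
      unfolding A using CS[OF cU kh(2), of j i] by (simp only: kh)
    also have "integral {knot j..knot (Suc j)} (\<lambda>y. (cmod (U i y))\<^sup>2) \<le> integral {-R..R} (\<lambda>y. (cmod (U i y))\<^sup>2)"
      by (intro integral_subset_le sub ij integrable_continuous_interval continuous_intros cU) auto
    also have "\<dots> \<le> integral {-R..R} (\<lambda>y. h * integral {-R..R} (\<lambda>x. (cmod (\<phi> (vec2 x y)))\<^sup>2))"
    proof (intro integral_le integrable_continuous_interval continuous_intros cU cI s)
      fix y
      have "integral {knot i..knot (Suc i)} (\<lambda>x. (cmod (\<phi> (vec2 x y)))\<^sup>2) \<le> integral {-R..R} (\<lambda>x. (cmod (\<phi> (vec2 x y)))\<^sup>2)"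
        by (intro integral_subset_le sub ij integrable_continuous_interval continuous_intros s) auto
      then show "(cmod (U i y))\<^sup>2 \<le> h * integral {-R..R} (\<lambda>x. (cmod (\<phi> (vec2 x y)))\<^sup>2)"
        using Ub[of i y] h by (meson mult_left_mono less_imp_le order_trans)
    qed
    also have "\<dots> = h * (\<integral>x. (cmod (\<phi> x))\<^sup>2 \<partial>lborel)" by (simp add: it[OF \<phi>])
    finally show ?thesis using h by (simp add: power2_eq_square)
  qed
  have "(\<integral>x. (cmod (\<phi> x))\<^sup>2 \<partial>lborel) \<le> integral {-R..R} (\<lambda>y. 2 * h\<^sup>2 * integral {-R..R} (\<lambda>x. (cmod (partial_deriv 1 \<phi> (vec2 x y)))\<^sup>2) +
     2 / h * (\<Sum>i<N. (cmod (U i y))\<^sup>2))"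
    unfolding it[OF \<phi>] U_def
    by (intro integral_le integrable_continuous_interval continuous_intros cI s sp sum_cells_inequality smooth_slice cU[unfolded U_def])
  also have "\<dots> = 2 * h\<^sup>2 * (\<integral>x. (cmod (partial_deriv 1 \<phi> x))\<^sup>2 \<partial>lborel) +
     2 / h * (\<Sum>i<N. integral {-R..R} (\<lambda>y. (cmod (U i y))\<^sup>2))"
  proof -
    have "integral {-R..R} (\<lambda>y. \<Sum>i<N. (cmod (U i y))\<^sup>2) = (\<Sum>i<N. integral {-R..R} (\<lambda>y. (cmod (U i y))\<^sup>2))"
      by (intro Henstock_Kurzweil_Integration.integral_sum integrable_continuous_interval continuous_intros cU) auto
    then show ?thesis using h
      by (subst Henstock_Kurzweil_Integration.integral_add)
        (auto intro!: integrable_continuous_interval continuous_intros cI sp cU simp: it[OF test_partial[OF \<phi>]])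
  qed
  finally have e1: "(\<integral>x. (cmod (\<phi> x))\<^sup>2 \<partial>lborel) \<le> 2 * h\<^sup>2 * (\<integral>x. (cmod (partial_deriv 1 \<phi> x))\<^sup>2 \<partial>lborel) +
     2 / h * (\<Sum>i<N. integral {-R..R} (\<lambda>y. (cmod (U i y))\<^sup>2))" .
  have "(\<Sum>i<N. integral {-R..R} (\<lambda>y. (cmod (U i y))\<^sup>2)) \<le>
     (\<Sum>i<N. 2 * h\<^sup>2 * integral {-R..R} (\<lambda>y. (cmod (U' i y))\<^sup>2) + 2 / h * (\<Sum>j<N. (cmod (cell_integral i j \<phi>))\<^sup>2))"
    unfolding A by (intro sum_mono sum_cells_inequality U cU')
  also have "\<dots> = 2 * h\<^sup>2 * (\<Sum>i<N. integral {-R..R} (\<lambda>y. (cmod (U' i y))\<^sup>2)) +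
      2 / h * (\<Sum>i<N. \<Sum>j<N. (cmod (cell_integral i j \<phi>))\<^sup>2)"
    by (simp add: sum.distrib sum_distrib_left)
  finally have e2: "(\<Sum>i<N. integral {-R..R} (\<lambda>y. (cmod (U i y))\<^sup>2)) \<le>
      2 * h\<^sup>2 * (\<Sum>i<N. integral {-R..R} (\<lambda>y. (cmod (U' i y))\<^sup>2)) +
      2 / h * (\<Sum>i<N. \<Sum>j<N. (cmod (cell_integral i j \<phi>))\<^sup>2)" .
  have "(\<Sum>i<N. integral {-R..R} (\<lambda>y. (cmod (U' i y))\<^sup>2)) \<le>
      (\<Sum>i<N. integral {-R..R} (\<lambda>y. h * integral {knot i..knot (Suc i)} (\<lambda>x. (cmod (partial_deriv 2 \<phi> (vec2 x y)))\<^sup>2)))"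
    by (intro sum_mono integral_le U'b integrable_continuous_interval continuous_intros cU' cI sp)
  also have "\<dots> = integral {-R..R} (\<lambda>y. \<Sum>i<N. h * integral {knot i..knot (Suc i)} (\<lambda>x. (cmod (partial_deriv 2 \<phi> (vec2 x y)))\<^sup>2))"
    by (intro Henstock_Kurzweil_Integration.integral_sum[symmetric] integrable_continuous_interval continuous_intros cI sp) auto
  also have "\<dots> = integral {-R..R} (\<lambda>y. h * integral {-R..R} (\<lambda>x. (cmod (partial_deriv 2 \<phi> (vec2 x y)))\<^sup>2))"
    unfolding sum_distrib_left[symmetric]
    by (subst sum_cells) (auto intro!: continuous_intros sp)
  also have "\<dots> = h * (\<integral>x. (cmod (partial_deriv 2 \<phi> x))\<^sup>2 \<partial>lborel)" by (simp add: it[OF test_partial[OF \<phi>]])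
  finally have e3: "(\<Sum>i<N. integral {-R..R} (\<lambda>y. (cmod (U' i y))\<^sup>2)) \<le>
      h * (\<integral>x. (cmod (partial_deriv 2 \<phi> x))\<^sup>2 \<partial>lborel)" .
  have h2: "0 \<le> 2 * h\<^sup>2" "0 \<le> 2 / h" using h by auto
  have "(\<integral>x. (cmod (\<phi> x))\<^sup>2 \<partial>lborel) \<le> 2 * h\<^sup>2 * (\<integral>x. (cmod (partial_deriv 1 \<phi> x))\<^sup>2 \<partial>lborel) +
      2 / h * (2 * h\<^sup>2 * (h * (\<integral>x. (cmod (partial_deriv 2 \<phi> x))\<^sup>2 \<partial>lborel)) + 2 / h * (\<Sum>i<N. \<Sum>j<N. (cmod (cell_integral i j \<phi>))\<^sup>2))"
    using e1 mult_left_mono[OF order_trans[OF e2 add_right_mono[OF mult_left_mono[OF e3 h2(1)]]] h2(2)] by linarith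
  also have "\<dots> = 2 * h\<^sup>2 * (\<integral>x. (cmod (partial_deriv 1 \<phi> x))\<^sup>2 \<partial>lborel) + 4 * h\<^sup>2 * (\<integral>x. (cmod (partial_deriv 2 \<phi> x))\<^sup>2 \<partial>lborel)
      + 4 / h\<^sup>2 * (\<Sum>i<N. \<Sum>j<N. (cmod (cell_integral i j \<phi>))\<^sup>2)"
    using h by (simp add: field_simps power2_eq_square)
  also have "\<dots> \<le> 4 * h\<^sup>2 * ((\<integral>x. (cmod (partial_deriv 1 \<phi> x))\<^sup>2 \<partial>lborel) + (\<integral>x. (cmod (partial_deriv 2 \<phi> x))\<^sup>2 \<partial>lborel)) +
      4 / h\<^sup>2 * (\<Sum>i<N. \<Sum>j<N. (cmod (cell_integral i j \<phi>))\<^sup>2)"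
    by (simp add: algebra_simps)
  finally show "(\<integral>x. (cmod (\<phi> x))\<^sup>2 \<partial>lborel) \<le>
      4 * h\<^sup>2 * ((\<integral>x. (cmod (partial_deriv 1 \<phi> x))\<^sup>2 \<partial>lborel) + (\<integral>x. (cmod (partial_deriv 2 \<phi> x))\<^sup>2 \<partial>lborel)) +
      4 / h\<^sup>2 * (\<Sum>i<N. \<Sum>j<N. (cmod (cell_integral i j \<phi>))\<^sup>2)" .
qed

lemma cell_integral_diff:
  assumes "smooth f" "smooth g"
  shows "cell_integral i j (\<lambda>x. f x - g x) = cell_integral i j f - cell_integral i j g"
proof -
  have c: "continuous_on A (\<lambda>y. integral {a..b} (\<lambda>x. f (vec2 x y)))" if "smooth f" for f a b A
    unfolding cbox_interval[symmetric]
    by (rule integral_continuous_on_param) (auto simp: split_beta intro!: continuous_intros that)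
  have "integral {a..b} (\<lambda>x. f (vec2 x y) - g (vec2 x y)) = integral {a..b} (\<lambda>x. f (vec2 x y)) - integral {a..b} (\<lambda>x. g (vec2 x y))" for a b y
    by (intro Henstock_Kurzweil_Integration.integral_diff integrable_continuous_interval continuous_intros assms)
  then show ?thesis
    unfolding cell_integral_def
    by (simp, intro Henstock_Kurzweil_Integration.integral_diff integrable_continuous_interval c assms)
qed

end

lemma cmod_diff_square_le: "(cmod (a - b))\<^sup>2 \<le> 2 * (cmod a)\<^sup>2 + 2 * (cmod b)\<^sup>2"
proof -
  have "(cmod (a - b))\<^sup>2 \<le> (cmod a + cmod b)\<^sup>2" by (intro power_mono norm_triangle_ineq4) simp
  also have "\<dots> \<le> 2 * (cmod a)\<^sup>2 + 2 * (cmod b)\<^sup>2"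
    using sum_squares_bound[of "cmod a" "cmod b"] by (simp add: power2_sum)
  finally show ?thesis .
qed

lemma partial_deriv_diff:
  assumes "smooth f" "smooth g"
  shows "partial_deriv j (\<lambda>x. f x - g x) = (\<lambda>x. partial_deriv j f x - partial_deriv j g x)"
proof
  fix x
  have "((\<lambda>x. f x - g x) has_derivative (\<lambda>h. frechet_derivative f (at x) h - frechet_derivative g (at x) h)) (at x)"
    using assms smooth_differentiable by (intro has_derivative_diff) (auto simp: frechet_derivative_works[symmetric])
  from partial_deriv_eq[OF this]
  show "partial_deriv j (\<lambda>x. f x - g x) x = partial_deriv j f x - partial_deriv j g x"
    by (simp add: partial_deriv_def)
qed

lemma integral_diff_square_le:
  assumes "\<phi> \<in> test_functions \<Omega>" "\<psi> \<in> test_functions \<Omega>"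
  shows "(\<integral>x. (cmod (\<phi> x - \<psi> x))\<^sup>2 \<partial>lborel) \<le> 2 * (\<integral>x. (cmod (\<phi> x))\<^sup>2 \<partial>lborel) + 2 * (\<integral>x. (cmod (\<psi> x))\<^sup>2 \<partial>lborel)"
proof -
  have "(\<integral>x. (cmod (\<phi> x - \<psi> x))\<^sup>2 \<partial>lborel) \<le> (\<integral>x. 2 * (cmod (\<phi> x))\<^sup>2 + 2 * (cmod (\<psi> x))\<^sup>2 \<partial>lborel)"
    by (intro integral_mono test_norm_square_integrable[OF test_diff[OF assms]] cmod_diff_square_le)
       (simp add: test_norm_square_integrable[OF assms(1)] test_norm_square_integrable[OF assms(2)])
  also have "\<dots> = 2 * (\<integral>x. (cmod (\<phi> x))\<^sup>2 \<partial>lborel) + 2 * (\<integral>x. (cmod (\<psi> x))\<^sup>2 \<partial>lborel)"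
    by (simp add: test_norm_square_integrable[OF assms(1)] test_norm_square_integrable[OF assms(2)])
  finally show ?thesis .
qed

text \<open>The cell integrals for all grids are countably many bounded sequences, so along one
  subsequence all of them converge. A fine grid makes the energy term uniformly small, and on this
  one grid the finitely many cell integrals of differences tend to 0.\<close>

theorem Rellich:
  assumes \<Omega>: "bounded \<Omega>" and \<phi>: "\<And>n. \<phi> n \<in> test_functions \<Omega>"
    and C: "\<And>n. (\<integral>x. (cmod (\<phi> n x))\<^sup>2 \<partial>lborel) + (\<integral>x. (cmod (partial_deriv 1 (\<phi> n) x))\<^sup>2 \<partial>lborel)
      + (\<integral>x. (cmod (partial_deriv 2 (\<phi> n) x))\<^sup>2 \<partial>lborel) \<le> C"
  shows "\<exists>r::nat\<Rightarrow>nat. strict_mono r \<and>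
    (\<forall>e>0. \<exists>K. \<forall>m\<ge>K. \<forall>n\<ge>K. (\<integral>x. (cmod (\<phi> (r m) x - \<phi> (r n) x))\<^sup>2 \<partial>lborel) < e)"
proof -
  obtain R where R: "R > 0" "\<Omega> \<subseteq> square R" using bounded_subset_square[OF \<Omega>] by blast
  have \<phi>R: "\<phi> n \<in> test_functions (square R)" for n by (rule test_mono[OF \<phi> R(2)])
  have nn: "(\<integral>x. (cmod (f x))\<^sup>2 \<partial>lborel) \<ge> 0" for f :: "real^2 \<Rightarrow> complex" by simp
  have C0: "C \<ge> 0" using C[of 0] nn[of "\<phi> 0"] nn[of "partial_deriv 1 (\<phi> 0)"] nn[of "partial_deriv 2 (\<phi> 0)"] by linarith
  have C1: "(\<integral>x. (cmod (\<phi> n x))\<^sup>2 \<partial>lborel) \<le> C"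
    and C2: "(\<integral>x. (cmod (partial_deriv 1 (\<phi> n) x))\<^sup>2 \<partial>lborel) + (\<integral>x. (cmod (partial_deriv 2 (\<phi> n) x))\<^sup>2 \<partial>lborel) \<le> C" for n
    using C[of n] nn[of "\<phi> n"] nn[of "partial_deriv 1 (\<phi> n)"] nn[of "partial_deriv 2 (\<phi> n)"] by linarith+
  \<comment> \<open>The triples \<open>(N, i, j)\<close> form a countable index type; those outside
    the grid get the value 0, which keeps the family bounded.\<close>
  define F where "F n = (\<lambda>(N, i, j). if i < N \<and> j < N then cell_integral R (2 * R / real N) i j (\<phi> n) else 0)" for n
  have Fb: "cmod (F n p) \<le> sqrt ((2 * R)\<^sup>2 * C)" for n p
  proof -
    obtain N i j where p: "p = (N, i, j)" by (cases p)
    show ?thesis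
    proof (cases "i < N \<and> j < N")
      case True
      then have N: "N > 0" by auto
      have "(cmod (F n p))\<^sup>2 \<le> (2 * R / N)\<^sup>2 * (\<integral>x. (cmod (\<phi> n x))\<^sup>2 \<partial>lborel)"
        using cell_integral_bound[OF R(1) N refl \<phi>R, of i j] True by (simp add: F_def p)
      also have "\<dots> \<le> (2 * R)\<^sup>2 * C"
      proof (intro mult_mono C1 power_mono nn)
        show "2 * R / real N \<le> 2 * R" using N R(1) by (simp add: field_simps)
      qed (use R in auto)
      finally show ?thesis by (rule real_le_rsqrt)
    qed (use C0 in \<open>auto simp: F_def p\<close>)
  qed
  have "\<exists>r::nat\<Rightarrow>nat. strict_mono r \<and> (\<forall>p. \<exists>l. (\<lambda>n. F (r n) p) \<longlonglongrightarrow> l)"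
  proof (rule function_convergent_subsequence[of UNIV F "sqrt ((2 * R)\<^sup>2 * C)"])
    show "cmod (F n p) \<le> sqrt ((2 * R)\<^sup>2 * C)" for n p by (rule Fb)
    fix k :: "nat \<Rightarrow> nat" assume "strict_mono k" "\<And>p. p \<in> UNIV \<Longrightarrow> \<exists>l. (\<lambda>n. F (k n) p) \<longlonglongrightarrow> l"
    then show "\<exists>r::nat\<Rightarrow>nat. strict_mono r \<and> (\<forall>p. \<exists>l. (\<lambda>n. F (r n) p) \<longlonglongrightarrow> l)" by blast
  qed simp
  then obtain r :: "nat \<Rightarrow> nat" where r: "strict_mono r" "\<And>p. \<exists>l. (\<lambda>n. F (r n) p) \<longlonglongrightarrow> l" by blast
  then obtain l where l: "\<And>p. (\<lambda>n. F (r n) p) \<longlonglongrightarrow> l p" by metis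
  have "\<exists>K. \<forall>m\<ge>K. \<forall>n\<ge>K. (\<integral>x. (cmod (\<phi> (r m) x - \<phi> (r n) x))\<^sup>2 \<partial>lborel) < e" if e: "e > 0" for e
  proof -
    have "(\<lambda>N. 16 * (2 * R * (1 / real N))\<^sup>2 * C) \<longlonglongrightarrow> 16 * (2 * R * 0)\<^sup>2 * C"
      by (intro tendsto_intros lim_1_over_n)
    then have "\<forall>\<^sub>F N in sequentially. 16 * (2 * R * (1 / real N))\<^sup>2 * C < e / 2"
      using e by (intro order_tendstoD(2)[where y = 0 and a = "e / 2"]) auto
    then have "\<forall>\<^sub>F N in sequentially. 16 * (2 * R * (1 / real N))\<^sup>2 * C < e / 2 \<and> N > 0"
      using eventually_gt_at_top[of 0] by eventually_elim auto
    then obtain N where N: "N > 0" "16 * (2 * R / real N)\<^sup>2 * C < e / 2"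
      by (auto dest!: eventually_happens)
    define h where "h = 2 * R / real N"
    have h: "h > 0" using N R by (simp add: h_def)
    define S where "S n = (\<Sum>i<N. \<Sum>j<N. (cmod (F (r n) (N, i, j) - l (N, i, j)))\<^sup>2)" for n
    have "S \<longlonglongrightarrow> (\<Sum>i<N. \<Sum>j<N. (cmod (l (N, i, j) - l (N, i, j)))\<^sup>2)"
      unfolding S_def by (intro tendsto_intros l)
    then have "S \<longlonglongrightarrow> 0" by simp
    \<comment> \<open>The factor \<open>1 / 32\<close>: the cell integrals of a difference
      contribute at most \<open>2 * S m + 2 * S n\<close>, and \<open>grid_inequality\<close>
      multiplies this by \<open>4 / h^2\<close>; the result stays below
      \<open>e / 2\<close>.\<close>
    then obtain K where K: "\<And>n. n \<ge> K \<Longrightarrow> S n < e * h\<^sup>2 / 32"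
      using order_tendstoD(2)[of S 0 sequentially "e * h\<^sup>2 / 32"] e h by (auto simp: eventually_sequentially)
    show ?thesis
    proof (intro exI[of _ K] allI impI)
      fix m n assume mn: "m \<ge> K" "n \<ge> K"
      define d where "d = (\<lambda>x. \<phi> (r m) x - \<phi> (r n) x)"
      have d: "d \<in> test_functions (square R)" unfolding d_def by (intro test_diff \<phi>R)
      have s: "smooth (\<phi> k)" for k by (rule test_smooth[OF \<phi>])
      have pd: "(\<integral>x. (cmod (partial_deriv j d x))\<^sup>2 \<partial>lborel) \<le>
          2 * (\<integral>x. (cmod (partial_deriv j (\<phi> (r m)) x))\<^sup>2 \<partial>lborel) + 2 * (\<integral>x. (cmod (partial_deriv j (\<phi> (r n)) x))\<^sup>2 \<partial>lborel)" for j
        unfolding d_def partial_deriv_diff[OF s s]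
        by (rule integral_diff_square_le[OF test_partial[OF \<phi>] test_partial[OF \<phi>]])
      have g: "(\<integral>x. (cmod (partial_deriv 1 d x))\<^sup>2 \<partial>lborel) + (\<integral>x. (cmod (partial_deriv 2 d x))\<^sup>2 \<partial>lborel) \<le> 4 * C"
        using pd[of 1] pd[of 2] C2[of "r m"] C2[of "r n"] by linarith
      have "(\<Sum>i<N. \<Sum>j<N. (cmod (cell_integral R h i j d))\<^sup>2) \<le>
        (\<Sum>i<N. \<Sum>j<N. 2 * (cmod (F (r m) (N, i, j) - l (N, i, j)))\<^sup>2 + 2 * (cmod (F (r n) (N, i, j) - l (N, i, j)))\<^sup>2)"
      proof (intro sum_mono)
        fix i j assume ij: "i \<in> {..<N}" "j \<in> {..<N}"
        have "cell_integral R h i j d = (F (r m) (N, i, j) - l (N, i, j)) - (F (r n) (N, i, j) - l (N, i, j))"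
          using ij unfolding d_def h_def by (subst cell_integral_diff[OF R(1) N(1) refl s s]) (simp add: F_def)
        then show "(cmod (cell_integral R h i j d))\<^sup>2 \<le>
          2 * (cmod (F (r m) (N, i, j) - l (N, i, j)))\<^sup>2 + 2 * (cmod (F (r n) (N, i, j) - l (N, i, j)))\<^sup>2"
          using cmod_diff_square_le by metis
      qed
      also have "\<dots> = 2 * S m + 2 * S n" by (simp add: S_def sum.distrib sum_distrib_left)
      also have "\<dots> < e * h\<^sup>2 / 8" using K[OF mn(1)] K[OF mn(2)] by linarith
      finally have c: "4 / h\<^sup>2 * (\<Sum>i<N. \<Sum>j<N. (cmod (cell_integral R h i j d))\<^sup>2) \<le> 4 / h\<^sup>2 * (e * h\<^sup>2 / 8)"
        by (intro mult_left_mono) auto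
      have "(\<integral>x. (cmod (d x))\<^sup>2 \<partial>lborel) \<le> 4 * h\<^sup>2 * (4 * C) + 4 / h\<^sup>2 * (e * h\<^sup>2 / 8)"
      proof -
        have "0 \<le> 4 * h\<^sup>2" by simp
        from mult_left_mono[OF g this] show ?thesis
          using grid_inequality[OF R(1) N(1) h_def d] c by linarith
      qed
      also have "\<dots> < e" using N(2) h by (simp add: h_def[symmetric])
      finally show "(\<integral>x. (cmod (\<phi> (r m) x - \<phi> (r n) x))\<^sup>2 \<partial>lborel) < e" by (simp add: d_def)
    qed
  qed
  then show ?thesis using r(1) by blast
qed

section \<open>The space of square integrable functions\<close>

definition inner_L2 :: "(real^2) set \<Rightarrow> (real^2 \<Rightarrow> complex) \<Rightarrow> (real^2 \<Rightarrow> complex) \<Rightarrow> complex" where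
  "inner_L2 \<Omega> u v = integral\<^sup>L (lebesgue_on \<Omega>) (\<lambda>x. u x * cnj (v x))"

definition cscale :: "complex \<Rightarrow> (real^2 \<Rightarrow> complex) \<Rightarrow> real^2 \<Rightarrow> complex" where
  "cscale c u = (\<lambda>x. c * u x)"

lemma L2_measurable: "u \<in> L2 \<Omega> \<Longrightarrow> u \<in> borel_measurable (lebesgue_on \<Omega>)"
  by (simp add: L2_def)

lemma L2_square_integrable: "u \<in> L2 \<Omega> \<Longrightarrow> integrable (lebesgue_on \<Omega>) (\<lambda>x. (cmod (u x))\<^sup>2)"
  by (simp add: L2_def)

lemma L2_product_integrable:
  assumes "u \<in> L2 \<Omega>" "v \<in> L2 \<Omega>"
  shows "integrable (lebesgue_on \<Omega>) (\<lambda>x. u x * v x)"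
proof (rule Bochner_Integration.integrable_bound)
  show "integrable (lebesgue_on \<Omega>) (\<lambda>x. (cmod (u x))\<^sup>2 + (cmod (v x))\<^sup>2)"
    using assms by (simp add: L2_def)
  show "(\<lambda>x. u x * v x) \<in> borel_measurable (lebesgue_on \<Omega>)"
    using assms by (intro borel_measurable_times) (auto simp: L2_def)
  have "a * b \<le> a\<^sup>2 + b\<^sup>2" if "a \<ge> 0" "b \<ge> 0" for a b :: real
    using sum_squares_bound[of a b] mult_nonneg_nonneg[OF that] by linarith
  then show "AE x in lebesgue_on \<Omega>. norm (u x * v x) \<le> norm ((cmod (u x))\<^sup>2 + (cmod (v x))\<^sup>2)"
    by (intro AE_I2) (simp add: norm_mult)
qed

lemma L2_cnj: "u \<in> L2 \<Omega> \<Longrightarrow> (\<lambda>x. cnj (u x)) \<in> L2 \<Omega>"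
  by (auto simp: L2_def intro: borel_measurable_continuous_on[OF continuous_on_cnj[OF continuous_on_id]])

lemma L2_inner_integrable:
  "u \<in> L2 \<Omega> \<Longrightarrow> v \<in> L2 \<Omega> \<Longrightarrow> integrable (lebesgue_on \<Omega>) (\<lambda>x. u x * cnj (v x))"
  by (intro L2_product_integrable L2_cnj)

lemma L2_add: "u \<in> L2 \<Omega> \<Longrightarrow> v \<in> L2 \<Omega> \<Longrightarrow> (\<lambda>x. u x + v x) \<in> L2 \<Omega>"
proof -
  assume u: "u \<in> L2 \<Omega>" and v: "v \<in> L2 \<Omega>"
  have m: "(\<lambda>x. u x + v x) \<in> borel_measurable (lebesgue_on \<Omega>)"
    using u v by (intro borel_measurable_add) (auto simp: L2_def)
  have "integrable (lebesgue_on \<Omega>) (\<lambda>x. (cmod (u x + v x))\<^sup>2)"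
  proof (rule Bochner_Integration.integrable_bound)
    show "integrable (lebesgue_on \<Omega>) (\<lambda>x. 2 * (cmod (u x))\<^sup>2 + 2 * (cmod (v x))\<^sup>2)"
      using u v by (simp add: L2_def)
    show "(\<lambda>x. (cmod (u x + v x))\<^sup>2) \<in> borel_measurable (lebesgue_on \<Omega>)" using m by simp
    show "AE x in lebesgue_on \<Omega>. norm ((cmod (u x + v x))\<^sup>2) \<le> norm (2 * (cmod (u x))\<^sup>2 + 2 * (cmod (v x))\<^sup>2)"
      using cmod_diff_square_le[of "u _" "- v _"] by (intro AE_I2) simp
  qed
  with m show ?thesis by (simp add: L2_def)
qed

lemma L2_bounded_mult:
  assumes "u \<in> L2 \<Omega>" "f \<in> borel_measurable (lebesgue_on \<Omega>)" "\<And>x. x \<in> \<Omega> \<Longrightarrow> cmod (f x) \<le> C"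
  shows "(\<lambda>x. f x * u x) \<in> L2 \<Omega>"
proof -
  have m: "(\<lambda>x. f x * u x) \<in> borel_measurable (lebesgue_on \<Omega>)"
    using assms by (intro borel_measurable_times) (auto simp: L2_def)
  have "integrable (lebesgue_on \<Omega>) (\<lambda>x. (cmod (f x * u x))\<^sup>2)"
  proof (rule Bochner_Integration.integrable_bound)
    show "integrable (lebesgue_on \<Omega>) (\<lambda>x. C\<^sup>2 * (cmod (u x))\<^sup>2)"
      by (intro integrable_mult_right L2_square_integrable assms)
    show "(\<lambda>x. (cmod (f x * u x))\<^sup>2) \<in> borel_measurable (lebesgue_on \<Omega>)" using m by simp
    show "AE x in lebesgue_on \<Omega>. norm ((cmod (f x * u x))\<^sup>2) \<le> norm (C\<^sup>2 * (cmod (u x))\<^sup>2)"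
      by (intro AE_I2) (auto simp: norm_mult power_mult_distrib space_restrict_space intro!: mult_right_mono power_mono assms)
  qed
  with m show ?thesis by (simp add: L2_def)
qed

lemma L2_scale: "u \<in> L2 \<Omega> \<Longrightarrow> (\<lambda>x. c * u x) \<in> L2 \<Omega>"
  using L2_bounded_mult[of u \<Omega> "\<lambda>_. c" "cmod c"] by simp

lemma inner_L2_self: "inner_L2 \<Omega> u u = of_real (integral\<^sup>L (lebesgue_on \<Omega>) (\<lambda>x. (cmod (u x))\<^sup>2))"
  unfolding inner_L2_def complex_norm_square[symmetric] by (rule integral_complex_of_real)

lemma vector_space_cscale: "vector_space cscale"
  by unfold_locales (auto simp: cscale_def fun_eq_iff algebra_simps)

interpretation L2: hermitian_form cscale "L2 \<Omega>" "inner_L2 \<Omega>" for \<Omega>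
proof -
  interpret vector_space cscale by (rule vector_space_cscale)
  show "hermitian_form cscale (L2 \<Omega>) (inner_L2 \<Omega>)"
  proof
    show "subspace (L2 \<Omega>)"
    proof (rule subspaceI)
      show "0 \<in> L2 \<Omega>" by (simp add: L2_def zero_fun_def)
    qed (auto simp: cscale_def plus_fun_def intro: L2_add L2_scale)
    show "inner_L2 \<Omega> (u + v) w = inner_L2 \<Omega> u w + inner_L2 \<Omega> v w" if "u \<in> L2 \<Omega>" "v \<in> L2 \<Omega>" "w \<in> L2 \<Omega>" for u v w
      using that by (simp add: inner_L2_def distrib_right L2_inner_integrable)
    show "inner_L2 \<Omega> (cscale c u) v = c * inner_L2 \<Omega> u v" for c u v
      by (simp add: inner_L2_def cscale_def mult.assoc)
    show "inner_L2 \<Omega> v u = cnj (inner_L2 \<Omega> u v)" for u v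
      unfolding inner_L2_def Bochner_Integration.integral_cnj[symmetric] by (simp add: mult.commute)
    show "Re (inner_L2 \<Omega> u u) \<ge> 0" for u
      by (simp add: inner_L2_self)
  qed
qed

lemma L2_q_eq: "L2.q \<Omega> u = integral\<^sup>L (lebesgue_on \<Omega>) (\<lambda>x. (cmod (u x))\<^sup>2)"
  by (simp add: L2.q_def inner_L2_self)

lemma L2_norm_eq: "L2_norm \<Omega> u = sqrt (L2.q \<Omega> u)"
  by (simp add: L2_norm_def L2_q_eq)

lemma L2_norm_tendsto_iff: "(\<lambda>n. L2_norm \<Omega> (f n)) \<longlonglongrightarrow> 0 \<longleftrightarrow> (\<lambda>n. L2.q \<Omega> (f n)) \<longlonglongrightarrow> 0"
proof
  assume "(\<lambda>n. L2_norm \<Omega> (f n)) \<longlonglongrightarrow> 0"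
  then have "(\<lambda>n. (L2_norm \<Omega> (f n))\<^sup>2) \<longlonglongrightarrow> 0\<^sup>2" by (rule tendsto_power)
  then show "(\<lambda>n. L2.q \<Omega> (f n)) \<longlonglongrightarrow> 0" by (simp add: L2_norm_eq L2_q_eq)
next
  assume "(\<lambda>n. L2.q \<Omega> (f n)) \<longlonglongrightarrow> 0"
  from tendsto_real_sqrt[OF this] show "(\<lambda>n. L2_norm \<Omega> (f n)) \<longlonglongrightarrow> 0" by (simp add: L2_norm_eq)
qed

lemma L2_nn_integral: "u \<in> L2 \<Omega> \<Longrightarrow> (\<integral>\<^sup>+x. ennreal ((cmod (u x))\<^sup>2) \<partial>lebesgue_on \<Omega>) = ennreal (L2.q \<Omega> u)"
  unfolding L2_q_eq by (rule nn_integral_eq_integral) (auto simp: L2_square_integrable)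

lemma L2_q_zero_AE: "u \<in> L2 \<Omega> \<Longrightarrow> L2.q \<Omega> u = 0 \<longleftrightarrow> (AE x in lebesgue_on \<Omega>. u x = 0)"
  unfolding L2_q_eq by (subst integral_nonneg_eq_0_iff_AE) (auto simp: L2_square_integrable)

lemma convergent_of_summable_differences:
  fixes f :: "nat \<Rightarrow> 'a::banach"
  assumes "summable (\<lambda>k. norm (f (Suc k) - f k))"
  shows "convergent f"
proof -
  obtain s where "(\<lambda>k. f (Suc k) - f k) sums s" using summable_norm_cancel[OF assms] by (auto simp: summable_def)
  then have "(\<lambda>n. f n - f 0) \<longlonglongrightarrow> s" unfolding sums_def by (simp add: sum_lessThan_telescope)
  from tendsto_add[OF this tendsto_const[of "f 0"]] show ?thesis by (auto simp: convergent_def)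
qed

text \<open>Riesz-Fischer for functions instead of classes. Along a subsequence whose consecutive
  squared distances are below \<open>4^-k\<close>, almost every sequence of values has summable
  increments. The limit is taken pointwise, and Fatou's lemma carries the bounds over to it.\<close>

theorem L2_complete:
  assumes X: "\<And>n. X n \<in> L2 \<Omega>" and Cauchy: "\<And>e. e > 0 \<Longrightarrow> \<exists>N. \<forall>m\<ge>N. \<forall>n\<ge>N. L2.q \<Omega> (X m - X n) < e"
  shows "\<exists>u\<in>L2 \<Omega>. (\<lambda>n. L2.q \<Omega> (X n - u)) \<longlonglongrightarrow> 0"
proof -
  let ?M = "lebesgue_on \<Omega>"
  have [measurable]: "X n \<in> borel_measurable ?M" for n using X by (rule L2_measurable)
  obtain N where N: "\<And>k m n. m \<ge> N k \<Longrightarrow> n \<ge> N k \<Longrightarrow> L2.q \<Omega> (X m - X n) < (1/4)^k"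
    using Cauchy[of "(1/4)^_"] by (metis zero_less_divide_1_iff zero_less_numeral zero_less_power)
  \<comment> \<open>Summing the \<open>N i\<close> makes \<open>r\<close> monotone and keeps
    \<open>r k \<ge> N k\<close>.\<close>
  define r where "r k = (\<Sum>i\<le>k. N i)" for k
  have rN: "r k \<ge> N k" for k unfolding r_def by (rule member_le_sum) auto
  have rmono: "k \<le> l \<Longrightarrow> r k \<le> r l" for k l unfolding r_def by (rule sum_mono2) auto
  define Y where "Y k = X (r k)" for k
  have [measurable]: "Y k \<in> borel_measurable ?M" for k by (simp add: Y_def)
  define D where "D k x = (cmod (Y (Suc k) x - Y k x))\<^sup>2" for k x
  have [measurable]: "D k \<in> borel_measurable ?M" for k unfolding D_def by measurable
  have D: "(\<integral>\<^sup>+x. ennreal (D k x) \<partial>?M) \<le> ennreal ((1/4)^k)" for k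
  proof -
    have "(\<integral>\<^sup>+x. ennreal (D k x) \<partial>?M) = ennreal (L2.q \<Omega> (Y (Suc k) - Y k))"
      using L2_nn_integral[of "Y (Suc k) - Y k" \<Omega>] X by (simp add: D_def Y_def L2.diff_in)
    also have "\<dots> \<le> ennreal ((1/4)^k)"
      unfolding Y_def using N[of k "r (Suc k)" "r k"] rN[of k] rmono[of k "Suc k"]
      by (intro ennreal_leI less_imp_le) simp
    finally show ?thesis .
  qed
  \<comment> \<open>The weight \<open>2^k\<close> leaves the sum of the integrals finite, and almost
    everywhere it forces \<open>D k x \<le> C / 2^k\<close>; so the square roots, which are the
    increments, are summable as well.\<close>
  have "(\<integral>\<^sup>+x. (\<Sum>k. ennreal (2^k * D k x)) \<partial>?M) = (\<Sum>k. \<integral>\<^sup>+x. ennreal (2^k * D k x) \<partial>?M)"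
    by (rule nn_integral_suminf) measurable
  also have "\<dots> \<le> (\<Sum>k. ennreal ((1/2)^k))"
  proof (intro suminf_le)
    fix k
    have "(\<integral>\<^sup>+x. ennreal (2^k * D k x) \<partial>?M) = ennreal (2^k) * (\<integral>\<^sup>+x. ennreal (D k x) \<partial>?M)"
      by (subst nn_integral_cmult[symmetric]) (auto simp: ennreal_mult'' D_def)
    also have "\<dots> \<le> ennreal (2^k) * ennreal ((1/4)^k)" by (intro mult_left_mono D) auto
    also have "\<dots> = ennreal ((1/2)^k)" by (simp add: ennreal_mult'[symmetric] power_mult_distrib[symmetric])
    finally show "(\<integral>\<^sup>+x. ennreal (2^k * D k x) \<partial>?M) \<le> ennreal ((1/2)^k)" .
  qed auto
  also have "\<dots> = ennreal (\<Sum>k. (1/2)^k)" by (intro suminf_ennreal2) auto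
  also have "\<dots> < \<infinity>" by simp
  finally have "(\<integral>\<^sup>+x. (\<Sum>k. ennreal (2^k * D k x)) \<partial>?M) \<noteq> \<infinity>" by simp
  then have "AE x in ?M. (\<Sum>k. ennreal (2^k * D k x)) \<noteq> \<infinity>"
    by (intro nn_integral_PInf_AE) measurable
  then have conv: "AE x in ?M. convergent (\<lambda>k. Y k x)"
  proof eventually_elim
    case (elim x)
    have "summable (\<lambda>k. 2^k * D k x)"
      by (rule summable_suminf_not_top) (use elim in \<open>auto simp: D_def\<close>)
    then have "Bseq (\<lambda>k. 2^k * D k x)" by (intro convergent_imp_Bseq summable_imp_convergent)
    then obtain C where "\<forall>k. norm (2^k * D k x) \<le> C" unfolding Bseq_def by blast
    then have C: "2^k * D k x \<le> C" for k by (metis abs_le_D1 real_norm_def)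
    have "0 \<le> 2^0 * D 0 x" by (simp add: D_def)
    then have C0: "C \<ge> 0" using C[of 0] by linarith
    have "norm (norm (Y (Suc k) x - Y k x)) \<le> sqrt C * (sqrt (1/2))^k" for k
    proof -
      have "D k x \<le> C * (1/2)^k" using C[of k] by (simp add: field_simps power_divide)
      then have "sqrt (D k x) \<le> sqrt (C * (1/2)^k)" by simp
      then show ?thesis by (simp add: D_def real_sqrt_mult real_sqrt_power)
    qed
    moreover have "summable (\<lambda>k. sqrt C * (sqrt (1/2))^k)"
      by (intro summable_mult summable_geometric) simp
    ultimately have "summable (\<lambda>k. norm (Y (Suc k) x - Y k x))"
      by (rule summable_comparison_test'[where N = 0, rotated])
    then show ?case by (rule convergent_of_summable_differences)
  qed
  define u where "u x = lim (\<lambda>k. Y k x)" for x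
  have um [measurable]: "u \<in> borel_measurable ?M" unfolding u_def by (rule borel_measurable_lim_metric) simp
  have bound: "(\<integral>\<^sup>+x. ennreal ((cmod (X n x - u x))\<^sup>2) \<partial>?M) \<le> ennreal ((1/4)^k)" if n: "n \<ge> N k" for n k
  proof -
    have "(\<integral>\<^sup>+x. ennreal ((cmod (X n x - u x))\<^sup>2) \<partial>?M) = (\<integral>\<^sup>+x. liminf (\<lambda>l. ennreal ((cmod (X n x - Y l x))\<^sup>2)) \<partial>?M)"
    proof (rule nn_integral_cong_AE, use conv in eventually_elim)
      case (elim x)
      then have "(\<lambda>k. Y k x) \<longlonglongrightarrow> u x" unfolding u_def by (simp add: convergent_LIMSEQ_iff)
      then have "(\<lambda>l. ennreal ((cmod (X n x - Y l x))\<^sup>2)) \<longlonglongrightarrow> ennreal ((cmod (X n x - u x))\<^sup>2)"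
        by (intro tendsto_intros tendsto_ennrealI)
      then show ?case by (intro lim_imp_Liminf[symmetric]) auto
    qed
    also have "\<dots> \<le> liminf (\<lambda>l. \<integral>\<^sup>+x. ennreal ((cmod (X n x - Y l x))\<^sup>2) \<partial>?M)"
      by (rule nn_integral_liminf) measurable
    also have "\<dots> \<le> ennreal ((1/4)^k)"
    proof -
      have "(\<integral>\<^sup>+x. ennreal ((cmod (X n x - Y l x))\<^sup>2) \<partial>?M) \<le> ennreal ((1/4)^k)" if "l \<ge> k" for l
      proof -
        have "r l \<ge> N k" using rN[of k] rmono[OF that] by linarith
        then have "L2.q \<Omega> (X n - Y l) \<le> (1/4)^k" unfolding Y_def using N[OF n] by (simp add: less_imp_le)
        then show ?thesis using L2_nn_integral[of "X n - Y l" \<Omega>] X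
          by (simp add: Y_def L2.diff_in ennreal_leI)
      qed
      then have "\<forall>\<^sub>F l in sequentially. (\<integral>\<^sup>+x. ennreal ((cmod (X n x - Y l x))\<^sup>2) \<partial>?M) \<le> ennreal ((1/4)^k)"
        by (auto simp: eventually_sequentially)
      then show ?thesis by (intro Liminf_le) auto
    qed
    finally show ?thesis .
  qed
  have Xu: "X n - u \<in> L2 \<Omega>" if "n \<ge> N 0" for n
  proof -
    have "integrable ?M (\<lambda>x. (cmod (X n x - u x))\<^sup>2)"
    proof (rule integrableI_nonneg)
      show "(\<integral>\<^sup>+x. ennreal ((cmod (X n x - u x))\<^sup>2) \<partial>?M) < \<infinity>"
        by (rule le_less_trans[OF bound[OF that]]) simp
    qed auto
    then show ?thesis by (simp add: L2_def fun_diff_def)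
  qed
  have u: "u \<in> L2 \<Omega>"
  proof -
    have "X (N 0) - (X (N 0) - u) \<in> L2 \<Omega>" by (intro L2.diff_in X Xu) simp
    then show ?thesis by simp
  qed
  have le: "L2.q \<Omega> (X n - u) \<le> (1/4)^k" if "n \<ge> N k" for n k
    using bound[OF that] L2_nn_integral[of "X n - u" \<Omega>] X u by (simp add: L2.diff_in)
  have "(\<lambda>n. L2.q \<Omega> (X n - u)) \<longlonglongrightarrow> 0"
  proof (intro LIMSEQ_I)
    fix e :: real assume e: "e > 0"
    obtain k where k: "(1/4::real)^k < e" using real_arch_pow_inv[OF e, of "1/4"] by auto
    have "norm (L2.q \<Omega> (X n - u) - 0) < e" if "n \<ge> N k" for n
      using le[OF that] k L2.q_nonneg[OF L2.diff_in[OF X u], of n] by simp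
    then show "\<exists>no. \<forall>n\<ge>no. norm (L2.q \<Omega> (X n - u) - 0) < e" by blast
  qed
  then show ?thesis using u by blast
qed

lemma
  fixes f :: "real^2 \<Rightarrow> 'b::{banach, second_countable_topology}"
  assumes \<Omega>: "open \<Omega>" and f: "f \<in> borel_measurable borel" and z: "\<And>x. x \<notin> \<Omega> \<Longrightarrow> f x = 0"
  shows integral_lebesgue_on_eq_lborel: "integral\<^sup>L (lebesgue_on \<Omega>) f = integral\<^sup>L lborel f"
    and integrable_lebesgue_on_iff_lborel: "integrable (lebesgue_on \<Omega>) f \<longleftrightarrow> integrable lborel f"
proof -
  have m: "\<Omega> \<inter> space lebesgue \<in> sets lebesgue" using \<Omega> by simp
  have eq: "(\<lambda>x. indicator \<Omega> x *\<^sub>R f x) = f" using z by (auto simp: fun_eq_iff indicator_def)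
  have fm: "f \<in> borel_measurable lborel" using f by simp
  show "integral\<^sup>L (lebesgue_on \<Omega>) f = integral\<^sup>L lborel f"
    using integral_restrict_space[OF m, of f] integral_completion[OF fm] by (simp add: eq)
  show "integrable (lebesgue_on \<Omega>) f \<longleftrightarrow> integrable lborel f"
    using integrable_restrict_space[OF m, of f] integrable_completion[OF fm] by (simp add: eq)
qed

lemma test_borel: "\<phi> \<in> test_functions \<Omega> \<Longrightarrow> \<phi> \<in> borel_measurable borel"
  by (intro borel_measurable_continuous_onI smooth_continuous test_smooth)

lemma smooth_borel: "smooth f \<Longrightarrow> f \<in> borel_measurable borel"
  by (intro borel_measurable_continuous_onI smooth_continuous)

lemma lebesgue_on_measurable: "f \<in> borel_measurable borel \<Longrightarrow> f \<in> borel_measurable (lebesgue_on \<Omega>)"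
  by (intro measurable_restrict_space1 measurable_completion) simp

lemma test_L2:
  assumes "open \<Omega>" "\<phi> \<in> test_functions \<Omega>"
  shows "\<phi> \<in> L2 \<Omega>"
proof -
  have "integrable (lebesgue_on \<Omega>) (\<lambda>x. (cmod (\<phi> x))\<^sup>2)"
    using assms test_borel[OF assms(2)]
    by (subst integrable_lebesgue_on_iff_lborel) (auto simp: test_norm_square_integrable test_zero_outside)
  then show ?thesis using test_borel[OF assms(2)] by (simp add: L2_def lebesgue_on_measurable)
qed

lemma L2_q_test:
  assumes "open \<Omega>" "\<phi> \<in> test_functions \<Omega>"
  shows "L2.q \<Omega> \<phi> = (\<integral>x. (cmod (\<phi> x))\<^sup>2 \<partial>lborel)"
  unfolding L2_q_eq using assms test_borel[OF assms(2)]
  by (intro integral_lebesgue_on_eq_lborel) (auto simp: test_zero_outside)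

lemma inner_L2_test:
  assumes "open \<Omega>" "\<phi> \<in> test_functions \<Omega>" "smooth \<psi>"
  shows "inner_L2 \<Omega> \<phi> \<psi> = (\<integral>x. \<phi> x * cnj (\<psi> x) \<partial>lborel)"
  unfolding inner_L2_def using assms test_borel[OF assms(2)] smooth_borel[OF smooth_cnj[OF assms(3)]]
  by (intro integral_lebesgue_on_eq_lborel) (auto simp: test_zero_outside)

lemma test_ops:
  "\<phi> \<in> test_functions \<Omega> \<Longrightarrow> \<psi> \<in> test_functions \<Omega> \<Longrightarrow> \<phi> + \<psi> \<in> test_functions \<Omega>"
  "\<phi> \<in> test_functions \<Omega> \<Longrightarrow> \<psi> \<in> test_functions \<Omega> \<Longrightarrow> \<phi> - \<psi> \<in> test_functions \<Omega>"
  "\<phi> \<in> test_functions \<Omega> \<Longrightarrow> cscale c \<phi> \<in> test_functions \<Omega>"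
  by (auto simp: plus_fun_def fun_diff_def cscale_def intro: test_add test_diff test_scale)

lemma partial_deriv_scale: "smooth f \<Longrightarrow> partial_deriv j (\<lambda>x. c * f x) = (\<lambda>x. c * partial_deriv j f x)"
proof -
  have "partial_deriv j (\<lambda>x. c) = (\<lambda>x. 0)"
    using partial_deriv_eq[OF has_derivative_const] by (auto simp: fun_eq_iff)
  then show "smooth f \<Longrightarrow> ?thesis"
    by (auto simp: fun_eq_iff partial_deriv_mult smooth_differentiable)
qed

section \<open>The magnetic form\<close>

text \<open>For the potential \<open>(-B x2, 0)\<close> this is the first covariant derivative plus
  \<open>\<i>\<close> times the second. Composed with its adjoint it gives the magnetic Laplacian
  minus \<open>B\<close>: the shift of the operator is exactly what makes its form the square of one
  first-order operator.\<close>

definition mdbar :: "real \<Rightarrow> (real^2 \<Rightarrow> complex) \<Rightarrow> real^2 \<Rightarrow> complex" where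
  "mdbar B \<phi> = (\<lambda>x. partial_deriv 1 \<phi> x + \<i> * partial_deriv 2 \<phi> x + \<i> * of_real B * of_real (x $ 2) * \<phi> x)"

text \<open>The adjoint composed with \<open>mdbar B\<close>: this is the magnetic operator on smooth functions.\<close>

definition mlaplacian :: "real \<Rightarrow> (real^2 \<Rightarrow> complex) \<Rightarrow> real^2 \<Rightarrow> complex" where
  "mlaplacian B \<zeta> = (\<lambda>x. - partial_deriv 1 (mdbar B \<zeta>) x + \<i> * partial_deriv 2 (mdbar B \<zeta>) x
     - \<i> * of_real B * of_real (x $ 2) * mdbar B \<zeta> x)"

lemma mdbar_eq_dbar: "mdbar B \<phi> x = dbar \<phi> x + \<i> * of_real B * of_real (x $ 2) * \<phi> x"
  by (simp add: mdbar_def dbar_def)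

lemma smooth_mdbar: "smooth \<phi> \<Longrightarrow> smooth (mdbar B \<phi>)"
  unfolding mdbar_def by (intro smooth_intros)

lemma test_mdbar: "\<phi> \<in> test_functions \<Omega> \<Longrightarrow> mdbar B \<phi> \<in> test_functions \<Omega>"
  unfolding mdbar_def by (intro test_add test_scale test_partial test_mult smooth_intros)

lemma test_mlaplacian: "\<phi> \<in> test_functions \<Omega> \<Longrightarrow> mlaplacian B \<phi> \<in> test_functions \<Omega>"
proof -
  assume \<phi>: "\<phi> \<in> test_functions \<Omega>"
  have "(\<lambda>x. (-1) * partial_deriv 1 (mdbar B \<phi>) x + \<i> * partial_deriv 2 (mdbar B \<phi>) x
     - \<i> * of_real B * of_real (x $ 2) * mdbar B \<phi> x) \<in> test_functions \<Omega>"
    by (intro test_add test_diff test_scale test_partial test_mult smooth_intros test_mdbar \<phi>)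
  then show ?thesis by (simp add: mlaplacian_def)
qed

lemma mdbar_ops:
  assumes "smooth \<phi>" "smooth \<psi>"
  shows "mdbar B (\<phi> + \<psi>) = mdbar B \<phi> + mdbar B \<psi>" "mdbar B (\<phi> - \<psi>) = mdbar B \<phi> - mdbar B \<psi>"
    "mdbar B (cscale c \<phi>) = cscale c (mdbar B \<phi>)"
proof -
  have "partial_deriv j (\<lambda>x. \<phi> x + \<psi> x) = (\<lambda>x. partial_deriv j \<phi> x + partial_deriv j \<psi> x)" for j
    using assms by (simp add: fun_eq_iff partial_deriv_add smooth_differentiable)
  then show "mdbar B (\<phi> + \<psi>) = mdbar B \<phi> + mdbar B \<psi>"
    by (simp add: mdbar_def fun_eq_iff plus_fun_def algebra_simps)
  show "mdbar B (\<phi> - \<psi>) = mdbar B \<phi> - mdbar B \<psi>"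
    using assms by (simp add: mdbar_def fun_eq_iff fun_diff_def partial_deriv_diff algebra_simps)
  show "mdbar B (cscale c \<phi>) = cscale c (mdbar B \<phi>)"
    using assms by (simp add: mdbar_def fun_eq_iff cscale_def partial_deriv_scale algebra_simps)
qed

lemma mdbar_adjoint:
  assumes \<Omega>: "open \<Omega>" and \<phi>: "\<phi> \<in> test_functions \<Omega>" and \<zeta>: "smooth \<zeta>"
  shows "inner_L2 \<Omega> (mdbar B \<phi>) (mdbar B \<zeta>) = inner_L2 \<Omega> \<phi> (mlaplacian B \<zeta>)"
proof -
  define \<eta> where "\<eta> = mdbar B \<zeta>"
  have \<eta>: "smooth \<eta>" unfolding \<eta>_def by (rule smooth_mdbar[OF \<zeta>])
  have sL: "smooth (mlaplacian B \<zeta>)" unfolding mlaplacian_def by (intro smooth_intros smooth_mdbar \<zeta>)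
  have i: "integrable lborel (\<lambda>x. f x * g x)" if "f \<in> test_functions \<Omega>" "smooth g" for f g
    using test_integrable[OF test_mult[OF that]] by (simp add: mult.commute)
  have ibp: "(\<integral>x. partial_deriv j \<phi> x * cnj (\<eta> x) \<partial>lborel) = - (\<integral>x. \<phi> x * cnj (partial_deriv j \<eta> x) \<partial>lborel)" for j
    using integration_by_parts[OF \<phi> smooth_cnj[OF \<eta>], of j] by (simp add: partial_deriv_cnj \<eta>)
  have sb: "smooth (\<lambda>x. \<i> * of_real B * of_real (x $ 2) * cnj (\<eta> x))"
    by (intro smooth_intros \<eta>)
  have "inner_L2 \<Omega> (mdbar B \<phi>) \<eta> = (\<integral>x. partial_deriv 1 \<phi> x * cnj (\<eta> x) + \<i> * (partial_deriv 2 \<phi> x * cnj (\<eta> x)) +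
      \<phi> x * (\<i> * of_real B * of_real (x $ 2) * cnj (\<eta> x)) \<partial>lborel)"
    unfolding inner_L2_test[OF \<Omega> test_mdbar[OF \<phi>] \<eta>]
    by (intro Bochner_Integration.integral_cong) (auto simp: mdbar_def algebra_simps)
  also have "\<dots> = - (\<integral>x. \<phi> x * cnj (partial_deriv 1 \<eta> x) \<partial>lborel) - \<i> * (\<integral>x. \<phi> x * cnj (partial_deriv 2 \<eta> x) \<partial>lborel) +
      (\<integral>x. \<phi> x * (\<i> * of_real B * of_real (x $ 2) * cnj (\<eta> x)) \<partial>lborel)"
    using i[OF test_partial[OF \<phi>] smooth_cnj[OF \<eta>], of 1] i[OF test_partial[OF \<phi>] smooth_cnj[OF \<eta>], of 2]
      i[OF \<phi> sb] by (simp add: ibp del: mult.assoc)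
  also have "\<dots> = (\<integral>x. - (\<phi> x * cnj (partial_deriv 1 \<eta> x)) - \<i> * (\<phi> x * cnj (partial_deriv 2 \<eta> x)) +
      \<phi> x * (\<i> * of_real B * of_real (x $ 2) * cnj (\<eta> x)) \<partial>lborel)"
    using i[OF \<phi> smooth_cnj[OF smooth_partial[OF \<eta>]], of 1] i[OF \<phi> smooth_cnj[OF smooth_partial[OF \<eta>]], of 2]
      i[OF \<phi> sb] by (simp del: mult.assoc)
  also have "\<dots> = inner_L2 \<Omega> \<phi> (mlaplacian B \<zeta>)"
    unfolding inner_L2_test[OF \<Omega> \<phi> sL]
    by (intro Bochner_Integration.integral_cong) (auto simp: mlaplacian_def \<eta>_def[symmetric] algebra_simps)
  finally show ?thesis by (simp add: \<eta>_def)
qed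

text \<open>The closure of \<open>mdbar B\<close> on test functions, kept as a set of pairs. The
  first component determines the second only up to null sets; the graph avoids choosing a
  representative and is itself the vector space that carries the two forms.\<close>

definition magnetic_graph :: "(real^2) set \<Rightarrow> real \<Rightarrow> ((real^2 \<Rightarrow> complex) \<times> (real^2 \<Rightarrow> complex)) set" where
  "magnetic_graph \<Omega> B = {(u, w). u \<in> L2 \<Omega> \<and> w \<in> L2 \<Omega> \<and> (\<exists>\<phi>. (\<forall>k::nat. \<phi> k \<in> test_functions \<Omega>) \<and>
     (\<lambda>k. L2.q \<Omega> (\<phi> k - u)) \<longlonglongrightarrow> 0 \<and> (\<lambda>k. L2.q \<Omega> (mdbar B (\<phi> k) - w)) \<longlonglongrightarrow> 0)}"

definition pscale :: "complex \<Rightarrow> (real^2 \<Rightarrow> complex) \<times> (real^2 \<Rightarrow> complex) \<Rightarrow> (real^2 \<Rightarrow> complex) \<times> (real^2 \<Rightarrow> complex)" where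
  "pscale c p = (cscale c (fst p), cscale c (snd p))"

lemma vector_space_pscale: "vector_space pscale"
  by unfold_locales (auto simp: pscale_def cscale_def fun_eq_iff prod_eq_iff algebra_simps)

lemma magnetic_graphE:
  assumes "p \<in> magnetic_graph \<Omega> B"
  obtains \<phi> where "fst p \<in> L2 \<Omega>" "snd p \<in> L2 \<Omega>" "\<And>k::nat. \<phi> k \<in> test_functions \<Omega>"
    "(\<lambda>k. L2.q \<Omega> (\<phi> k - fst p)) \<longlonglongrightarrow> 0" "(\<lambda>k. L2.q \<Omega> (mdbar B (\<phi> k) - snd p)) \<longlonglongrightarrow> 0"
  using assms that unfolding magnetic_graph_def case_prod_unfold mem_Collect_eq by blast

lemma test_in_graph: "open \<Omega> \<Longrightarrow> \<phi> \<in> test_functions \<Omega> \<Longrightarrow> (\<phi>, mdbar B \<phi>) \<in> magnetic_graph \<Omega> B"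
  by (auto simp: magnetic_graph_def test_L2 test_mdbar intro!: exI[of _ "\<lambda>_. \<phi>"])

lemma L2_q_add_tendsto:
  assumes "\<And>k::nat. f k \<in> L2 \<Omega>" "\<And>k. g k \<in> L2 \<Omega>" "(\<lambda>k. L2.q \<Omega> (f k)) \<longlonglongrightarrow> 0" "(\<lambda>k. L2.q \<Omega> (g k)) \<longlonglongrightarrow> 0"
  shows "(\<lambda>k. L2.q \<Omega> (f k + g k)) \<longlonglongrightarrow> 0"
proof (rule tendsto_sandwich[of "\<lambda>_. 0"])
  have "(\<lambda>k. 2 * L2.q \<Omega> (f k) + 2 * L2.q \<Omega> (g k)) \<longlonglongrightarrow> 2 * 0 + 2 * 0"
    by (intro tendsto_intros assms)
  then show "(\<lambda>k. 2 * L2.q \<Omega> (f k) + 2 * L2.q \<Omega> (g k)) \<longlonglongrightarrow> 0" by simp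
qed (use assms in \<open>auto simp: L2.q_nonneg L2.add_in L2.q_add_le\<close>)

lemma L2_q_scale_tendsto:
  assumes "\<And>k::nat. f k \<in> L2 \<Omega>" "(\<lambda>k. L2.q \<Omega> (f k)) \<longlonglongrightarrow> 0"
  shows "(\<lambda>k. L2.q \<Omega> (cscale c (f k))) \<longlonglongrightarrow> 0"
  using tendsto_mult_left[OF assms(2), of "(cmod c)\<^sup>2"] by (simp add: L2.q_scale assms)

lemma graph_subspace:
  assumes \<Omega>: "open \<Omega>"
  shows "module.subspace pscale (magnetic_graph \<Omega> B)"
proof -
  interpret vector_space pscale by (rule vector_space_pscale)
  show ?thesis
  proof (rule subspaceI)
    have "((\<lambda>x. 0), mdbar B (\<lambda>x. 0)) \<in> magnetic_graph \<Omega> B" by (rule test_in_graph[OF \<Omega> test_zero])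
    moreover have "mdbar B (\<lambda>x. 0) = 0"
      using partial_deriv_eq[OF has_derivative_const] by (auto simp: mdbar_def fun_eq_iff)
    ultimately show "0 \<in> magnetic_graph \<Omega> B" by (simp add: zero_prod_def zero_fun_def)
  next
    fix p r assume pr: "p \<in> magnetic_graph \<Omega> B" "r \<in> magnetic_graph \<Omega> B"
    obtain \<phi> where p: "fst p \<in> L2 \<Omega>" "snd p \<in> L2 \<Omega>" "\<And>k::nat. \<phi> k \<in> test_functions \<Omega>"
        "(\<lambda>k. L2.q \<Omega> (\<phi> k - fst p)) \<longlonglongrightarrow> 0" "(\<lambda>k. L2.q \<Omega> (mdbar B (\<phi> k) - snd p)) \<longlonglongrightarrow> 0"
      using magnetic_graphE[OF pr(1)] by blast
    obtain \<psi> where r: "fst r \<in> L2 \<Omega>" "snd r \<in> L2 \<Omega>" "\<And>k::nat. \<psi> k \<in> test_functions \<Omega>"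
        "(\<lambda>k. L2.q \<Omega> (\<psi> k - fst r)) \<longlonglongrightarrow> 0" "(\<lambda>k. L2.q \<Omega> (mdbar B (\<psi> k) - snd r)) \<longlonglongrightarrow> 0"
      using magnetic_graphE[OF pr(2)] by blast
    note t = test_L2[OF \<Omega>] test_mdbar test_smooth
    have "(\<lambda>k. L2.q \<Omega> ((\<phi> k + \<psi> k) - fst (p + r))) \<longlonglongrightarrow> 0"
      using L2_q_add_tendsto[OF _ _ p(4) r(4)] p r t by (simp add: L2.diff_in algebra_simps)
    moreover have "(\<lambda>k. L2.q \<Omega> (mdbar B (\<phi> k + \<psi> k) - snd (p + r))) \<longlonglongrightarrow> 0"
      using L2_q_add_tendsto[OF _ _ p(5) r(5)] p r t by (simp add: mdbar_ops[OF t(3)[OF p(3)] t(3)[OF r(3)]] L2.diff_in algebra_simps)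
    ultimately show "p + r \<in> magnetic_graph \<Omega> B"
      using p r by (auto simp: magnetic_graph_def case_prod_unfold intro!: exI[of _ "\<lambda>k. \<phi> k + \<psi> k"] test_ops)
  next
    fix c p assume p: "p \<in> magnetic_graph \<Omega> B"
    obtain \<phi> where p: "fst p \<in> L2 \<Omega>" "snd p \<in> L2 \<Omega>" "\<And>k::nat. \<phi> k \<in> test_functions \<Omega>"
        "(\<lambda>k. L2.q \<Omega> (\<phi> k - fst p)) \<longlonglongrightarrow> 0" "(\<lambda>k. L2.q \<Omega> (mdbar B (\<phi> k) - snd p)) \<longlonglongrightarrow> 0"
      using magnetic_graphE[OF p] by blast
    note t = test_L2[OF \<Omega>] test_mdbar test_smooth
    have cd: "cscale c f - cscale c g = cscale c (f - g)" for f g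
      by (simp add: cscale_def fun_eq_iff algebra_simps)
    have "(\<lambda>k. L2.q \<Omega> (cscale c (\<phi> k) - cscale c (fst p))) \<longlonglongrightarrow> 0"
      unfolding cd by (rule L2_q_scale_tendsto) (use p t in \<open>auto simp: L2.diff_in\<close>)
    moreover have "(\<lambda>k. L2.q \<Omega> (mdbar B (cscale c (\<phi> k)) - cscale c (snd p))) \<longlonglongrightarrow> 0"
      unfolding mdbar_ops(3)[OF t(3)[OF p(3)] t(3)[OF p(3)]] cd
      by (rule L2_q_scale_tendsto) (use p t in \<open>auto simp: L2.diff_in\<close>)
    ultimately show "pscale c p \<in> magnetic_graph \<Omega> B"
      using p by (auto simp: magnetic_graph_def pscale_def L2.scale_in intro!: exI[of _ "\<lambda>k. cscale c (\<phi> k)"] test_ops)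
  qed
qed

text \<open>On a bounded domain the coordinate \<open>x2\<close> is bounded, so
  \<open>mdbar B\<close> and \<open>dbar\<close> differ by a bounded operator. This carries
  estimates for the gradient over to the magnetic form and back.\<close>

lemma x2_bound:
  assumes "bounded (\<Omega> :: (real^2) set)"
  shows "\<exists>C>0. \<forall>u\<in>L2 \<Omega>. (\<lambda>x. \<i> * of_real B * of_real (x $ 2) * u x) \<in> L2 \<Omega> \<and>
    L2.q \<Omega> (\<lambda>x. \<i> * of_real B * of_real (x $ 2) * u x) \<le> C * L2.q \<Omega> u"
proof -
  obtain R where R: "R > 0" "\<And>x. x \<in> \<Omega> \<Longrightarrow> norm x \<le> R" using assms bounded_pos by blast
  define C where "C = \<bar>B\<bar> * R + 1"
  have C: "C > 0" using R by (simp add: C_def add_nonneg_pos)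
  have b: "cmod (\<i> * of_real B * of_real (x $ 2)) \<le> C" if "x \<in> \<Omega>" for x :: "real^2"
  proof -
    have "\<bar>x $ 2\<bar> \<le> R" using R(2)[OF that] component_le_norm_cart order_trans by blast
    then have "\<bar>B\<bar> * \<bar>x $ 2\<bar> \<le> \<bar>B\<bar> * R" by (simp add: mult_left_mono)
    then show ?thesis by (simp add: norm_mult C_def)
  qed
  have m: "(\<lambda>x::real^2. \<i> * of_real B * of_real (x $ 2)) \<in> borel_measurable (lebesgue_on \<Omega>)"
    by (intro lebesgue_on_measurable smooth_borel smooth_intros)
  show ?thesis
  proof (intro exI[of _ "C\<^sup>2"] conjI ballI)
    fix u assume u: "u \<in> L2 \<Omega>"
    show L: "(\<lambda>x. \<i> * of_real B * of_real (x $ 2) * u x) \<in> L2 \<Omega>" by (rule L2_bounded_mult[OF u m b])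
    have "(\<integral>x. (cmod (\<i> * of_real B * of_real (x $ 2) * u x))\<^sup>2 \<partial>lebesgue_on \<Omega>) \<le> (\<integral>x. C\<^sup>2 * (cmod (u x))\<^sup>2 \<partial>lebesgue_on \<Omega>)"
    proof (rule integral_mono)
      show "integrable (lebesgue_on \<Omega>) (\<lambda>x. (cmod (\<i> * of_real B * of_real (x $ 2) * u x))\<^sup>2)" by (rule L2_square_integrable[OF L])
      show "(cmod (\<i> * of_real B * of_real (x $ 2) * u x))\<^sup>2 \<le> C\<^sup>2 * (cmod (u x))\<^sup>2" if "x \<in> space (lebesgue_on \<Omega>)" for x
        using b[of x] that by (auto simp: norm_mult[of "_ * _" "u x"] power_mult_distrib space_restrict_space intro!: mult_right_mono power_mono)
    qed (use L2_square_integrable[OF u] in simp)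
    then show "L2.q \<Omega> (\<lambda>x. \<i> * of_real B * of_real (x $ 2) * u x) \<le> C\<^sup>2 * L2.q \<Omega> u"
      by (simp add: L2_q_eq)
  qed (use C in simp)
qed

lemma hermitian_graph_forms:
  assumes \<Omega>: "open \<Omega>"
  shows "hermitian_form pscale (magnetic_graph \<Omega> B) (\<lambda>p r. inner_L2 \<Omega> (snd p) (snd r))"
    "hermitian_form pscale (magnetic_graph \<Omega> B) (\<lambda>p r. inner_L2 \<Omega> (fst p) (fst r))"
proof -
  interpret vector_space pscale by (rule vector_space_pscale)
  have L: "fst p \<in> L2 \<Omega>" "snd p \<in> L2 \<Omega>" if "p \<in> magnetic_graph \<Omega> B" for p
    using that by (auto simp: magnetic_graph_def)
  show "hermitian_form pscale (magnetic_graph \<Omega> B) (\<lambda>p r. inner_L2 \<Omega> (snd p) (snd r))"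
    by unfold_locales (auto simp: graph_subspace[OF \<Omega>] L pscale_def L2.add_left L2.scale_left L2.cnj_swap[symmetric] L2.Re_self_nonneg)
  show "hermitian_form pscale (magnetic_graph \<Omega> B) (\<lambda>p r. inner_L2 \<Omega> (fst p) (fst r))"
    by unfold_locales (auto simp: graph_subspace[OF \<Omega>] L pscale_def L2.add_left L2.scale_left L2.cnj_swap[symmetric] L2.Re_self_nonneg)
qed

text \<open>\<open>dbar \<phi>\<close> is \<open>mdbar B \<phi>\<close> minus \<open>\<phi>\<close>
  times a bounded function, and on test functions the \<open>L2\<close> norm of
  \<open>dbar \<phi>\<close> is that of the whole gradient.\<close>

lemma dbar_square_le:
  assumes \<Omega>: "open \<Omega>" and C: "C > 0" "\<And>u. u \<in> L2 \<Omega> \<Longrightarrow> (\<lambda>x. \<i> * of_real B * of_real (x $ 2) * u x) \<in> L2 \<Omega> \<and>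
    L2.q \<Omega> (\<lambda>x. \<i> * of_real B * of_real (x $ 2) * u x) \<le> C * L2.q \<Omega> u"
    and \<phi>: "\<phi> \<in> test_functions \<Omega>"
  shows "L2.q \<Omega> (partial_deriv 1 \<phi>) + L2.q \<Omega> (partial_deriv 2 \<phi>) \<le> 2 * L2.q \<Omega> (mdbar B \<phi>) + 2 * C * L2.q \<Omega> \<phi>"
proof -
  define b where "b = (\<lambda>x. \<i> * of_real B * of_real (x $ 2) * \<phi> x)"
  have dt: "dbar \<phi> \<in> test_functions \<Omega>"
    unfolding dbar_def[abs_def] by (intro test_add test_scale test_partial \<phi>)
  have L: "mdbar B \<phi> \<in> L2 \<Omega>" "b \<in> L2 \<Omega>" "L2.q \<Omega> b \<le> C * L2.q \<Omega> \<phi>"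
    using C(2)[OF test_L2[OF \<Omega> \<phi>]] test_L2[OF \<Omega> test_mdbar[OF \<phi>]] by (auto simp: b_def)
  have "dbar \<phi> = mdbar B \<phi> - b" by (auto simp: fun_eq_iff mdbar_eq_dbar b_def)
  then have "L2.q \<Omega> (dbar \<phi>) \<le> 2 * L2.q \<Omega> (mdbar B \<phi>) + 2 * L2.q \<Omega> b"
    using L2.parallelogram[OF L(1,2)] L2.q_nonneg[OF L2.add_in[OF L(1,2)]] by simp
  also have "L2.q \<Omega> (dbar \<phi>) = L2.q \<Omega> (partial_deriv 1 \<phi>) + L2.q \<Omega> (partial_deriv 2 \<phi>)"
    using integral_dbar_square[OF \<phi>] by (simp add: L2_q_test[OF \<Omega>] dt test_partial[OF \<phi>])
  finally show ?thesis using L(3) by simp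
qed

lemma graph_approx:
  assumes \<Omega>: "open \<Omega>" and p: "p \<in> magnetic_graph \<Omega> B" and e: "e > 0"
  shows "\<exists>\<phi>\<in>test_functions \<Omega>. L2.q \<Omega> (\<phi> - fst p) < e \<and> L2.q \<Omega> (mdbar B \<phi> - snd p) < e"
proof -
  obtain \<phi> where \<phi>: "\<And>k::nat. \<phi> k \<in> test_functions \<Omega>"
    "(\<lambda>k. L2.q \<Omega> (\<phi> k - fst p)) \<longlonglongrightarrow> 0" "(\<lambda>k. L2.q \<Omega> (mdbar B (\<phi> k) - snd p)) \<longlonglongrightarrow> 0"
    using magnetic_graphE[OF p] by blast
  have "\<forall>\<^sub>F k in sequentially. L2.q \<Omega> (\<phi> k - fst p) < e \<and> L2.q \<Omega> (mdbar B (\<phi> k) - snd p) < e"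
    using order_tendstoD(2)[OF \<phi>(2) e] order_tendstoD(2)[OF \<phi>(3) e] by eventually_elim simp
  then show ?thesis using \<phi>(1) by (auto dest!: eventually_happens)
qed

text \<open>Both components converge in \<open>L2\<close>. Test functions within
  \<open>1 / Suc n\<close> of the \<open>n\<close>-th pair then converge to the limit pair, which
  puts it into the graph.\<close>

lemma graph_complete:
  assumes \<Omega>: "open \<Omega>" and X: "\<And>n. X n \<in> magnetic_graph \<Omega> B"
    and C: "\<And>e. e > 0 \<Longrightarrow> \<exists>N. \<forall>m\<ge>N. \<forall>n\<ge>N. L2.q \<Omega> (snd (X m - X n)) < e \<and> L2.q \<Omega> (fst (X m - X n)) < e"
  shows "\<exists>x\<in>magnetic_graph \<Omega> B. (\<lambda>n. L2.q \<Omega> (snd (X n - x))) \<longlonglongrightarrow> 0 \<and> (\<lambda>n. L2.q \<Omega> (fst (X n - x))) \<longlonglongrightarrow> 0"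
proof -
  have L: "fst (X n) \<in> L2 \<Omega>" "snd (X n) \<in> L2 \<Omega>" for n using X[of n] by (auto simp: magnetic_graph_def)
  obtain u where u: "u \<in> L2 \<Omega>" "(\<lambda>n. L2.q \<Omega> (fst (X n) - u)) \<longlonglongrightarrow> 0"
    using L2_complete[of "\<lambda>n. fst (X n)" \<Omega>] L C by (auto simp: fst_diff) meson
  obtain w where w: "w \<in> L2 \<Omega>" "(\<lambda>n. L2.q \<Omega> (snd (X n) - w)) \<longlonglongrightarrow> 0"
    using L2_complete[of "\<lambda>n. snd (X n)" \<Omega>] L C by (auto simp: snd_diff) meson
  have "\<forall>n. \<exists>\<phi>\<in>test_functions \<Omega>. L2.q \<Omega> (\<phi> - fst (X n)) < 1 / Suc n \<and> L2.q \<Omega> (mdbar B \<phi> - snd (X n)) < 1 / Suc n"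
    by (intro allI graph_approx[OF \<Omega> X]) simp
  then obtain \<phi> where \<phi>: "\<And>n. \<phi> n \<in> test_functions \<Omega>" "\<And>n. L2.q \<Omega> (\<phi> n - fst (X n)) < 1 / Suc n"
      "\<And>n. L2.q \<Omega> (mdbar B (\<phi> n) - snd (X n)) < 1 / Suc n" by metis
  note t = test_L2[OF \<Omega> \<phi>(1)] test_L2[OF \<Omega> test_mdbar[OF \<phi>(1)]]
  have to0: "f \<longlonglongrightarrow> 0" if "\<And>n. f n < 1 / Suc n" "\<And>n. f n \<ge> 0" for f :: "nat \<Rightarrow> real"
    by (rule tendsto_sandwich[OF _ _ tendsto_const LIMSEQ_Suc[OF lim_1_over_n]])
       (use that less_imp_le in \<open>auto intro!: always_eventually\<close>)
  have 1: "(\<lambda>n. L2.q \<Omega> (\<phi> n - fst (X n))) \<longlonglongrightarrow> 0"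
    by (rule to0[OF \<phi>(2) L2.q_nonneg[OF L2.diff_in[OF t(1) L(1)]]])
  have 2: "(\<lambda>n. L2.q \<Omega> (mdbar B (\<phi> n) - snd (X n))) \<longlonglongrightarrow> 0"
    by (rule to0[OF \<phi>(3) L2.q_nonneg[OF L2.diff_in[OF t(2) L(2)]]])
  have "(\<lambda>n. L2.q \<Omega> (\<phi> n - u)) \<longlonglongrightarrow> 0"
    using L2_q_add_tendsto[OF L2.diff_in[OF t(1) L(1)] L2.diff_in[OF L(1) u(1)] 1 u(2)] by simp
  moreover have "(\<lambda>n. L2.q \<Omega> (mdbar B (\<phi> n) - w)) \<longlonglongrightarrow> 0"
    using L2_q_add_tendsto[OF L2.diff_in[OF t(2) L(2)] L2.diff_in[OF L(2) w(1)] 2 w(2)] by simp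
  ultimately have "(u, w) \<in> magnetic_graph \<Omega> B"
    using \<phi>(1) u(1) w(1) by (auto simp: magnetic_graph_def)
  then show ?thesis using u(2) w(2) by (intro bexI[of _ "(u, w)"]) simp_all
qed

text \<open>Each pair is replaced by a test function within \<open>1 / Suc n\<close>. Bounded
  magnetic energy bounds the gradient of these functions, so \<open>Rellich\<close> applies to them;
  the replacement errors vanish along the subsequence.\<close>

lemma graph_compact:
  assumes \<Omega>: "open \<Omega>" "bounded \<Omega>" and X: "\<And>n. X n \<in> magnetic_graph \<Omega> B"
    and K: "\<And>n. L2.q \<Omega> (snd (X n)) + L2.q \<Omega> (fst (X n)) \<le> K"
  shows "\<exists>r::nat\<Rightarrow>nat. strict_mono r \<and> (\<forall>e>0. \<exists>N. \<forall>m\<ge>N. \<forall>n\<ge>N. L2.q \<Omega> (fst (X (r m) - X (r n))) < e)"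
proof -
  have L: "fst (X n) \<in> L2 \<Omega>" "snd (X n) \<in> L2 \<Omega>" for n using X[of n] by (auto simp: magnetic_graph_def)
  have "\<forall>n. \<exists>\<phi>\<in>test_functions \<Omega>. L2.q \<Omega> (\<phi> - fst (X n)) < 1 / Suc n \<and> L2.q \<Omega> (mdbar B \<phi> - snd (X n)) < 1 / Suc n"
    by (intro allI graph_approx[OF \<Omega>(1) X]) simp
  then obtain \<phi> where \<phi>: "\<And>n. \<phi> n \<in> test_functions \<Omega>" "\<And>n. L2.q \<Omega> (\<phi> n - fst (X n)) < 1 / Suc n"
      "\<And>n. L2.q \<Omega> (mdbar B (\<phi> n) - snd (X n)) < 1 / Suc n" by metis
  note t = test_L2[OF \<Omega>(1) \<phi>(1)] test_L2[OF \<Omega>(1) test_mdbar[OF \<phi>(1)]]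
  obtain C where C: "C > 0" "\<And>u. u \<in> L2 \<Omega> \<Longrightarrow> (\<lambda>x. \<i> * of_real B * of_real (x $ 2) * u x) \<in> L2 \<Omega> \<and>
    L2.q \<Omega> (\<lambda>x. \<i> * of_real B * of_real (x $ 2) * u x) \<le> C * L2.q \<Omega> u"
    using x2_bound[OF \<Omega>(2), of B] by blast
  have one: "1 / real (Suc n) \<le> 1" for n by simp
  have K': "L2.q \<Omega> (fst (X n)) \<le> K" "L2.q \<Omega> (snd (X n)) \<le> K" for n
    using K[of n] L2.q_nonneg[OF L(1), of n] L2.q_nonneg[OF L(2), of n] by linarith+
  have q1: "L2.q \<Omega> (\<phi> n) \<le> 2 + 2 * K" for n
    using L2.q_add_le[OF L2.diff_in[OF t(1)[of n] L(1)[of n]] L(1)[of n]] \<phi>(2)[of n] one[of n] K'[of n]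
    unfolding diff_add_cancel by linarith
  have q2: "L2.q \<Omega> (mdbar B (\<phi> n)) \<le> 2 + 2 * K" for n
    using L2.q_add_le[OF L2.diff_in[OF t(2)[of B n] L(2)[of n]] L(2)[of n]] \<phi>(3)[of n] one[of n] K'[of n]
    unfolding diff_add_cancel by linarith
  have d: "L2.q \<Omega> (partial_deriv 1 (\<phi> n)) + L2.q \<Omega> (partial_deriv 2 (\<phi> n)) \<le>
      2 * L2.q \<Omega> (mdbar B (\<phi> n)) + 2 * C * L2.q \<Omega> (\<phi> n)" for n
    by (rule dbar_square_le[OF \<Omega>(1) C(1) _ \<phi>(1)]) (use C(2) in blast)
  have d2: "L2.q \<Omega> (partial_deriv 1 (\<phi> n)) + L2.q \<Omega> (partial_deriv 2 (\<phi> n)) \<le> 2 * (2 + 2 * K) + 2 * C * (2 + 2 * K)" for n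
    by (rule order_trans[OF d add_mono[OF mult_left_mono[OF q2] mult_left_mono[OF q1]]]) (use C(1) in simp_all)
  have "L2.q \<Omega> (\<phi> n) + L2.q \<Omega> (partial_deriv 1 (\<phi> n)) + L2.q \<Omega> (partial_deriv 2 (\<phi> n)) \<le> (2 + 2 * K) + (2 * (2 + 2 * K) + 2 * C * (2 + 2 * K))" for n
    unfolding add.assoc[of "L2.q \<Omega> (\<phi> n)"] by (rule add_mono[OF q1 d2])
  then obtain r :: "nat \<Rightarrow> nat" where r: "strict_mono r"
    "\<And>e. e > 0 \<Longrightarrow> \<exists>N. \<forall>m\<ge>N. \<forall>n\<ge>N. (\<integral>x. (cmod (\<phi> (r m) x - \<phi> (r n) x))\<^sup>2 \<partial>lborel) < e"
    using Rellich[OF \<Omega>(2) \<phi>(1)] unfolding L2_q_test[OF \<Omega>(1) \<phi>(1)] L2_q_test[OF \<Omega>(1) test_partial[OF \<phi>(1)]] by meson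
  have "\<exists>N. \<forall>m\<ge>N. \<forall>n\<ge>N. L2.q \<Omega> (fst (X (r m) - X (r n))) < e" if e: "e > 0" for e
  proof -
    \<comment> \<open>In the final estimate the distance of the two test functions has weight 2 and
      each of the two replacement errors weight 4; \<open>e / 16\<close> for each leaves
      \<open>10 * e / 16\<close>.\<close>
    obtain N1 where N1: "\<And>m n. m \<ge> N1 \<Longrightarrow> n \<ge> N1 \<Longrightarrow> (\<integral>x. (cmod (\<phi> (r m) x - \<phi> (r n) x))\<^sup>2 \<partial>lborel) < e / 16"
      using r(2)[of "e / 16"] e by auto
    obtain N2 where N2: "N2 > 0" "1 / real N2 < e / 16"
      using real_arch_inverse[of "e / 16"] e by (auto simp: inverse_eq_divide)
    show ?thesis
    proof (intro exI[of _ "max N1 N2"] allI impI)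
      fix m n assume mn: "m \<ge> max N1 N2" "n \<ge> max N1 N2"
      have small: "L2.q \<Omega> (\<phi> (r k) - fst (X (r k))) < e / 16" if "k \<ge> max N1 N2" for k
      proof -
        have "N2 \<le> Suc (r k)" using that seq_suble[OF r(1), of k] by linarith
        then have "1 / real (Suc (r k)) \<le> 1 / real N2" using N2(1) by (intro divide_left_mono) auto
        then show ?thesis using \<phi>(2)[of "r k"] N2(2) by linarith
      qed
      let ?d = "\<lambda>k. \<phi> (r k) - fst (X (r k))"
      have d: "?d k \<in> L2 \<Omega>" for k by (intro L2.diff_in t L)
      have pd: "\<phi> (r m) - \<phi> (r n) \<in> L2 \<Omega>" by (intro L2.diff_in t)
      have "L2.q \<Omega> (\<phi> (r m) - \<phi> (r n)) < e / 16"
        using N1[of m n] mn by (simp add: L2_q_test[OF \<Omega>(1) test_ops(2)[OF \<phi>(1) \<phi>(1)]])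
      moreover have "L2.q \<Omega> (?d n - ?d m) \<le> 2 * L2.q \<Omega> (?d n) + 2 * L2.q \<Omega> (?d m)"
        using L2.parallelogram[OF d d, of n m] L2.q_nonneg[OF L2.add_in[OF d d], of n m] by linarith
      moreover have "L2.q \<Omega> ((\<phi> (r m) - \<phi> (r n)) + (?d n - ?d m)) \<le> 2 * L2.q \<Omega> (\<phi> (r m) - \<phi> (r n)) + 2 * L2.q \<Omega> (?d n - ?d m)"
        by (rule L2.q_add_le[OF pd L2.diff_in[OF d d]])
      moreover have "(\<phi> (r m) - \<phi> (r n)) + (?d n - ?d m) = fst (X (r m) - X (r n))" by simp
      ultimately show "L2.q \<Omega> (fst (X (r m) - X (r n))) < e"
        using small[OF mn(1)] small[OF mn(2)] e by simp
    qed
  qed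
  then show ?thesis using r(1) by blast
qed

text \<open>Monomials in the complex coordinate times one bump. A combination of norm zero vanishes
  everywhere by continuity, so the polynomial factor has infinitely many zeros on the ball and all
  its coefficients are zero.\<close>

lemma graph_infinite_dim:
  assumes \<Omega>: "open \<Omega>" "\<Omega> \<noteq> {}"
  shows "\<exists>\<phi>. (\<forall>i<n::nat. \<phi> i \<in> test_functions \<Omega>) \<and> (\<forall>c. L2.q \<Omega> (\<lambda>x. \<Sum>i<n. c i * \<phi> i x) = 0 \<longrightarrow> (\<forall>i<n. c i = 0))"
proof -
  obtain p where "p \<in> \<Omega>" using \<Omega>(2) by blast
  then obtain \<beta> r where b: "\<beta> \<in> test_functions \<Omega>" "r > 0" "\<And>x. \<beta> x \<noteq> 0 \<longleftrightarrow> x \<in> ball p r"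
    using bump_exists[OF \<Omega>(1)] by metis
  define \<phi> where "\<phi> i = (\<lambda>x. to_complex x ^ i * \<beta> x)" for i :: nat
  have \<phi>: "\<phi> i \<in> test_functions \<Omega>" for i
    unfolding \<phi>_def by (intro test_mult b smooth_power smooth_to_complex)
  have "\<forall>i<n. c i = 0" if "L2.q \<Omega> (\<lambda>x. \<Sum>i<n. c i * \<phi> i x) = 0" for c
  proof -
    define f where "f = (\<lambda>x. \<Sum>i<n. c i * \<phi> i x)"
    have f: "f \<in> test_functions \<Omega>" unfolding f_def by (intro test_sum test_scale \<phi>)
    have "(\<integral>x. (cmod (f x))\<^sup>2 \<partial>lborel) = 0"
      using that unfolding f_def[symmetric] L2_q_test[OF \<Omega>(1) f] .
    then have "AE x in lborel. f x = 0"
      by (subst (asm) integral_nonneg_eq_0_iff_AE) (auto simp: test_norm_square_integrable[OF f])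
    have fz: "f x = 0" if x: "x \<in> ball p r" for x
    proof (rule ccontr)
      assume "f x \<noteq> 0"
      moreover have "open {x. f x \<noteq> 0}"
        using smooth_continuous[OF test_smooth[OF f], of UNIV] by (intro open_Collect_neq continuous_on_const)
      moreover have "{x. f x \<noteq> 0} \<in> null_sets lborel"
        using \<open>AE x in lborel. f x = 0\<close> \<open>open {x. f x \<noteq> 0}\<close> by (subst AE_iff_null_sets) auto
      ultimately show False
        using open_not_negligible[of "{x. f x \<noteq> 0}"] null_sets_completionI
        by (auto simp: negligible_iff_null_sets)
    qed
    have poly0: "(\<Sum>i<n. c i * to_complex x ^ i) = 0" if "x \<in> ball p r" for x
      using fz[OF that] b(3)[of x] that by (auto simp: f_def \<phi>_def mult.assoc[symmetric] sum_distrib_right[symmetric])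
    show ?thesis
    proof (cases n)
      case (Suc m)
      have inj: "inj_on to_complex (ball p r)"
        by (rule inj_onI) (auto simp: to_complex_def vec_eq_iff forall_2)
      have "infinite (to_complex ` ball p r)"
        using uncountable_infinite[OF uncountable_ball[OF b(2)], of p] by (simp add: finite_image_iff[OF inj])
      moreover have "to_complex ` ball p r \<subseteq> {z. (\<Sum>i\<le>m. c i * z ^ i) = 0}"
        using poly0 by (auto simp: Suc lessThan_Suc_atMost)
      ultimately have "infinite {z. (\<Sum>i\<le>m. c i * z ^ i) = 0}" using finite_subset by blast
      then show ?thesis using polyfun_finite_roots[of c m] Suc by (auto simp: less_Suc_eq_le)
    qed simp
  qed
  then show ?thesis using \<phi> by blast
qed

lemma sum_fun_apply2: "(\<Sum>i\<in>I. f i) x = (\<Sum>i\<in>I. f i x)" for f :: "'i \<Rightarrow> 'a \<Rightarrow> 'b::comm_monoid_add"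
  by (induction I rule: infinite_finite_induct) auto

lemma form_pair_graph:
  assumes \<Omega>: "open \<Omega>" "bounded \<Omega>" "\<Omega> \<noteq> {}"
  shows "form_pair pscale (magnetic_graph \<Omega> B) (\<lambda>p r. inner_L2 \<Omega> (snd p) (snd r)) (\<lambda>p r. inner_L2 \<Omega> (fst p) (fst r))"
proof -
  interpret A: hermitian_form pscale "magnetic_graph \<Omega> B" "\<lambda>p r. inner_L2 \<Omega> (snd p) (snd r)"
    by (rule hermitian_graph_forms[OF \<Omega>(1)])
  interpret B: hermitian_form pscale "magnetic_graph \<Omega> B" "\<lambda>p r. inner_L2 \<Omega> (fst p) (fst r)"
    by (rule hermitian_graph_forms[OF \<Omega>(1)])
  have qA: "A.q p = L2.q \<Omega> (snd p)" and qB: "B.q p = L2.q \<Omega> (fst p)" for p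
    by (simp_all add: A.q_def B.q_def L2.q_def)
  show ?thesis
  proof unfold_locales
    show "\<exists>u. (\<forall>i<n::nat. u i \<in> magnetic_graph \<Omega> B) \<and> (\<forall>c. B.q (\<Sum>i<n. pscale (c i) (u i)) = 0 \<longrightarrow> (\<forall>i<n. c i = 0))" for n
    proof -
      obtain \<phi> where \<phi>: "\<forall>i<n. \<phi> i \<in> test_functions \<Omega>"
        "\<And>c. L2.q \<Omega> (\<lambda>x. \<Sum>i<n. c i * \<phi> i x) = 0 \<Longrightarrow> (\<forall>i<n. c i = 0)"
        using graph_infinite_dim[OF \<Omega>(1,3), of n] by blast
      have "fst (\<Sum>i<n. pscale (c i) (\<phi> i, mdbar B (\<phi> i))) = (\<lambda>x. \<Sum>i<n. c i * \<phi> i x)" for c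
        by (simp add: fst_sum fun_eq_iff sum_fun_apply2 pscale_def cscale_def)
      then show ?thesis using \<phi> test_in_graph[OF \<Omega>(1)]
        by (intro exI[of _ "\<lambda>i. (\<phi> i, mdbar B (\<phi> i))"]) (simp add: qB)
    qed
    show "\<exists>x\<in>magnetic_graph \<Omega> B. (\<lambda>n. A.q (X n - x)) \<longlonglongrightarrow> 0 \<and> (\<lambda>n. B.q (X n - x)) \<longlonglongrightarrow> 0"
      if "\<And>n. X n \<in> magnetic_graph \<Omega> B"
        "\<And>e. e > 0 \<Longrightarrow> \<exists>N. \<forall>m\<ge>N. \<forall>n\<ge>N. A.q (X m - X n) < e \<and> B.q (X m - X n) < e" for X
      using graph_complete[OF \<Omega>(1), of X B] that unfolding qA qB by blast
    show "\<exists>r::nat\<Rightarrow>nat. strict_mono r \<and> (\<forall>e>0. \<exists>N. \<forall>m\<ge>N. \<forall>n\<ge>N. B.q (X (r m) - X (r n)) < e)"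
      if "\<And>n. X n \<in> magnetic_graph \<Omega> B" "\<And>n. A.q (X n) + B.q (X n) \<le> C" for X C
      by (rule graph_compact[OF \<Omega>(1,2), of X B C, folded qA qB]) (use that in auto)
  qed
qed

section \<open>Eigenfunctions\<close>

lemma limits_eq:
  fixes X Y :: "nat \<Rightarrow> complex"
  assumes "X \<longlonglongrightarrow> a" "Y \<longlonglongrightarrow> b" "\<And>k. X k = Y k"
  shows "a = b"
proof -
  have "X = Y" using assms(3) by blast
  then show ?thesis using assms(1,2) LIMSEQ_unique by blast
qed

lemma distr_of_eq_inner: "distr_of \<Omega> u \<phi> = inner_L2 \<Omega> u (\<lambda>x. cnj (\<phi> x))"
  by (simp add: distr_of_def inner_L2_def)

lemma distr_of_lincomb:
  assumes "u \<in> L2 \<Omega>" "f \<in> L2 \<Omega>" "g \<in> L2 \<Omega>"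
  shows "distr_of \<Omega> u f + c * distr_of \<Omega> u g = distr_of \<Omega> u (\<lambda>x. f x + c * g x)"
proof -
  have "(\<lambda>x. u x * (f x + c * g x)) = (\<lambda>x. u x * f x + c * (u x * g x))"
    by (simp add: fun_eq_iff algebra_simps)
  then show ?thesis
    using assms by (simp add: distr_of_def L2_product_integrable)
qed

lemma distr_of_cong: "(\<And>x. \<phi> x = \<psi> x) \<Longrightarrow> distr_of \<Omega> u \<phi> = distr_of \<Omega> u \<psi>"
  by (metis ext)

text \<open>All derivatives are moved onto the test function. As the pairing is bilinear, the
  transpose of the operator appears: its first-order term has the opposite sign to that in
  \<open>mlaplacian_eq\<close>, and conjugating the test function reconciles the two.\<close>

lemma magnetic_operator_distr_of:
  assumes \<Omega>: "open \<Omega>" and u: "u \<in> L2 \<Omega>" and \<phi>: "\<phi> \<in> test_functions \<Omega>"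
  shows "magnetic_operator B (distr_of \<Omega> u) \<phi> = distr_of \<Omega> u (\<lambda>x.
     - (partial_deriv 1 (partial_deriv 1 \<phi>) x + partial_deriv 2 (partial_deriv 2 \<phi>) x)
     + 2 * \<i> * of_real B * of_real (x $ 2) * partial_deriv 1 \<phi> x
     + ((of_real B)\<^sup>2 * (of_real (x $ 2))\<^sup>2 - of_real B) * \<phi> x)"
proof -
  let ?T = "distr_of \<Omega> u"
  define A where "A = (\<lambda>x::real^2. complex_of_real (- B * x $ 2))"
  have A: "smooth A"
  proof -
    have "smooth (\<lambda>x. of_real (- B) * of_real (x $ 2))" by (intro smooth_intros)
    then show ?thesis by (simp add: A_def)
  qed
  have vp: "complex_of_real (vector_potential B x $ 1) = A x" "complex_of_real (vector_potential B x $ 2) = 0" for x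
    by (simp_all add: vector_potential_def A_def)
  note s = test_smooth[OF \<phi>]
  have t: "(\<lambda>x. A x * f x) \<in> test_functions \<Omega>" if "f \<in> test_functions \<Omega>" for f by (rule test_mult[OF that A])
  have L: "f \<in> test_functions \<Omega> \<Longrightarrow> f \<in> L2 \<Omega>" for f by (rule test_L2[OF \<Omega>])
  have T0: "?T (\<lambda>x. 0) = 0" by (simp add: distr_of_def)
  have c2: "covariant_deriv B 2 S \<psi> = - S (partial_deriv 2 \<psi>) - \<i> * S (\<lambda>x. 0)" for S \<psi>
    by (simp add: covariant_deriv_def distr_deriv_def distr_mult_def vp)
  have c1: "covariant_deriv B 1 S \<psi> = - S (partial_deriv 1 \<psi>) - \<i> * S (\<lambda>x. A x * \<psi> x)" for S \<psi>
    by (simp add: covariant_deriv_def distr_deriv_def distr_mult_def vp)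
  have pz: "partial_deriv j (\<lambda>x. 0) = (\<lambda>x. 0)" for j
    using partial_deriv_eq[OF has_derivative_const] by (auto simp: fun_eq_iff)
  have 2: "covariant_deriv B 2 (covariant_deriv B 2 ?T) \<phi> = ?T (partial_deriv 2 (partial_deriv 2 \<phi>))"
    by (simp add: c2 T0 pz)
  have 1: "covariant_deriv B 1 (covariant_deriv B 1 ?T) \<phi> = ?T (partial_deriv 1 (partial_deriv 1 \<phi>)) +
      \<i> * ?T (\<lambda>x. A x * partial_deriv 1 \<phi> x) + \<i> * ?T (partial_deriv 1 (\<lambda>x. A x * \<phi> x)) +
      (-1) * ?T (\<lambda>x. A x * (A x * \<phi> x))"
    by (simp add: c1 algebra_simps)
  have "magnetic_operator B ?T \<phi> = (-1) * (?T (partial_deriv 1 (partial_deriv 1 \<phi>)) +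
      \<i> * ?T (\<lambda>x. A x * partial_deriv 1 \<phi> x) + \<i> * ?T (partial_deriv 1 (\<lambda>x. A x * \<phi> x)) +
      (-1) * ?T (\<lambda>x. A x * (A x * \<phi> x)) + 1 * ?T (partial_deriv 2 (partial_deriv 2 \<phi>)) + of_real B * ?T \<phi>)"
    unfolding magnetic_operator_def sum_2 1 2 by simp
  also have "\<dots> = 0 + (-1) * ?T (\<lambda>x. partial_deriv 1 (partial_deriv 1 \<phi>) x +
      \<i> * (A x * partial_deriv 1 \<phi> x) + \<i> * partial_deriv 1 (\<lambda>x. A x * \<phi> x) x +
      (-1) * (A x * (A x * \<phi> x)) + 1 * partial_deriv 2 (partial_deriv 2 \<phi>) x + of_real B * \<phi> x)"
    by (subst distr_of_lincomb[OF u], (intro L test_add test_scale test_partial t \<phi>; fail)+)+ simp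
  also have "0 = ?T (\<lambda>x. 0)" by (simp add: T0)
  also have "?T (\<lambda>x. 0) + (-1) * ?T (\<lambda>x. partial_deriv 1 (partial_deriv 1 \<phi>) x +
      \<i> * (A x * partial_deriv 1 \<phi> x) + \<i> * partial_deriv 1 (\<lambda>x. A x * \<phi> x) x +
      (-1) * (A x * (A x * \<phi> x)) + 1 * partial_deriv 2 (partial_deriv 2 \<phi>) x + of_real B * \<phi> x) =
      ?T (\<lambda>x. 0 + (-1) * (partial_deriv 1 (partial_deriv 1 \<phi>) x +
      \<i> * (A x * partial_deriv 1 \<phi> x) + \<i> * partial_deriv 1 (\<lambda>x. A x * \<phi> x) x +
      (-1) * (A x * (A x * \<phi> x)) + 1 * partial_deriv 2 (partial_deriv 2 \<phi>) x + of_real B * \<phi> x))"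
    by (rule distr_of_lincomb[OF u]) (intro L test_add test_scale test_partial t \<phi> test_zero)+
  also have "\<dots> = ?T (\<lambda>x.
     - (partial_deriv 1 (partial_deriv 1 \<phi>) x + partial_deriv 2 (partial_deriv 2 \<phi>) x)
     + 2 * \<i> * of_real B * of_real (x $ 2) * partial_deriv 1 \<phi> x
     + ((of_real B)\<^sup>2 * (of_real (x $ 2))\<^sup>2 - of_real B) * \<phi> x)"
  proof (rule distr_of_cong)
    fix x
    have Aeq: "A = (\<lambda>x. of_real (- B) * of_real (x $ 2))" by (simp add: A_def)
    have "partial_deriv 1 A x = 0"
      unfolding Aeq by (subst partial_deriv_scale) (simp_all add: partial_deriv_coord)
    then have d: "partial_deriv 1 (\<lambda>x. A x * \<phi> x) x = A x * partial_deriv 1 \<phi> x"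
      using A s by (simp add: partial_deriv_mult smooth_differentiable)
    show "0 + (-1) * (partial_deriv 1 (partial_deriv 1 \<phi>) x +
      \<i> * (A x * partial_deriv 1 \<phi> x) + \<i> * partial_deriv 1 (\<lambda>x. A x * \<phi> x) x +
      (-1) * (A x * (A x * \<phi> x)) + 1 * partial_deriv 2 (partial_deriv 2 \<phi>) x + of_real B * \<phi> x) =
      - (partial_deriv 1 (partial_deriv 1 \<phi>) x + partial_deriv 2 (partial_deriv 2 \<phi>) x)
     + 2 * \<i> * of_real B * of_real (x $ 2) * partial_deriv 1 \<phi> x
     + ((of_real B)\<^sup>2 * (of_real (x $ 2))\<^sup>2 - of_real B) * \<phi> x"
      unfolding d by (simp add: A_def power2_eq_square algebra_simps)
  qed
  finally show ?thesis .
qed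

text \<open>The term with \<open>- of_real B\<close> arises when the second derivative falls on the
  coefficient \<open>b\<close>: the two parts of the first-order operator do not commute.\<close>

lemma mlaplacian_eq:
  assumes s: "smooth \<zeta>"
  shows "mlaplacian B \<zeta> x = - (partial_deriv 1 (partial_deriv 1 \<zeta>) x + partial_deriv 2 (partial_deriv 2 \<zeta>) x)
     - 2 * \<i> * of_real B * of_real (x $ 2) * partial_deriv 1 \<zeta> x
     + ((of_real B)\<^sup>2 * (of_real (x $ 2))\<^sup>2 - of_real B) * \<zeta> x"
proof -
  note sp = smooth_partial[OF s] smooth_partial[OF smooth_partial[OF s]]
  define b where "b = (\<lambda>x::real^2. \<i> * of_real B * complex_of_real (x $ 2))"
  have b: "smooth b" unfolding b_def by (intro smooth_intros)
  have db: "partial_deriv 1 b x = 0" "partial_deriv 2 b x = \<i> * of_real B"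
    unfolding b_def by (simp_all add: partial_deriv_scale partial_deriv_coord)
  have eq: "mdbar B \<zeta> = (\<lambda>x. partial_deriv 1 \<zeta> x + \<i> * partial_deriv 2 \<zeta> x + b x * \<zeta> x)"
    by (simp add: mdbar_def b_def)
  have d: "partial_deriv j (mdbar B \<zeta>) x = partial_deriv j (partial_deriv 1 \<zeta>) x + \<i> * partial_deriv j (partial_deriv 2 \<zeta>) x
      + (partial_deriv j b x * \<zeta> x + b x * partial_deriv j \<zeta> x)" for j
  proof -
    have "smooth (\<lambda>x. \<i> * partial_deriv 2 \<zeta> x)" "smooth (\<lambda>x. b x * \<zeta> x)"
      "smooth (\<lambda>x. partial_deriv 1 \<zeta> x + \<i> * partial_deriv 2 \<zeta> x)"
      by (intro smooth_intros s b)+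
    then show ?thesis unfolding eq
      using sp b s by (simp add: partial_deriv_add partial_deriv_mult partial_deriv_scale smooth_differentiable)
  qed
  show ?thesis
    unfolding mlaplacian_def d db by (simp add: eq b_def partial_deriv_commute[OF s] power2_eq_square algebra_simps)
qed

lemma magnetic_operator_weak:
  assumes \<Omega>: "open \<Omega>" and u: "u \<in> L2 \<Omega>" and \<phi>: "\<phi> \<in> test_functions \<Omega>"
  shows "magnetic_operator B (distr_of \<Omega> u) \<phi> = inner_L2 \<Omega> u (mlaplacian B (\<lambda>x. cnj (\<phi> x)))"
proof -
  note s = test_smooth[OF \<phi>]
  have "cnj (mlaplacian B (\<lambda>x. cnj (\<phi> x)) x) =
     - (partial_deriv 1 (partial_deriv 1 \<phi>) x + partial_deriv 2 (partial_deriv 2 \<phi>) x)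
     + 2 * \<i> * of_real B * of_real (x $ 2) * partial_deriv 1 \<phi> x
     + ((of_real B)\<^sup>2 * (of_real (x $ 2))\<^sup>2 - of_real B) * \<phi> x" for x
    by (simp add: mlaplacian_eq[OF smooth_cnj[OF s]] partial_deriv_cnj s smooth_partial)
  then show ?thesis
    unfolding magnetic_operator_distr_of[OF assms] by (simp add: distr_of_def inner_L2_def)
qed

lemma L2_q_mult_tendsto:
  assumes b: "bounded \<Omega>" and f: "\<And>k::nat. f k \<in> L2 \<Omega>" "(\<lambda>k. L2.q \<Omega> (f k)) \<longlonglongrightarrow> 0"
  shows "(\<lambda>k. L2.q \<Omega> (\<lambda>x. \<i> * of_real B * of_real (x $ 2) * f k x)) \<longlonglongrightarrow> 0"
proof -
  obtain C where C: "C > 0" "\<And>u. u \<in> L2 \<Omega> \<Longrightarrow> (\<lambda>x. \<i> * of_real B * of_real (x $ 2) * u x) \<in> L2 \<Omega> \<and>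
    L2.q \<Omega> (\<lambda>x. \<i> * of_real B * of_real (x $ 2) * u x) \<le> C * L2.q \<Omega> u"
    using x2_bound[OF b, of B] by blast
  have "(\<lambda>k. C * L2.q \<Omega> (f k)) \<longlonglongrightarrow> C * 0" by (intro tendsto_intros f)
  then show ?thesis
    by (intro tendsto_sandwich[OF _ _ tendsto_const, of 0 "\<lambda>k. L2.q \<Omega> (\<lambda>x. \<i> * of_real B * of_real (x $ 2) * f k x)" sequentially "\<lambda>k. C * L2.q \<Omega> (f k)"] always_eventually)
       (use C f L2.q_nonneg in auto)
qed

lemma graph_weak_identity:
  assumes \<Omega>: "open \<Omega>" and p: "p \<in> magnetic_graph \<Omega> B" and \<zeta>: "\<zeta> \<in> test_functions \<Omega>"
  shows "inner_L2 \<Omega> (snd p) (mdbar B \<zeta>) = inner_L2 \<Omega> (fst p) (mlaplacian B \<zeta>)"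
proof -
  obtain \<phi> where \<phi>: "fst p \<in> L2 \<Omega>" "snd p \<in> L2 \<Omega>" "\<And>k::nat. \<phi> k \<in> test_functions \<Omega>"
    "(\<lambda>k. L2.q \<Omega> (\<phi> k - fst p)) \<longlonglongrightarrow> 0" "(\<lambda>k. L2.q \<Omega> (mdbar B (\<phi> k) - snd p)) \<longlonglongrightarrow> 0"
    using magnetic_graphE[OF p] by blast
  note t = test_L2[OF \<Omega>] test_mdbar test_mlaplacian
  have "(\<lambda>k. inner_L2 \<Omega> (mdbar B (\<phi> k)) (mdbar B \<zeta>)) \<longlonglongrightarrow> inner_L2 \<Omega> (snd p) (mdbar B \<zeta>)"
    by (rule L2.form_tendsto[OF _ \<phi>(2,5)]) (auto intro: t \<phi> \<zeta>)
  moreover have "(\<lambda>k. inner_L2 \<Omega> (\<phi> k) (mlaplacian B \<zeta>)) \<longlonglongrightarrow> inner_L2 \<Omega> (fst p) (mlaplacian B \<zeta>)"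
    by (rule L2.form_tendsto[OF _ \<phi>(1,4)]) (auto intro: t \<phi> \<zeta>)
  moreover have "inner_L2 \<Omega> (mdbar B (\<phi> k)) (mdbar B \<zeta>) = inner_L2 \<Omega> (\<phi> k) (mlaplacian B \<zeta>)" for k
    by (rule mdbar_adjoint[OF \<Omega> \<phi>(3) test_smooth[OF \<zeta>]])
  ultimately show ?thesis by (rule limits_eq)
qed

text \<open>Test functions are dense in the graph by its definition, and both sides are continuous
  in \<open>r\<close> for the graph norm.\<close>

lemma graph_eigen_extend:
  assumes \<Omega>: "open \<Omega>" and p: "p \<in> magnetic_graph \<Omega> B"
    and eq: "\<And>\<zeta>. \<zeta> \<in> test_functions \<Omega> \<Longrightarrow> inner_L2 \<Omega> (snd p) (mdbar B \<zeta>) = \<mu> * inner_L2 \<Omega> (fst p) \<zeta>"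
    and r: "r \<in> magnetic_graph \<Omega> B"
  shows "inner_L2 \<Omega> (snd p) (snd r) = \<mu> * inner_L2 \<Omega> (fst p) (fst r)"
proof -
  obtain \<phi> where \<phi>: "fst r \<in> L2 \<Omega>" "snd r \<in> L2 \<Omega>" "\<And>k::nat. \<phi> k \<in> test_functions \<Omega>"
    "(\<lambda>k. L2.q \<Omega> (\<phi> k - fst r)) \<longlonglongrightarrow> 0" "(\<lambda>k. L2.q \<Omega> (mdbar B (\<phi> k) - snd r)) \<longlonglongrightarrow> 0"
    using magnetic_graphE[OF r] by blast
  have pL: "fst p \<in> L2 \<Omega>" "snd p \<in> L2 \<Omega>" using p by (auto simp: magnetic_graph_def)
  note t = test_L2[OF \<Omega>] test_mdbar
  have lim: "(\<lambda>k. inner_L2 \<Omega> v (f k)) \<longlonglongrightarrow> inner_L2 \<Omega> v g"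
    if "\<And>k. f k \<in> L2 \<Omega>" "g \<in> L2 \<Omega>" "(\<lambda>k. L2.q \<Omega> (f k - g)) \<longlonglongrightarrow> 0" "v \<in> L2 \<Omega>" for f g v
    using tendsto_cnj[OF L2.form_tendsto[OF that]]
    unfolding L2.cnj_swap[OF that(1) that(4), symmetric] L2.cnj_swap[OF that(2) that(4), symmetric] .
  have "(\<lambda>k. inner_L2 \<Omega> (snd p) (mdbar B (\<phi> k))) \<longlonglongrightarrow> inner_L2 \<Omega> (snd p) (snd r)"
    by (rule lim[OF _ \<phi>(2,5) pL(2)]) (auto intro: t \<phi>)
  moreover have "(\<lambda>k. \<mu> * inner_L2 \<Omega> (fst p) (\<phi> k)) \<longlonglongrightarrow> \<mu> * inner_L2 \<Omega> (fst p) (fst r)"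
    by (intro tendsto_intros lim[OF _ \<phi>(1,4) pL(1)]) (auto intro: t \<phi>)
  ultimately show ?thesis using eq[OF \<phi>(3)] by (rule limits_eq)
qed

definition graph_eigenvector :: "(real^2) set \<Rightarrow> real \<Rightarrow> real \<Rightarrow> (real^2 \<Rightarrow> complex) \<times> (real^2 \<Rightarrow> complex) \<Rightarrow> bool" where
  "graph_eigenvector \<Omega> B \<mu> p \<longleftrightarrow> p \<in> magnetic_graph \<Omega> B \<and>
    (\<forall>r\<in>magnetic_graph \<Omega> B. inner_L2 \<Omega> (snd p) (snd r) = of_real \<mu> * inner_L2 \<Omega> (fst p) (fst r))"

text \<open>Because \<open>x2\<close> is bounded, the test functions that approximate
  \<open>u\<close> and its gradient also make \<open>mdbar B\<close> converge. The second component
  has to be \<open>g 1 + \<i> g 2 + \<i> B x2 u\<close>.\<close>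

lemma eigenspace_imp_graph_eigenvector:
  assumes \<Omega>: "open \<Omega>" "bounded \<Omega>" and u: "u \<in> magnetic_eigenspace \<Omega> B \<mu>"
  shows "\<exists>w. graph_eigenvector \<Omega> B \<mu> (u, w)"
proof -
  have uL: "u \<in> L2 \<Omega>" and eq: "distr_eq \<Omega> (magnetic_operator B (distr_of \<Omega> u)) (distr_of \<Omega> (\<lambda>x. of_real \<mu> * u x))"
    using u by (auto simp: magnetic_eigenspace_def magnetic_domain_def H1_0_def)
  obtain g \<phi> where g: "\<And>j. g j \<in> L2 \<Omega>" and \<phi>: "\<And>k::nat. \<phi> k \<in> test_functions \<Omega>"
    "(\<lambda>k. L2_norm \<Omega> (\<lambda>x. \<phi> k x - u x)) \<longlonglongrightarrow> 0"
    "\<And>j. (\<lambda>k. L2_norm \<Omega> (\<lambda>x. partial_deriv j (\<phi> k) x - g j x)) \<longlonglongrightarrow> 0"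
    using u by (auto simp: magnetic_eigenspace_def magnetic_domain_def H1_0_def)
  have \<phi>0: "(\<lambda>k. L2.q \<Omega> (\<phi> k - u)) \<longlonglongrightarrow> 0" and \<phi>1: "(\<lambda>k. L2.q \<Omega> (partial_deriv j (\<phi> k) - g j)) \<longlonglongrightarrow> 0" for j
    using \<phi>(2,3)[unfolded L2_norm_tendsto_iff] by (simp_all add: fun_diff_def)
  define b where "b f = (\<lambda>x. \<i> * of_real B * of_real (x $ 2) * f x)" for f :: "real^2 \<Rightarrow> complex"
  have bL: "b f \<in> L2 \<Omega>" if "f \<in> L2 \<Omega>" for f using x2_bound[OF \<Omega>(2), of B] that unfolding b_def by blast
  define w where "w = (g 1 + cscale \<i> (g 2)) + b u"
  have wL: "w \<in> L2 \<Omega>" unfolding w_def by (intro L2.add_in L2.scale_in g bL uL)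
  note t = test_L2[OF \<Omega>(1) \<phi>(1)] test_L2[OF \<Omega>(1) test_partial[OF \<phi>(1)]]
  have "(\<lambda>k. L2.q \<Omega> (((partial_deriv 1 (\<phi> k) - g 1) + cscale \<i> (partial_deriv 2 (\<phi> k) - g 2)) + b (\<phi> k - u))) \<longlonglongrightarrow> 0"
  proof (intro L2_q_add_tendsto L2_q_scale_tendsto \<phi>1)
    show "(\<lambda>k. L2.q \<Omega> (b (\<phi> k - u))) \<longlonglongrightarrow> 0"
      unfolding b_def by (rule L2_q_mult_tendsto[OF \<Omega>(2) _ \<phi>0]) (intro L2.diff_in t uL)
  qed (intro L2.add_in L2.scale_in L2.diff_in t g uL bL)+
  moreover have "((partial_deriv 1 (\<phi> k) - g 1) + cscale \<i> (partial_deriv 2 (\<phi> k) - g 2)) + b (\<phi> k - u) = mdbar B (\<phi> k) - w" for k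
    by (simp add: fun_eq_iff w_def b_def cscale_def mdbar_def algebra_simps)
  ultimately have G: "(u, w) \<in> magnetic_graph \<Omega> B"
    using uL wL \<phi>(1) \<phi>0 by (auto simp: magnetic_graph_def intro!: exI[of _ \<phi>])
  have "inner_L2 \<Omega> (snd (u, w)) (mdbar B \<zeta>) = of_real \<mu> * inner_L2 \<Omega> (fst (u, w)) \<zeta>" if \<zeta>: "\<zeta> \<in> test_functions \<Omega>" for \<zeta>
  proof -
    have "inner_L2 \<Omega> w (mdbar B \<zeta>) = inner_L2 \<Omega> u (mlaplacian B \<zeta>)"
      using graph_weak_identity[OF \<Omega>(1) G \<zeta>] by simp
    also have "\<dots> = magnetic_operator B (distr_of \<Omega> u) (\<lambda>x. cnj (\<zeta> x))"
      using magnetic_operator_weak[OF \<Omega>(1) uL test_cnj[OF \<zeta>]] by simp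
    also have "\<dots> = distr_of \<Omega> (\<lambda>x. of_real \<mu> * u x) (\<lambda>x. cnj (\<zeta> x))"
      using eq test_cnj[OF \<zeta>] by (auto simp: distr_eq_def)
    also have "\<dots> = of_real \<mu> * inner_L2 \<Omega> u \<zeta>"
      by (simp add: distr_of_def inner_L2_def mult.assoc)
    finally show ?thesis by simp
  qed
  from graph_eigen_extend[OF \<Omega>(1) G this] show ?thesis using G unfolding graph_eigenvector_def by blast
qed

text \<open>Two things have to be recovered from the graph: both weak partial derivatives, although
  only their combination in \<open>mdbar B\<close> is controlled, and a Laplacian in
  \<open>L2\<close>. The first follows from \<open>dbar_square_le\<close> for differences of the
  approximating test functions, the second from the eigenvalue equation.\<close>

lemma graph_eigenvector_imp_eigenspace:
  assumes \<Omega>: "open \<Omega>" "bounded \<Omega>" and p: "graph_eigenvector \<Omega> B \<mu> p"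
  shows "fst p \<in> magnetic_eigenspace \<Omega> B \<mu>"
proof -
  define u where "u = fst p"
  define w where "w = snd p"
  have G: "p \<in> magnetic_graph \<Omega> B" and eig: "\<And>r. r \<in> magnetic_graph \<Omega> B \<Longrightarrow> inner_L2 \<Omega> w (snd r) = of_real \<mu> * inner_L2 \<Omega> u (fst r)"
    using p by (auto simp: graph_eigenvector_def u_def w_def)
  obtain \<phi> where uL: "u \<in> L2 \<Omega>" and wL: "w \<in> L2 \<Omega>" and \<phi>: "\<And>k::nat. \<phi> k \<in> test_functions \<Omega>"
    and \<phi>0: "(\<lambda>k. L2.q \<Omega> (\<phi> k - u)) \<longlonglongrightarrow> 0" and \<phi>w: "(\<lambda>k. L2.q \<Omega> (mdbar B (\<phi> k) - w)) \<longlonglongrightarrow> 0"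
    using magnetic_graphE[OF G] unfolding u_def w_def by blast
  obtain C where C: "C > 0" "\<And>u. u \<in> L2 \<Omega> \<Longrightarrow> (\<lambda>x. \<i> * of_real B * of_real (x $ 2) * u x) \<in> L2 \<Omega> \<and>
    L2.q \<Omega> (\<lambda>x. \<i> * of_real B * of_real (x $ 2) * u x) \<le> C * L2.q \<Omega> u"
    using x2_bound[OF \<Omega>(2), of B] by blast
  note t = test_L2[OF \<Omega>(1) \<phi>] test_L2[OF \<Omega>(1) test_partial[OF \<phi>]] test_L2[OF \<Omega>(1) test_mdbar[OF \<phi>]]
  have Cauchy: "\<exists>N. \<forall>m\<ge>N. \<forall>n\<ge>N. L2.q \<Omega> (f m - f n) < e"
    if f: "\<And>k. f k \<in> L2 \<Omega>" "l \<in> L2 \<Omega>" "(\<lambda>k. L2.q \<Omega> (f k - l)) \<longlonglongrightarrow> 0" and e: "e > 0" for f :: "nat \<Rightarrow> _" and l e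
  proof -
    obtain N where N: "\<And>n. n \<ge> N \<Longrightarrow> L2.q \<Omega> (f n - l) < e / 4"
      using order_tendstoD(2)[OF f(3), of "e / 4"] e by (auto simp: eventually_sequentially)
    have "L2.q \<Omega> (f m - f n) < e" if "m \<ge> N" "n \<ge> N" for m n
    proof -
      have "L2.q \<Omega> ((f m - l) + (l - f n)) \<le> 2 * L2.q \<Omega> (f m - l) + 2 * L2.q \<Omega> (l - f n)"
        by (intro L2.q_add_le L2.diff_in f)
      then show ?thesis using N[OF that(1)] N[OF that(2)] L2.q_minus[OF f(1)[of n] f(2)] by simp
    qed
    then show ?thesis by blast
  qed
  have "\<exists>v\<in>L2 \<Omega>. (\<lambda>k. L2.q \<Omega> (partial_deriv j (\<phi> k) - v)) \<longlonglongrightarrow> 0" for j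
  proof (rule L2_complete[OF t(2)])
    fix e :: real assume e: "e > 0"
    define e' where "e' = e / (4 + 4 * C)"
    have "4 + 4 * C > 0" using C(1) by simp
    then have "e' * (4 + 4 * C) = e" "e' > 0" using e by (simp_all add: e'_def)
    then have e': "e' > 0" "2 * e' + 2 * C * e' < e" using e by (simp_all add: algebra_simps)
    obtain N1 where N1: "\<And>m n. m \<ge> N1 \<Longrightarrow> n \<ge> N1 \<Longrightarrow> L2.q \<Omega> (\<phi> m - \<phi> n) < e'"
      using Cauchy[OF t(1) uL \<phi>0 e'(1)] by blast
    obtain N2 where N2: "\<And>m n. m \<ge> N2 \<Longrightarrow> n \<ge> N2 \<Longrightarrow> L2.q \<Omega> (mdbar B (\<phi> m) - mdbar B (\<phi> n)) < e'"
      using Cauchy[OF t(3) wL \<phi>w e'(1)] by blast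
    have "L2.q \<Omega> (partial_deriv j (\<phi> m) - partial_deriv j (\<phi> n)) < e" if "m \<ge> max N1 N2" "n \<ge> max N1 N2" for m n
    proof -
      have d: "\<phi> m - \<phi> n \<in> test_functions \<Omega>" by (rule test_ops(2)[OF \<phi> \<phi>])
      have pd: "partial_deriv i (\<phi> m - \<phi> n) = partial_deriv i (\<phi> m) - partial_deriv i (\<phi> n)" for i
        using partial_deriv_diff[OF test_smooth[OF \<phi>] test_smooth[OF \<phi>]] by (simp add: fun_diff_def)
      have "L2.q \<Omega> (partial_deriv 1 (\<phi> m - \<phi> n)) + L2.q \<Omega> (partial_deriv 2 (\<phi> m - \<phi> n)) \<le>
          2 * L2.q \<Omega> (mdbar B (\<phi> m - \<phi> n)) + 2 * C * L2.q \<Omega> (\<phi> m - \<phi> n)"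
        by (rule dbar_square_le[OF \<Omega>(1) C(1) _ d]) (use C(2) in blast)
      also have "\<dots> \<le> 2 * e' + 2 * C * e'"
        unfolding mdbar_ops(2)[OF test_smooth[OF \<phi>] test_smooth[OF \<phi>]]
        using N1[of m n] N2[of m n] that C(1) by (intro add_mono mult_left_mono) auto
      finally have le: "L2.q \<Omega> (partial_deriv 1 (\<phi> m - \<phi> n)) + L2.q \<Omega> (partial_deriv 2 (\<phi> m - \<phi> n)) < e"
        using e'(2) by linarith
      have nn: "L2.q \<Omega> (partial_deriv i (\<phi> m - \<phi> n)) \<ge> 0" for i
        by (rule L2.q_nonneg[OF test_L2[OF \<Omega>(1) test_partial[OF d]]])
      show ?thesis using le nn[of 1] nn[of 2] exhaust_2[of j] unfolding pd[symmetric] by auto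
    qed
    then show "\<exists>N. \<forall>m\<ge>N. \<forall>n\<ge>N. L2.q \<Omega> (partial_deriv j (\<phi> m) - partial_deriv j (\<phi> n)) < e" by blast
  qed
  then obtain g where gL: "\<And>j. g j \<in> L2 \<Omega>" and g: "\<And>j. (\<lambda>k. L2.q \<Omega> (partial_deriv j (\<phi> k) - g j)) \<longlonglongrightarrow> 0"
    by metis
  have wg: "distr_of \<Omega> u (partial_deriv j \<psi>) = - distr_of \<Omega> (g j) \<psi>" if \<psi>: "\<psi> \<in> test_functions \<Omega>" for j \<psi>
  proof -
    have "(\<lambda>k. inner_L2 \<Omega> (\<phi> k) (\<lambda>x. cnj (partial_deriv j \<psi> x))) \<longlonglongrightarrow> inner_L2 \<Omega> u (\<lambda>x. cnj (partial_deriv j \<psi> x))"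
      by (rule L2.form_tendsto[OF t(1) uL \<phi>0 test_L2[OF \<Omega>(1) test_cnj[OF test_partial[OF \<psi>]]]])
    moreover have "(\<lambda>k. - inner_L2 \<Omega> (partial_deriv j (\<phi> k)) (\<lambda>x. cnj (\<psi> x))) \<longlonglongrightarrow> - inner_L2 \<Omega> (g j) (\<lambda>x. cnj (\<psi> x))"
      by (intro tendsto_minus L2.form_tendsto[OF t(2) gL g test_L2[OF \<Omega>(1) test_cnj[OF \<psi>]]])
    moreover have "inner_L2 \<Omega> (\<phi> k) (\<lambda>x. cnj (partial_deriv j \<psi> x)) = - inner_L2 \<Omega> (partial_deriv j (\<phi> k)) (\<lambda>x. cnj (\<psi> x))" for k
      using integration_by_parts[OF \<phi> test_smooth[OF \<psi>], of j k]
      by (simp add: inner_L2_test[OF \<Omega>(1) \<phi> test_smooth[OF test_cnj[OF test_partial[OF \<psi>]]]]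
          inner_L2_test[OF \<Omega>(1) test_partial[OF \<phi>] test_smooth[OF test_cnj[OF \<psi>]]])
    ultimately show ?thesis unfolding distr_of_eq_inner by (rule limits_eq)
  qed
  have H1: "u \<in> H1_0 \<Omega>"
    unfolding H1_0_def
  proof (intro CollectI conjI uL exI[of _ g] exI[of _ \<phi>] allI gL \<phi>)
    show "weak_gradient \<Omega> u g"
      by (auto simp: weak_gradient_def distr_eq_def distr_deriv_def wg)
    show "(\<lambda>k. L2_norm \<Omega> (\<lambda>x. \<phi> k x - u x)) \<longlonglongrightarrow> 0"
      unfolding L2_norm_tendsto_iff using \<phi>0 by (simp add: fun_diff_def)
    show "(\<lambda>k. L2_norm \<Omega> (\<lambda>x. partial_deriv j (\<phi> k) x - g j x)) \<longlonglongrightarrow> 0" for j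
      unfolding L2_norm_tendsto_iff using g[of j] by (simp add: fun_diff_def)
  qed
  have op: "magnetic_operator B (distr_of \<Omega> u) \<psi> = distr_of \<Omega> (\<lambda>x. of_real \<mu> * u x) \<psi>" if \<psi>: "\<psi> \<in> test_functions \<Omega>" for \<psi>
  proof -
    have "magnetic_operator B (distr_of \<Omega> u) \<psi> = inner_L2 \<Omega> u (mlaplacian B (\<lambda>x. cnj (\<psi> x)))"
      by (rule magnetic_operator_weak[OF \<Omega>(1) uL \<psi>])
    also have "\<dots> = inner_L2 \<Omega> w (mdbar B (\<lambda>x. cnj (\<psi> x)))"
      using graph_weak_identity[OF \<Omega>(1) G test_cnj[OF \<psi>]] by (simp add: u_def w_def)
    also have "\<dots> = of_real \<mu> * inner_L2 \<Omega> u (\<lambda>x. cnj (\<psi> x))"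
      using eig[OF test_in_graph[OF \<Omega>(1) test_cnj[OF \<psi>]]] by simp
    also have "\<dots> = distr_of \<Omega> (\<lambda>x. of_real \<mu> * u x) \<psi>"
      by (simp add: distr_of_def inner_L2_def mult.assoc)
    finally show ?thesis .
  qed
  \<comment> \<open>The eigenvalue equation solved for the Laplacian of \<open>u\<close>, with
    \<open>g 1\<close> in place of its first partial derivative.\<close>
  define v where "v = (\<lambda>x. - 2 * (\<i> * of_real B * of_real (x $ 2) * g 1 x) + ((of_real B)\<^sup>2 * (of_real (x $ 2))\<^sup>2 - of_real B - of_real \<mu>) * u x)"
  obtain R where R: "R > 0" "\<And>x. x \<in> \<Omega> \<Longrightarrow> norm x \<le> R" using \<Omega>(2) bounded_pos by blast
  have "(\<lambda>x. ((of_real B)\<^sup>2 * (of_real (x $ 2))\<^sup>2 - of_real B - of_real \<mu>) * u x) \<in> L2 \<Omega>"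
  proof (rule L2_bounded_mult[OF uL, where C = "B\<^sup>2 * R\<^sup>2 + \<bar>B\<bar> + \<bar>\<mu>\<bar>"])
    show "(\<lambda>x::real^2. (complex_of_real B)\<^sup>2 * (of_real (x $ 2))\<^sup>2 - of_real B - of_real \<mu>) \<in> borel_measurable (lebesgue_on \<Omega>)"
      by (intro lebesgue_on_measurable smooth_borel smooth_intros)
    fix x :: "real^2" assume "x \<in> \<Omega>"
    then have "\<bar>x $ 2\<bar> \<le> R" using R(2) component_le_norm_cart order_trans by blast
    then have "(x $ 2)\<^sup>2 \<le> R\<^sup>2" using abs_le_square_iff[of "x $ 2" R] R(1) by simp
    then have x: "B\<^sup>2 * (x $ 2)\<^sup>2 \<le> B\<^sup>2 * R\<^sup>2" by (intro mult_left_mono) auto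
    have "cmod ((complex_of_real B)\<^sup>2 * (of_real (x $ 2))\<^sup>2 - of_real B - of_real \<mu>) = \<bar>B\<^sup>2 * (x $ 2)\<^sup>2 - B - \<mu>\<bar>"
      by (metis norm_of_real of_real_diff of_real_mult of_real_power real_norm_def)
    also have "\<dots> \<le> B\<^sup>2 * R\<^sup>2 + \<bar>B\<bar> + \<bar>\<mu>\<bar>"
    proof -
      have "0 \<le> B\<^sup>2 * (x $ 2)\<^sup>2" by simp
      then show ?thesis using x by linarith
    qed
    finally show "cmod ((complex_of_real B)\<^sup>2 * (of_real (x $ 2))\<^sup>2 - of_real B - of_real \<mu>) \<le> B\<^sup>2 * R\<^sup>2 + \<bar>B\<bar> + \<bar>\<mu>\<bar>" .
  qed
  then have vL: "v \<in> L2 \<Omega>"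
    unfolding v_def using C(2)[OF gL[of 1]] by (intro L2_add L2_scale) auto
  have "distr_laplacian (distr_of \<Omega> u) \<psi> = distr_of \<Omega> v \<psi>" if \<psi>: "\<psi> \<in> test_functions \<Omega>" for \<psi>
  proof -
    note L = test_L2[OF \<Omega>(1)]
    let ?T = "distr_of \<Omega> u"
    define x2 where "x2 = (\<lambda>x::real^2. complex_of_real (x $ 2))"
    have x2: "smooth x2" unfolding x2_def by simp
    define c where "c = (\<lambda>x::real^2. (of_real B)\<^sup>2 * (x2 x)\<^sup>2 - of_real B)"
    have c: "smooth c" unfolding c_def by (intro smooth_intros x2)
    have lap: "distr_laplacian ?T \<psi> = ?T (partial_deriv 1 (partial_deriv 1 \<psi>)) + 1 * ?T (partial_deriv 2 (partial_deriv 2 \<psi>))"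
      by (simp add: distr_laplacian_def distr_deriv_def sum_2)
    have "partial_deriv 1 x2 x = 0" for x by (simp add: x2_def partial_deriv_coord)
    then have px: "partial_deriv 1 (\<lambda>x. x2 x * \<psi> x) = (\<lambda>x. x2 x * partial_deriv 1 \<psi> x)"
      using x2 \<psi> by (simp add: fun_eq_iff partial_deriv_mult test_smooth smooth_differentiable)
    have tp: "(\<lambda>x. x2 x * \<psi> x) \<in> test_functions \<Omega>" "(\<lambda>x. x2 x * partial_deriv 1 \<psi> x) \<in> test_functions \<Omega>"
      "(\<lambda>x. c x * \<psi> x) \<in> test_functions \<Omega>" by (intro test_mult test_partial \<psi> x2 c)+
    have "magnetic_operator B ?T \<psi> = ?T (\<lambda>x. ((c x * \<psi> x + (2 * \<i> * of_real B) * (x2 x * partial_deriv 1 \<psi> x))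
       + (-1) * partial_deriv 1 (partial_deriv 1 \<psi>) x) + (-1) * partial_deriv 2 (partial_deriv 2 \<psi>) x)"
      unfolding magnetic_operator_distr_of[OF \<Omega>(1) uL \<psi>]
      by (rule distr_of_cong) (simp add: c_def x2_def algebra_simps)
    also have "\<dots> = ?T (\<lambda>x. c x * \<psi> x) + (2 * \<i> * of_real B) * ?T (\<lambda>x. x2 x * partial_deriv 1 \<psi> x)
       + (-1) * ?T (partial_deriv 1 (partial_deriv 1 \<psi>)) + (-1) * ?T (partial_deriv 2 (partial_deriv 2 \<psi>))"
      by (subst distr_of_lincomb[OF uL], (intro L test_add test_scale test_partial tp \<psi>; fail)+)+ simp
    finally have "distr_laplacian ?T \<psi> = ?T (\<lambda>x. c x * \<psi> x) + (2 * \<i> * of_real B) * ?T (\<lambda>x. x2 x * partial_deriv 1 \<psi> x)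
       - distr_of \<Omega> (\<lambda>x. of_real \<mu> * u x) \<psi>"
      unfolding lap op[OF \<psi>] by (simp add: algebra_simps)
    also have "?T (\<lambda>x. x2 x * partial_deriv 1 \<psi> x) = - distr_of \<Omega> (g 1) (\<lambda>x. x2 x * \<psi> x)"
      using wg[OF tp(1), of 1] by (simp add: px)
    also have "?T (\<lambda>x. c x * \<psi> x) + (2 * \<i> * of_real B) * - distr_of \<Omega> (g 1) (\<lambda>x. x2 x * \<psi> x) - distr_of \<Omega> (\<lambda>x. of_real \<mu> * u x) \<psi>
       = distr_of \<Omega> v \<psi>"
    proof -
      have i: "integrable (lebesgue_on \<Omega>) (\<lambda>x. u x * (c x * \<psi> x))" "integrable (lebesgue_on \<Omega>) (\<lambda>x. g 1 x * (x2 x * \<psi> x))"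
        "integrable (lebesgue_on \<Omega>) (\<lambda>x. of_real \<mu> * u x * \<psi> x)"
        by (intro L2_product_integrable uL gL L L2_scale tp \<psi>)+
      have "(\<lambda>x. v x * \<psi> x) = (\<lambda>x. u x * (c x * \<psi> x) + (- (2 * \<i> * of_real B)) * (g 1 x * (x2 x * \<psi> x)) - of_real \<mu> * u x * \<psi> x)"
        by (simp add: fun_eq_iff v_def c_def x2_def algebra_simps)
      then show ?thesis
        unfolding distr_of_def using i by (simp del: mult_minus_left)
    qed
    finally show ?thesis .
  qed
  then have "u \<in> magnetic_domain \<Omega>"
    using H1 vL by (auto simp: magnetic_domain_def distr_eq_def)
  then show ?thesis
    using op by (auto simp: magnetic_eigenspace_def distr_eq_def u_def[symmetric])
qed

section \<open>Variational bounds for the eigenvalues\<close>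

text \<open>If \<open>l k < l' k\<close>, the value \<open>l k\<close> occurs in \<open>l'\<close>
  only at indices below \<open>k\<close>, where the sequences agree. In \<open>l\<close> it occurs
  at the same indices and once more at \<open>k\<close>, which contradicts the common
  multiplicity.\<close>

lemma eigenvalue_enumeration_le:
  assumes l: "eigenvalue_enumeration \<Omega> B l" and l': "eigenvalue_enumeration \<Omega> B l'"
    and eq: "\<And>i. i < k \<Longrightarrow> l i = l' i"
  shows "l' k \<le> l k"
proof (rule ccontr)
  assume "\<not> l' k \<le> l k"
  then have less: "l k < l' k" by simp
  define F where "F = {i. l' i = l k}"
  have sub: "F \<subseteq> {..<k}"
  proof
    fix i assume "i \<in> F"
    then have "l' i < l' k" using less by (simp add: F_def)
    then show "i \<in> {..<k}" using l' by (metis eigenvalue_enumeration_def lessThan_iff linorder_not_le monoD)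
  qed
  then have fin: "finite F" using finite_subset by blast
  have "insert k F \<subseteq> {i. l i = l k}" using sub eq by (auto simp: F_def)
  moreover have "k \<notin> F" using sub by blast
  then have "card (insert k F) = Suc (card F)" using fin by (rule card_insert_disjoint[rotated])
  ultimately have "\<exists>K. finite K \<and> card K = Suc (card F) \<and> (\<forall>i\<in>K. l i = l k)"
    using fin by (intro exI[of _ "insert k F"]) auto
  then have "multiplicity_at_least \<Omega> B (l k) (Suc (card F))"
    using l unfolding eigenvalue_enumeration_def by blast
  then obtain K where K: "finite K" "card K = Suc (card F)" "\<forall>i\<in>K. l' i = l k"
    using l' unfolding eigenvalue_enumeration_def by blast
  then have "card K \<le> card F" by (intro card_mono fin) (auto simp: F_def)
  then show False using K by simp
qed

lemma eigenvalue_enumeration_unique: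
  assumes "eigenvalue_enumeration \<Omega> B l" "eigenvalue_enumeration \<Omega> B l'"
  shows "l = l'"
proof
  fix k show "l k = l' k"
  proof (induction k rule: less_induct)
    case (less k)
    then show ?case
      using eigenvalue_enumeration_le[OF assms, of k] eigenvalue_enumeration_le[OF assms(2,1), of k] by fastforce
  qed
qed

lemma cscale_sum: "(\<Sum>i\<in>I. cscale (c i) (f i)) = (\<lambda>x. \<Sum>i\<in>I. c i * f i x)"
  by (simp add: fun_eq_iff sum_fun_apply2 cscale_def)

lemma mdbar_sum:
  assumes "\<And>i. i \<in> I \<Longrightarrow> smooth (f i)"
  shows "mdbar B (\<Sum>i\<in>I. cscale (c i) (f i)) = (\<Sum>i\<in>I. cscale (c i) (mdbar B (f i)))"
  using assms
proof (induction I rule: infinite_finite_induct)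
  case (insert i I)
  have 1: "smooth (cscale (c i) (f i))" unfolding cscale_def using insert by (intro smooth_intros) simp
  have 2: "smooth (\<Sum>i\<in>I. cscale (c i) (f i))" unfolding cscale_sum using insert by (intro smooth_intros) simp
  have 3: "smooth (f i)" using insert by simp
  have 4: "mdbar B (\<Sum>i\<in>I. cscale (c i) (f i)) = (\<Sum>i\<in>I. cscale (c i) (mdbar B (f i)))"
    using insert by blast
  show ?case unfolding sum.insert[OF insert(1,2)] mdbar_ops(1)[OF 1 2] mdbar_ops(3)[OF 3 3] 4 ..
next
  case empty
  have "mdbar B (\<lambda>x. 0) = 0"
    using partial_deriv_eq[OF has_derivative_const] by (auto simp: mdbar_def fun_eq_iff)
  then show ?case by (simp add: zero_fun_def)
next
  case (infinite I)
  have "mdbar B (\<lambda>x. 0) = 0"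
    using partial_deriv_eq[OF has_derivative_const] by (auto simp: mdbar_def fun_eq_iff)
  then show ?case using infinite by (simp add: zero_fun_def)
qed

text \<open>The sequence comes from \<open>spectral_sequence\<close> on the graph. Two by-products
  are kept: normalised eigenvectors, for lower bounds, and the half of the min-max principle that
  bounds \<open>l k\<close> by trial spaces of dimension \<open>k + 1\<close>.\<close>

theorem eigenvalue_enumeration_exists:
  assumes \<Omega>: "open \<Omega>" "bounded \<Omega>" "\<Omega> \<noteq> {}"
  shows "\<exists>l. eigenvalue_enumeration \<Omega> B l \<and>
    (\<forall>k. \<exists>p. graph_eigenvector \<Omega> B (l k) p \<and> L2.q \<Omega> (fst p) = 1) \<and>
    (\<forall>k \<phi> \<Lambda>. (\<forall>i\<le>k. \<phi> i \<in> test_functions \<Omega>) \<longrightarrow>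
       (\<forall>c. (\<exists>i\<le>k. c i \<noteq> 0) \<longrightarrow> L2.q \<Omega> (\<Sum>i\<le>k. cscale (c i) (\<phi> i)) > 0 \<and>
         L2.q \<Omega> (mdbar B (\<Sum>i\<le>k. cscale (c i) (\<phi> i))) \<le> \<Lambda> * L2.q \<Omega> (\<Sum>i\<le>k. cscale (c i) (\<phi> i))) \<longrightarrow>
       l k \<le> \<Lambda>)"
proof -
  interpret form_pair pscale "magnetic_graph \<Omega> B" "\<lambda>p r. inner_L2 \<Omega> (snd p) (snd r)" "\<lambda>p r. inner_L2 \<Omega> (fst p) (fst r)"
    by (rule form_pair_graph[OF \<Omega>])
  have qA: "A.q p = L2.q \<Omega> (snd p)" and qB: "B.q p = L2.q \<Omega> (fst p)" for p
    by (simp_all add: A.q_def B.q_def L2.q_def)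
  let ?G = "magnetic_graph \<Omega> B"
  have GL: "fst p \<in> L2 \<Omega>" "snd p \<in> L2 \<Omega>" if "p \<in> ?G" for p using that by (auto simp: magnetic_graph_def)
  obtain l e where mono: "mono l" and e': "\<forall>k. e k \<in> ?G"
    and orth': "\<forall>j k. inner_L2 \<Omega> (fst (e j)) (fst (e k)) = (if j = k then 1 else 0)"
    and eig': "\<forall>k. \<forall>v\<in>?G. inner_L2 \<Omega> (snd (e k)) (snd v) = of_real (l k) * inner_L2 \<Omega> (fst (e k)) (fst v)"
    and unb': "\<forall>M. \<exists>k. l k > M" and min': "\<forall>k. \<forall>v\<in>perp e k. l k * B.q v \<le> A.q v"
    using spectral_sequence by (elim exE conjE)
  have e: "e k \<in> ?G" and unb: "\<exists>k. l k > M" and min: "v \<in> perp e k \<Longrightarrow> l k * B.q v \<le> A.q v"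
    and orth: "inner_L2 \<Omega> (fst (e j)) (fst (e k)) = (if j = k then 1 else 0)"
    and eig: "v \<in> ?G \<Longrightarrow> inner_L2 \<Omega> (snd (e k)) (snd v) = of_real (l k) * inner_L2 \<Omega> (fst (e k)) (fst v)" for j k v M
    using e' orth' eig' unb' min' by blast+
  have ev: "graph_eigenvector \<Omega> B (l k) (e k)" for k using e eig by (simp add: graph_eigenvector_def)
  have qe: "L2.q \<Omega> (fst (e k)) = 1" for k using orth[of k k] by (simp add: L2.q_def)
  have fs: "fst (\<Sum>i\<in>I. pscale (c i) (p i)) = (\<Sum>i\<in>I. cscale (c i) (fst (p i)))"
      "snd (\<Sum>i\<in>I. pscale (c i) (p i)) = (\<Sum>i\<in>I. cscale (c i) (snd (p i)))" for I c and p :: "nat \<Rightarrow> _"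
    by (simp_all add: fst_sum snd_sum pscale_def)
  have fin: "finite {k. l k = \<mu>}" for \<mu>
  proof -
    obtain N where "l N > \<mu>" using unb by blast
    then have "k \<le> N" if "l k = \<mu>" for k using that monoD[OF mono, of N k] by (cases "N \<le> k") auto
    then have "{k. l k = \<mu>} \<subseteq> {..N}" by blast
    then show ?thesis using finite_subset by blast
  qed
  have enum: "multiplicity_at_least \<Omega> B \<mu> m \<longleftrightarrow> (\<exists>K. finite K \<and> card K = m \<and> (\<forall>k\<in>K. l k = \<mu>))" for \<mu> m
  proof
    assume "\<exists>K. finite K \<and> card K = m \<and> (\<forall>k\<in>K. l k = \<mu>)"
    then obtain K where K: "finite K" "card K = m" "\<forall>k\<in>K. l k = \<mu>" by blast
    obtain f where f: "bij_betw f {..<m} K" using ex_bij_betw_nat_finite[OF K(1)] K(2) by (auto simp: atLeast0LessThan)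
    have fK: "f i \<in> K" if "i < m" for i using f that by (auto simp: bij_betw_def)
    define u where "u i = fst (e (f i))" for i
    have uL: "u i \<in> L2 \<Omega>" for i unfolding u_def by (rule GL[OF e])
    have "u i \<in> magnetic_eigenspace \<Omega> B \<mu>" if "i < m" for i
      using graph_eigenvector_imp_eigenspace[OF \<Omega>(1,2) ev[of "f i"]] K(3) fK[OF that] by (simp add: u_def)
    moreover have "AE_independent \<Omega> m u"
      unfolding AE_independent_def
    proof (intro allI impI)
      fix c j assume ae: "AE x in lebesgue_on \<Omega>. (\<Sum>i<m. c i * u i x) = 0" and j: "j < m"
      define s where "s = (\<Sum>i<m. cscale (c i) (u i))"
      have sL: "s \<in> L2 \<Omega>" unfolding s_def by (intro L2.sum_in L2.scale_in uL)
      have "L2.q \<Omega> s = 0" using ae L2_q_zero_AE[OF sL] by (simp add: s_def cscale_sum)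
      then have "inner_L2 \<Omega> s (u j) = 0" using L2.Cauchy_Schwarz[OF sL uL[of j]] by simp
      moreover have "inner_L2 \<Omega> s (u j) = (\<Sum>i<m. c i * (if f i = f j then 1 else 0))"
        unfolding s_def by (subst L2.sum_left) (auto intro!: L2.scale_in uL sum.cong simp: L2.scale_left uL, auto simp: u_def orth)
      moreover have "\<dots> = (\<Sum>i<m. c i * (if i = j then 1 else 0))"
        using f j by (intro sum.cong) (auto simp: bij_betw_def inj_on_def)
      moreover have "\<dots> = c j" using j by (simp add: if_distrib cong: if_cong)
      ultimately show "c j = 0" by simp
    qed
    ultimately show "multiplicity_at_least \<Omega> B \<mu> m" unfolding multiplicity_at_least_def by blast
  next
    assume "multiplicity_at_least \<Omega> B \<mu> m"
    then obtain u where u: "\<And>i. i < m \<Longrightarrow> u i \<in> magnetic_eigenspace \<Omega> B \<mu>" and ind: "AE_independent \<Omega> m u"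
      unfolding multiplicity_at_least_def by blast
    have "\<exists>w. \<forall>i<m. graph_eigenvector \<Omega> B \<mu> (u i, w i)"
      using eigenspace_imp_graph_eigenvector[OF \<Omega>(1,2) u] by metis
    then obtain w where w: "\<And>i. i < m \<Longrightarrow> graph_eigenvector \<Omega> B \<mu> (u i, w i)" by blast
    define J where "J = {k. l k = \<mu>}"
    have J: "finite J" unfolding J_def by (rule fin)
    \<comment> \<open>With more independent eigenfunctions than indices where
      \<open>l k = \<mu>\<close>, some nontrivial combination \<open>v\<close> is orthogonal to all
      these \<open>e k\<close>, and by symmetry to the other ones as well. Then \<open>v\<close>
      lies in some \<open>perp e k\<close> with \<open>l k > \<mu>\<close>, while its energy is
      \<open>\<mu> * B.q v\<close>; so \<open>v\<close> is null.\<close>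
    have "m \<le> card J"
    proof (rule ccontr)
      assume "\<not> m \<le> card J"
      then have "card J < card {..<m}" by simp
      obtain f where f: "bij_betw f {..<card J} J" using ex_bij_betw_nat_finite[OF J] by (auto simp: atLeast0LessThan)
      obtain c where c: "\<exists>i\<in>{..<m}. c i \<noteq> 0" "\<forall>k<card J. (\<Sum>i<m. c i * inner_L2 \<Omega> (u i) (fst (e (f k)))) = 0"
        using underdetermined_system[OF _ \<open>card J < card {..<m}\<close>, of "\<lambda>k i. inner_L2 \<Omega> (u i) (fst (e (f k)))"] by auto
      define v where "v = (\<Sum>i<m. pscale (c i) (u i, w i))"
      have uw: "(u i, w i) \<in> ?G" if "i < m" for i using w[OF that] by (simp add: graph_eigenvector_def)
      have vG: "v \<in> ?G" unfolding v_def by (intro A.sum_in A.scale_in uw) simp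
      have bv: "inner_L2 \<Omega> (fst v) (fst r) = (\<Sum>i<m. c i * inner_L2 \<Omega> (u i) (fst r))" if "r \<in> ?G" for r
        unfolding v_def using B.sum_left[of "{..<m}" "\<lambda>i. pscale (c i) (u i, w i)" r] B.scale_left uw that
        by (simp add: B.scale_in)
      have av: "inner_L2 \<Omega> (snd v) (snd r) = of_real \<mu> * inner_L2 \<Omega> (fst v) (fst r)" if "r \<in> ?G" for r
      proof -
        have "inner_L2 \<Omega> (snd v) (snd r) = (\<Sum>i<m. c i * inner_L2 \<Omega> (w i) (snd r))"
          unfolding v_def using A.sum_left[of "{..<m}" "\<lambda>i. pscale (c i) (u i, w i)" r] A.scale_left uw that
          by (simp add: A.scale_in)
        also have "\<dots> = of_real \<mu> * inner_L2 \<Omega> (fst v) (fst r)"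
          unfolding bv[OF that] sum_distrib_left
          using w that by (intro sum.cong) (auto simp: graph_eigenvector_def)
        finally show ?thesis .
      qed
      have orthv: "inner_L2 \<Omega> (fst v) (fst (e k)) = 0" for k
      proof (cases "k \<in> J")
        case True
        then obtain i where "i < card J" "k = f i" using f by (auto simp: bij_betw_def)
        then show ?thesis using c(2) bv[OF e] by simp
      next
        case False
        have "of_real \<mu> * inner_L2 \<Omega> (fst v) (fst (e k)) = inner_L2 \<Omega> (snd v) (snd (e k))"
          using av[OF e] by simp
        also have "\<dots> = cnj (of_real (l k) * inner_L2 \<Omega> (fst (e k)) (fst v))"
          using eig[OF vG] A.cnj_swap[OF e vG] by simp
        also have "\<dots> = of_real (l k) * inner_L2 \<Omega> (fst v) (fst (e k))"
          using B.cnj_swap[OF e vG] by simp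
        finally show ?thesis using False by (simp add: J_def)
      qed
      obtain k where k: "l k > \<mu>" using unb by blast
      have "v \<in> perp e k" using vG orthv by (simp add: perp_def)
      then have "l k * B.q v \<le> A.q v" by (rule min)
      also have "A.q v = \<mu> * B.q v" using av[OF vG] by (simp add: A.q_def B.q_def)
      finally have "(l k - \<mu>) * B.q v \<le> 0" by (simp add: algebra_simps)
      then have "B.q v \<le> 0" using k by (simp add: mult_le_0_iff)
      then have "L2.q \<Omega> (fst v) = 0" using B.q_nonneg[OF vG] by (simp add: qB)
      then have "AE x in lebesgue_on \<Omega>. (\<Sum>i<m. c i * u i x) = 0"
        using L2_q_zero_AE[OF GL(1)[OF vG]] by (simp add: v_def fs cscale_sum)
      then show False using ind c(1) by (auto simp: AE_independent_def)
    qed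
    then obtain K where "K \<subseteq> J" "card K = m" "finite K" using obtain_subset_with_card_n by metis
    then show "\<exists>K. finite K \<and> card K = m \<and> (\<forall>k\<in>K. l k = \<mu>)" by (auto simp: J_def)
  qed
  have minmax: "l k \<le> \<Lambda>" if \<phi>: "\<forall>i\<le>k. \<phi> i \<in> test_functions \<Omega>"
    and c: "\<forall>c. (\<exists>i\<le>k. c i \<noteq> 0) \<longrightarrow> L2.q \<Omega> (\<Sum>i\<le>k. cscale (c i) (\<phi> i)) > 0 \<and>
         L2.q \<Omega> (mdbar B (\<Sum>i\<le>k. cscale (c i) (\<phi> i))) \<le> \<Lambda> * L2.q \<Omega> (\<Sum>i\<le>k. cscale (c i) (\<phi> i))"
    for k \<phi> \<Lambda>
  proof -
    have G: "(\<phi> i, mdbar B (\<phi> i)) \<in> ?G" if "i < Suc k" for i using \<phi> that by (intro test_in_graph \<Omega>) simp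
    \<comment> \<open>\<open>k + 1\<close> trial functions meet \<open>k\<close> linear conditions,
      so their span contains a nontrivial combination orthogonal to the first \<open>k\<close>
      eigenvectors.\<close>
    obtain c where c': "\<exists>i<Suc k. c i \<noteq> 0" "(\<Sum>i<Suc k. pscale (c i) (\<phi> i, mdbar B (\<phi> i))) \<in> perp e k"
      using perp_meets_span[of "Suc k" "\<lambda>i. (\<phi> i, mdbar B (\<phi> i))" k e] G e by auto
    define f where "f = (\<Sum>i\<le>k. cscale (c i) (\<phi> i))"
    have s: "smooth (\<phi> i)" if "i \<in> {..k}" for i using \<phi> that test_smooth by blast
    have m: "mdbar B f = (\<Sum>i\<le>k. cscale (c i) (mdbar B (\<phi> i)))" unfolding f_def by (rule mdbar_sum[OF s])
    have "l k * L2.q \<Omega> f \<le> L2.q \<Omega> (mdbar B f)"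
      using min[OF c'(2)] unfolding m unfolding f_def qA qB fs by (simp add: lessThan_Suc_atMost)
    also have "\<dots> \<le> \<Lambda> * L2.q \<Omega> f" using c c'(1) by (auto simp: f_def less_Suc_eq_le)
    finally show ?thesis using c c'(1) by (auto simp: f_def less_Suc_eq_le)
  qed
  have "eigenvalue_enumeration \<Omega> B l" unfolding eigenvalue_enumeration_def using mono enum by blast
  then show ?thesis using ev qe minmax by blast
qed

lemma graph_form_lower_bound:
  assumes \<Omega>: "open \<Omega>" and p: "p \<in> magnetic_graph \<Omega> B"
    and b: "\<And>\<phi>. \<phi> \<in> test_functions \<Omega> \<Longrightarrow> \<Lambda> * (\<integral>x. (cmod (\<phi> x))\<^sup>2 \<partial>lborel) \<le> (\<integral>x. (cmod (mdbar B \<phi> x))\<^sup>2 \<partial>lborel)"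
  shows "\<Lambda> * L2.q \<Omega> (fst p) \<le> L2.q \<Omega> (snd p)"
proof -
  obtain \<phi> where \<phi>: "fst p \<in> L2 \<Omega>" "snd p \<in> L2 \<Omega>" "\<And>k::nat. \<phi> k \<in> test_functions \<Omega>"
    "(\<lambda>k. L2.q \<Omega> (\<phi> k - fst p)) \<longlonglongrightarrow> 0" "(\<lambda>k. L2.q \<Omega> (mdbar B (\<phi> k) - snd p)) \<longlonglongrightarrow> 0"
    using magnetic_graphE[OF p] by blast
  have t: "\<phi> k \<in> L2 \<Omega>" "mdbar B (\<phi> k) \<in> L2 \<Omega>" for k by (intro test_L2 test_mdbar \<Omega> \<phi>)+
  have "(\<lambda>k. \<Lambda> * L2.q \<Omega> (\<phi> k)) \<longlonglongrightarrow> \<Lambda> * L2.q \<Omega> (fst p)"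
    by (intro tendsto_intros L2.q_tendsto[OF t(1) \<phi>(1,4)])
  moreover have "(\<lambda>k. L2.q \<Omega> (mdbar B (\<phi> k))) \<longlonglongrightarrow> L2.q \<Omega> (snd p)"
    by (rule L2.q_tendsto[OF t(2) \<phi>(2,5)])
  moreover have "\<Lambda> * L2.q \<Omega> (\<phi> k) \<le> L2.q \<Omega> (mdbar B (\<phi> k))" for k
    using b[OF \<phi>(3)] by (simp add: L2_q_test[OF \<Omega>] \<phi>(3) test_mdbar[OF \<phi>(3)])
  ultimately show ?thesis by (intro LIMSEQ_le) auto
qed

text \<open>Uniqueness of the enumeration resolves the \<open>THE\<close> in the definition. The
  lower bound concerns the whole form and is therefore the same for every \<open>n\<close>.
  Eigenvalue \<open>n\<close> is the entry \<open>n - 1\<close> of the sequence, so \<open>n\<close>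
  trial functions bound it.\<close>

theorem magnetic_eigenvalue_bounds:
  assumes \<Omega>: "open \<Omega>" "bounded \<Omega>" "\<Omega> \<noteq> {}"
  shows magnetic_eigenvalue_ge: "(\<And>\<phi>. \<phi> \<in> test_functions \<Omega> \<Longrightarrow>
      \<Lambda> * (\<integral>x. (cmod (\<phi> x))\<^sup>2 \<partial>lborel) \<le> (\<integral>x. (cmod (mdbar B \<phi> x))\<^sup>2 \<partial>lborel)) \<Longrightarrow>
      \<Lambda> \<le> magnetic_eigenvalue n \<Omega> B"
    and magnetic_eigenvalue_le: "\<lbrakk>\<And>i. i < n \<Longrightarrow> \<phi> i \<in> test_functions \<Omega>; n \<ge> 1;
      \<And>c. \<exists>i<n. c i \<noteq> 0 \<Longrightarrow> (\<integral>x. (cmod (\<Sum>i<n. c i * \<phi> i x))\<^sup>2 \<partial>lborel) > 0 \<and>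
        (\<integral>x. (cmod (mdbar B (\<lambda>x. \<Sum>i<n. c i * \<phi> i x) x))\<^sup>2 \<partial>lborel) \<le> \<Lambda> * (\<integral>x. (cmod (\<Sum>i<n. c i * \<phi> i x))\<^sup>2 \<partial>lborel)\<rbrakk> \<Longrightarrow>
      magnetic_eigenvalue n \<Omega> B \<le> \<Lambda>"
proof -
  obtain l where l: "eigenvalue_enumeration \<Omega> B l"
    and ev: "\<And>k. \<exists>p. graph_eigenvector \<Omega> B (l k) p \<and> L2.q \<Omega> (fst p) = 1"
    and mm: "\<And>k \<phi> \<Lambda>. (\<forall>i\<le>k. \<phi> i \<in> test_functions \<Omega>) \<Longrightarrow>
       (\<forall>c. (\<exists>i\<le>k. c i \<noteq> 0) \<longrightarrow> L2.q \<Omega> (\<Sum>i\<le>k. cscale (c i) (\<phi> i)) > 0 \<and>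
         L2.q \<Omega> (mdbar B (\<Sum>i\<le>k. cscale (c i) (\<phi> i))) \<le> \<Lambda> * L2.q \<Omega> (\<Sum>i\<le>k. cscale (c i) (\<phi> i))) \<Longrightarrow> l k \<le> \<Lambda>"
    using eigenvalue_enumeration_exists[OF \<Omega>, of B] by blast
  have "(THE l. eigenvalue_enumeration \<Omega> B l) = l"
    using l eigenvalue_enumeration_unique by blast
  then have val: "magnetic_eigenvalue n \<Omega> B = l (n - 1)" by (simp add: magnetic_eigenvalue_def)
  show "\<Lambda> \<le> magnetic_eigenvalue n \<Omega> B"
    if b: "\<And>\<phi>. \<phi> \<in> test_functions \<Omega> \<Longrightarrow> \<Lambda> * (\<integral>x. (cmod (\<phi> x))\<^sup>2 \<partial>lborel) \<le> (\<integral>x. (cmod (mdbar B \<phi> x))\<^sup>2 \<partial>lborel)"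
  proof -
    obtain p where p: "graph_eigenvector \<Omega> B (l (n - 1)) p" "L2.q \<Omega> (fst p) = 1" using ev by blast
    have "\<Lambda> * L2.q \<Omega> (fst p) \<le> L2.q \<Omega> (snd p)"
      using p(1) by (intro graph_form_lower_bound[OF \<Omega>(1) _ b]) (auto simp: graph_eigenvector_def)
    also have "L2.q \<Omega> (snd p) = l (n - 1) * L2.q \<Omega> (fst p)"
      using p(1) by (simp add: graph_eigenvector_def L2.q_def)
    finally show ?thesis using p(2) val by simp
  qed
  show "magnetic_eigenvalue n \<Omega> B \<le> \<Lambda>"
    if \<phi>: "\<And>i. i < n \<Longrightarrow> \<phi> i \<in> test_functions \<Omega>" and n: "n \<ge> 1"
      and c: "\<And>c. \<exists>i<n. c i \<noteq> 0 \<Longrightarrow> (\<integral>x. (cmod (\<Sum>i<n. c i * \<phi> i x))\<^sup>2 \<partial>lborel) > 0 \<and>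
        (\<integral>x. (cmod (mdbar B (\<lambda>x. \<Sum>i<n. c i * \<phi> i x) x))\<^sup>2 \<partial>lborel) \<le> \<Lambda> * (\<integral>x. (cmod (\<Sum>i<n. c i * \<phi> i x))\<^sup>2 \<partial>lborel)"
  proof -
    have n': "{..n - 1} = {..<n}" using n by auto
    have le: "i \<le> n - 1 \<longleftrightarrow> i < n" for i using n by auto
    show ?thesis unfolding val
    proof (rule mm; intro allI impI)
      show "\<phi> i \<in> test_functions \<Omega>" if "i \<le> n - 1" for i using \<phi> that le by blast
      fix c :: "nat \<Rightarrow> complex" assume "\<exists>i\<le>n - 1. c i \<noteq> 0"
      then have ex: "\<exists>i<n. c i \<noteq> 0" using le by blast
      have t: "(\<lambda>x. \<Sum>i<n. c i * \<phi> i x) \<in> test_functions \<Omega>" by (intro test_sum test_scale \<phi>) simp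
      show "L2.q \<Omega> (\<Sum>i\<le>n - 1. cscale (c i) (\<phi> i)) > 0 \<and>
         L2.q \<Omega> (mdbar B (\<Sum>i\<le>n - 1. cscale (c i) (\<phi> i))) \<le> \<Lambda> * L2.q \<Omega> (\<Sum>i\<le>n - 1. cscale (c i) (\<phi> i))"
        using \<open>\<And>c. \<exists>i<n. c i \<noteq> 0 \<Longrightarrow> _\<close>[OF ex] unfolding n' cscale_sum L2_q_test[OF \<Omega>(1) t] L2_q_test[OF \<Omega>(1) test_mdbar[OF t]] .
    qed
  qed
qed

section \<open>Gauge transformations\<close>

lemma surj_to_complex: "surj to_complex"
proof (rule surjI[of _ "\<lambda>z. vec2 (Re z) (Im z)"])
  show "to_complex (vec2 (Re z) (Im z)) = z" for z by (simp add: to_complex_def)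
qed

lemma open_to_complex_image: "open \<Omega> \<Longrightarrow> open (to_complex ` \<Omega>)"
  by (rule open_surjective_linear_image[OF _ linear_to_complex surj_to_complex])

text \<open>\<open>dbar\<close> passes over holomorphic factors and multiplies
  \<open>exp (b x2^2 / 2)\<close> by \<open>\<i> b x2\<close>, so this factor shifts the field by
  \<open>b\<close>. With field 0 and \<open>b = B\<close> it removes the field for the lower bound;
  with \<open>b = - B\<close> it builds the trial functions on the disk.\<close>

lemma mdbar_gauge:
  assumes \<phi>: "\<phi> \<in> test_functions \<Omega>" and g: "g holomorphic_on to_complex ` \<Omega>" and \<Omega>: "open \<Omega>"
  shows "(\<lambda>x. exp (of_real (b / 2) * (of_real (x $ 2) * of_real (x $ 2))) * \<phi> x * g (to_complex x)) \<in> test_functions \<Omega>"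
    "mdbar B (\<lambda>x. exp (of_real (b / 2) * (of_real (x $ 2) * of_real (x $ 2))) * \<phi> x * g (to_complex x)) x =
      exp (of_real (b / 2) * (of_real (x $ 2) * of_real (x $ 2))) * g (to_complex x) * mdbar (B + b) \<phi> x"
proof -
  define E where "E = (\<lambda>x::real^2. exp (of_real (b / 2) * (of_real (x $ 2) * of_real (x $ 2)) :: complex))"
  have ss: "smooth (\<lambda>x. of_real (b / 2) * (of_real (x $ 2) * of_real (x $ 2)))" by (intro smooth_intros)
  have E: "smooth E" unfolding E_def by (intro smooth_intros)
  note op = open_to_complex_image[OF \<Omega>]
  note s = test_smooth[OF \<phi>]
  define \<eta> where "\<eta> = (\<lambda>x. E x * \<phi> x)"
  have \<eta>: "\<eta> \<in> test_functions \<Omega>" unfolding \<eta>_def by (rule test_mult[OF \<phi> E])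
  define v where "v = (\<lambda>x. \<eta> x * g (to_complex x))"
  have v: "v \<in> test_functions \<Omega>" unfolding v_def by (rule test_mult_holomorphic[OF \<eta> g op])
  have dE: "partial_deriv 1 E x = 0" "partial_deriv 2 E x = of_real b * of_real (x $ 2) * E x" for x
  proof -
    have sc: "smooth (\<lambda>x. of_real (x $ 2) * of_real (x $ 2) :: complex)" by (intro smooth_intros)
    have "partial_deriv j (\<lambda>x. of_real (x $ 2) * of_real (x $ 2) :: complex) x =
        partial_deriv j (\<lambda>x. of_real (x $ 2)) x * of_real (x $ 2) + of_real (x $ 2) * partial_deriv j (\<lambda>x. of_real (x $ 2)) x" for j
      by (intro partial_deriv_mult coord_differentiable)
    then show "partial_deriv 1 E x = 0" "partial_deriv 2 E x = of_real b * of_real (x $ 2) * E x"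
      unfolding E_def partial_deriv_unary(1)[OF smooth_differentiable[OF ss]] partial_deriv_scale[OF sc]
      by (simp_all add: partial_deriv_coord)
  qed
  have d\<eta>: "dbar \<eta> x = E x * mdbar b \<phi> x" for x
    using E s by (simp add: dbar_def \<eta>_def partial_deriv_mult smooth_differentiable dE mdbar_def algebra_simps)
  have "dbar v x = dbar \<eta> x * g (to_complex x)"
    unfolding dbar_def v_def partial_deriv_test_holomorphic[OF \<eta> g op] to_complex_axis
    by (simp add: algebra_simps)
  then have "mdbar B v x = E x * g (to_complex x) * mdbar (B + b) \<phi> x"
    unfolding mdbar_eq_dbar[of B v] d\<eta> by (simp add: v_def \<eta>_def mdbar_def algebra_simps)
  with v show "(\<lambda>x. exp (of_real (b / 2) * (of_real (x $ 2) * of_real (x $ 2))) * \<phi> x * g (to_complex x)) \<in> test_functions \<Omega>"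
    "mdbar B (\<lambda>x. exp (of_real (b / 2) * (of_real (x $ 2) * of_real (x $ 2))) * \<phi> x * g (to_complex x)) x =
      exp (of_real (b / 2) * (of_real (x $ 2) * of_real (x $ 2))) * g (to_complex x) * mdbar (B + b) \<phi> x"
    by (simp_all add: v_def \<eta>_def E_def)
qed

text \<open>The weight has modulus \<open>exp (B \<psi>)\<close> with \<open>\<psi>\<close> between
  \<open>-m\<close> and \<open>\<epsilon>\<close>. In the field-free Poincare inequality for the
  weighted function \<open>v\<close> this costs \<open>exp (-2 B m)\<close> on one side and
  \<open>exp (2 B \<epsilon>)\<close> on the other. The room \<open>\<epsilon>\<close> is left
  because the boundary condition for \<open>\<psi>\<close> will be met only approximately.\<close>

lemma holomorphic_gauge_bound:
  assumes \<phi>: "\<phi> \<in> test_functions \<Omega>" and \<Omega>: "open \<Omega>" "bounded \<Omega>" "measure lebesgue \<Omega> \<le> 1"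
    and F: "F holomorphic_on to_complex ` \<Omega>" and B: "B \<ge> 0"
    and up: "\<And>x. x \<in> \<Omega> \<Longrightarrow> (x $ 2)\<^sup>2 / 2 + Re (F (to_complex x)) \<le> \<epsilon>"
    and low: "\<And>x. x \<in> \<Omega> \<Longrightarrow> - m \<le> (x $ 2)\<^sup>2 / 2 + Re (F (to_complex x))"
  shows "exp (- 2 * B * (m + \<epsilon>)) * (\<integral>x. (cmod (\<phi> x))\<^sup>2 \<partial>lborel) \<le> (\<integral>x. (cmod (mdbar B \<phi> x))\<^sup>2 \<partial>lborel)"
proof -
  define E where "E = (\<lambda>x::real^2. exp (of_real (B / 2) * (of_real (x $ 2) * of_real (x $ 2)) :: complex))"
  define g where "g = (\<lambda>z. exp (of_real B * F z))"
  have g: "g holomorphic_on to_complex ` \<Omega>" unfolding g_def by (intro holomorphic_intros F)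
  define v where "v = (\<lambda>x. E x * \<phi> x * g (to_complex x))"
  have v: "v \<in> test_functions \<Omega>"
    using mdbar_gauge(1)[OF \<phi> g \<Omega>(1), of B] unfolding v_def E_def .
  have dv: "dbar v x = E x * g (to_complex x) * mdbar B \<phi> x" for x
  proof -
    have "dbar v x = mdbar 0 v x" by (simp add: mdbar_eq_dbar)
    also have "\<dots> = E x * g (to_complex x) * mdbar (0 + B) \<phi> x"
      using mdbar_gauge(2)[OF \<phi> g \<Omega>(1), where B = 0 and b = B] unfolding v_def E_def .
    finally show ?thesis by simp
  qed
  have weight: "cmod (E x * g (to_complex x)) = exp (B * ((x $ 2)\<^sup>2 / 2 + Re (F (to_complex x))))" for x
    by (simp add: E_def g_def norm_mult exp_add[symmetric] power2_eq_square algebra_simps)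
  have wu: "(cmod (dbar v x))\<^sup>2 \<le> exp (2 * B * \<epsilon>) * (cmod (mdbar B \<phi> x))\<^sup>2" for x
  proof (cases "x \<in> \<Omega>")
    case True
    have "cmod (E x * g (to_complex x)) \<le> exp (B * \<epsilon>)"
      unfolding weight using up[OF True] B by (simp add: mult_left_mono)
    then have "(cmod (E x * g (to_complex x)))\<^sup>2 \<le> (exp (B * \<epsilon>))\<^sup>2" by (intro power_mono) auto
    also have "(exp (B * \<epsilon>))\<^sup>2 = exp (2 * B * \<epsilon>)" by (simp add: exp_double[symmetric] mult.assoc)
    finally show ?thesis unfolding dv norm_mult[of "E x * g (to_complex x)"] power_mult_distrib
      by (intro mult_right_mono) auto
  qed (simp add: dv test_zero_outside[OF test_mdbar[OF \<phi>]])
  have wl: "exp (- 2 * B * m) * (cmod (\<phi> x))\<^sup>2 \<le> (cmod (v x))\<^sup>2" for x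
  proof (cases "x \<in> \<Omega>")
    case True
    have "B * (- m) \<le> B * ((x $ 2)\<^sup>2 / 2 + Re (F (to_complex x)))" using low[OF True] B by (rule mult_left_mono)
    then have "exp (B * (- m)) \<le> cmod (E x * g (to_complex x))" unfolding weight by simp
    then have "(exp (B * (- m)))\<^sup>2 \<le> (cmod (E x * g (to_complex x)))\<^sup>2" by (intro power_mono) auto
    moreover have "(exp (B * (- m)))\<^sup>2 = exp (- 2 * B * m)" by (simp add: exp_double[symmetric])
    moreover have "v x = E x * g (to_complex x) * \<phi> x" by (simp add: v_def)
    ultimately show ?thesis unfolding norm_mult[of "E x * g (to_complex x)"] power_mult_distrib
      by (metis norm_mult power_mult_distrib mult_right_mono zero_le_power2)
  qed (simp add: test_zero_outside[OF \<phi>])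
  have dvt: "dbar v \<in> test_functions \<Omega>"
    unfolding dbar_def[abs_def] by (intro test_add test_scale test_partial v)
  have "exp (- 2 * B * m) * (\<integral>x. (cmod (\<phi> x))\<^sup>2 \<partial>lborel) = (\<integral>x. exp (- 2 * B * m) * (cmod (\<phi> x))\<^sup>2 \<partial>lborel)" by simp
  also have "\<dots> \<le> (\<integral>x. (cmod (v x))\<^sup>2 \<partial>lborel)"
    by (intro integral_mono wl test_norm_square_integrable[OF v] integrable_mult_right test_norm_square_integrable[OF \<phi>])
  also have "\<dots> \<le> (\<integral>x. (cmod (dbar v x))\<^sup>2 \<partial>lborel)"
    using Poincare_inequality[OF v \<Omega>] by (simp add: integral_dbar_square[OF v])
  also have "\<dots> \<le> (\<integral>x. exp (2 * B * \<epsilon>) * (cmod (mdbar B \<phi> x))\<^sup>2 \<partial>lborel)"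
    by (intro integral_mono wu integrable_mult_right test_norm_square_integrable[OF dvt] test_norm_square_integrable[OF test_mdbar[OF \<phi>]])
  also have "\<dots> = exp (2 * B * \<epsilon>) * (\<integral>x. (cmod (mdbar B \<phi> x))\<^sup>2 \<partial>lborel)" by simp
  finally have "exp (- (2 * B * \<epsilon>)) * (exp (- 2 * B * m) * (\<integral>x. (cmod (\<phi> x))\<^sup>2 \<partial>lborel)) \<le>
      exp (- (2 * B * \<epsilon>)) * (exp (2 * B * \<epsilon>) * (\<integral>x. (cmod (mdbar B \<phi> x))\<^sup>2 \<partial>lborel))"
    by (intro mult_left_mono) auto
  then show ?thesis unfolding mult.assoc[symmetric] exp_add[symmetric] by (simp add: algebra_simps)
qed

section \<open>Polar coordinates and Taylor coefficients\<close>

lemma cbox_integral_iterated: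
  fixes k :: "real^2 \<Rightarrow> real"
  assumes k: "continuous_on (cbox (vec2 a c) (vec2 b d)) k"
  shows "integral (cbox (vec2 a c) (vec2 b d)) k = integral {a..b} (\<lambda>x. integral {c..d} (\<lambda>y. k (vec2 x y)))"
proof -
  let ?C = "cbox (vec2 a c) (vec2 b d)" and ?D = "cbox (a, c) (b, d)"
  define K where "K x = indicator ?C x *\<^sub>R k x" for x
  have mem: "vec2 x y \<in> ?C \<longleftrightarrow> (x, y) \<in> ?D" for x y
    by (auto simp: mem_box_cart forall_2 cbox_Pair_eq)
  have Ki: "integrable lborel K"
    unfolding K_def by (rule borel_integrable_compact[OF compact_cbox k])
  have Km: "K \<in> borel_measurable borel" using borel_measurable_integrable[OF Ki] by simp
  have m1: "(\<lambda>p. vec2 (fst p) (snd p)) \<in> borel_measurable (borel :: (real \<times> real) measure)"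
    by (intro borel_measurable_continuous_onI continuous_intros)
  have kc: "continuous_on ?D (\<lambda>p. k (vec2 (fst p) (snd p)))"
    by (intro continuous_on_compose2[OF k] continuous_intros) (auto simp: mem)
  have Keq: "K (vec2 (fst p) (snd p)) = indicator ?D p *\<^sub>R k (vec2 (fst p) (snd p))" for p
    using mem[of "fst p" "snd p"] by (auto simp: K_def indicator_def)
  have gi: "integrable lborel (\<lambda>p. indicator ?D p *\<^sub>R k (vec2 (fst p) (snd p)))"
    by (rule borel_integrable_compact[OF compact_cbox kc])
  have ind: "integral UNIV (\<lambda>p. indicator A p *\<^sub>R f p) = integral A f" for A and f :: "'a::euclidean_space \<Rightarrow> real"
  proof -
    have "(\<lambda>p. indicator A p *\<^sub>R f p) = (\<lambda>p. if p \<in> A then f p else 0)" by (auto simp: indicator_def)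
    then show ?thesis by (simp add: Henstock_Kurzweil_Integration.integral_restrict_UNIV)
  qed
  have "integral ?C k = integral UNIV K" by (simp only: K_def[abs_def] ind)
  also have "\<dots> = integral\<^sup>L lborel K" by (rule integral_lborel[OF Ki])
  also have "\<dots> = integral\<^sup>L (distr lborel borel (\<lambda>p. vec2 (fst p) (snd p))) K"
    using distr_vec2 by (simp add: case_prod_unfold)
  also have "\<dots> = integral\<^sup>L lborel (\<lambda>p. K (vec2 (fst p) (snd p)))"
    using m1 Km by (subst integral_distr) auto
  also have "\<dots> = integral UNIV (\<lambda>p. indicator ?D p *\<^sub>R k (vec2 (fst p) (snd p)))"
    unfolding Keq by (rule integral_lborel[OF gi, symmetric])
  also have "\<dots> = integral ?D (\<lambda>p. k (vec2 (fst p) (snd p)))" by (rule ind)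
  also have "\<dots> = integral (cbox a b) (\<lambda>x. integral (cbox c d) (\<lambda>y. k (vec2 x y)))"
    using integral_prod_continuous[OF kc] by simp
  finally show ?thesis by simp
qed

definition of_complex :: "complex \<Rightarrow> real^2" where
  "of_complex z = vec2 (Re z) (Im z)"

lemma to_of_complex [simp]: "to_complex (of_complex z) = z" "of_complex (to_complex x) = x"
  by (simp_all add: to_complex_def of_complex_def)

lemma linear_of_complex: "linear of_complex"
  by (rule linearI) (simp_all add: of_complex_def vec_eq_iff forall_2)

lemma bounded_linear_of_complex: "bounded_linear of_complex"
  using linear_of_complex by (simp add: linear_conv_bounded_linear)

lemma inj_of_complex: "inj of_complex"
  by (metis injI to_of_complex(1))

lemma norm_of_complex [simp]: "norm (of_complex z) = cmod z"
  by (metis norm_to_complex to_of_complex(1))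

text \<open>The scalar case of the vector-valued theorem, by way of \<open>real^1\<close>.\<close>

lemma change_of_variables_real:
  fixes f :: "real^2 \<Rightarrow> real"
  assumes "S \<in> sets lebesgue" "\<And>x. x \<in> S \<Longrightarrow> (g has_derivative g' x) (at x within S)" "inj_on g S"
    "(\<lambda>x. \<bar>det (matrix (g' x))\<bar> * f (g x)) absolutely_integrable_on S"
  shows "f absolutely_integrable_on (g ` S)"
    "integral (g ` S) f = integral S (\<lambda>x. \<bar>det (matrix (g' x))\<bar> * f (g x))"
  using has_absolute_integral_change_of_variables[OF assms(1-3), of "\<lambda>x. vec (f x) :: real^1"
      "vec (integral S (\<lambda>x. \<bar>det (matrix (g' x))\<bar> * f (g x)))"] assms(4)
  unfolding absolutely_integrable_on_1_iff integral_on_1_eq by auto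

text \<open>The open box keeps \<open>polar\<close> injective. Its image is the disk without its
  centre and a slit, and is used below only as a subset of the disk; for lower bounds this
  suffices.\<close>

definition polar_box :: "real \<Rightarrow> (real^2) set" where
  "polar_box s = box (vec2 0 (- pi)) (vec2 s pi)"

definition polar :: "real^2 \<Rightarrow> complex" where
  "polar x = of_real (x $ 1) * exp (\<i> * of_real (x $ 2))"

lemma mem_polar_box: "x \<in> polar_box s \<longleftrightarrow> 0 < x $ 1 \<and> x $ 1 < s \<and> - pi < x $ 2 \<and> x $ 2 < pi"
  by (auto simp: polar_box_def mem_box_cart forall_2)

lemma cmod_polar: "cmod (polar x) = \<bar>x $ 1\<bar>"
  by (simp add: polar_def norm_mult)

lemma inj_polar: "inj_on polar (polar_box s)"
proof (rule inj_onI)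
  fix x y assume x: "x \<in> polar_box s" and y: "y \<in> polar_box s" and eq: "polar x = polar y"
  have 1: "x $ 1 = y $ 1" using x y arg_cong[OF eq, of cmod] by (simp add: cmod_polar mem_polar_box)
  have Arg: "Arg (polar z) = z $ 2" if "z \<in> polar_box s" for z
    using that unfolding polar_def
    by (intro Arg_unique[of "z $ 1"]) (auto simp: mem_polar_box)
  then have "x $ 2 = y $ 2" using x y eq by metis
  with 1 show "x = y" by (simp add: vec_eq_iff forall_2)
qed

lemma polar_has_derivative:
  "(polar has_derivative (\<lambda>h. exp (\<i> * of_real (x $ 2)) * (of_real (h $ 1) + \<i> * of_real (x $ 1) * of_real (h $ 2)))) (at x)"
proof -
  have c: "((\<lambda>x::real^2. of_real (x $ i) :: complex) has_derivative (\<lambda>h. of_real (h $ i))) (at x)" for i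
    by (intro bounded_linear_imp_has_derivative bounded_linear_compose[OF bounded_linear_of_real] bounded_linear_vec_nth)
  have "((\<lambda>x::real^2. exp (\<i> * of_real (x $ 2)) :: complex) has_derivative
      (\<lambda>h. exp (\<i> * of_real (x $ 2)) * (\<i> * of_real (h $ 2)))) (at x)"
    by (rule has_derivative_comp_field[OF DERIV_exp has_derivative_mult_right[OF c]])
  from has_derivative_mult[OF c[of 1] this] show ?thesis
    unfolding polar_def[abs_def] by (rule has_derivative_eq_rhs) (simp add: algebra_simps)
qed

lemma polar_map_derivative:
  assumes "h field_differentiable (at (polar x))"
  shows "((\<lambda>x. of_complex (h (polar x))) has_derivative
    (\<lambda>v. of_complex (deriv h (polar x) * exp (\<i> * of_real (x $ 2)) * (of_real (v $ 1) + \<i> * of_real (x $ 1) * of_real (v $ 2))))) (at x)"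
  using bounded_linear.has_derivative[OF bounded_linear_of_complex
      has_derivative_comp_field[OF field_differentiable_derivI[OF assms] polar_has_derivative]]
  by (simp add: mult.assoc)

lemma det_polar_map:
  "det (matrix (\<lambda>v::real^2. of_complex (w * (of_real (v $ 1) + \<i> * of_real r * of_real (v $ 2))))) = r * (cmod w)\<^sup>2"
  unfolding det_2 matrix_def cmod_power2
  by (simp add: of_complex_def axis_def power2_eq_square algebra_simps)

text \<open>One substitution through polar coordinates and \<open>h\<close> together, with Jacobian
  \<open>\<rho> |h'|^2\<close>. Weight 1 gives the area of a conformal image; the identity for
  \<open>h\<close> gives integrals over a disk.\<close>

lemma polar_change_of_variables:
  fixes F :: "real^2 \<Rightarrow> real"
  assumes h: "h holomorphic_on ball 0 R" and s: "0 < s" "s < R" and inj: "inj_on h (ball 0 s)"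
    and F: "continuous_on UNIV F"
  shows "F absolutely_integrable_on ((\<lambda>x. of_complex (h (polar x))) ` polar_box s)"
    "integral ((\<lambda>x. of_complex (h (polar x))) ` polar_box s) F =
      integral {0..s} (\<lambda>\<rho>. integral {-pi..pi} (\<lambda>\<theta>. \<rho> * (cmod (deriv h (of_real \<rho> * cis \<theta>)))\<^sup>2 * F (of_complex (h (of_real \<rho> * cis \<theta>)))))"
proof -
  let ?S = "polar_box s" and ?C = "cbox (vec2 0 (-pi)) (vec2 s pi)"
  have inC: "polar x \<in> ball 0 R" if "x \<in> ?C" for x
    using that s by (auto simp: cmod_polar mem_box_cart forall_2)
  have SC: "?S \<subseteq> ?C" unfolding polar_box_def by (rule box_subset_cbox)
  have fd: "h field_differentiable (at (polar x))" if "x \<in> ?C" for x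
    using inC[OF that] h holomorphic_on_imp_differentiable_at by blast
  let ?g = "\<lambda>x. of_complex (h (polar x))"
  let ?g' = "\<lambda>(x::real^2) (v::real^2). of_complex (deriv h (polar x) * exp (\<i> * of_real (x $ 2)) * (of_real (v $ 1) + \<i> * of_real (x $ 1) * of_real (v $ 2)))"
  define k where "k = (\<lambda>x::real^2. x $ 1 * (cmod (deriv h (polar x)))\<^sup>2 * F (?g x))"
  have cp: "continuous_on A polar" for A
    unfolding polar_def by (intro continuous_intros)
  have kc: "continuous_on ?C k"
    unfolding k_def
    by (intro continuous_intros continuous_on_compose2[OF F] bounded_linear.continuous_on[OF bounded_linear_of_complex]
        continuous_on_compose2[OF holomorphic_on_imp_continuous_on[OF h] cp]
        continuous_on_compose2[OF holomorphic_on_imp_continuous_on[OF holomorphic_deriv[OF h open_ball]] cp])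
       (use inC in auto)
  have ki: "k absolutely_integrable_on ?C" by (rule absolutely_integrable_continuous[OF kc])
  then have kS: "k absolutely_integrable_on ?S"
    by (rule set_integrable_subset) (use SC in \<open>auto simp: polar_box_def\<close>)
  have jac: "\<bar>det (matrix (?g' x))\<bar> * F (?g x) = k x" if "x \<in> ?S" for x
    using that unfolding det_polar_map by (simp add: k_def norm_mult mem_polar_box)
  have S: "?S \<in> sets lebesgue" by (simp add: polar_box_def)
  have der: "(?g has_derivative ?g' x) (at x within ?S)" if "x \<in> ?S" for x
    using polar_map_derivative[OF fd] that SC has_derivative_at_withinI by blast
  have "polar ` ?S \<subseteq> ball 0 s" by (auto simp: cmod_polar mem_polar_box)
  then have "inj_on (\<lambda>x. h (polar x)) ?S"
    using comp_inj_on[OF inj_polar inj_on_subset[OF inj]] by (simp add: o_def)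
  then have injg: "inj_on ?g ?S" using inj_of_complex by (auto simp: inj_on_def)
  have ai: "(\<lambda>x. \<bar>det (matrix (?g' x))\<bar> * F (?g x)) absolutely_integrable_on ?S"
    using kS by (rule absolutely_integrable_spike[of _ _ "{}", simplified]) (use jac in auto)
  note cov = change_of_variables_real[OF S der injg ai]
  show "F absolutely_integrable_on (?g ` ?S)" by (rule cov(1))
  have "integral (?g ` ?S) F = integral ?S (\<lambda>x. \<bar>det (matrix (?g' x))\<bar> * F (?g x))" by (rule cov(2))
  also have "\<dots> = integral ?S k"
    by (rule Henstock_Kurzweil_Integration.integral_cong) (rule jac)
  also have "\<dots> = integral ?C k" unfolding polar_box_def by (rule integral_open_interval)
  also have "\<dots> = integral {0..s} (\<lambda>\<rho>. integral {-pi..pi} (\<lambda>\<theta>. k (vec2 \<rho> \<theta>)))"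
    by (rule cbox_integral_iterated[OF kc])
  finally show "integral (?g ` ?S) F =
      integral {0..s} (\<lambda>\<rho>. integral {-pi..pi} (\<lambda>\<theta>. \<rho> * (cmod (deriv h (of_real \<rho> * cis \<theta>)))\<^sup>2 * F (of_complex (h (of_real \<rho> * cis \<theta>)))))"
    by (simp add: k_def polar_def cis_conv_exp)
qed

section \<open>Taylor coefficients and means over circles\<close>

definition taylor_coeff :: "(complex \<Rightarrow> complex) \<Rightarrow> nat \<Rightarrow> complex" where
  "taylor_coeff h n = (deriv ^^ n) h 0 / fact n"

lemma taylor_summable:
  assumes h: "h holomorphic_on ball 0 R" and \<rho>: "0 \<le> \<rho>" "\<rho> < R"
  shows "summable (\<lambda>n. cmod (taylor_coeff h n) * \<rho> ^ n)"
proof -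
  obtain t where t: "\<rho> < t" "t < R" using dense[OF \<rho>(2)] by blast
  have "summable (\<lambda>n. taylor_coeff h n * of_real t ^ n)"
    using holomorphic_power_series[OF h, of "of_real t"] t \<rho> by (auto simp: taylor_coeff_def summable_def)
  from powser_insidea[OF this, of "of_real \<rho>"] show ?thesis
    using t \<rho> by (simp add: norm_mult norm_power)
qed

lemma taylor_uniform_limit:
  assumes h: "h holomorphic_on ball 0 R" and \<rho>: "0 \<le> \<rho>" "\<rho> < R"
  shows "uniform_limit (cball 0 \<rho>) (\<lambda>N z. \<Sum>n<N. taylor_coeff h n * z ^ n) h sequentially"
proof -
  have "uniform_limit (cball 0 \<rho>) (\<lambda>N z. \<Sum>n<N. taylor_coeff h n * z ^ n) (\<lambda>z. \<Sum>n. taylor_coeff h n * z ^ n) sequentially"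
    by (rule Weierstrass_m_test[OF _ taylor_summable[OF h \<rho>]])
       (auto simp: norm_mult norm_power intro!: mult_left_mono power_mono)
  moreover have "(\<Sum>n. taylor_coeff h n * z ^ n) = h z" if "z \<in> cball 0 \<rho>" for z
    using holomorphic_power_series[OF h, of z] that \<rho> by (simp add: taylor_coeff_def sums_iff)
  ultimately show ?thesis
    using uniform_limit_cong'[of "cball 0 \<rho>" "\<lambda>N z. \<Sum>n<N. taylor_coeff h n * z ^ n" "\<lambda>N z. \<Sum>n<N. taylor_coeff h n * z ^ n"
        "\<lambda>z. \<Sum>n. taylor_coeff h n * z ^ n" h sequentially] by blast
qed

lemma cis_orthogonality:
  "((\<lambda>\<theta>. cis (of_int k * \<theta>)) has_integral (if k = 0 then 2 * of_real pi else 0)) {-pi..pi}"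
proof (cases "k = 0")
  case True
  then show ?thesis using has_integral_const_real[of "1::complex" "-pi" pi]
    by (simp add: scaleR_conv_of_real)
next
  case False
  define w where "w = \<i> * complex_of_int k"
  have w: "w \<noteq> 0" using False by (simp add: w_def)
  have "((\<lambda>t. exp (w * of_real t)) has_integral exp (w * of_real pi) / w - exp (w * of_real (- pi)) / w) {-pi..pi}"
  proof (rule fundamental_theorem_of_calculus)
    fix x :: real
    have "((\<lambda>z. exp (w * z) / w) has_field_derivative exp (w * of_real x)) (at (of_real x))"
      using w by (auto intro!: derivative_eq_intros)
    then show "((\<lambda>t. exp (w * of_real t) / w) has_vector_derivative exp (w * of_real x)) (at x within {-pi..pi})"
      by (rule has_vector_derivative_real_field)
  qed simp
  moreover have "exp (w * of_real pi) = exp (w * of_real (- pi))"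
    by (rule exp_eq[THEN iffD2]) (auto simp: w_def algebra_simps intro!: exI[of _ k])
  ultimately show ?thesis using False by (simp add: cis_conv_exp w_def algebra_simps)
qed

lemma Parseval_polynomial:
  "((\<lambda>\<theta>. (cmod (\<Sum>n<N. c n * (of_real \<rho> * cis \<theta>) ^ n))\<^sup>2) has_integral (2 * pi * (\<Sum>n<N. (cmod (c n))\<^sup>2 * \<rho> ^ (2 * n)))) {-pi..pi}"
proof -
  define A where "A n m = c n * cnj (c m) * of_real (\<rho> ^ (n + m))" for n m
  have "((\<lambda>\<theta>. \<Sum>n<N. \<Sum>m<N. A n m * cis (of_int (int n - int m) * \<theta>)) has_integral
      (\<Sum>n<N. \<Sum>m<N. A n m * (if int n - int m = 0 then 2 * of_real pi else 0))) {-pi..pi}"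
    by (intro has_integral_sum has_integral_mult_right cis_orthogonality) auto
  from has_integral_linear[OF this bounded_linear_Re]
  have "((\<lambda>\<theta>. Re (\<Sum>n<N. \<Sum>m<N. A n m * cis (of_int (int n - int m) * \<theta>))) has_integral
      Re (\<Sum>n<N. \<Sum>m<N. A n m * (if int n - int m = 0 then 2 * of_real pi else 0))) {-pi..pi}"
    by (simp add: o_def)
  moreover have "Re (\<Sum>n<N. \<Sum>m<N. A n m * cis (of_int (int n - int m) * \<theta>)) = (cmod (\<Sum>n<N. c n * (of_real \<rho> * cis \<theta>) ^ n))\<^sup>2" for \<theta>
  proof -
    have t: "(c n * (of_real \<rho> * cis \<theta>) ^ n) * cnj (c m * (of_real \<rho> * cis \<theta>) ^ m) = A n m * cis (of_int (int n - int m) * \<theta>)" for n m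
    proof -
      have p: "(of_real \<rho> * cis \<theta>) ^ k = of_real (\<rho> ^ k) * cis (real k * \<theta>)" for k
        by (simp only: power_mult_distrib Complex.DeMoivre of_real_power)
      have "cis (real n * \<theta>) * cnj (cis (real m * \<theta>)) = cis (of_int (int n - int m) * \<theta>)"
        by (simp add: cis_cnj cis_mult left_diff_distrib)
      then show ?thesis unfolding p A_def by (simp add: power_add mult_ac)
    qed
    have "of_real ((cmod (\<Sum>n<N. c n * (of_real \<rho> * cis \<theta>) ^ n))\<^sup>2) =
      (\<Sum>n<N. c n * (of_real \<rho> * cis \<theta>) ^ n) * cnj (\<Sum>n<N. c n * (of_real \<rho> * cis \<theta>) ^ n)"
      by (rule complex_norm_square)
    also have "\<dots> = (\<Sum>n<N. \<Sum>m<N. A n m * cis (of_int (int n - int m) * \<theta>))"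
      unfolding cnj_sum sum_product t ..
    finally show ?thesis by (metis Re_complex_of_real)
  qed
  moreover have "Re (\<Sum>n<N. \<Sum>m<N. A n m * (if int n - int m = 0 then 2 * of_real pi else 0)) =
      2 * pi * (\<Sum>n<N. (cmod (c n))\<^sup>2 * \<rho> ^ (2 * n))"
  proof -
    have "(\<Sum>m<N. A n m * (if int n - int m = 0 then 2 * of_real pi else 0)) = of_real (2 * pi * ((cmod (c n))\<^sup>2 * \<rho> ^ (2 * n)))" if "n < N" for n
    proof -
      have "(\<Sum>m<N. A n m * (if int n - int m = 0 then 2 * of_real pi else 0)) = (\<Sum>m<N. if n = m then A n m * (2 * of_real pi) else 0)"
        by (intro sum.cong) auto
      also have "\<dots> = A n n * (2 * of_real pi)" using that by simp
      also have "A n n = of_real ((cmod (c n))\<^sup>2 * \<rho> ^ (2 * n))"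
        unfolding A_def complex_norm_square[symmetric] by (simp add: mult_2)
      finally show ?thesis by simp
    qed
    then have "(\<Sum>n<N. \<Sum>m<N. A n m * (if int n - int m = 0 then 2 * of_real pi else 0)) =
      of_real (\<Sum>n<N. 2 * pi * ((cmod (c n))\<^sup>2 * \<rho> ^ (2 * n)))" unfolding of_real_sum by (intro sum.cong) auto
    then show ?thesis by (simp only: Re_complex_of_real sum_distrib_left)
  qed
  ultimately show ?thesis by simp
qed

text \<open>The identity for polynomials passes to the limit, since the Taylor polynomials converge
  uniformly on the circle and \<open>h\<close> is bounded there.\<close>

lemma Parseval:
  assumes h: "h holomorphic_on ball 0 R" and \<rho>: "0 \<le> \<rho>" "\<rho> < R"
  shows "(\<lambda>n. 2 * pi * ((cmod (taylor_coeff h n))\<^sup>2 * \<rho> ^ (2 * n))) sums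
    integral {-pi..pi} (\<lambda>\<theta>. (cmod (h (of_real \<rho> * cis \<theta>)))\<^sup>2)"
proof -
  define q where "q N z = (\<Sum>n<N. taylor_coeff h n * z ^ n)" for N z
  have u: "uniform_limit {-pi..pi} (\<lambda>N \<theta>. q N (of_real \<rho> * cis \<theta>)) (\<lambda>\<theta>. h (of_real \<rho> * cis \<theta>)) sequentially"
    unfolding uniform_limit_iff
  proof (intro allI impI)
    fix e :: real assume "e > 0"
    then have "\<forall>\<^sub>F N in sequentially. \<forall>z\<in>cball 0 \<rho>. dist (q N z) (h z) < e"
      using taylor_uniform_limit[OF h \<rho>] unfolding uniform_limit_iff q_def by blast
    then show "\<forall>\<^sub>F N in sequentially. \<forall>\<theta>\<in>{-pi..pi}. dist (q N (of_real \<rho> * cis \<theta>)) (h (of_real \<rho> * cis \<theta>)) < e"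
      by eventually_elim (use \<rho> in \<open>auto simp: norm_mult\<close>)
  qed
  have ch: "continuous_on {-pi..pi} (\<lambda>\<theta>. h (of_real \<rho> * cis \<theta>))"
    using \<rho> by (intro continuous_on_compose2[OF holomorphic_on_imp_continuous_on[OF h]] continuous_intros) (auto simp: norm_mult)
  have bd: "bounded ((\<lambda>\<theta>. cmod (h (of_real \<rho> * cis \<theta>))) ` {-pi..pi})"
    by (intro compact_imp_bounded compact_continuous_image continuous_intros ch) simp
  have un: "uniform_limit {-pi..pi} (\<lambda>N \<theta>. cmod (q N (of_real \<rho> * cis \<theta>))) (\<lambda>\<theta>. cmod (h (of_real \<rho> * cis \<theta>))) sequentially"
    by (intro uniform_limit_intros u)
  have "uniform_limit {-pi..pi} (\<lambda>N \<theta>. (cmod (q N (of_real \<rho> * cis \<theta>)))\<^sup>2) (\<lambda>\<theta>. (cmod (h (of_real \<rho> * cis \<theta>)))\<^sup>2) sequentially"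
    unfolding power2_eq_square by (rule uniform_lim_mult[OF un un bd bd])
  then obtain I J where IJ: "\<And>N. ((\<lambda>\<theta>. (cmod (q N (of_real \<rho> * cis \<theta>)))\<^sup>2) has_integral I N) {-pi..pi}"
    "((\<lambda>\<theta>. (cmod (h (of_real \<rho> * cis \<theta>)))\<^sup>2) has_integral J) {-pi..pi}" "I \<longlonglongrightarrow> J"
    by (rule uniform_limit_integral) (auto simp: q_def intro!: continuous_intros)
  have "I = (\<lambda>N. \<Sum>n<N. 2 * pi * ((cmod (taylor_coeff h n))\<^sup>2 * \<rho> ^ (2 * n)))"
    using has_integral_unique[OF IJ(1)[unfolded q_def] Parseval_polynomial] by (simp add: fun_eq_iff sum_distrib_left)
  then show ?thesis using IJ(3) by (simp add: sums_def integral_unique[OF IJ(2)])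
qed

text \<open>A truncated Parseval series is a lower bound on each circle, and a finite sum can be
  integrated over the radius term by term.\<close>

lemma disk_integral_lower_bound:
  assumes H: "H holomorphic_on ball 0 R" and s: "0 < s" "s < R"
  shows "(\<Sum>n<N. pi * (cmod (taylor_coeff H n))\<^sup>2 * s ^ (2 * n + 2) / (real n + 1)) \<le>
    integral {0..s} (\<lambda>\<rho>. integral {-pi..pi} (\<lambda>\<theta>. \<rho> * (cmod (H (of_real \<rho> * cis \<theta>)))\<^sup>2))"
proof -
  have c: "continuous_on {0..s} (\<lambda>\<rho>. integral (cbox (-pi) pi) (\<lambda>\<theta>. \<rho> * (cmod (H (of_real \<rho> * cis \<theta>)))\<^sup>2))"
    using s by (intro integral_continuous_on_param)
      (auto simp: split_beta norm_mult intro!: continuous_intros continuous_on_compose2[OF holomorphic_on_imp_continuous_on[OF H]])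
  define c' where "c' n = 2 * pi * (cmod (taylor_coeff H n))\<^sup>2" for n
  have "((\<lambda>\<rho>. \<Sum>n<N. c' n * \<rho> ^ (2 * n + 1)) has_integral (\<Sum>n<N. c' n * (s ^ (2 * n + 2) / (2 * n + 2) - 0 ^ (2 * n + 2) / (2 * n + 2)))) {0..s}"
  proof (intro has_integral_sum has_integral_mult_right)
    fix n :: nat
    show "((\<lambda>\<rho>. \<rho> ^ (2 * n + 1)) has_integral s ^ (2 * n + 2) / (2 * n + 2) - 0 ^ (2 * n + 2) / (2 * n + 2)) {0..s}"
    proof (rule fundamental_theorem_of_calculus)
      fix x
      have "((\<lambda>\<rho>. \<rho> ^ (2 * n + 2) / (2 * n + 2)) has_real_derivative x ^ (2 * n + 1)) (at x)"
      proof -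
        have e: "2 * n + 2 = Suc (2 * n + 1)" "2 * real n + 2 = real (Suc (2 * n + 1))" by simp_all
        have "((\<lambda>\<rho>. \<rho> ^ Suc m / real (Suc m)) has_real_derivative x ^ m) (at x)" for m
          using DERIV_cdivide[OF DERIV_pow[of "Suc m" x], of "real (Suc m)"] by (simp del: of_nat_Suc power_Suc)
        then show ?thesis by (simp only: e)
      qed
      then show "((\<lambda>\<rho>. \<rho> ^ (2 * n + 2) / (2 * n + 2)) has_vector_derivative x ^ (2 * n + 1)) (at x within {0..s})"
        using has_real_derivative_iff_has_vector_derivative has_vector_derivative_at_within by blast
    qed (use s in simp)
  qed simp
  moreover have "(\<Sum>n<N. c' n * (s ^ (2 * n + 2) / (2 * n + 2) - 0 ^ (2 * n + 2) / (2 * n + 2))) =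
     (\<Sum>n<N. pi * (cmod (taylor_coeff H n))\<^sup>2 * s ^ (2 * n + 2) / (real n + 1))"
    by (intro sum.cong) (auto simp: c'_def field_simps)
  ultimately have i: "((\<lambda>\<rho>. \<Sum>n<N. c' n * \<rho> ^ (2 * n + 1)) has_integral
     (\<Sum>n<N. pi * (cmod (taylor_coeff H n))\<^sup>2 * s ^ (2 * n + 2) / (real n + 1))) {0..s}" by simp
  have "(\<Sum>n<N. c' n * \<rho> ^ (2 * n + 1)) \<le> integral {-pi..pi} (\<lambda>\<theta>. \<rho> * (cmod (H (of_real \<rho> * cis \<theta>)))\<^sup>2)" if "\<rho> \<in> {0..s}" for \<rho>
  proof -
    have \<rho>: "0 \<le> \<rho>" "\<rho> < R" using that s by auto
    have "(\<Sum>n<N. 2 * pi * ((cmod (taylor_coeff H n))\<^sup>2 * \<rho> ^ (2 * n))) \<le> integral {-pi..pi} (\<lambda>\<theta>. (cmod (H (of_real \<rho> * cis \<theta>)))\<^sup>2)"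
      using Parseval[OF H \<rho>] \<rho> by (metis (no_types, lifting) sum_le_suminf sums_iff finite_lessThan mult_nonneg_nonneg pi_ge_zero zero_le_numeral zero_le_power zero_le_power2)
    then have "\<rho> * (\<Sum>n<N. 2 * pi * ((cmod (taylor_coeff H n))\<^sup>2 * \<rho> ^ (2 * n))) \<le> \<rho> * integral {-pi..pi} (\<lambda>\<theta>. (cmod (H (of_real \<rho> * cis \<theta>)))\<^sup>2)"
      using \<rho>(1) by (rule mult_left_mono)
    then show ?thesis by (simp add: c'_def sum_distrib_left algebra_simps)
  qed
  then show ?thesis
    using c i by (intro has_integral_le[OF i integrable_integral]) (auto intro!: integrable_continuous_interval)
qed

lemma taylor_coeff_deriv: "taylor_coeff (deriv h) n = of_nat (Suc n) * taylor_coeff h (Suc n)"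
proof -
  have "(deriv ^^ n) (deriv h) = (deriv ^^ Suc n) h" by (simp only: funpow_Suc_right o_apply)
  then show ?thesis by (simp add: taylor_coeff_def fact_Suc del: funpow.simps of_nat_Suc)
qed

text \<open>The area is the integral of \<open>|h'|^2\<close>, and orthogonality of the powers turns
  it into \<open>\<pi>\<close> times the sum of \<open>n |a_n|^2 s^(2n)\<close>. The index is
  shifted by one, because coefficient \<open>n\<close> of \<open>h'\<close> is
  \<open>(n + 1)\<close> times coefficient \<open>n + 1\<close> of \<open>h\<close>.\<close>

lemma area_lower_bound:
  assumes h: "h holomorphic_on ball 0 R" and s: "0 < s" "s < R" and inj: "inj_on h (ball 0 s)"
  shows "of_complex ` h ` ball 0 s \<in> lmeasurable"
    "(\<Sum>n<N. pi * (real (Suc n) * (cmod (taylor_coeff h (Suc n)))\<^sup>2) * s ^ (2 * n + 2)) \<le> measure lebesgue (of_complex ` h ` ball 0 s)"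
proof -
  have sub: "ball 0 s \<subseteq> (ball 0 R :: complex set)" "cball 0 s \<subseteq> (ball 0 R :: complex set)" using s by auto
  have op: "open (h ` ball 0 s)"
    by (rule open_mapping_thm3[OF holomorphic_on_subset[OF h sub(1)] open_ball inj])
  have "compact (h ` cball 0 s)"
    by (intro compact_continuous_image holomorphic_on_imp_continuous_on holomorphic_on_subset[OF h sub(2)]) simp
  then have "bounded (h ` ball 0 s)" by (rule bounded_subset[OF compact_imp_bounded]) auto
  then have bd: "bounded (of_complex ` h ` ball 0 s)"
    using bounded_linear_image bounded_linear_of_complex by blast
  have "of_complex ` h ` ball 0 s = to_complex -` (h ` ball 0 s)"
    by (metis (no_types, lifting) bij_betw_def bij_def inj_of_complex surj_to_complex to_of_complex(1) to_of_complex(2) inj_on_inverseI inv_into_f_f bij_vimage_eq_inv_image inv_equality)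
  then have "open (of_complex ` h ` ball 0 s)"
    using open_vimage[OF op smooth_continuous[OF smooth_to_complex]] by simp
  then show lm: "of_complex ` h ` ball 0 s \<in> lmeasurable" using bd by (intro lmeasurable_open)
  let ?I = "(\<lambda>x. of_complex (h (polar x))) ` polar_box s"
  note cov = polar_change_of_variables[OF h s inj continuous_on_const[of _ 1]]
  have Isub: "?I \<subseteq> of_complex ` h ` ball 0 s" by (auto simp: cmod_polar mem_polar_box)
  have Ilm: "?I \<in> lmeasurable"
    using set_lebesgue_integral_eq_integral(1)[OF cov(1)] by (simp add: lmeasurable_iff_integrable_on)
  have "(\<Sum>n<N. pi * (real (Suc n) * (cmod (taylor_coeff h (Suc n)))\<^sup>2) * s ^ (2 * n + 2)) =
     (\<Sum>n<N. pi * (cmod (taylor_coeff (deriv h) n))\<^sup>2 * s ^ (2 * n + 2) / (real n + 1))"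
    by (intro sum.cong) (auto simp: taylor_coeff_deriv norm_mult power_mult_distrib power2_eq_square field_simps simp del: of_nat_Suc, simp_all add: field_simps)
  also have "\<dots> \<le> integral {0..s} (\<lambda>\<rho>. integral {-pi..pi} (\<lambda>\<theta>. \<rho> * (cmod (deriv h (of_real \<rho> * cis \<theta>)))\<^sup>2))"
    by (rule disk_integral_lower_bound[OF holomorphic_deriv[OF h open_ball] s])
  also have "\<dots> = measure lebesgue ?I"
    using cov(2) lmeasure_integral[OF Ilm] by simp
  also have "\<dots> \<le> measure lebesgue (of_complex ` h ` ball 0 s)"
    by (rule measure_mono_fmeasurable[OF Isub _ lm]) (use Ilm in auto)
  finally show "(\<Sum>n<N. pi * (real (Suc n) * (cmod (taylor_coeff h (Suc n)))\<^sup>2) * s ^ (2 * n + 2)) \<le> measure lebesgue (of_complex ` h ` ball 0 s)" .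
qed

section \<open>Asymmetry of conformal images\<close>

lemma measure_ball_real2: "r \<ge> 0 \<Longrightarrow> measure lebesgue (ball (c::real^2) r) = pi * r\<^sup>2"
  using circle_area[of r c] by (simp add: mult.commute)

lemma disk_of_area_translate: "(\<lambda>y. y + x) ` disk_of_area a = ball x (sqrt (a / pi))"
proof -
  have "(\<lambda>y. y + x) = (+) x" by (auto simp: add.commute)
  then have "(\<lambda>y. y + x) ` disk_of_area a = (+) x ` ball 0 (sqrt (a / pi))" by (simp only: disk_of_area_def)
  also have "\<dots> = ball x (sqrt (a / pi))" using ball_translation[of x 0 "sqrt (a / pi)"] by simp
  finally show ?thesis .
qed

lemma fraenkel_asymmetry_le:
  assumes "measure lebesgue \<Omega> = 1"
  shows "fraenkel_asymmetry \<Omega> \<le> measure lebesgue (sym_diff \<Omega> (ball x (sqrt (1 / pi))))"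
proof -
  have "fraenkel_asymmetry \<Omega> = (INF x. measure lebesgue (sym_diff \<Omega> (ball x (sqrt (1 / pi)))))"
    unfolding fraenkel_asymmetry_def assms disk_of_area_translate by simp
  also have "\<dots> \<le> measure lebesgue (sym_diff \<Omega> (ball x (sqrt (1 / pi))))"
    by (rule cINF_lower) (auto intro!: bdd_belowI[of _ 0])
  finally show ?thesis .
qed

lemma fraenkel_asymmetry_nonneg: "fraenkel_asymmetry \<Omega> \<ge> 0"
  unfolding fraenkel_asymmetry_def by (rule cINF_greatest) auto

text \<open>\<open>E\<close> is the part of \<Omega> known to lie in the enlarged disk
  \<open>D'\<close>. Then \<open>\<Omega> - D\<close> is covered by \<open>\<Omega> - E\<close> and
  \<open>D' - D\<close>, and \<open>D - \<Omega>\<close> by \<open>D' - E\<close>; the measure of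
  each of these is a difference of known measures.\<close>

lemma sym_diff_le:
  assumes lm: "\<Omega> \<in> lmeasurable" "D \<in> lmeasurable" "E \<in> lmeasurable" "D' \<in> lmeasurable"
    and m: "measure lebesgue \<Omega> = 1" "measure lebesgue D = 1" and sub: "E \<subseteq> \<Omega>" "E \<subseteq> D'" "D \<subseteq> D'"
  shows "measure lebesgue (sym_diff \<Omega> D) \<le> 2 * (1 - measure lebesgue E) + 2 * (measure lebesgue D' - 1)"
proof -
  note f = fmeasurable.Diff fmeasurable.Un fmeasurable.Int lm
  have 1: "measure lebesgue (sym_diff \<Omega> D) \<le> measure lebesgue (\<Omega> - D) + measure lebesgue (D - \<Omega>)"
    by (intro measure_Un_le) (auto intro!: fmeasurableD f)
  have "measure lebesgue (\<Omega> - D) \<le> measure lebesgue ((\<Omega> - E) \<union> (D' - D))"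
    using sub by (intro measure_mono_fmeasurable) (auto intro!: fmeasurableD f)
  also have "\<dots> \<le> measure lebesgue (\<Omega> - E) + measure lebesgue (D' - D)"
    by (intro measure_Un_le) (auto intro!: fmeasurableD f)
  finally have 2: "measure lebesgue (\<Omega> - D) \<le> measure lebesgue (\<Omega> - E) + measure lebesgue (D' - D)" .
  have 3: "measure lebesgue (D - \<Omega>) \<le> measure lebesgue (D' - E)"
    using sub by (intro measure_mono_fmeasurable) (auto intro!: fmeasurableD f)
  have 4: "measure lebesgue (\<Omega> - E) = 1 - measure lebesgue E"
    "measure lebesgue (D' - D) = measure lebesgue D' - 1"
    "measure lebesgue (D' - E) = measure lebesgue D' - measure lebesgue E"
    using sub m by (simp_all add: measurable_measure_Diff lm fmeasurableD)
  have "measure lebesgue (sym_diff \<Omega> D) \<le> (1 - measure lebesgue E) + (measure lebesgue D' - 1) + (measure lebesgue D' - measure lebesgue E)"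
    using order_trans[OF 1 add_mono[OF 2 3]] unfolding 4 .
  then show ?thesis by (simp add: algebra_simps)
qed

lemma taylor_square_summable:
  assumes "h holomorphic_on ball 0 R" "R > 1"
  shows "summable (\<lambda>n. (cmod (taylor_coeff h n))\<^sup>2)"
  using sums_summable[OF Parseval[OF assms(1), of 1]] assms(2) by simp

text \<open>Each term of the remainder is split by \<open>2 x y \<le> (x / d)^2 + (y d)^2\<close>.
  The coefficients contribute at most \<open>d^3 / (2 d^2)\<close>, the geometric series at most
  \<open>d^2 / 2 * (1 / d)\<close>, so both parts are at most \<open>d / 2\<close>. The exponent 3
  in the hypothesis is the one that balances them.\<close>

lemma affine_approximation:
  assumes h: "h holomorphic_on ball 0 R" "R > 1" and d: "0 < d" "d < 1"
    and small: "(\<Sum>n. (cmod (taylor_coeff h (n + 2)))\<^sup>2) \<le> d ^ 3" and z: "(cmod z)\<^sup>2 \<le> 1 - d"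
  shows "cmod (h z - taylor_coeff h 0 - taylor_coeff h 1 * z) \<le> d"
proof -
  let ?a = "taylor_coeff h"
  have "(cmod z)\<^sup>2 < 1" using z d by linarith
  then have zc: "cmod z < 1" by (simp add: power2_less_imp_less power_less_one_iff abs_square_less_1)
  then have "(\<lambda>n. ?a n * z ^ n) sums h z"
    using holomorphic_power_series[OF h(1), of z] h(2) by (simp add: taylor_coeff_def)
  then have s: "(\<lambda>n. ?a (n + 2) * z ^ (n + 2)) sums (h z - (?a 0 + ?a 1 * z))"
    using sums_split_initial_segment[of "\<lambda>n. ?a n * z ^ n" "h z" 2] by (simp add: numeral_2_eq_2)
  have gs: "(\<lambda>n. ((cmod z)\<^sup>2) ^ n) sums (1 / (1 - (cmod z)\<^sup>2))"
    using zc by (intro geometric_sums) (simp add: abs_square_less_1)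
  have b: "cmod (?a (n + 2) * z ^ (n + 2)) \<le> (cmod (?a (n + 2)))\<^sup>2 / (2 * d\<^sup>2) + d\<^sup>2 / 2 * ((cmod z)\<^sup>2) ^ n" for n
  proof -
    define x where "x = cmod (?a (n + 2))"
    define y where "y = cmod z ^ (n + 2)"
    have "2 * (x / d) * (y * d) \<le> (x / d)\<^sup>2 + (y * d)\<^sup>2" by (rule sum_squares_bound)
    then have "x * y \<le> x\<^sup>2 / (2 * d\<^sup>2) + d\<^sup>2 / 2 * y\<^sup>2" using d by (simp add: power_divide power_mult_distrib field_simps)
    also have "y\<^sup>2 \<le> ((cmod z)\<^sup>2) ^ n"
    proof -
      have "y\<^sup>2 = ((cmod z)\<^sup>2) ^ (n + 2)" by (simp only: y_def power_mult[symmetric] mult.commute)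
      also have "\<dots> \<le> ((cmod z)\<^sup>2) ^ n" using zc by (intro power_decreasing) (auto simp: power_le_one)
      finally show ?thesis .
    qed
    finally show ?thesis using d by (simp add: x_def y_def norm_mult norm_power mult_left_mono)
  qed
  have sa: "summable (\<lambda>n. (cmod (?a (n + 2)))\<^sup>2)"
    using taylor_square_summable[OF h] by (subst summable_iff_shift)
  have sb: "(\<lambda>n. (cmod (?a (n + 2)))\<^sup>2 / (2 * d\<^sup>2) + d\<^sup>2 / 2 * ((cmod z)\<^sup>2) ^ n) sums
      ((\<Sum>n. (cmod (?a (n + 2)))\<^sup>2) / (2 * d\<^sup>2) + d\<^sup>2 / 2 * (1 / (1 - (cmod z)\<^sup>2)))"
    by (intro sums_add sums_divide sums_mult gs summable_sums sa)
  have "cmod (h z - (?a 0 + ?a 1 * z)) \<le> (\<Sum>n. (cmod (?a (n + 2)))\<^sup>2) / (2 * d\<^sup>2) + d\<^sup>2 / 2 * (1 / (1 - (cmod z)\<^sup>2))"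
    using norm_suminf_le[OF b sums_summable[OF sb]] s sb by (simp add: sums_iff)
  also have "\<dots> \<le> d ^ 3 / (2 * d\<^sup>2) + d\<^sup>2 / 2 * (1 / d)"
    using small z d by (intro add_mono divide_right_mono mult_left_mono divide_left_mono) auto
  also have "\<dots> = d" using d by (simp add: power2_eq_square power3_eq_cube)
  finally show ?thesis by (simp add: algebra_simps)
qed

text \<open>The deficit \<open>\<delta>\<close> bounds all coefficients beyond \<open>a\<^sub>1\<close>. With \<open>d = \<delta>\<^bsup>1/3\<^esup>\<close>, the map is affine up to
  an error \<open>d\<close> on the disk of squared radius \<open>1 - d\<close>, which traps a set of area
  \<open>1 - O(d)\<close> inside a disk of radius \<open>O(d)\<close> too large.\<close>

lemma asymmetry_of_conformal_image:
  assumes h: "h holomorphic_on ball 0 R" "R > 1" "inj_on h (ball 0 1)"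
    and \<Omega>: "open \<Omega>" "bounded \<Omega>" "measure lebesgue \<Omega> = 1" "of_complex ` h ` ball 0 1 \<subseteq> \<Omega>"
  shows "(\<Sum>n. (cmod (taylor_coeff h (Suc n)))\<^sup>2) \<le> 1 / pi - (fraenkel_asymmetry \<Omega> / 43) ^ 3"
proof -
  define b where "b n = (cmod (taylor_coeff h (Suc n)))\<^sup>2" for n
  have b0: "b n \<ge> 0" for n by (simp add: b_def)
  have bs: "summable b" unfolding b_def using taylor_square_summable[OF h(1,2)] by (subst summable_Suc_iff)
  have \<Omega>lm: "\<Omega> \<in> lmeasurable" using \<Omega> by (intro lmeasurable_open)
  have area: "(\<Sum>n<N. real (Suc n) * b n) \<le> 1 / pi" for N
  proof -
    have "(\<Sum>n<N. pi * (real (Suc n) * b n)) \<le> measure lebesgue (of_complex ` h ` ball 0 1)"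
      using area_lower_bound(2)[OF h(1) _ h(2,3), of N] by (simp add: b_def)
    also have "\<dots> \<le> measure lebesgue \<Omega>"
      using area_lower_bound(1)[OF h(1) _ h(2,3)] by (intro measure_mono_fmeasurable \<Omega> \<Omega>lm) auto
    also note \<Omega>(3)
    finally show ?thesis unfolding sum_distrib_left[symmetric]
      by (simp add: pos_le_divide_eq mult.commute del: of_nat_Suc)
  qed
  have ws: "summable (\<lambda>n. real (Suc n) * b n)"
    by (rule bounded_imp_summable[of _ "1 / pi"]) (use area[of "Suc _"] b0 in \<open>auto simp: lessThan_Suc_atMost\<close>)
  have T: "(\<Sum>n. real (Suc n) * b n) \<le> 1 / pi" by (rule suminf_le_const[OF ws area])
  define \<delta> where "\<delta> = 1 / pi - suminf b"
  have nb: "(\<lambda>n. real n * b n) = (\<lambda>n. real (Suc n) * b n - b n)" by (auto simp: algebra_simps)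
  have nbs: "summable (\<lambda>n. real n * b n)" unfolding nb by (intro summable_diff ws bs)
  \<comment> \<open>Area at most 1 bounds the sum of \<open>(n + 1) * b n\<close> by
    \<open>1 / \<pi>\<close>; subtracting the sum of \<open>b n\<close> leaves the deficit. The
    weight \<open>n\<close> kills only the term \<open>b 0\<close>, so the deficit controls every
    coefficient beyond the linear one.\<close>
  have nbT: "(\<Sum>n. real n * b n) \<le> \<delta>" unfolding nb using suminf_diff[OF ws bs] T by (simp add: \<delta>_def)
  have bs1: "summable (\<lambda>n. b (Suc n))" using bs by (subst summable_Suc_iff)
  have tail: "(\<Sum>n. b (Suc n)) \<le> \<delta>"
  proof -
    have "(\<Sum>n. b (Suc n)) \<le> (\<Sum>n. real (Suc n) * b (Suc n))"
    proof (rule suminf_le[OF _ bs1])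
      show "summable (\<lambda>n. real (Suc n) * b (Suc n))" using nbs by (subst (asm) summable_Suc_iff[symmetric])
      show "b (Suc n) \<le> real (Suc n) * b (Suc n)" for n using b0[of "Suc n"] by (simp add: algebra_simps)
    qed
    also have "\<dots> = (\<Sum>n. real n * b n)" using suminf_split_head[OF nbs] by simp
    finally show ?thesis using nbT by linarith
  qed
  have \<delta>0: "\<delta> \<ge> 0" using order_trans[OF suminf_nonneg[OF bs1 b0] tail] .
  \<comment> \<open>The whole sum is \<open>1 / \<pi> - \<delta>\<close>, and the tail takes at most
    one more \<open>\<delta>\<close>.\<close>
  have head: "b 0 \<ge> 1 / pi - 2 * \<delta>" using suminf_split_head[OF bs] tail by (simp add: \<delta>_def)
  have b0le: "b 0 \<le> 1 / pi" using area[of 1] by simp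
  define R0 where "R0 = sqrt (1 / pi)"
  have R0: "0 < R0" "R0 \<le> 1" "pi * R0\<^sup>2 = 1" using pi_gt3 by (auto simp: R0_def)
  have bound: "fraenkel_asymmetry \<Omega> \<le> 42 * d" if d: "0 < d" "d < 1" "\<delta> \<le> d ^ 3" for d
  proof -
    define s where "s = sqrt (1 - d)"
    have s1: "0 < s" "s < 1" "s\<^sup>2 = 1 - d" using d by (simp_all add: s_def)
    then have s: "0 < s" "s < 1" "s < R" "s\<^sup>2 = 1 - d" using h(2) by simp_all
    define c where "c = of_complex (taylor_coeff h 0)"
    define E where "E = of_complex ` h ` ball 0 s"
    have inj: "inj_on h (ball 0 s)" using s by (intro inj_on_subset[OF h(3)]) auto
    note al = area_lower_bound[OF h(1) s(1,3) inj]
    have a1: "cmod (taylor_coeff h 1) \<le> R0"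
      using b0le unfolding b_def R0_def by (intro real_le_rsqrt) simp
    have Esub: "E \<subseteq> ball c (R0 + d)"
    proof
      fix x assume "x \<in> E"
      then obtain z where z: "x = of_complex (h z)" "cmod z < s" by (auto simp: E_def)
      have "(cmod z)\<^sup>2 \<le> s\<^sup>2" using z by (intro power_mono) auto
      then have ap: "cmod (h z - taylor_coeff h 0 - taylor_coeff h 1 * z) \<le> d"
        using tail d(3) s(4) by (intro affine_approximation[OF h(1,2) d(1,2)]) (auto simp: b_def numeral_2_eq_2)
      have "cmod (taylor_coeff h 1 * z) \<le> R0 * cmod z" unfolding norm_mult using a1 by (intro mult_right_mono) auto
      also have "\<dots> < R0 * 1" using z(2) s(2) R0(1) by (intro mult_strict_left_mono) auto
      finally have "cmod (taylor_coeff h 1 * z) < R0" by simp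
      then have "cmod (h z - taylor_coeff h 0) < R0 + d"
        using norm_triangle_ineq[of "h z - taylor_coeff h 0 - taylor_coeff h 1 * z" "taylor_coeff h 1 * z"] ap by simp
      moreover have "dist x c = cmod (h z - taylor_coeff h 0)"
        unfolding z(1) c_def dist_norm by (metis linear_of_complex linear_diff norm_of_complex)
      ultimately show "x \<in> ball c (R0 + d)" by (simp add: dist_commute)
    qed
    have "pi * b 0 * s\<^sup>2 \<le> measure lebesgue E"
      using al(2)[of 1] by (simp add: b_def E_def power2_eq_square[of s])
    moreover have "pi * b 0 \<ge> 1 - 2 * pi * d ^ 3"
    proof -
      have "b 0 \<ge> 1 / pi - 2 * d ^ 3" using head d(3) by linarith
      then have "pi * b 0 \<ge> pi * (1 / pi - 2 * d ^ 3)" by (intro mult_left_mono) auto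
      then show ?thesis by (simp add: algebra_simps)
    qed
    then have "pi * b 0 * s\<^sup>2 \<ge> (1 - 2 * pi * d ^ 3) * s\<^sup>2" by (intro mult_right_mono) auto
    moreover have "(1 - 2 * pi * d ^ 3) * s\<^sup>2 \<ge> 1 - 2 * pi * d ^ 3 - d"
      unfolding s(4) using d by (simp add: algebra_simps)
    ultimately have E1: "measure lebesgue E \<ge> 1 - 2 * pi * d ^ 3 - d" by linarith
    have "measure lebesgue (sym_diff \<Omega> (ball c R0)) \<le> 2 * (1 - measure lebesgue E) + 2 * (measure lebesgue (ball c (R0 + d)) - 1)"
    proof (rule sym_diff_le)
      have "E \<subseteq> of_complex ` h ` ball 0 1" unfolding E_def using s(2) by (intro image_mono) auto
      then show "E \<subseteq> \<Omega>" using \<Omega>(4) by blast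
      show "measure lebesgue (ball c R0) = 1" using R0 measure_ball_real2[of R0 c] by simp
      show "ball c R0 \<subseteq> ball c (R0 + d)" using d(1) by (intro subset_ball) simp
    qed (use al(1) Esub \<Omega> \<Omega>lm in \<open>auto simp: E_def\<close>)
    also have "measure lebesgue (ball c (R0 + d)) = 1 + 2 * pi * R0 * d + pi * d\<^sup>2"
      using R0 d(1) measure_ball_real2[of "R0 + d" c] by (simp add: power2_sum distrib_left)
    finally have "fraenkel_asymmetry \<Omega> \<le> 2 * (1 - measure lebesgue E) + 2 * (1 + 2 * pi * R0 * d + pi * d\<^sup>2 - 1)"
      by (rule order_trans[OF fraenkel_asymmetry_le[OF \<Omega>(3), of c, folded R0_def]])
    also have "\<dots> \<le> 2 * (2 * pi * d ^ 3 + d) + 2 * (1 + 2 * pi * R0 * d + pi * d\<^sup>2 - 1)"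
    proof (intro add_right_mono mult_left_mono)
      show "1 - measure lebesgue E \<le> 2 * pi * d ^ 3 + d" using E1 by simp
    qed simp
    also have "\<dots> = 4 * pi * d ^ 3 + 2 * d + 4 * pi * R0 * d + 2 * pi * d\<^sup>2" by (simp add: algebra_simps)
    finally have "fraenkel_asymmetry \<Omega> \<le> 4 * pi * d ^ 3 + 2 * d + 4 * pi * R0 * d + 2 * pi * d\<^sup>2" .
    \<comment> \<open>From \<open>\<pi> < 4\<close>, \<open>R0 \<le> 1\<close> and
      \<open>d < 1\<close>, each term is at most a multiple of \<open>d\<close>; the coefficients
      add up to 42.\<close>
    also have "\<dots> \<le> 16 * d + 2 * d + 16 * d + 8 * d"
    proof (intro add_mono)
      have "d ^ 3 \<le> d" using d power_decreasing[of 1 3 d] by simp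
      then show "4 * pi * d ^ 3 \<le> 16 * d" using pi_less_4 d by (intro mult_mono) auto
      have "pi * R0 \<le> 4 * 1" using pi_less_4 R0 by (intro mult_mono) auto
      then show "4 * pi * R0 * d \<le> 16 * d" using d by (intro mult_right_mono) (auto simp: mult.commute)
      have "d\<^sup>2 \<le> d" using d power_decreasing[of 1 2 d] by simp
      then show "2 * pi * d\<^sup>2 \<le> 8 * d" using pi_less_4 d by (intro mult_mono) auto
    qed simp
    finally show ?thesis by simp
  qed
  \<comment> \<open>This makes one 43rd of the asymmetry smaller than 1, as \<open>bound\<close>
    demands of \<open>d\<close>.\<close>
  have le2: "fraenkel_asymmetry \<Omega> \<le> 2"
  proof -
    have "measure lebesgue (sym_diff \<Omega> (ball 0 R0)) \<le> measure lebesgue (\<Omega> - ball 0 R0) + measure lebesgue (ball 0 R0 - \<Omega>)"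
      using \<Omega>lm by (intro measure_Un_le) auto
    also have "\<dots> \<le> measure lebesgue \<Omega> + measure lebesgue (ball (0::real^2) R0)"
      using \<Omega>lm by (intro add_mono measure_mono_fmeasurable) auto
    also have "\<dots> = 2" using \<Omega>(3) R0 measure_ball_real2[of R0 0] by simp
    finally show ?thesis by (rule order_trans[OF fraenkel_asymmetry_le[OF \<Omega>(3), of 0, folded R0_def]])
  qed
  have "\<delta> \<ge> (fraenkel_asymmetry \<Omega> / 43) ^ 3"
  proof (cases "fraenkel_asymmetry \<Omega> = 0")
    case True then show ?thesis using \<delta>0 by simp
  next
    case False
    then have pos: "fraenkel_asymmetry \<Omega> > 0" using fraenkel_asymmetry_nonneg[of \<Omega>] by linarith
    show ?thesis
    proof (rule ccontr)
      assume "\<not> ?thesis"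
      \<comment> \<open>A deficit below the cube of \<open>d\<close>, with \<open>d\<close> one 43rd
        of the asymmetry, would give at most \<open>42 / 43\<close> of the asymmetry as its own
        bound. The number 43 is simply the next integer after 42.\<close>
      then have "fraenkel_asymmetry \<Omega> \<le> 42 * (fraenkel_asymmetry \<Omega> / 43)"
        using pos le2 by (intro bound) auto
      then show False using pos by simp
    qed
  qed
  then show ?thesis by (simp add: \<delta>_def b_def[abs_def])
qed

section \<open>The lower bound\<close>

text \<open>\<open>|H + 1|^2 - |H|^2 = 2 Re H + 1\<close>, and adding 1 changes only the Taylor
  coefficient of order 0. The difference of the two Parseval identities is therefore the mean value
  property.\<close>

lemma mean_value_Re:
  assumes H: "H holomorphic_on ball 0 R" "R > 1"
  shows "integral {-pi..pi} (\<lambda>\<theta>. Re (H (cis \<theta>))) = 2 * pi * Re (H 0)"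
proof -
  let ?H1 = "\<lambda>z. H z + 1"
  have H1: "?H1 holomorphic_on ball 0 R" by (intro holomorphic_intros H)
  have cH: "continuous_on {-pi..pi} (\<lambda>\<theta>. H (cis \<theta>))"
    using H(2) by (intro continuous_on_compose2[OF holomorphic_on_imp_continuous_on[OF H(1)]] continuous_intros) auto
  have coeff: "taylor_coeff ?H1 n = taylor_coeff H n + (if n = 0 then 1 else 0)" for n
  proof -
    have "(deriv ^^ n) (\<lambda>z. H z + (\<lambda>_. 1) z) 0 = (deriv ^^ n) H 0 + (deriv ^^ n) (\<lambda>_. 1) 0"
      using H by (intro higher_deriv_add[where S = "ball 0 R"]) auto
    moreover have "(deriv ^^ n) (\<lambda>_. 1 :: complex) 0 = (if n = 0 then 1 else 0)"
      by (simp add: higher_deriv_const)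
    ultimately show ?thesis by (auto simp: taylor_coeff_def add_divide_distrib)
  qed
  have "(\<lambda>n. 2 * pi * ((cmod (taylor_coeff ?H1 n))\<^sup>2 * 1 ^ (2 * n)) - 2 * pi * ((cmod (taylor_coeff H n))\<^sup>2 * 1 ^ (2 * n))) sums
    (integral {-pi..pi} (\<lambda>\<theta>. (cmod (?H1 (of_real 1 * cis \<theta>)))\<^sup>2) - integral {-pi..pi} (\<lambda>\<theta>. (cmod (H (of_real 1 * cis \<theta>)))\<^sup>2))"
    using H(2) by (intro sums_diff Parseval[OF H1] Parseval[OF H(1)]) auto
  moreover have "2 * pi * ((cmod (taylor_coeff ?H1 n))\<^sup>2 * 1 ^ (2 * n)) - 2 * pi * ((cmod (taylor_coeff H n))\<^sup>2 * 1 ^ (2 * n)) =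
      (if n = 0 then 2 * pi * (2 * Re (H 0) + 1) else 0)" for n
  proof (cases "n = 0")
    case True
    have "(cmod (w + 1))\<^sup>2 - (cmod w)\<^sup>2 = 2 * Re w + 1" for w
      unfolding cmod_power2 by (simp add: power2_eq_square algebra_simps)
    then show ?thesis using True unfolding coeff by (simp add: taylor_coeff_def right_diff_distrib[symmetric])
  qed (simp add: coeff)
  ultimately have "(\<lambda>n. if n = 0 then 2 * pi * (2 * Re (H 0) + 1) else 0) sums
    (integral {-pi..pi} (\<lambda>\<theta>. (cmod (H (cis \<theta>) + 1))\<^sup>2) - integral {-pi..pi} (\<lambda>\<theta>. (cmod (H (cis \<theta>)))\<^sup>2))"
    by simp
  moreover have "(\<lambda>n. if n = 0 then 2 * pi * (2 * Re (H 0) + 1) else 0) sums (2 * pi * (2 * Re (H 0) + 1))"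
    using sums_If_finite_set[of "{0::nat}" "\<lambda>_. 2 * pi * (2 * Re (H 0) + 1)"] by simp
  ultimately have 1: "integral {-pi..pi} (\<lambda>\<theta>. (cmod (H (cis \<theta>) + 1))\<^sup>2) - integral {-pi..pi} (\<lambda>\<theta>. (cmod (H (cis \<theta>)))\<^sup>2)
      = 2 * pi * (2 * Re (H 0) + 1)"
    using sums_unique2 by blast
  have "integral {-pi..pi} (\<lambda>\<theta>. (cmod (H (cis \<theta>) + 1))\<^sup>2) - integral {-pi..pi} (\<lambda>\<theta>. (cmod (H (cis \<theta>)))\<^sup>2)
      = integral {-pi..pi} (\<lambda>\<theta>. (cmod (H (cis \<theta>) + 1))\<^sup>2 - (cmod (H (cis \<theta>)))\<^sup>2)"
    by (intro Henstock_Kurzweil_Integration.integral_diff[symmetric] integrable_continuous_interval continuous_intros cH)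
  also have "\<dots> = integral {-pi..pi} (\<lambda>\<theta>. 2 * Re (H (cis \<theta>)) + 1)"
    by (intro Henstock_Kurzweil_Integration.integral_cong) (simp add: cmod_power2, simp add: power2_eq_square algebra_simps)
  also have "\<dots> = 2 * integral {-pi..pi} (\<lambda>\<theta>. Re (H (cis \<theta>))) + 2 * pi"
  proof -
    have "((\<lambda>\<theta>. 2 * Re (H (cis \<theta>)) + 1) has_integral (2 * integral {-pi..pi} (\<lambda>\<theta>. Re (H (cis \<theta>))) + 2 * pi)) {-pi..pi}"
      using has_integral_const_real[of "1::real" "-pi" pi]
      by (intro has_integral_add has_integral_mult_right integrable_integral integrable_continuous_interval continuous_intros cH) simp
    then show ?thesis by (rule integral_unique)
  qed
  finally show ?thesis using 1 by (simp add: algebra_simps)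
qed

text \<open>On the unit circle \<open>cnj z = 1 / z\<close>, so the squared modulus of a polynomial is a trigonometric
  polynomial and has an explicit holomorphic extension.\<close>

lemma circle_majorant_polynomial:
  fixes b :: "nat \<Rightarrow> complex"
  shows "\<exists>G. G holomorphic_on UNIV \<and> (\<forall>z. cmod z = 1 \<longrightarrow> Re (G z) = (cmod (\<Sum>n<N. b n * z ^ n))\<^sup>2)"
proof -
  \<comment> \<open>On the circle a product with \<open>n < m\<close> would have the negative degree
    \<open>n - m\<close>. It is replaced by its conjugate, which keeps the real part and makes every
    exponent nonnegative.\<close>
  define G where "G z = (\<Sum>n<N. \<Sum>m<N. if m \<le> n then b n * cnj (b m) * z ^ (n - m) else b m * cnj (b n) * z ^ (m - n))" for z
  have "G holomorphic_on UNIV"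
    unfolding G_def
  proof (intro holomorphic_on_sum)
    show "(\<lambda>z. if m \<le> n then b n * cnj (b m) * z ^ (n - m) else b m * cnj (b n) * z ^ (m - n)) holomorphic_on UNIV" for n m
      by (cases "m \<le> n") (auto intro!: holomorphic_intros)
  qed
  moreover have "Re (G z) = (cmod (\<Sum>n<N. b n * z ^ n))\<^sup>2" if z: "cmod z = 1" for z
  proof -
    have zc: "z * cnj z = 1" using complex_norm_square[of z] z by simp
    have p: "z ^ n * cnj z ^ m = z ^ (n - m)" if "m \<le> n" for n m
    proof -
      have "z ^ n = z ^ (n - m) * z ^ m" using that by (simp add: power_add[symmetric])
      then have "z ^ n * cnj z ^ m = z ^ (n - m) * (z * cnj z) ^ m" by (simp add: power_mult_distrib)
      then show ?thesis by (simp add: zc)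
    qed
    have t: "Re (if m \<le> n then b n * cnj (b m) * z ^ (n - m) else b m * cnj (b n) * z ^ (m - n)) =
       Re ((b n * z ^ n) * cnj (b m * z ^ m))" for n m
    proof (cases "m \<le> n")
      case True
      have "(b n * z ^ n) * cnj (b m * z ^ m) = b n * cnj (b m) * (z ^ n * cnj z ^ m)" by simp
      then have "b n * cnj (b m) * z ^ (n - m) = (b n * z ^ n) * cnj (b m * z ^ m)" by (simp only: p[OF True])
      then show ?thesis using True by (simp only: if_True)
    next
      case False
      have "cnj ((b n * z ^ n) * cnj (b m * z ^ m)) = b m * cnj (b n) * (z ^ m * cnj z ^ n)" by simp
      then have "cnj ((b n * z ^ n) * cnj (b m * z ^ m)) = b m * cnj (b n) * z ^ (m - n)" using False p[of n m] by simp
      then show ?thesis using False by (metis complex_cnj_cnj cnj.sel(1))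
    qed
    have "of_real ((cmod (\<Sum>n<N. b n * z ^ n))\<^sup>2) = (\<Sum>n<N. b n * z ^ n) * cnj (\<Sum>n<N. b n * z ^ n)"
      by (rule complex_norm_square)
    also have "\<dots> = (\<Sum>n<N. \<Sum>m<N. (b n * z ^ n) * cnj (b m * z ^ m))" by (simp only: cnj_sum sum_product)
    finally have "(cmod (\<Sum>n<N. b n * z ^ n))\<^sup>2 = Re (\<Sum>n<N. \<Sum>m<N. (b n * z ^ n) * cnj (b m * z ^ m))"
      by (metis Re_complex_of_real)
    then show ?thesis by (simp only: G_def Re_sum t)
  qed
  ultimately show ?thesis by blast
qed

text \<open>The identity \<open>id\<close> between squared moduli shows that disk and circle are
  preserved. The radius \<open>R2\<close> beyond 1 matters because Parseval is applied on the unit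
  circle itself to a composition with this map; compactness of the closed disk provides it.\<close>

lemma moebius_properties:
  assumes z0: "cmod z0 < 1" and R: "R > 1"
  defines "M \<equiv> (\<lambda>z. (z + z0) / (1 + cnj z0 * z))"
  shows "\<exists>R2>1. M holomorphic_on ball 0 R2 \<and> M ` ball 0 R2 \<subseteq> ball 0 R"
    "M 0 = z0" "\<And>z. cmod z = 1 \<Longrightarrow> cmod (M z) = 1" "M ` ball 0 1 \<subseteq> ball 0 1" "inj_on M (ball 0 1)"
proof -
  have den: "1 + cnj z0 * z \<noteq> 0" if "cmod z \<le> 1" for z
  proof
    assume "1 + cnj z0 * z = 0"
    then have "cnj z0 * z = -1" by (simp add: add_eq_0_iff)
    then have "cmod z0 * cmod z = 1" by (metis complex_mod_cnj norm_minus_cancel norm_mult norm_one)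
    moreover have "cmod z0 * cmod z \<le> cmod z0 * 1" using that by (intro mult_left_mono) auto
    ultimately show False using z0 by simp
  qed
  have id: "(cmod (1 + cnj z0 * z))\<^sup>2 - (cmod (z + z0))\<^sup>2 = (1 - (cmod z0)\<^sup>2) * (1 - (cmod z)\<^sup>2)" for z
    unfolding cmod_power2 by (simp add: power2_eq_square algebra_simps)
  show "M 0 = z0" by (simp add: M_def)
  show circ: "cmod (M z) = 1" if "cmod z = 1" for z
  proof -
    have "(cmod (1 + cnj z0 * z))\<^sup>2 = (cmod (z + z0))\<^sup>2" using id[of z] that by simp
    then have "cmod (1 + cnj z0 * z) = cmod (z + z0)" by (simp add: power2_eq_iff_nonneg)
    then show ?thesis using den[of z] that by (simp add: M_def norm_divide flip: \<open>cmod (1 + cnj z0 * z) = cmod (z + z0)\<close>)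
  qed
  have disk: "cmod (M z) < 1" if "cmod z < 1" for z
  proof -
    have "(cmod z0)\<^sup>2 < 1" "(cmod z)\<^sup>2 < 1" using z0 that by (simp_all add: abs_square_less_1)
    then have "(1 - (cmod z0)\<^sup>2) * (1 - (cmod z)\<^sup>2) > 0" by simp
    then have "(cmod (z + z0))\<^sup>2 < (cmod (1 + cnj z0 * z))\<^sup>2" using id[of z] by linarith
    then have "cmod (z + z0) < cmod (1 + cnj z0 * z)" by (rule power2_less_imp_less) simp
    then show ?thesis using den[of z] that by (simp add: M_def norm_divide)
  qed
  then show "M ` ball 0 1 \<subseteq> ball 0 1" by auto
  show "inj_on M (ball 0 1)"
  proof (rule inj_onI)
    fix z w assume zw: "z \<in> ball 0 1" "w \<in> ball 0 1" and eq: "M z = M w"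
    have "(z + z0) * (1 + cnj z0 * w) = (w + z0) * (1 + cnj z0 * z)"
      using eq den[of z] den[of w] zw by (simp add: M_def frac_eq_eq)
    then have "(z - w) * (1 - z0 * cnj z0) = 0" by (simp add: algebra_simps)
    moreover have "1 - z0 * cnj z0 \<noteq> 0"
    proof
      assume "1 - z0 * cnj z0 = 0"
      then have "complex_of_real ((cmod z0)\<^sup>2) = 1" unfolding complex_norm_square by simp
      then have "(cmod z0)\<^sup>2 = 1" using of_real_eq_1_iff by blast
      then show False using z0 abs_square_less_1[of "cmod z0"] by simp
    qed
    ultimately show "z = w" by simp
  qed
  define U where "U = {z. 1 + cnj z0 * z \<noteq> 0}"
  have U: "open U" unfolding U_def by (intro open_Collect_neq continuous_intros)
  have MU: "M holomorphic_on U" unfolding M_def by (intro holomorphic_intros) (auto simp: U_def)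
  have "open (U \<inter> M -` ball 0 R)"
    using continuous_open_preimage[OF holomorphic_on_imp_continuous_on[OF MU] U open_ball] .
  moreover have "cball 0 1 \<subseteq> U \<inter> M -` ball 0 R"
  proof
    fix z :: complex assume "z \<in> cball 0 1"
    then have z: "cmod z \<le> 1" by simp
    then have "cmod (M z) \<le> 1" using disk[of z] circ[of z] by (cases "cmod z = 1") auto
    then show "z \<in> U \<inter> M -` ball 0 R" using den[OF z] R by (simp add: U_def)
  qed
  ultimately obtain e where e: "e > 0" "(\<Union>x\<in>cball 0 1. ball x e) \<subseteq> U \<inter> M -` ball 0 R"
    using compact_subset_open_imp_ball_epsilon_subset[OF compact_cball] by metis
  have sub: "ball 0 (1 + e) \<subseteq> U \<inter> M -` ball 0 R"
  proof
    fix z :: complex assume z: "z \<in> ball 0 (1 + e)"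
    show "z \<in> U \<inter> M -` ball 0 R"
    proof (cases "cmod z \<le> 1")
      case True
      then have "z \<in> (\<Union>x\<in>cball 0 1. ball x e)" using e(1) by (intro UN_I[of z]) auto
      then show ?thesis using e(2) by blast
    next
      case False
      \<comment> \<open>A point just outside the closed disk is compared with its radial projection
        \<open>sgn z\<close>.\<close>
      have "dist (sgn z) z = cmod z - 1"
      proof -
        have "z \<noteq> 0" using False by auto
        have "z - sgn z = (1 - 1 / cmod z) *\<^sub>R z" by (simp add: sgn_div_norm algebra_simps divide_inverse)
        then have "cmod (z - sgn z) = \<bar>1 - 1 / cmod z\<bar> * cmod z" by simp
        also have "\<dots> = cmod z - 1" using False \<open>z \<noteq> 0\<close> by (simp add: abs_if field_simps)
        finally show ?thesis by (simp add: dist_norm norm_minus_commute)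
      qed
      then have "z \<in> ball (sgn z) e" using z by simp
      moreover have "sgn z \<in> cball 0 1" by (cases "z = 0") (simp_all add: norm_sgn)
      ultimately show ?thesis using e(2) by blast
    qed
  qed
  show "\<exists>R2>1. M holomorphic_on ball 0 R2 \<and> M ` ball 0 R2 \<subseteq> ball 0 R"
    using sub e(1) by (intro exI[of _ "1 + e"]) (auto intro: holomorphic_on_subset[OF MU])
qed

text \<open>Precomposing with the automorphism of the disk that takes 0 to \<open>z0\<close> turns both
  \<open>Re (G z0)\<close> and \<open>(cmod (f z0))\<^sup>2\<close> into data at the centre. As \<open>p\<close> approximates \<open>f\<close>, the function
  \<open>((cmod (f z0))\<^sup>2 - Re (G z0)) / 4\<close> approximates \<open>\<psi>\<close>.\<close>

lemma conformal_potential_bound: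
  assumes f: "f holomorphic_on ball 0 R" "R > 1" "inj_on f (ball 0 1)"
    and \<Omega>: "open \<Omega>" "bounded \<Omega>" "measure lebesgue \<Omega> = 1" "of_complex ` f ` ball 0 1 \<subseteq> \<Omega>"
    and p: "\<And>z. cmod z = 1 \<Longrightarrow> \<bar>(cmod (p z))\<^sup>2 - (cmod (f z))\<^sup>2\<bar> \<le> \<epsilon>"
    and G: "G holomorphic_on UNIV" "\<And>z. cmod z = 1 \<Longrightarrow> Re (G z) = (cmod (p z))\<^sup>2"
    and z0: "cmod z0 < 1"
  shows "(cmod (f z0))\<^sup>2 - \<epsilon> \<le> Re (G z0)"
    "Re (G z0) \<le> (cmod (f z0))\<^sup>2 + 1 / pi - (fraenkel_asymmetry \<Omega> / 43) ^ 3 + \<epsilon>"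
proof -
  define M where "M = (\<lambda>z. (z + z0) / (1 + cnj z0 * z))"
  note Mp = moebius_properties[OF z0 f(2), folded M_def]
  have M0: "M 0 = z0" by (simp add: M_def)
  have circ: "cmod (M z) = 1" if "cmod z = 1" for z
    unfolding M_def by (rule moebius_properties(3)[OF z0 f(2) that])
  obtain R2 where R2: "R2 > 1" "M holomorphic_on ball 0 R2" "M ` ball 0 R2 \<subseteq> ball 0 R" using Mp(1) by blast
  define h where "h = f \<circ> M"
  have h: "h holomorphic_on ball 0 R2" unfolding h_def
    by (rule holomorphic_on_compose_gen[OF R2(2) f(1) R2(3)])
  have hinj: "inj_on h (ball 0 1)" unfolding h_def
    by (rule comp_inj_on[OF Mp(5) inj_on_subset[OF f(3) Mp(4)]])
  have hsub: "of_complex ` h ` ball 0 1 \<subseteq> \<Omega>"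
    unfolding h_def image_comp[symmetric]
    by (rule subset_trans[OF image_mono[OF image_mono[OF Mp(4)]] \<Omega>(4)])
  have GM: "(G \<circ> M) holomorphic_on ball 0 R2"
    by (rule holomorphic_on_compose_gen[OF R2(2) G(1)]) simp
  have cGM: "continuous_on {-pi..pi} (\<lambda>\<theta>. (G \<circ> M) (cis \<theta>))" and ch: "continuous_on {-pi..pi} (\<lambda>\<theta>. h (cis \<theta>))"
    using R2(1) by (intro continuous_on_compose2[OF holomorphic_on_imp_continuous_on[OF GM]]
      continuous_on_compose2[OF holomorphic_on_imp_continuous_on[OF h]] continuous_intros; auto)+
  \<comment> \<open>The comparison on the circle becomes one at \<open>z0\<close>: the mean of
    \<open>Re G\<close> is its value at \<open>M 0 = z0\<close>, and by Parseval the mean of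
    \<open>|h|^2\<close> is \<open>|f z0|^2\<close>, from the coefficient of order 0, plus the sum
    \<open>S1\<close> of the others.\<close>
  have mean: "integral {-pi..pi} (\<lambda>\<theta>. Re ((G \<circ> M) (cis \<theta>))) = 2 * pi * Re (G z0)"
    using mean_value_Re[OF GM R2(1)] by (simp only: o_apply M0)
  define S1 where "S1 = (\<Sum>n. (cmod (taylor_coeff h (Suc n)))\<^sup>2)"
  have sm: "summable (\<lambda>n. (cmod (taylor_coeff h n))\<^sup>2)" by (rule taylor_square_summable[OF h R2(1)])
  have "(\<lambda>n. 2 * pi * (cmod (taylor_coeff h n))\<^sup>2) sums integral {-pi..pi} (\<lambda>\<theta>. (cmod (h (cis \<theta>)))\<^sup>2)"
    using Parseval[OF h, of 1] R2(1) by simp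
  then have "integral {-pi..pi} (\<lambda>\<theta>. (cmod (h (cis \<theta>)))\<^sup>2) = 2 * pi * (\<Sum>n. (cmod (taylor_coeff h n))\<^sup>2)"
    using suminf_mult[OF sm, of "2 * pi"] by (simp add: sums_iff)
  also have "(\<Sum>n. (cmod (taylor_coeff h n))\<^sup>2) = (cmod (f z0))\<^sup>2 + S1"
    using suminf_split_head[OF sm] M0 by (simp add: S1_def taylor_coeff_def h_def)
  finally have Ih: "integral {-pi..pi} (\<lambda>\<theta>. (cmod (h (cis \<theta>)))\<^sup>2) = 2 * pi * ((cmod (f z0))\<^sup>2 + S1)" .
  have near: "\<bar>Re ((G \<circ> M) (cis \<theta>)) - (cmod (h (cis \<theta>)))\<^sup>2\<bar> \<le> \<epsilon>" for \<theta>
    using G(2)[OF circ, of "cis \<theta>"] p[OF circ, of "cis \<theta>"] by (simp add: h_def)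
  have i: "(\<lambda>\<theta>. Re ((G \<circ> M) (cis \<theta>))) integrable_on {-pi..pi}" "(\<lambda>\<theta>. (cmod (h (cis \<theta>)))\<^sup>2) integrable_on {-pi..pi}"
    by (intro integrable_continuous_interval continuous_intros cGM ch)+
  have "((\<lambda>\<theta>. (cmod (h (cis \<theta>)))\<^sup>2 + \<epsilon>) has_integral (2 * pi * ((cmod (f z0))\<^sup>2 + S1) + 2 * pi * \<epsilon>)) {-pi..pi}"
    using has_integral_const_real[of \<epsilon> "-pi" pi] integrable_integral[OF i(2)] unfolding Ih
    by (intro has_integral_add) simp_all
  then have "2 * pi * Re (G z0) \<le> 2 * pi * ((cmod (f z0))\<^sup>2 + S1) + 2 * pi * \<epsilon>"
    unfolding mean[symmetric] using near by (intro has_integral_le[OF integrable_integral[OF i(1)]]) (auto simp: abs_le_iff algebra_simps)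
  then have up: "Re (G z0) \<le> (cmod (f z0))\<^sup>2 + S1 + \<epsilon>" by (simp add: distrib_left[symmetric])
  have "((\<lambda>\<theta>. (cmod (h (cis \<theta>)))\<^sup>2 - \<epsilon>) has_integral (2 * pi * ((cmod (f z0))\<^sup>2 + S1) - 2 * pi * \<epsilon>)) {-pi..pi}"
    using has_integral_const_real[of \<epsilon> "-pi" pi] integrable_integral[OF i(2)] unfolding Ih
    by (intro has_integral_diff) simp_all
  then have "2 * pi * ((cmod (f z0))\<^sup>2 + S1) - 2 * pi * \<epsilon> \<le> 2 * pi * Re (G z0)"
    unfolding mean[symmetric] using near by (intro has_integral_le[OF _ integrable_integral[OF i(1)]]) (auto simp: abs_le_iff algebra_simps)
  then have low: "(cmod (f z0))\<^sup>2 + S1 - \<epsilon> \<le> Re (G z0)" by (simp add: right_diff_distrib[symmetric])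
  have "summable (\<lambda>n. (cmod (taylor_coeff h (Suc n)))\<^sup>2)"
    by (rule iffD2[OF summable_Suc_iff[of "\<lambda>n. (cmod (taylor_coeff h n))\<^sup>2"] sm])
  then have "S1 \<ge> 0" unfolding S1_def by (rule suminf_nonneg) simp
  moreover have "S1 \<le> 1 / pi - (fraenkel_asymmetry \<Omega> / 43) ^ 3"
    unfolding S1_def by (rule asymmetry_of_conformal_image[OF h R2(1) hinj \<Omega>(1-3) hsub])
  ultimately show "(cmod (f z0))\<^sup>2 - \<epsilon> \<le> Re (G z0)"
    "Re (G z0) \<le> (cmod (f z0))\<^sup>2 + 1 / pi - (fraenkel_asymmetry \<Omega> / 43) ^ 3 + \<epsilon>"
    using up low by linarith+
qed

lemma simply_connected_to_complex:
  assumes "simply_connected \<Omega>"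
  shows "simply_connected (to_complex ` \<Omega>)"
proof -
  have "inj to_complex" by (metis injI to_of_complex(2))
  then show ?thesis
    using linear_homeomorphic_image[OF linear_to_complex] homeomorphic_simply_connected_eq assms by blast
qed

lemma Riemann_map:
  assumes \<Omega>: "open \<Omega>" "simply_connected \<Omega>" "bounded \<Omega>" "\<Omega> \<noteq> {}"
  obtains g k where "g holomorphic_on ball 0 1" "k holomorphic_on to_complex ` \<Omega>"
    "\<And>z. z \<in> ball 0 1 \<Longrightarrow> g z \<in> to_complex ` \<Omega> \<and> k (g z) = z"
    "\<And>w. w \<in> to_complex ` \<Omega> \<Longrightarrow> k w \<in> ball 0 1 \<and> g (k w) = w"
proof -
  let ?U = "to_complex ` \<Omega>"
  have "bounded ?U" using bounded_linear_image[OF \<Omega>(3) bounded_linear_to_complex] .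
  then have "?U \<noteq> UNIV" using not_bounded_UNIV by metis
  moreover have "?U \<noteq> {}" using \<Omega>(4) by blast
  moreover have "open ?U \<and> simply_connected ?U"
    using open_to_complex_image[OF \<Omega>(1)] simply_connected_to_complex[OF \<Omega>(2)] by blast
  ultimately have "\<exists>k g. k holomorphic_on ?U \<and> g holomorphic_on ball 0 1 \<and>
           (\<forall>z \<in> ?U. k z \<in> ball 0 1 \<and> g (k z) = z) \<and> (\<forall>z \<in> ball 0 1. g z \<in> ?U \<and> k (g z) = z)"
    unfolding Riemann_mapping_theorem by blast
  then obtain k g where "k holomorphic_on ?U" "g holomorphic_on ball 0 1"
    "\<forall>z \<in> ?U. k z \<in> ball 0 1 \<and> g (k z) = z" "\<forall>z \<in> ball 0 1. g z \<in> ?U \<and> k (g z) = z" by blast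
  then show ?thesis using that by blast
qed

text \<open>The approximation on the circle needs a map analytic on the closed disk, and
  \<open>g\<close> need not extend so far. With \<open>K\<close> the preimage of the support inside
  the disk of radius \<open>r\<close>, the map \<open>f z = g (r z)\<close> extends, and its image
  \<open>\<Omega>'\<close> of the unit disk still contains the support. The asymmetry of \<Omega>
  survives, because \<open>asymmetry_of_conformal_image\<close> asks only for an image inside
  \<Omega>.\<close>

theorem magnetic_form_lower_bound:
  assumes \<Omega>: "open \<Omega>" "simply_connected \<Omega>" "bounded \<Omega>" "measure lebesgue \<Omega> = 1"
    and B: "B \<ge> 0" and \<phi>: "\<phi> \<in> test_functions \<Omega>"
  shows "exp (- 2 * B * ((1 / pi - (fraenkel_asymmetry \<Omega> / 43) ^ 3) / 4)) * (\<integral>x. (cmod (\<phi> x))\<^sup>2 \<partial>lborel)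
    \<le> (\<integral>x. (cmod (mdbar B \<phi> x))\<^sup>2 \<partial>lborel)"
proof -
  let ?U = "to_complex ` \<Omega>"
  define m where "m = (1 / pi - (fraenkel_asymmetry \<Omega> / 43) ^ 3) / 4"
  have ne: "\<Omega> \<noteq> {}" using \<Omega>(4) by auto
  obtain g k where g: "g holomorphic_on ball 0 1" and k: "k holomorphic_on ?U"
    and gk: "\<And>z. z \<in> ball 0 1 \<Longrightarrow> g z \<in> ?U \<and> k (g z) = z" and kg: "\<And>w. w \<in> ?U \<Longrightarrow> k w \<in> ball 0 1 \<and> g (k w) = w"
    using Riemann_map[OF \<Omega>(1,2,3) ne] by metis
  have supp: "compact (tsupp \<phi>)" "tsupp \<phi> \<subseteq> \<Omega>" using \<phi> by (auto simp: test_functions_iff)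
  define K where "K = k ` to_complex ` tsupp \<phi>"
  have "compact K" unfolding K_def
    by (intro compact_continuous_image holomorphic_on_imp_continuous_on[OF holomorphic_on_subset[OF k]]
        smooth_continuous smooth_to_complex supp image_mono)
  moreover have "K \<subseteq> ball 0 1" using kg supp(2) by (auto simp: K_def)
  ultimately obtain r where r: "0 < r" "r < 1" "K \<subseteq> ball 0 r"
  proof -
    obtain e where e: "e > 0" "(\<Union>x\<in>K. ball x e) \<subseteq> ball 0 1"
      using compact_subset_open_imp_ball_epsilon_subset[OF \<open>compact K\<close> open_ball \<open>K \<subseteq> ball 0 1\<close>] by metis
    \<comment> \<open>A point of \<open>K\<close> with modulus at least \<open>1 - e / 2\<close>,
      moved outward by \<open>e / 2\<close>, would leave the unit disk although the
      \<open>e\<close>-ball around it does not. The \<open>1 / 2\<close> in the maximum keeps away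
      from 0, where \<open>sgn\<close> gives no direction, and keeps \<open>r\<close>
      positive.\<close>
    have nb: "cmod x < max (1 / 2) (1 - e / 2)" if "x \<in> K" for x
    proof (rule ccontr)
      assume "\<not> ?thesis"
      then have x: "cmod x \<ge> 1 - e / 2" "cmod x \<ge> 1 / 2" by auto
      then have x0: "cmod x > 0" by linarith
      have "dist x (x + (e / 2) *\<^sub>R sgn x) < e" using x0 e(1) by (simp add: dist_norm norm_sgn)
      then have "x + (e / 2) *\<^sub>R sgn x \<in> (\<Union>x\<in>K. ball x e)" by (intro UN_I[OF that]) (simp only: mem_ball)
      then have "x + (e / 2) *\<^sub>R sgn x \<in> ball 0 1" by (rule subsetD[OF e(2)])
      moreover have "x + (e / 2) *\<^sub>R sgn x = (1 + e / 2 / cmod x) *\<^sub>R x"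
        by (simp only: sgn_div_norm scaleR_left_distrib scaleR_scaleR scaleR_one divide_inverse)
      then have "cmod (x + (e / 2) *\<^sub>R sgn x) = (1 + e / 2 / cmod x) * cmod x" using e(1) by simp
      then have "cmod (x + (e / 2) *\<^sub>R sgn x) = cmod x + e / 2" using x0 by (simp add: field_simps)
      ultimately show False using x(1) by simp
    qed
    show ?thesis
      by (rule that[of "max (1 / 2) (1 - e / 2)"]) (use nb e(1) in auto)
  qed
  define f where "f = (\<lambda>z. g (of_real r * z))"
  have rb: "of_real r * z \<in> ball 0 1" if "z \<in> ball 0 (1 / r)" for z :: complex
    using that r by (simp add: norm_mult field_simps)
  have R: "1 / r > 1" using r by simp
  have f: "f holomorphic_on ball 0 (1 / r)"
    unfolding f_def using rb by (intro holomorphic_on_compose_gen[OF _ g, unfolded o_def] holomorphic_intros) auto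
  have kf: "k (f z) = of_real r * z" "f z \<in> ?U" if "z \<in> ball 0 (1 / r)" for z
    using gk[OF rb[OF that]] by (simp_all add: f_def)
  have sub1: "ball 0 1 \<subseteq> (ball 0 (1 / r) :: complex set)" "cball 0 1 \<subseteq> (ball 0 (1 / r) :: complex set)" using R by auto
  have finj: "inj_on f (ball 0 1)"
    by (rule inj_onI) (metis kf(1) r(1) sub1(1) subsetD mult_cancel_left of_real_eq_0_iff less_irrefl)
  have fsub: "of_complex ` f ` ball 0 1 \<subseteq> \<Omega>"
    using kf(2) sub1(1) by (force simp del: mem_ball)
  define \<Omega>' where "\<Omega>' = of_complex ` f ` ball 0 1"
  have tU: "to_complex ` \<Omega>' = f ` ball 0 1" by (simp add: \<Omega>'_def image_image)
  have "open (f ` ball 0 1)"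
    by (rule open_mapping_thm3[OF holomorphic_on_subset[OF f sub1(1)] open_ball finj])
  moreover have "\<Omega>' = to_complex -` (f ` ball 0 1)"
    unfolding \<Omega>'_def by (auto simp: image_iff) (metis mem_ball_0 to_of_complex(2))
  ultimately have o': "open \<Omega>'" using open_vimage[OF _ smooth_continuous[OF smooth_to_complex]] by simp
  have sub': "\<Omega>' \<subseteq> \<Omega>" unfolding \<Omega>'_def by (rule fsub)
  have b': "bounded \<Omega>'" using bounded_subset[OF \<Omega>(3) sub'] .
  have m': "measure lebesgue \<Omega>' \<le> 1"
    unfolding \<Omega>(4)[symmetric] by (rule measure_mono_fmeasurable[OF sub']) (use o' lmeasurable_open[OF \<Omega>(3,1)] in auto)
  have "tsupp \<phi> \<subseteq> \<Omega>'"
  proof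
    fix x assume x: "x \<in> tsupp \<phi>"
    define w where "w = to_complex x"
    have "k w \<in> K" unfolding K_def w_def by (intro imageI x)
    then have "k w \<in> ball 0 r" using r(3) by blast
    then have "k w / of_real r \<in> ball 0 1" using r by (simp add: norm_divide)
    moreover have "f (k w / of_real r) = w" using kg[of w] x supp(2) r(1) by (auto simp: f_def w_def)
    ultimately have "w \<in> f ` ball 0 1" by (metis image_eqI)
    then show "x \<in> \<Omega>'" unfolding \<Omega>'_def w_def by (metis image_eqI to_of_complex(2))
  qed
  then have \<phi>': "\<phi> \<in> test_functions \<Omega>'" using \<phi> by (simp add: test_functions_iff)
  have main: "exp (- 2 * B * (m + \<epsilon>)) * (\<integral>x. (cmod (\<phi> x))\<^sup>2 \<partial>lborel) \<le> (\<integral>x. (cmod (mdbar B \<phi> x))\<^sup>2 \<partial>lborel)"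
    if \<epsilon>: "\<epsilon> > 0" for \<epsilon>
  proof -
    have ul: "uniform_limit (cball 0 1) (\<lambda>N z. \<Sum>n<N. taylor_coeff f n * z ^ n) f sequentially"
      by (rule taylor_uniform_limit[OF f]) (use R in auto)
    have "compact (f ` cball 0 1)"
      by (intro compact_continuous_image holomorphic_on_imp_continuous_on holomorphic_on_subset[OF f sub1(2)]) simp
    then obtain C where C: "C > 0" "\<And>z. z \<in> cball 0 1 \<Longrightarrow> cmod (f z) \<le> C"
      using compact_imp_bounded bounded_pos by (metis imageI)
    \<comment> \<open>On the circle \<open>|p| + |f|\<close> is at most \<open>2 C + 1\<close>, so
      an approximation to within \<open>\<eta>\<close> changes the squared modulus by at most
      \<open>\<epsilon>\<close>.\<close>
    define \<eta> where "\<eta> = min 1 (\<epsilon> / (2 * C + 1))"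
    have \<eta>: "0 < \<eta>" "\<eta> \<le> 1" "\<eta> * (2 * C + 1) \<le> \<epsilon>"
    proof -
      have c: "2 * C + 1 > 0" using C(1) by simp
      then show "0 < \<eta>" using \<epsilon> by (simp add: \<eta>_def)
      show "\<eta> \<le> 1" by (simp add: \<eta>_def)
      have "\<eta> \<le> \<epsilon> / (2 * C + 1)" by (simp add: \<eta>_def)
      then show "\<eta> * (2 * C + 1) \<le> \<epsilon>" using c by (simp add: pos_le_divide_eq)
    qed
    have "\<forall>\<^sub>F N in sequentially. \<forall>z\<in>cball 0 1. dist (\<Sum>n<N. taylor_coeff f n * z ^ n) (f z) < \<eta>"
      by (rule uniform_limitD[OF ul \<eta>(1)])
    from eventually_happens'[OF sequentially_bot this]
    obtain N where N: "\<And>z. z \<in> cball 0 1 \<Longrightarrow> cmod ((\<Sum>n<N. taylor_coeff f n * z ^ n) - f z) < \<eta>"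
      unfolding dist_norm by blast
    define p where "p z = (\<Sum>n<N. taylor_coeff f n * z ^ n)" for z
    obtain G where G: "G holomorphic_on UNIV" "\<And>z. cmod z = 1 \<Longrightarrow> Re (G z) = (cmod (p z))\<^sup>2"
      using circle_majorant_polynomial[where b = "taylor_coeff f" and N = N] unfolding p_def by blast
    have near: "\<bar>(cmod (p z))\<^sup>2 - (cmod (f z))\<^sup>2\<bar> \<le> \<epsilon>" if z: "cmod z = 1" for z
    proof -
      have "cmod (p z - f z) < \<eta>" unfolding p_def by (rule N) (simp add: z)
      then have 1: "\<bar>cmod (p z) - cmod (f z)\<bar> \<le> \<eta>"
        using norm_triangle_ineq3[of "p z" "f z"] by linarith
      have 2: "cmod (f z) \<le> C" using C(2)[of z] z by simp
      have "\<bar>(cmod (p z))\<^sup>2 - (cmod (f z))\<^sup>2\<bar> = \<bar>cmod (p z) - cmod (f z)\<bar> * (cmod (p z) + cmod (f z))"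
        by (simp add: power2_eq_square square_diff_square_factored abs_mult mult.commute)
      also have "\<dots> \<le> \<eta> * (2 * C + 1)" using 1 2 \<eta>(2) by (intro mult_mono) auto
      finally show ?thesis using \<eta>(3) by linarith
    qed
    have pot: "(cmod (f z))\<^sup>2 - \<epsilon> \<le> Re (G z)"
      "Re (G z) \<le> (cmod (f z))\<^sup>2 + 1 / pi - (fraenkel_asymmetry \<Omega> / 43) ^ 3 + \<epsilon>" if z: "cmod z < 1" for z
      by (rule conformal_potential_bound[OF f R finj \<Omega>(1,3,4) fsub _ G(1) _ z, of p]; fact near G(2))+
    \<comment> \<open>As \<open>x2^2 / 2 + Re (w^2 / 4) = |w|^2 / 4\<close>, the exponent becomes
      \<open>(|w|^2 - Re G) / 4\<close>. It is nearly 0 on the boundary, where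
      \<open>Re G = |p|^2\<close> is close to \<open>|f|^2\<close>.\<close>
    define F where "F w = w\<^sup>2 / 4 - G (k w / of_real r) / 4" for w
    have F: "F holomorphic_on to_complex ` \<Omega>'"
    proof -
      have ks: "k holomorphic_on to_complex ` \<Omega>'" by (rule holomorphic_on_subset[OF k image_mono[OF sub']])
      have "(\<lambda>w. k w / of_real r) holomorphic_on to_complex ` \<Omega>'" using r(1) by (intro holomorphic_intros ks) auto
      then have "(G \<circ> (\<lambda>w. k w / of_real r)) holomorphic_on to_complex ` \<Omega>'"
        by (rule holomorphic_on_compose_gen[OF _ G(1)]) simp
      then show ?thesis unfolding F_def o_def by (intro holomorphic_intros) auto
    qed
    have val: "\<exists>z0. cmod z0 < 1 \<and> (x $ 2)\<^sup>2 / 2 + Re (F (to_complex x)) = ((cmod (f z0))\<^sup>2 - Re (G z0)) / 4" if "x \<in> \<Omega>'" for x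
    proof -
      have "to_complex x \<in> f ` ball 0 1" using imageI[OF that, of to_complex] unfolding tU .
      then obtain z0 where z0: "z0 \<in> ball 0 1" "to_complex x = f z0" by (rule imageE) (rule that, assumption+)
      have "k (f z0) / of_real r = z0" unfolding kf(1)[OF subsetD[OF sub1(1) z0(1)]] using r(1) by simp
      then have "F (to_complex x) = (to_complex x)\<^sup>2 / 4 - G z0 / 4" by (simp add: F_def z0(2))
      moreover have "(x $ 2)\<^sup>2 / 2 + Re ((to_complex x)\<^sup>2 / 4) = (cmod (to_complex x))\<^sup>2 / 4"
        unfolding cmod_power2 by (simp add: to_complex_def power2_eq_square field_simps)
      ultimately show ?thesis using z0 by (intro exI[of _ z0]) (simp add: diff_divide_distrib)
    qed
    \<comment> \<open>The error \<open>\<epsilon>\<close> of \<open>pot\<close>, divided by 4,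
      enters once in the lower and once in the upper bound of the exponent; the sum is within
      \<open>\<epsilon>\<close>.\<close>
    have "exp (- 2 * B * ((m + \<epsilon> / 4) + \<epsilon> / 4)) * (\<integral>x. (cmod (\<phi> x))\<^sup>2 \<partial>lborel) \<le> (\<integral>x. (cmod (mdbar B \<phi> x))\<^sup>2 \<partial>lborel)"
    proof (rule holomorphic_gauge_bound[OF \<phi>' o' b' m' F B])
      fix x assume "x \<in> \<Omega>'"
      from val[OF this]
      obtain z0 where z0: "cmod z0 < 1" and eq: "(x $ 2)\<^sup>2 / 2 + Re (F (to_complex x)) = ((cmod (f z0))\<^sup>2 - Re (G z0)) / 4"
        by (elim exE conjE)
      show "(x $ 2)\<^sup>2 / 2 + Re (F (to_complex x)) \<le> \<epsilon> / 4" unfolding eq using pot(1)[OF z0] by simp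
      show "- (m + \<epsilon> / 4) \<le> (x $ 2)\<^sup>2 / 2 + Re (F (to_complex x))" unfolding eq m_def using pot(2)[OF z0] by (simp add: field_simps)
    qed
    moreover have "exp (- 2 * B * (m + \<epsilon>)) \<le> exp (- 2 * B * ((m + \<epsilon> / 4) + \<epsilon> / 4))"
      using B \<epsilon> by (simp add: mult_left_mono)
    then have "exp (- 2 * B * (m + \<epsilon>)) * (\<integral>x. (cmod (\<phi> x))\<^sup>2 \<partial>lborel) \<le> exp (- 2 * B * ((m + \<epsilon> / 4) + \<epsilon> / 4)) * (\<integral>x. (cmod (\<phi> x))\<^sup>2 \<partial>lborel)"
      by (intro mult_right_mono) simp_all
    ultimately show ?thesis by linarith
  qed
  have "((\<lambda>\<epsilon>. exp (- 2 * B * (m + \<epsilon>)) * (\<integral>x. (cmod (\<phi> x))\<^sup>2 \<partial>lborel)) \<longlongrightarrow> exp (- 2 * B * (m + 0)) * (\<integral>x. (cmod (\<phi> x))\<^sup>2 \<partial>lborel)) (at_right 0)"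
    by (intro tendsto_intros)
  then have "exp (- 2 * B * (m + 0)) * (\<integral>x. (cmod (\<phi> x))\<^sup>2 \<partial>lborel) \<le> (\<integral>x. (cmod (mdbar B \<phi> x))\<^sup>2 \<partial>lborel)"
    by (rule tendsto_upperbound) (use main eventually_at_right_less[of "0::real"] in \<open>auto elim: eventually_mono\<close>)
  then show ?thesis by (simp add: m_def)
qed

section \<open>Trial functions on the disk\<close>

text \<open>\<open>S t = flat 1 (e - flat 1 (1 - t))\<close> with \<open>e\<close> the value of
  \<open>flat 1\<close> at 1: for \<open>t \<le> 0\<close> the inner argument is at most 0, for
  \<open>t \<ge> 1\<close> it is constantly \<open>e\<close>. The plateau value
  \<open>s1 = flat 1 e\<close> is kept as it is, and smoothness of compositions is inherited from
  \<open>flat\<close>.\<close>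

lemma smooth_step_exists:
  "\<exists>S S' :: real \<Rightarrow> real. \<exists>C s1. C > 0 \<and> s1 > 0 \<and> (\<forall>t. (S has_field_derivative S' t) (at t)) \<and>
    (\<forall>t\<le>0. S t = 0) \<and> (\<forall>t\<ge>1. S t = s1) \<and> (\<forall>t. \<bar>S' t\<bar> \<le> C) \<and> (\<forall>t. t \<le> 0 \<or> t \<ge> 1 \<longrightarrow> S' t = 0) \<and>
    (\<forall>f. smooth f \<longrightarrow> smooth (\<lambda>x. of_real (S (Re (f x)))))"
proof -
  define e where "e = exp (- 1 :: real)"
  define q :: "real poly" where "q = [:0, 0, 1:] * (1 - pderiv 1)"
  define S where "S t = flat 1 (e - flat 1 (1 - t))" for t
  define S' where "S' t = flat q (e - flat 1 (1 - t)) * flat q (1 - t)" for t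
  have der: "(S has_field_derivative S' t) (at t)" for t
  proof -
    have "((\<lambda>t. 1 - t) has_field_derivative (- 1)) (at t)" by (auto intro!: derivative_eq_intros)
    from DERIV_chain2[OF flat_has_derivative this]
    have "((\<lambda>t. flat 1 (1 - t)) has_field_derivative flat q (1 - t) * (- 1)) (at t)" unfolding q_def .
    then have "((\<lambda>t. e - flat 1 (1 - t)) has_field_derivative flat q (1 - t)) (at t)"
      by (auto intro!: derivative_eq_intros)
    from DERIV_chain2[OF flat_has_derivative this] show ?thesis unfolding S_def[abs_def] S'_def q_def .
  qed
  have low: "e - flat 1 (1 - t) \<le> 0" if "t \<le> 0" for t
    using that by (simp add: flat_def e_def field_simps)
  have S0: "S t = 0" if "t \<le> 0" for t using low[OF that] by (simp add: S_def flat_def[of _ "e - _"])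
  have S1: "S t = flat 1 e" if "t \<ge> 1" for t using that by (simp add: S_def flat_def[of _ "1 - t"])
  have pos: "flat 1 e > 0" by (simp add: flat_def e_def)
  have S'0: "S' t = 0" if "t \<le> 0 \<or> t \<ge> 1" for t
  proof (cases "t \<ge> 1")
    case False
    then show ?thesis using that low[of t] by (simp add: S'_def flat_def[of _ "e - _"])
  qed (simp add: S'_def flat_def[of _ "1 - t"])
  have cf: "continuous_on UNIV (flat p)" for p
    using flat_has_derivative DERIV_isCont by (metis continuous_at_imp_continuous_on)
  have "continuous_on {0..1} S'" unfolding S'_def[abs_def]
    by (intro continuous_intros continuous_on_compose2[OF cf]) auto
  then have "compact (S' ` {0..1})" by (rule compact_continuous_image) simp
  then obtain C where C: "C > 0" "\<And>t. t \<in> {0..1} \<Longrightarrow> \<bar>S' t\<bar> \<le> C"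
    using compact_imp_bounded bounded_pos by (metis imageI real_norm_def)
  have bd: "\<bar>S' t\<bar> \<le> C" for t using C(1) C(2)[of t] S'0[of t] by (cases "t \<in> {0..1}") auto
  have "smooth (\<lambda>x. of_real (S (Re (f x))))" if "smooth f" for f
  proof -
    have "smooth (\<lambda>x. of_real (flat 1 (Re (of_real e - of_real (flat 1 (Re (1 - f x)))))))"
      by (intro smooth_intros that)
    then show ?thesis by (simp add: S_def)
  qed
  then show ?thesis using C(1) pos der S0 S1 bd S'0 by blast
qed

text \<open>A smooth step in the variable \<open>B (r2 - |x|^2)\<close>. \<open>C\<close> and
  \<open>s1\<close> are fixed before \<open>B\<close> and \<open>r2\<close>, so that the estimate
  for the disk has a constant independent of \<open>B\<close>; the factor \<open>B\<close> in the
  derivative is the price of a layer in which \<open>|x|^2\<close> varies by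
  \<open>1 / B\<close>.\<close>

lemma radial_cutoff_exists:
  obtains C s1 where "C > 0" "s1 > (0::real)"
    "\<And>B r2. B > 0 \<Longrightarrow> 0 \<le> r2 \<Longrightarrow> r2 < R\<^sup>2 \<Longrightarrow> 0 \<le> R \<Longrightarrow> \<exists>f \<in> test_functions (ball 0 R).
       (\<forall>x. B * (r2 - (norm x)\<^sup>2) \<ge> 1 \<longrightarrow> f x = of_real s1) \<and>
       (\<forall>x. cmod (mdbar 0 f x) \<le> C * B * norm x) \<and>
       (\<forall>x. B * (r2 - (norm x)\<^sup>2) \<le> 0 \<or> B * (r2 - (norm x)\<^sup>2) \<ge> 1 \<longrightarrow> mdbar 0 f x = 0)"
proof -
  obtain S S' :: "real \<Rightarrow> real" and C s1 where C: "C > 0" "s1 > 0" and der: "\<And>t. (S has_field_derivative S' t) (at t)"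
    and S0: "\<And>t. t \<le> 0 \<Longrightarrow> S t = 0" and S1: "\<And>t. t \<ge> 1 \<Longrightarrow> S t = s1" and bd: "\<And>t. \<bar>S' t\<bar> \<le> C"
    and S'0: "\<And>t. t \<le> 0 \<or> t \<ge> 1 \<Longrightarrow> S' t = 0" and sm: "\<And>f. smooth f \<Longrightarrow> smooth (\<lambda>x. of_real (S (Re (f x))))"
    using smooth_step_exists by blast
  have main: "\<exists>f \<in> test_functions (ball 0 R).
       (\<forall>x. B * (r2 - (norm x)\<^sup>2) \<ge> 1 \<longrightarrow> f x = of_real s1) \<and>
       (\<forall>x. cmod (mdbar 0 f x) \<le> 2 * C * B * norm x) \<and>
       (\<forall>x. B * (r2 - (norm x)\<^sup>2) \<le> 0 \<or> B * (r2 - (norm x)\<^sup>2) \<ge> 1 \<longrightarrow> mdbar 0 f x = 0)"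
    if B: "B > 0" and r2: "0 \<le> r2" "r2 < R\<^sup>2" "0 \<le> R" for B r2
  proof -
    define w where "w = (\<lambda>x::real^2. of_real B * (of_real r2 - (of_real (x $ 1) * of_real (x $ 1) + of_real (x $ 2) * of_real (x $ 2))) :: complex)"
    have nx: "(norm x)\<^sup>2 = x $ 1 * x $ 1 + x $ 2 * x $ 2" for x :: "real^2"
      by (simp add: norm_vec_def L2_set_def sum_2 power2_eq_square)
    have Rew: "Re (w x) = B * (r2 - (norm x)\<^sup>2)" for x by (simp add: w_def nx)
    define f where "f = (\<lambda>x. complex_of_real (S (Re (w x))))"
    have sw: "smooth w" unfolding w_def by (intro smooth_intros)
    have sf: "smooth f" unfolding f_def by (rule sm[OF sw])
    have fz: "f x = 0" if "x \<notin> cball 0 (sqrt r2)" for x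
    proof -
      have "sqrt r2 < norm x" using that by simp
      then have "r2 < (norm x)\<^sup>2" using r2(1) by (metis real_less_lsqrt real_sqrt_less_iff norm_ge_zero real_sqrt_abs abs_of_nonneg)
      then show ?thesis using B by (simp add: f_def Rew S0 mult_nonneg_nonpos)
    qed
    have "{x. f x \<noteq> 0} \<subseteq> cball 0 (sqrt r2)" using fz by blast
    then have sub: "tsupp f \<subseteq> cball 0 (sqrt r2)" by (intro closure_minimal closed_cball)
    moreover have "cball 0 (sqrt r2) \<subseteq> ball (0::real^2) R"
      using r2 real_less_lsqrt[of R r2] by auto
    ultimately have ft: "f \<in> test_functions (ball 0 R)"
      unfolding test_functions_iff using sf sub bounded_subset[OF bounded_cball sub] by (auto simp: compact_eq_bounded_closed)
    have pw: "partial_deriv j w x = of_real (- 2 * B * x $ j)" for j x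
    proof -
      have d: "((\<lambda>x::real^2. of_real (x $ i) :: complex) has_derivative (\<lambda>h. of_real (h $ i))) (at x)" for i
        by (intro bounded_linear_imp_has_derivative bounded_linear_compose[OF bounded_linear_of_real] bounded_linear_vec_nth)
      have "(w has_derivative (\<lambda>h. of_real B * (0 - ((of_real (x $ 1) * of_real (h $ 1) + of_real (h $ 1) * of_real (x $ 1)) +
         (of_real (x $ 2) * of_real (h $ 2) + of_real (h $ 2) * of_real (x $ 2)))))) (at x)"
        unfolding w_def
        by (intro has_derivative_mult_right has_derivative_diff has_derivative_const has_derivative_add has_derivative_mult d)
      from partial_deriv_eq[OF this, of j] show ?thesis using exhaust_2[of j] by (auto simp: axis_def)
    qed
    have pf: "partial_deriv j f x = of_real (S' (Re (w x)) * (- 2 * B * x $ j))" for j x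
    proof -
      have "(w has_derivative frechet_derivative w (at x)) (at x)"
        using smooth_differentiable[OF sw] by (simp add: frechet_derivative_works)
      from partial_deriv_eq[OF has_derivative_of_real_Re[OF der this], of j] pw[of j x]
      show ?thesis unfolding f_def by (simp add: partial_deriv_def)
    qed
    have df: "mdbar 0 f x = of_real (S' (Re (w x)) * (- 2 * B)) * to_complex x" for x
      by (simp add: mdbar_def pf to_complex_alt algebra_simps)
    have "cmod (mdbar 0 f x) \<le> 2 * C * B * norm x" for x
    proof -
      have "cmod (mdbar 0 f x) = \<bar>S' (Re (w x))\<bar> * (2 * B * norm x)"
        unfolding df norm_mult norm_of_real norm_to_complex using B by (simp add: abs_mult)
      also have "\<dots> \<le> C * (2 * B * norm x)" using bd B by (intro mult_right_mono) auto
      finally show ?thesis by (simp add: mult_ac)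
    qed
    moreover have "mdbar 0 f x = 0" if "B * (r2 - (norm x)\<^sup>2) \<le> 0 \<or> B * (r2 - (norm x)\<^sup>2) \<ge> 1" for x
      using S'0[of "Re (w x)"] that by (simp add: df Rew)
    moreover have "f x = of_real s1" if "B * (r2 - (norm x)\<^sup>2) \<ge> 1" for x
      using that by (simp add: f_def Rew S1)
    ultimately show ?thesis using ft by (intro bexI[of _ f]) auto
  qed
  show ?thesis by (rule that[of "2 * C" s1]) (use C main in auto)
qed

text \<open>Distinct powers of the complex coordinate are orthogonal on every circle, so the
  integral has no mixed terms.\<close>

lemma disk_polynomial_integral:
  assumes s: "0 < s"
  shows "(\<lambda>x. (cmod (\<Sum>i<n. c i * to_complex x ^ i))\<^sup>2) absolutely_integrable_on ((\<lambda>x. of_complex (polar x)) ` polar_box s)"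
    "integral ((\<lambda>x. of_complex (polar x)) ` polar_box s) (\<lambda>x. (cmod (\<Sum>i<n. c i * to_complex x ^ i))\<^sup>2) =
      (\<Sum>i<n. pi * (cmod (c i))\<^sup>2 * s ^ (2 * i + 2) / (real i + 1))"
    "(\<lambda>x. of_complex (polar x)) ` polar_box s \<subseteq> ball 0 s"
proof -
  let ?F = "\<lambda>x. (cmod (\<Sum>i<n. c i * to_complex x ^ i))\<^sup>2"
  have cF: "continuous_on UNIV ?F"
    by (intro continuous_intros smooth_continuous smooth_to_complex)
  have pc: "?F absolutely_integrable_on ((\<lambda>x. of_complex (polar x)) ` polar_box s)"
    "integral ((\<lambda>x. of_complex (polar x)) ` polar_box s) ?F =
      integral {0..s} (\<lambda>\<rho>. integral {-pi..pi} (\<lambda>\<theta>. \<rho> * (cmod (\<Sum>i<n. c i * (of_real \<rho> * cis \<theta>) ^ i))\<^sup>2))"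
    using polar_change_of_variables[of "\<lambda>z. z" "s + 1" s ?F] s cF
    by (simp_all add: holomorphic_on_ident)
  show "?F absolutely_integrable_on ((\<lambda>x. of_complex (polar x)) ` polar_box s)" by (rule pc)
  have "integral {-pi..pi} (\<lambda>\<theta>. \<rho> * (cmod (\<Sum>i<n. c i * (of_real \<rho> * cis \<theta>) ^ i))\<^sup>2) =
     (\<Sum>i<n. (2 * pi * (cmod (c i))\<^sup>2) * \<rho> ^ (2 * i + 1))" for \<rho>
    using integral_unique[OF has_integral_mult_right[OF Parseval_polynomial[where N = n and c = c and \<rho> = \<rho>], of \<rho>]]
    by (simp add: sum_distrib_left mult_ac)
  moreover have "((\<lambda>\<rho>. \<Sum>i<n. (2 * pi * (cmod (c i))\<^sup>2) * \<rho> ^ (2 * i + 1)) has_integral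
     (\<Sum>i<n. (2 * pi * (cmod (c i))\<^sup>2) * (s ^ (2 * i + 2) / (2 * real i + 2)))) {0..s}"
  proof (intro has_integral_sum has_integral_mult_right)
    fix i :: nat
    have "((\<lambda>\<rho>. \<rho> ^ (2 * i + 1)) has_integral (s ^ (2 * i + 2) / (2 * real i + 2) - 0 ^ (2 * i + 2) / (2 * real i + 2))) {0..s}"
    proof (rule fundamental_theorem_of_calculus)
      fix \<rho> assume "\<rho> \<in> {0..s}"
      have "((\<lambda>\<rho>. \<rho> ^ (2 * i + 2) / (2 * real i + 2)) has_field_derivative \<rho> ^ (2 * i + 1)) (at \<rho> within {0..s})"
        by (rule derivative_eq_intros refl | simp)+ (simp add: field_simps)
      then show "((\<lambda>\<rho>. \<rho> ^ (2 * i + 2) / (2 * real i + 2)) has_vector_derivative \<rho> ^ (2 * i + 1)) (at \<rho> within {0..s})"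
        by (simp add: has_real_derivative_iff_has_vector_derivative)
    qed (use s in simp)
    then show "((\<lambda>\<rho>. \<rho> ^ (2 * i + 1)) has_integral (s ^ (2 * i + 2) / (2 * real i + 2))) {0..s}" by simp
  qed simp
  ultimately have "integral ((\<lambda>x. of_complex (polar x)) ` polar_box s) ?F =
     (\<Sum>i<n. (2 * pi * (cmod (c i))\<^sup>2) * (s ^ (2 * i + 2) / (2 * real i + 2)))"
    unfolding pc(2) by (simp add: integral_unique)
  also have "\<dots> = (\<Sum>i<n. pi * (cmod (c i))\<^sup>2 * s ^ (2 * i + 2) / (real i + 1))"
    by (intro sum.cong refl) (simp add: field_simps del: power_Suc)
  finally show "integral ((\<lambda>x. of_complex (polar x)) ` polar_box s) ?F = (\<Sum>i<n. pi * (cmod (c i))\<^sup>2 * s ^ (2 * i + 2) / (real i + 1))" .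
  show "(\<lambda>x. of_complex (polar x)) ` polar_box s \<subseteq> ball 0 s"
    by (auto simp: mem_polar_box cmod_polar)
qed

text \<open>\<open>mdbar B\<close> acts on the cut-off alone. Its derivative, of order
  \<open>B\<close>, lives in a layer at the boundary where the squared Gaussian is at most
  \<open>exp 1 * exp (- B / (2 \<pi>))\<close>. The norm is bounded below on the disk of radius
  \<open>1 / sqrt B\<close>, where the Gaussian is of order 1 and the monomials cost at most
  \<open>B^n\<close>. Together this gives \<open>B^(n + 2)\<close>.\<close>

theorem disk_eigenvalue_upper_bound:
  assumes n: "n \<ge> 1"
  shows "\<exists>K>0. \<forall>B \<ge> 3 * pi. magnetic_eigenvalue n (disk_of_area 1) B \<le> K * B ^ (n + 2) * exp (- B / (2 * pi))"
proof -
  define R where "R = sqrt (1 / pi)"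
  have R: "0 \<le> R" "R\<^sup>2 = 1 / pi" "R > 0" by (simp_all add: R_def)
  obtain C s1 where C: "C > 0" "s1 > (0::real)" and cut:
    "\<And>B r2. B > 0 \<Longrightarrow> 0 \<le> r2 \<Longrightarrow> r2 < R\<^sup>2 \<Longrightarrow> 0 \<le> R \<Longrightarrow> \<exists>f \<in> test_functions (ball 0 R).
       (\<forall>x. B * (r2 - (norm x)\<^sup>2) \<ge> 1 \<longrightarrow> f x = of_real s1) \<and>
       (\<forall>x. cmod (mdbar 0 f x) \<le> C * B * norm x) \<and>
       (\<forall>x. B * (r2 - (norm x)\<^sup>2) \<le> 0 \<or> B * (r2 - (norm x)\<^sup>2) \<ge> 1 \<longrightarrow> mdbar 0 f x = 0)"
    using radial_cutoff_exists[where R = R] by metis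
  define b where "b = s1\<^sup>2 * exp (- 1 / 2) * pi / n"
  define a where "a = C\<^sup>2 * exp 1 * n"
  have ab: "a > 0" "b > 0" using C n by (simp_all add: a_def b_def)
  have "magnetic_eigenvalue n (disk_of_area 1) B \<le> a / b * B ^ (n + 2) * exp (- B / (2 * pi))" if B3: "B \<ge> 3 * pi" for B
  proof -
    have B: "B > 0" "B \<ge> 1" using B3 pi_gt3 by linarith+
    \<comment> \<open>The cut-off ends at \<open>|x|^2 = 1 / \<pi> - 1 / B\<close>, strictly inside
      the disk, and is constant once \<open>|x|^2 \<le> 1 / \<pi> - 2 / B\<close>. The condition
      \<open>B \<ge> 3 * pi\<close> puts the disk of radius \<open>1 / sqrt B\<close> into this
      plateau.\<close>
    define r2 where "r2 = 1 / pi - 1 / B"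
    have B\<pi>: "B / pi \<ge> 3" using B3 by (simp add: pos_le_divide_eq)
    have Br: "B * r2 = B / pi - 1" using B by (simp add: r2_def algebra_simps)
    have r2: "0 \<le> r2" "r2 < R\<^sup>2" "r2 \<le> 1"
    proof -
      have "B * r2 \<ge> 0" using Br B\<pi> by linarith
      then show "0 \<le> r2" using B by (simp add: zero_le_mult_iff)
      show "r2 < R\<^sup>2" using B by (simp add: r2_def R)
      have "1 / pi \<le> 1" using pi_gt3 by simp
      moreover have "1 / B \<ge> 0" using B by simp
      ultimately show "r2 \<le> 1" unfolding r2_def by linarith
    qed
    obtain f where f: "f \<in> test_functions (ball 0 R)" and f1: "\<And>x. B * (r2 - (norm x)\<^sup>2) \<ge> 1 \<Longrightarrow> f x = of_real s1"
      and fb: "\<And>x. cmod (mdbar 0 f x) \<le> C * B * norm x"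
      and f0: "\<And>x. B * (r2 - (norm x)\<^sup>2) \<le> 0 \<or> B * (r2 - (norm x)\<^sup>2) \<ge> 1 \<Longrightarrow> mdbar 0 f x = 0"
      using cut[OF B(1) r2(1,2) R(1)] by blast
    \<comment> \<open>\<open>E\<close> is the gauge factor with \<open>b = - B\<close>; the
      holomorphic \<open>G\<close> restores rotational symmetry, so that the product has modulus
      \<open>exp (- B |x|^2 / 4)\<close>.\<close>
    define E where "E = (\<lambda>x::real^2. exp (of_real (- B / 2) * (of_real (x $ 2) * of_real (x $ 2)) :: complex))"
    define G where "G = (\<lambda>z::complex. exp (of_real (- B / 4) * z\<^sup>2))"
    define \<phi> where "\<phi> i = (\<lambda>x. E x * f x * (to_complex x ^ i * G (to_complex x)))" for i :: nat
    define p where "p c x = (\<Sum>i<n. c i * to_complex x ^ i)" for c x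
    define Q where "Q c = (\<Sum>i<n. (cmod (c i))\<^sup>2)" for c :: "nat \<Rightarrow> complex"
    have weight: "cmod (E x) * cmod (G (to_complex x)) = exp (- (B / 4) * (norm x)\<^sup>2)" for x
    proof -
      have Re2: "Re ((to_complex x)\<^sup>2) = (x $ 1)\<^sup>2 - (x $ 2)\<^sup>2" by (simp add: to_complex_def power2_eq_square)
      have "cmod (E x) * cmod (G (to_complex x)) = exp (- B / 2 * (x $ 2 * x $ 2) + - B / 4 * ((x $ 1)\<^sup>2 - (x $ 2)\<^sup>2))"
        by (simp add: E_def G_def exp_add[symmetric] Re2)
      also have "- B / 2 * (x $ 2 * x $ 2) + - B / 4 * ((x $ 1)\<^sup>2 - (x $ 2)\<^sup>2) = - (B / 4) * (norm x)\<^sup>2"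
        by (simp add: norm_vec_def L2_set_def sum_2 power2_eq_square field_simps)
      finally show ?thesis .
    qed
    have weight2: "(cmod (E x))\<^sup>2 * (cmod (G (to_complex x)))\<^sup>2 = exp (- (B / 2) * (norm x)\<^sup>2)" for x
    proof -
      have "(cmod (E x))\<^sup>2 * (cmod (G (to_complex x)))\<^sup>2 = (exp (- (B / 4) * (norm x)\<^sup>2))\<^sup>2"
        by (simp only: weight[symmetric] power_mult_distrib)
      then show ?thesis by (simp add: exp_double[symmetric])
    qed
    have V: "(\<lambda>x. \<Sum>i<n. c i * \<phi> i x) \<in> test_functions (ball 0 R)"
      "(cmod (\<Sum>i<n. c i * \<phi> i x))\<^sup>2 = exp (- (B / 2) * (norm x)\<^sup>2) * (cmod (f x))\<^sup>2 * (cmod (p c x))\<^sup>2"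
      "(cmod (mdbar B (\<lambda>x. \<Sum>i<n. c i * \<phi> i x) x))\<^sup>2 = exp (- (B / 2) * (norm x)\<^sup>2) * (cmod (mdbar 0 f x))\<^sup>2 * (cmod (p c x))\<^sup>2"
      for c x
    proof -
      define g where "g z = (\<Sum>i<n. c i * z ^ i) * G z" for z
      have g: "g holomorphic_on to_complex ` ball 0 R" unfolding g_def G_def by (intro holomorphic_intros)
      have eq: "(\<Sum>i<n. c i * \<phi> i x) = E x * f x * g (to_complex x)" for x
        unfolding \<phi>_def g_def by (simp add: sum_distrib_left sum_distrib_right mult_ac)
      note gauge = mdbar_gauge[OF f g open_ball, where b = "- B", folded E_def]
      show "(\<lambda>x. \<Sum>i<n. c i * \<phi> i x) \<in> test_functions (ball 0 R)"
        using gauge(1) unfolding eq E_def .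
      have "mdbar B (\<lambda>x. \<Sum>i<n. c i * \<phi> i x) x = E x * g (to_complex x) * mdbar (B + - B) f x"
        using gauge(2)[of B x] unfolding eq E_def .
      then show "(cmod (mdbar B (\<lambda>x. \<Sum>i<n. c i * \<phi> i x) x))\<^sup>2 = exp (- (B / 2) * (norm x)\<^sup>2) * (cmod (mdbar 0 f x))\<^sup>2 * (cmod (p c x))\<^sup>2"
        unfolding weight2[symmetric] by (simp add: g_def p_def norm_mult power_mult_distrib)
      show "(cmod (\<Sum>i<n. c i * \<phi> i x))\<^sup>2 = exp (- (B / 2) * (norm x)\<^sup>2) * (cmod (f x))\<^sup>2 * (cmod (p c x))\<^sup>2"
        unfolding weight2[symmetric] eq by (simp add: g_def p_def norm_mult power_mult_distrib)
    qed
    have up: "(\<integral>x. (cmod (mdbar B (\<lambda>x. \<Sum>i<n. c i * \<phi> i x) x))\<^sup>2 \<partial>lborel) \<le> a * B\<^sup>2 * exp (- B / (2 * pi)) * Q c" for c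
    proof -
      define M where "M = a * B\<^sup>2 * exp (- B / (2 * pi)) * Q c"
      have pw: "(cmod (mdbar B (\<lambda>x. \<Sum>i<n. c i * \<phi> i x) x))\<^sup>2 \<le> indicator (ball 0 R) x *\<^sub>R M" for x
      proof (cases "mdbar 0 f x = 0")
        case True
        have "Q c \<ge> 0" by (simp add: Q_def sum_nonneg)
        then have "M \<ge> 0" using ab by (simp add: M_def)
        then show ?thesis using True unfolding V(3) by (simp add: indicator_def)
      next
        case False
        then have in1: "B * (r2 - (norm x)\<^sup>2) < 1" "B * (r2 - (norm x)\<^sup>2) > 0" using f0[of x] by linarith+
        then have nx: "(norm x)\<^sup>2 < r2" using B by (simp add: zero_less_mult_iff)
        then have nx1: "(norm x)\<^sup>2 \<le> 1\<^sup>2" "(norm x)\<^sup>2 < R\<^sup>2" using r2 by simp_all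
        then have n1: "norm x \<le> 1" "norm x < R" using R by (auto intro: power2_le_imp_le power2_less_imp_less)
        \<comment> \<open>In the layer \<open>B |x|^2\<close> exceeds
          \<open>B r2 - 1 = B / \<pi> - 2\<close>.\<close>
        have "- (B / 2) * (norm x)\<^sup>2 \<le> 1 + - B / (2 * pi)" using in1(1) Br by (simp add: algebra_simps)
        then have 1: "exp (- (B / 2) * (norm x)\<^sup>2) \<le> exp 1 * exp (- B / (2 * pi))" unfolding exp_add[symmetric] by simp
        have "cmod (mdbar 0 f x) \<le> C * B * 1"
          by (rule order_trans[OF fb]) (use n1 C B in \<open>intro mult_left_mono; simp\<close>)
        then have 2: "(cmod (mdbar 0 f x))\<^sup>2 \<le> (C * B)\<^sup>2" by (intro power_mono) auto
        have "cmod (p c x) \<le> (\<Sum>i<n. cmod (c i))"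
          unfolding p_def by (rule sum_norm_le) (use n1 in \<open>simp add: norm_mult norm_power norm_to_complex mult_left_le power_le_one\<close>)
        then have "(cmod (p c x))\<^sup>2 \<le> (\<Sum>i<n. cmod (c i))\<^sup>2" by (intro power_mono) auto
        also have "\<dots> \<le> Q c * n" using sum_squared_le_sum_of_squares[of "\<lambda>i. cmod (c i)" "{..<n}"] by (simp add: Q_def)
        finally have 3: "(cmod (p c x))\<^sup>2 \<le> Q c * n" .
        have "(cmod (mdbar B (\<lambda>x. \<Sum>i<n. c i * \<phi> i x) x))\<^sup>2 \<le> (exp 1 * exp (- B / (2 * pi))) * (C * B)\<^sup>2 * (Q c * n)"
          unfolding V(3) by (intro mult_mono 1 2 3) auto
        also have "\<dots> = M" by (simp add: M_def a_def power_mult_distrib mult_ac)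
        finally show ?thesis using n1(2) by simp
      qed
      have bR: "ball (0::real^2) R \<in> sets lborel" by simp
      have fin: "emeasure lborel (ball (0::real^2) R) < \<infinity>" by (rule emeasure_bounded_finite) simp
      have mR: "measure lborel (ball (0::real^2) R) = 1"
        using measure_ball_real2[OF R(1), of 0] R(2) by (simp add: measure_completion)
      have "(\<integral>x. (cmod (mdbar B (\<lambda>x. \<Sum>i<n. c i * \<phi> i x) x))\<^sup>2 \<partial>lborel) \<le> (\<integral>x. indicator (ball 0 R) (x :: real^2) *\<^sub>R M \<partial>lborel)"
        by (intro integral_mono pw test_norm_square_integrable[OF test_mdbar[OF V(1)]] integrable_indicator integrable_scaleR_left integrable_real_indicator bR fin)
      also have "\<dots> = M" using mR fin by simp
      finally show ?thesis unfolding M_def .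
    qed
    have low: "b * (1 / B) ^ n * Q c \<le> (\<integral>x. (cmod (\<Sum>i<n. c i * \<phi> i x))\<^sup>2 \<partial>lborel)" for c
    proof -
      define s where "s = 1 / sqrt B"
      have s: "s > 0" "s\<^sup>2 = 1 / B" using B by (simp_all add: s_def power_divide)
      define A where "A = (\<lambda>x. of_complex (polar x)) ` polar_box s"
      note pint = disk_polynomial_integral(1,2)[OF s(1), where n = n and c = c, folded A_def p_def]
      define W where "W = (\<lambda>x. (cmod (\<Sum>i<n. c i * \<phi> i x))\<^sup>2)"
      have Wt: "integrable lborel W" unfolding W_def by (rule test_norm_square_integrable[OF V(1)])
      have hW: "(W has_integral integral\<^sup>L lborel W) UNIV" by (rule has_integral_integral_lborel[OF Wt])
      have cW: "continuous_on UNIV W" unfolding W_def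
        by (intro continuous_intros smooth_continuous[OF test_smooth[OF V(1)]])
      have "W absolutely_integrable_on A"
        using polar_change_of_variables(1)[of "\<lambda>z. z" "s + 1" s W] s(1) cW by (simp add: holomorphic_on_ident A_def)
      then have iW: "W integrable_on A" using absolutely_integrable_on_def by blast
      have ip: "(\<lambda>x. (exp (- 1 / 2) * s1\<^sup>2) * (cmod (p c x))\<^sup>2) integrable_on A"
      proof -
        have "(\<lambda>x. (cmod (p c x))\<^sup>2) integrable_on A" using pint(1) absolutely_integrable_on_def by blast
        from integrable_cmul[OF this, of "exp (- 1 / 2) * s1\<^sup>2"] show ?thesis by simp
      qed
      have "(1 / B) ^ n * (pi / n) * Q c \<le> (\<Sum>i<n. pi * (cmod (c i))\<^sup>2 * s ^ (2 * i + 2) / (real i + 1))"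
        unfolding Q_def sum_distrib_left
      proof (rule sum_mono)
        fix i assume i: "i \<in> {..<n}"
        have "(1 / B) ^ n \<le> (1 / B) ^ Suc i" using B i by (intro power_decreasing) auto
        also have "(1 / B) ^ Suc i = s ^ (2 * Suc i)" by (simp only: power_mult s(2))
        finally have 1: "(1 / B) ^ n \<le> s ^ (2 * i + 2)" by (simp del: power_Suc)
        have 2: "pi / n \<le> pi / (real i + 1)" using i by (intro divide_left_mono) auto
        have "(1 / B) ^ n * (pi / n) * (cmod (c i))\<^sup>2 \<le> s ^ (2 * i + 2) * (pi / (real i + 1)) * (cmod (c i))\<^sup>2"
          using s(1) B by (intro mult_right_mono mult_mono 1 2) auto
        then show "(1 / B) ^ n * (pi / n) * (cmod (c i))\<^sup>2 \<le> pi * (cmod (c i))\<^sup>2 * s ^ (2 * i + 2) / (real i + 1)"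
          by (simp add: mult_ac del: power_Suc)
      qed
      then have "(exp (- 1 / 2) * s1\<^sup>2) * ((1 / B) ^ n * (pi / n) * Q c) \<le> (exp (- 1 / 2) * s1\<^sup>2) * integral A (\<lambda>x. (cmod (p c x))\<^sup>2)"
        unfolding pint(2) by (intro mult_left_mono) auto
      also have "\<dots> = integral A (\<lambda>x. (exp (- 1 / 2) * s1\<^sup>2) * (cmod (p c x))\<^sup>2)" by simp
      also have "\<dots> \<le> integral A W"
      proof (rule integral_le[OF ip iW])
        fix x assume "x \<in> A"
        then have "norm x < s" using disk_polynomial_integral(3)[OF s(1)] by (auto simp: A_def)
        then have "(norm x)\<^sup>2 < 1 / B" unfolding s(2)[symmetric] by (intro power_strict_mono) auto
        then have nx: "B * (norm x)\<^sup>2 < 1" using B by (simp add: field_simps)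
        then have "B * (r2 - (norm x)\<^sup>2) \<ge> 1" using Br B\<pi> by (simp add: right_diff_distrib)
        then have "f x = of_real s1" by (rule f1)
        then have "W x = exp (- (B / 2) * (norm x)\<^sup>2) * s1\<^sup>2 * (cmod (p c x))\<^sup>2" by (simp add: W_def V(2))
        moreover have "exp (- 1 / 2) \<le> exp (- (B / 2) * (norm x)\<^sup>2)" using nx by simp
        ultimately show "exp (- 1 / 2) * s1\<^sup>2 * (cmod (p c x))\<^sup>2 \<le> W x" by (simp add: mult_right_mono)
      qed
      also have "\<dots> \<le> integral UNIV W"
        by (rule integral_subset_le[OF _ iW]) (use hW in \<open>auto simp: W_def\<close>)
      also have "\<dots> = integral\<^sup>L lborel W" by (rule integral_unique[OF hW])
      finally show ?thesis unfolding W_def b_def by (simp add: mult_ac)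
    qed
    have "magnetic_eigenvalue n (ball 0 R) B \<le> a / b * B ^ (n + 2) * exp (- B / (2 * pi))"
    proof (rule magnetic_eigenvalue_le[where \<phi> = \<phi>])
      show "ball (0::real^2) R \<noteq> {}" using R(3) by simp
      show "\<phi> i \<in> test_functions (ball 0 R)" if "i < n" for i
      proof -
        \<comment> \<open>\<open>V\<close> speaks of linear combinations; Kronecker coefficients
          single out one trial function.\<close>
        have "(\<Sum>j<n. (if j = i then 1 else 0) * \<phi> j x) = \<phi> i x" for x
          using that by (simp add: mult_delta_left)
        then show ?thesis using V(1)[of "\<lambda>j. if j = i then 1 else 0"] by (simp only:)
      qed
      fix c :: "nat \<Rightarrow> complex" assume "\<exists>i<n. c i \<noteq> 0"
      then have Q: "Q c > 0" unfolding Q_def by (auto intro!: sum_pos2)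
      have "b * (1 / B) ^ n * Q c > 0" using ab B Q by simp
      then have pos: "(\<integral>x. (cmod (\<Sum>i<n. c i * \<phi> i x))\<^sup>2 \<partial>lborel) > 0" using low[of c] by linarith
      have "a * B\<^sup>2 * exp (- B / (2 * pi)) * Q c = (a / b * B ^ (n + 2) * exp (- B / (2 * pi))) * (b * (1 / B) ^ n * Q c)"
        using ab B by (simp add: power_add power2_eq_square field_simps)
      also have "\<dots> \<le> (a / b * B ^ (n + 2) * exp (- B / (2 * pi))) * (\<integral>x. (cmod (\<Sum>i<n. c i * \<phi> i x))\<^sup>2 \<partial>lborel)"
        using ab B by (intro mult_left_mono low) auto
      finally show "(\<integral>x. (cmod (\<Sum>i<n. c i * \<phi> i x))\<^sup>2 \<partial>lborel) > 0 \<and>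
        (\<integral>x. (cmod (mdbar B (\<lambda>x. \<Sum>i<n. c i * \<phi> i x) x))\<^sup>2 \<partial>lborel) \<le>
          a / b * B ^ (n + 2) * exp (- B / (2 * pi)) * (\<integral>x. (cmod (\<Sum>i<n. c i * \<phi> i x))\<^sup>2 \<partial>lborel)"
        using up[of c] pos by linarith
    qed (use n in simp_all)
    then show ?thesis by (simp add: disk_of_area_def R_def)
  qed
  moreover have "a / b > 0" using ab by simp
  ultimately show ?thesis by blast
qed

theorem theorem1:
  fixes n :: nat
  assumes "n \<ge> 1"
  shows "\<exists>c B\<^sub>0 :: real. c > 0 \<and> B\<^sub>0 > 0 \<and>
    (\<forall>\<Omega> :: (real^2) set. open \<Omega> \<longrightarrow> connected \<Omega> \<longrightarrow> bounded \<Omega> \<longrightarrow> simply_connected \<Omega> \<longrightarrow>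
       measure lebesgue \<Omega> = 1 \<longrightarrow>
       (\<forall>B \<ge> B\<^sub>0. magnetic_eigenvalue n \<Omega> B / magnetic_eigenvalue n (disk_of_area 1) B
          \<ge> 1 + c * B * fraenkel_asymmetry \<Omega> ^ 3 - ln B / c))"
proof -
  let ?D = "disk_of_area 1"
  obtain K where K: "K > 0" "\<And>B. B \<ge> 3 * pi \<Longrightarrow> magnetic_eigenvalue n ?D B \<le> K * B ^ (n + 2) * exp (- B / (2 * pi))"
    using disk_eigenvalue_upper_bound[OF assms] by blast
  \<comment> \<open>The first entry comes from the exponent
    \<open>B / 2 * (\<alpha> / 43)^3\<close>, the second from the power \<open>B^(n + 3)\<close>
    that the disk estimate leaves; their minimum serves both terms of the claim.\<close>
  define c :: real where "c = min (1 / (2 * 43 ^ 3)) (1 / real (n + 3))"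
  have c: "c > 0" "c \<le> 1 / (2 * 43 ^ 3)" "real (n + 3) \<le> 1 / c"
  proof -
    show c0: "c > 0" by (simp add: c_def)
    show "c \<le> 1 / (2 * 43 ^ 3)" unfolding c_def by (rule min.cobounded1)
    have "c \<le> 1 / real (n + 3)" unfolding c_def by (rule min.cobounded2)
    then show "real (n + 3) \<le> 1 / c" using c0 by (simp add: field_simps)
  qed
  have lower: "exp (- 2 * B * ((1 / pi - (fraenkel_asymmetry \<Omega> / 43) ^ 3) / 4)) \<le> magnetic_eigenvalue n \<Omega> B"
    if "open \<Omega>" "bounded \<Omega>" "simply_connected \<Omega>" "measure lebesgue \<Omega> = 1" "B \<ge> 0" for \<Omega> B
  proof (rule magnetic_eigenvalue_ge[OF that(1,2)])
    show "\<Omega> \<noteq> {}" using that(4) by auto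
  qed (rule magnetic_form_lower_bound[OF that(1,3,2,4,5)])
  have main: "magnetic_eigenvalue n \<Omega> B / magnetic_eigenvalue n ?D B \<ge> 1 + c * B * fraenkel_asymmetry \<Omega> ^ 3 - ln B / c"
    if \<Omega>: "open \<Omega>" "bounded \<Omega>" "simply_connected \<Omega>" "measure lebesgue \<Omega> = 1" and B: "B \<ge> max (3 * pi) K" for \<Omega> B
  proof -
    have B': "B \<ge> 3 * pi" "B \<ge> K" "B \<ge> 1" "B > 0" using B pi_gt3 by auto
    define \<alpha> where "\<alpha> = fraenkel_asymmetry \<Omega>"
    have \<alpha>: "\<alpha> \<ge> 0" unfolding \<alpha>_def by (rule fraenkel_asymmetry_nonneg)
    define t where "t = B / 2 * (\<alpha> / 43) ^ 3"
    have "exp (- B / (2 * pi) + t) \<le> magnetic_eigenvalue n \<Omega> B"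
    proof -
      have "- 2 * B * ((1 / pi - x) / 4) = - B / (2 * pi) + B / 2 * x" for x by (simp add: field_simps)
      then show ?thesis using lower[OF \<Omega>, of B] B'(4) by (simp only: t_def \<alpha>_def less_imp_le)
    qed
    \<comment> \<open>The lower bound holds for the disk as well and makes the denominator
      positive.\<close>
    moreover have pos: "magnetic_eigenvalue n ?D B > 0"
    proof -
      have "simply_connected ?D" unfolding disk_of_area_def by (rule convex_imp_simply_connected) (rule convex_ball)
      then have "exp (- 2 * B * ((1 / pi - (fraenkel_asymmetry ?D / 43) ^ 3) / 4)) \<le> magnetic_eigenvalue n ?D B"
        using measure_ball_real2[of "sqrt (1 / pi)" 0] B'(4) by (intro lower) (simp_all add: disk_of_area_def)
      then show ?thesis by (rule less_le_trans[OF exp_gt_zero])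
    qed
    moreover have up: "magnetic_eigenvalue n ?D B \<le> exp (real (n + 3) * ln B - B / (2 * pi))"
    proof -
      \<comment> \<open>\<open>B \<ge> K\<close> absorbs the constant into one more power of
        \<open>B\<close>.\<close>
      have "K * B ^ (n + 2) \<le> B * B ^ (n + 2)" using B' by (intro mult_right_mono) auto
      also have "\<dots> = B ^ (n + 3)" by (simp add: eval_nat_numeral)
      also have "\<dots> = exp (real (n + 3) * ln B)"
        using ln_realpow[of B "n + 3"] B'(4) by (metis exp_ln zero_less_power)
      finally have "K * B ^ (n + 2) * exp (- B / (2 * pi)) \<le> exp (real (n + 3) * ln B) * exp (- B / (2 * pi))"
        by (intro mult_right_mono) auto
      then show ?thesis using K(2)[OF B'(1)] by (simp add: exp_add[symmetric])
    qed
    ultimately have "exp (- B / (2 * pi) + t) / exp (real (n + 3) * ln B - B / (2 * pi)) \<le>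
        magnetic_eigenvalue n \<Omega> B / magnetic_eigenvalue n ?D B"
      by (intro frac_le) (auto intro: order_trans[OF exp_ge_zero])
    then have "exp (t - real (n + 3) * ln B) \<le> magnetic_eigenvalue n \<Omega> B / magnetic_eigenvalue n ?D B"
      by (simp add: exp_diff[symmetric])
    \<comment> \<open>This linearisation yields the leading 1 of the claim. It holds for exponents
      of either sign, so a small asymmetry needs no separate case.\<close>
    moreover have "1 + (t - real (n + 3) * ln B) \<le> exp (t - real (n + 3) * ln B)" by (rule exp_ge_add_one_self)
    moreover have "c * B * \<alpha> ^ 3 \<le> t"
    proof -
      have "c * (B * \<alpha> ^ 3) \<le> 1 / (2 * 43 ^ 3) * (B * \<alpha> ^ 3)" using c(2) \<alpha> B'(4) by (intro mult_right_mono) auto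
      then show ?thesis by (simp add: t_def power_divide mult_ac)
    qed
    moreover have "real (n + 3) * ln B \<le> 1 / c * ln B" using c(3) B'(3) by (intro mult_right_mono) auto
    ultimately have "1 + c * B * \<alpha> ^ 3 - 1 / c * ln B \<le> magnetic_eigenvalue n \<Omega> B / magnetic_eigenvalue n ?D B"
      by linarith
    then show ?thesis by (simp add: \<alpha>_def)
  qed
  show ?thesis
    by (rule exI[of _ c], rule exI[of _ "max (3 * pi) K"])
       (use c(1) K(1) main in \<open>auto simp: less_max_iff_disj\<close>)
qed

end
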